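(* Let $p$ be a prime and let $G$ and $H$ be $\mathbb{Z}_p$-modules with partial decomposition bases. Then $G\cong_p H$ if and only if $\hat u(\alpha,G)=\hat u(\alpha,H)$ for every $\alpha$ that is an ordinal or $\infty$, and $\hat w(e,G)=\hat w(e,H)$ for every equivalence class $e$ of Ulm sequences. Moreover, in that case, suppose $\mathcal{C}$ and $\mathcal{C}'$ are partial decomposition bases of $G$ and $H$ respectively which are closed under taking nonzero multiples of subsets (i.e. for any $X\in\mathcal{C}$, $x_1,\dots,x_n\in X$ and $a_1,\dots,a_n\in\mathbb{Z}\setminus\{0\}$, $\{a_1x_1,\dots,a_nx_n\}\in\mathcal{C}$, and likewise for $\mathcal{C}'$), and let $X_0\in\mathcal{C}$, $Y_0\in\mathcal{C}'$ and $f_0:X_0\to Y_0$ be a bijection with $U(x)=U(f_0(x))$ for all $x\in X_0$. Then one may take as a partial isomorphism $I: G\cong_p H$ the set of all maps $f:S\to T$ for which there exist $X\in\mathcal{C}$ and $Y\in\mathcal{C}'$ such that: (i) $S$ and $T$ are finitely generated submodules of $G$ and $H$ respectively; (ii) $f$ is a height-preserving isomorphism; (iii) $X\subseteq S\subseteq\langle X\rangle^0$ and $Y\subseteq T\subseteq\langle Y\rangle^0$; (iv) $f(X)=Y$; (v) $X_0\subseteq X$ and $f\restriction X_0=f_0$.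
   Context: $\mathbb{Z}_p$ denotes the integers localized at the prime $p$. $G\cong_p H$ means there is a nonempty set $I$ of isomorphisms between submodules of $G$ and submodules of $H$ (a partial isomorphism $I:G\cong_pH$) with the back-and-forth property: for any $f\in I$ and $a\in G$ (resp. $b\in H$) there is $g\in I$ with $f\subseteq g$ and $a\in\operatorname{domain}(g)$ (resp. $b\in\operatorname{range}(g)$). Define $p^0G=G$, $p^{\beta+1}G=p(p^\beta G)$, $p^\alpha G=\bigcap_{\beta<\alpha}p^\beta G$ for limit $\alpha$, and $p^\infty G=\bigcap_\alpha p^\alpha G$; the height $|x|$ is the ordinal $\alpha$ with $x\in p^\alpha G\setminus p^{\alpha+1}G$, or $\infty$ if none exists, computed in the ambient module; a map is height-preserving if $|f(x)|=|x|$ on its domain. $G[p]=\{x:px=0\}$, $p^\alpha G[p]=(p^\alpha G)[p]$. For an ordinal $\alpha$, $\hat u(\alpha,G)=\min\{\dim p^\alpha G[p]/p^{\alpha+1}G[p],\omega\}$ (dimension over $\mathbb{Z}/(p)$), and $\hat u(\infty,G)=\min\{\dim p^\infty G[p],\omega\}$. The Ulm sequence of $x$ is $U(x)=(|p^ix|)_{i\in\omega}$; Ulm sequences $(\alpha_i)$, $(\beta_i)$ are equivalent if there are positive integers $m,n$ with $\alpha_{i+n}=\beta_{i+m}$ for all $i\ge0$. A decomposition set is a linearly independent set $X$ of elements of infinite order with $|a_1x_1+\cdots+a_nx_n|=\min_i|a_ix_i|$ for all $x_i\in X$, $a_i\in\mathbb{Z}_p$. For a submodule $K$, $K^0=\{x: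 ax\in K\text{ for some }a\ne0\}$. A partial decomposition basis for $G$ is a nonempty collection $\mathcal{C}$ of finite decomposition sets of $G$ such that for all $X\in\mathcal{C}$ and $x\in G$ there is $Y\in\mathcal{C}$ with $X\subseteq Y$ and $x\in\langle Y\rangle^0$. For such $\mathcal{C}$ and an equivalence class $e$ of Ulm sequences, $\hat w_{\mathcal{C}}(e,G)$ is the maximum $n$ such that there are $X\in\mathcal{C}$ and distinct $x_1,\dots,x_n\in X$ with $U(x_i)\in e$, if such a maximum exists, and $\omega$ otherwise; this value does not depend on the choice of partial decomposition basis $\mathcal{C}$ of $G$, and is denoted $\hat w(e,G)$. *)

theory Defs
  imports
    "Jordan_Normal_Form.Missing_VectorSpace"
    "HOL-Number_Theory.Residues"
    "HOL-Library.Extended_Nat"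
begin

section \<open>Ordinals\<close>

text \<open>
  The type \<open>'c ordinal\<close> consists of the order types of all well-orders whose field is a set of
  elements of \<open>'c\<close>, that is, of all ordinals of cardinality at most that of \<open>'c\<close>.
\<close>

quotient_type 'c ordinal = "'c rel" / partial: "\<lambda>r s. (r, s) \<in> ordIso"
proof (rule part_equivpI)
  have "Well_order ({} :: 'c rel)"
    by simp
  from ordIso_reflexive[OF this] show "\<exists>r :: 'c rel. (r, r) \<in> ordIso" ..
  show "symp (\<lambda>r s :: 'c rel. (r, s) \<in> ordIso)"
    by (rule sympI) (rule ordIso_symmetric)
  show "transp (\<lambda>r s :: 'c rel. (r, s) \<in> ordIso)"
    by (rule transpI) (rule ordIso_transitive)
qed

instantiation ordinal :: (type) linorder
begin

lift_definition less_eq_ordinal :: "'a ordinal \<Rightarrow> 'a ordinal \<Rightarrow> bool"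
  is "\<lambda>r s. (r, s) \<in> ordLeq"
proof -
  fix r r' s s' :: "'a rel"
  assume r: "(r, r') \<in> ordIso" and s: "(s, s') \<in> ordIso"
  show "((r, s) \<in> ordLeq) = ((r', s') \<in> ordLeq)"
  proof
    show "(r', s') \<in> ordLeq" if "(r, s) \<in> ordLeq"
      by (rule ordIso_ordLeq_trans[OF ordIso_symmetric[OF r] ordLeq_ordIso_trans[OF that s]])
    show "(r, s) \<in> ordLeq" if "(r', s') \<in> ordLeq"
      by (rule ordIso_ordLeq_trans[OF r ordLeq_ordIso_trans[OF that ordIso_symmetric[OF s]]])
  qed
qed

lift_definition less_ordinal :: "'a ordinal \<Rightarrow> 'a ordinal \<Rightarrow> bool"
  is "\<lambda>r s. (r, s) \<in> ordLess"
proof -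
  fix r r' s s' :: "'a rel"
  assume r: "(r, r') \<in> ordIso" and s: "(s, s') \<in> ordIso"
  show "((r, s) \<in> ordLess) = ((r', s') \<in> ordLess)"
  proof
    show "(r', s') \<in> ordLess" if "(r, s) \<in> ordLess"
      by (rule ordIso_ordLess_trans[OF ordIso_symmetric[OF r] ordLess_ordIso_trans[OF that s]])
    show "(r, s) \<in> ordLess" if "(r', s') \<in> ordLess"
      by (rule ordIso_ordLess_trans[OF r ordLess_ordIso_trans[OF that ordIso_symmetric[OF s]]])
  qed
qed

instance
proof
  fix x y z :: "'a ordinal"
  show "(x < y) = (x \<le> y \<and> \<not> y \<le> x)"
  proof transfer
    fix r s :: "'a rel"
    assume "(r, r) \<in> ordIso" "(s, s) \<in> ordIso"
    then have "Well_order r" "Well_order s"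
      by (auto simp: ordIso_def)
    then show "((r, s) \<in> ordLess) = ((r, s) \<in> ordLeq \<and> (s, r) \<notin> ordLeq)"
      using not_ordLeq_iff_ordLess ordLess_imp_ordLeq by metis
  qed
  show "x \<le> x"
    by transfer (simp add: ordIso_imp_ordLeq)
  show "x \<le> y \<Longrightarrow> y \<le> z \<Longrightarrow> x \<le> z"
    by transfer (rule ordLeq_transitive)
  show "x \<le> y \<Longrightarrow> y \<le> x \<Longrightarrow> x = y"
    by transfer (simp add: ordIso_iff_ordLeq)
  show "x \<le> y \<or> y \<le> x"
    by transfer (auto simp: ordIso_def ordLeq_total)
qed

end

lemma wf_less_ordinal: "wf {(x :: 'a ordinal, y). x < y}"
proof (rule wf_subset)
  show "wf (inv_image ordLess (rep_ordinal :: 'a ordinal \<Rightarrow> 'a rel))"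
    by (rule wf_inv_image[OF wf_ordLess])
  show "{(x :: 'a ordinal, y). x < y} \<subseteq> inv_image ordLess rep_ordinal"
    by (auto simp: less_ordinal.rep_eq)
qed

instance ordinal :: (type) wellorder
  by (rule wf_wellorderI[OF wf_less_ordinal]) intro_classes

lemma not_surj_ordinal:
  fixes f :: "'c \<Rightarrow> 'c ordinal"
  shows "\<not> surj f"
proof
  assume "surj f"
  then obtain g :: "'c ordinal \<Rightarrow> 'c" where inj: "inj g"
    by (meson surj_imp_inj_inv)
  define r where "r = {(g a, g b) | a b. a \<le> b}"
  have field: "Field r = range g"
    unfolding r_def Field_def by auto
  have refl: "refl_on (Field r) r" "r \<subseteq> Field r \<times> Field r"
    unfolding field refl_on_def by (auto simp: r_def)
  have r_iff: "(g a, g b) \<in> r \<longleftrightarrow> a \<le> b" for a b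
    using inj by (auto simp: r_def inj_eq)
  have rE: "\<exists>a b. x = g a \<and> y = g b" if "(x, y) \<in> r" for x y
    using that by (auto simp: r_def)
  have trans: "trans r"
  proof (rule transI)
    fix x y z assume xy: "(x, y) \<in> r" and yz: "(y, z) \<in> r"
    from rE[OF xy] rE[OF yz] obtain a b c where "x = g a" "y = g b" "z = g c" by auto
    with xy yz show "(x, z) \<in> r" by (simp add: r_iff)
  qed
  have antisym: "antisym r"
  proof (rule antisymI)
    fix x y assume xy: "(x, y) \<in> r" and yx: "(y, x) \<in> r"
    from rE[OF xy] obtain a b where "x = g a" "y = g b" by auto
    with xy yx show "x = y" by (simp add: r_iff)
  qed
  have total: "total_on (Field r) r"
    unfolding total_on_def field by (auto simp: r_iff)
  have wf: "wf (r - Id)"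
  proof (rule wf_subset)
    show "wf (inv_image {(x :: 'c ordinal, y). x < y} (inv_into UNIV g))"
      by (simp add: wf)
    show "r - Id \<subseteq> inv_image {(x :: 'c ordinal, y). x < y} (inv_into UNIV g)"
      using inj by (auto simp: r_def)
  qed
  have wo: "Well_order r"
    using refl trans antisym total wf
    by (simp add: well_order_on_def linear_order_on_def partial_order_on_def preorder_on_def)
  define seg where "seg a = Restr r (underS r (g a))" for a
  have ofil: "wo_rel.ofilter r (underS r (g a))" for a
    using wo by (simp add: wo_rel.underS_ofilter wo_rel_def)
  have wo_seg: "Well_order (seg a)" for a
    unfolding seg_def by (rule Well_order_Restr[OF wo])
  define h where "h a = abs_ordinal (seg a)" for a
  have less_abs: "abs_ordinal s < abs_ordinal t" if "(s, t) \<in> ordLess" for s t :: "'c rel"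
    using that by (simp add: less_ordinal.abs_eq ordIso_reflexive ordLess_def)
  have under: "underS r (g a) = g ` {..<a}" for a
  proof (intro Set.set_eqI iffI)
    fix x assume "x \<in> underS r (g a)"
    then have x: "x \<noteq> g a" "(x, g a) \<in> r" by (auto simp: underS_def)
    from rE[OF x(2)] obtain b where "x = g b" by auto
    with x show "x \<in> g ` {..<a}" by (auto simp: r_iff order_less_le)
  next
    fix x assume "x \<in> g ` {..<a}"
    then obtain b where "x = g b" "b < a" by auto
    with inj show "x \<in> underS r (g a)" by (auto simp: underS_def r_iff inj_eq)
  qed
  have mono: "h a < h b" if "a < b" for a b
  proof -
    have "underS r (g a) \<subset> underS r (g b)"
    proof -
      have "g ` {..<a} \<subseteq> g ` {..<b}" "g a \<in> g ` {..<b}" "g a \<notin> g ` {..<a}"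
        using that inj by (auto simp: inj_eq)
      then show ?thesis unfolding under by blast
    qed
    then have "(seg a, seg b) \<in> ordLess"
      unfolding seg_def using ofilter_subset_ordLess[OF wo ofil ofil] by blast
    then show ?thesis
      unfolding h_def by (rule less_abs)
  qed
  have "h a < abs_ordinal r" for a
  proof -
    have "g a \<in> Field r"
      by (simp add: field)
    then have "underS r (g a) \<subset> Field r"
    proof -
      have "g a \<notin> g ` {..<a}" using inj by (auto simp: inj_eq)
      then show ?thesis unfolding under field by blast
    qed
    then have "(seg a, r) \<in> ordLess"
      unfolding seg_def using ofilter_ordLess[OF wo ofil] by blast
    then show ?thesis
      unfolding h_def by (rule less_abs)
  qed
  then have top: "h (abs_ordinal r) < abs_ordinal r" .
  have "a \<le> h a" for a
  proof (induction a rule: less_induct)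
    case (less a)
    show ?case
    proof (rule ccontr)
      assume "\<not> a \<le> h a"
      then have "h a < a" by simp
      from less.IH[OF this] mono[OF this] show False by simp
    qed
  qed
  with top show False
    by (meson leD)
qed

text \<open>
  For modules with element types \<open>'a\<close> and \<open>'b\<close>, the following type contains every ordinal that can
  be the height of an element of either module (cf. \<open>p_power_stable\<close> below). The type
  variable \<open>'o\<close> is arbitrary: a statement that is proved for all \<open>'o\<close> speaks about all ordinals,
  not only about those below a fixed bound.
\<close>

type_synonym ('a, 'b, 'o) ordinals = "('a + 'b + nat + 'o) ordinal"

datatype 'k height = Ord 'k | Infty

instantiation height :: (linorder) linorder
begin

fun less_eq_height :: "'a height \<Rightarrow> 'a height \<Rightarrow> bool" where
  "less_eq_height x Infty \<longleftrightarrow> True"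
| "less_eq_height Infty (Ord b) \<longleftrightarrow> False"
| "less_eq_height (Ord a) (Ord b) \<longleftrightarrow> a \<le> b"

definition less_height :: "'a height \<Rightarrow> 'a height \<Rightarrow> bool" where
  "less_height x y \<longleftrightarrow> x \<le> y \<and> \<not> y \<le> x"

instance
proof
  fix x y z :: "'a height"
  show "(x < y) = (x \<le> y \<and> \<not> y \<le> x)"
    by (rule less_height_def)
  show "x \<le> x"
    by (cases x) auto
  show "x \<le> y \<Longrightarrow> y \<le> z \<Longrightarrow> x \<le> z"
    by (cases x; cases y; cases z) auto
  show "x \<le> y \<Longrightarrow> y \<le> x \<Longrightarrow> x = y"
    by (cases x; cases y) auto
  show "x \<le> y \<or> y \<le> x"
    by (cases x; cases y) auto
qed

end


section \<open>Modules over the integers localized at a prime\<close>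

definition Z_loc :: "nat \<Rightarrow> rat ring" where
  "Z_loc p = \<lparr>carrier = {of_int a / of_int b | a b. \<not> int p dvd b},
     monoid.mult = (*), one = 1, zero = 0, add = (+)\<rparr>"

lemma Z_locI: "\<not> int p dvd b \<Longrightarrow> of_int a / of_int b \<in> carrier (Z_loc p)"
  by (auto simp: Z_loc_def)

lemma Z_loc_simps [simp]:
  "x \<otimes>\<^bsub>Z_loc p\<^esub> y = x * y" "\<one>\<^bsub>Z_loc p\<^esub> = 1"
  "\<zero>\<^bsub>Z_loc p\<^esub> = 0" "x \<oplus>\<^bsub>Z_loc p\<^esub> y = x + y"
  by (simp_all add: Z_loc_def)

lemma Z_loc_cring:
  assumes p: "prime p"
  shows "cring (Z_loc p)"
proof (rule cringI)
  have one: "\<not> int p dvd 1"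
    using p by (simp add: prime_nat_iff)
  have nd: "\<not> int p dvd b * d" if "\<not> int p dvd b" "\<not> int p dvd d" for b d
    using that p by (simp add: prime_dvd_mult_iff)
  have add: "x + y \<in> carrier (Z_loc p)" and mult: "x * y \<in> carrier (Z_loc p)"
    if "x \<in> carrier (Z_loc p)" "y \<in> carrier (Z_loc p)" for x y
  proof -
    from that obtain a b c d where *: "x = of_int a / of_int b" "\<not> int p dvd b"
      "y = of_int c / of_int d" "\<not> int p dvd d"
      by (auto simp: Z_loc_def)
    then have "b \<noteq> 0" "d \<noteq> 0" by auto
    with * have "x + y = of_int (a * d + c * b) / of_int (b * d)"
      and "x * y = of_int (a * c) / of_int (b * d)"
      by (simp_all add: field_simps)
    with nd[OF *(2,4)] show "x + y \<in> carrier (Z_loc p)" "x * y \<in> carrier (Z_loc p)"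
      by (metis Z_locI)+
  qed
  have int: "of_int k \<in> carrier (Z_loc p)" for k
  proof -
    from Z_locI[OF one, of k] show ?thesis by simp
  qed
  have "- x \<in> carrier (Z_loc p)" if "x \<in> carrier (Z_loc p)" for x
    using mult[OF int[of "-1"] that] by simp
  then show "abelian_group (Z_loc p)"
    using add int[of 0]
    by (intro abelian_groupI) (auto simp: ac_simps intro!: bexI[of _ "- x" for x])
  show "Group.comm_monoid (Z_loc p)"
    using mult int[of 1]
    by (intro Group.comm_monoidI) (auto simp: ac_simps)
qed (simp add: algebra_simps)

abbreviation submodule_gen :: "nat \<Rightarrow> (rat, 'a) module \<Rightarrow> 'a set \<Rightarrow> 'a set" where
  "submodule_gen p G X \<equiv> LinearCombinations.module.span (Z_loc p) G X"

text \<open>The submodule $K^0$.\<close>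

definition rational_hull :: "nat \<Rightarrow> (rat, 'a) module \<Rightarrow> 'a set \<Rightarrow> 'a set" where
  "rational_hull p G K = {x \<in> carrier G. \<exists>a \<in> carrier (Z_loc p). a \<noteq> 0 \<and> a \<odot>\<^bsub>G\<^esub> x \<in> K}"

definition fin_gen_submodule :: "nat \<Rightarrow> (rat, 'a) module \<Rightarrow> 'a set \<Rightarrow> bool" where
  "fin_gen_submodule p G S \<longleftrightarrow>
     LinearCombinations.submodule (Z_loc p) S G \<and> (\<exists>A. finite A \<and> A \<subseteq> carrier G \<and> S = submodule_gen p G A)"


subsection \<open>Heights\<close>

definition p_mult :: "nat \<Rightarrow> (rat, 'a) module \<Rightarrow> 'a set \<Rightarrow> 'a set" where
  "p_mult p G S = (\<lambda>x. of_nat p \<odot>\<^bsub>G\<^esub> x) ` S"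

definition is_pred :: "'k::wellorder \<Rightarrow> 'k \<Rightarrow> bool" where
  "is_pred \<beta> \<alpha> \<longleftrightarrow> \<beta> < \<alpha> \<and> (\<forall>\<gamma><\<alpha>. \<gamma> \<le> \<beta>)"

lemma is_pred_unique: "is_pred \<beta> \<alpha> \<Longrightarrow> is_pred \<gamma> \<alpha> \<Longrightarrow> \<beta> = \<gamma>"
  by (meson antisym is_pred_def)

function p_power :: "nat \<Rightarrow> (rat, 'a) module \<Rightarrow> 'k::wellorder \<Rightarrow> 'a set" where
  "p_power p G \<alpha> =
     (if \<forall>\<beta>. \<not> \<beta> < \<alpha> then carrier G
      else if \<exists>\<beta>. is_pred \<beta> \<alpha> then p_mult p G (p_power p G (THE \<beta>. is_pred \<beta> \<alpha>))
      else (\<Inter>\<beta>\<in>{..<\<alpha>}. p_power p G \<beta>))"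
  by auto
termination
proof (relation "inv_image {(x, y). x < y} (\<lambda>(p, G, \<alpha>). \<alpha>)")
  show "wf (inv_image {(x :: 'b, y). x < y} (\<lambda>(p :: nat, G :: (rat, 'a) module, \<alpha> :: 'b). \<alpha>))"
    by (simp add: wf)
next
  fix p :: nat and G :: "(rat, 'a) module" and \<alpha> :: 'b
  assume "\<exists>\<beta>. is_pred \<beta> \<alpha>"
  then obtain \<beta> where "is_pred \<beta> \<alpha>" ..
  moreover from this have "(THE \<beta>. is_pred \<beta> \<alpha>) = \<beta>"
    using is_pred_unique by blast
  ultimately show "((p, G, THE \<beta>. is_pred \<beta> \<alpha>), p, G, \<alpha>)
      \<in> inv_image {(x, y). x < y} (\<lambda>(p, G, \<alpha>). \<alpha>)"
    by (simp add: is_pred_def)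
qed auto

declare p_power.simps [simp del]

lemma p_power_zero: "(\<And>\<beta>. \<not> \<beta> < \<alpha>) \<Longrightarrow> p_power p G \<alpha> = carrier G"
  by (simp add: p_power.simps)

lemma p_power_Suc:
  assumes "is_pred \<beta> \<alpha>"
  shows "p_power p G \<alpha> = p_mult p G (p_power p G \<beta>)"
proof -
  have "(THE \<beta>. is_pred \<beta> \<alpha>) = \<beta>"
    using assms is_pred_unique by blast
  with assms show ?thesis
    by (subst p_power.simps) (auto simp: is_pred_def)
qed

lemma p_power_limit:
  assumes "\<beta> < \<alpha>" "\<And>\<beta>. \<not> is_pred \<beta> \<alpha>"
  shows "p_power p G \<alpha> = (\<Inter>\<beta>\<in>{..<\<alpha>}. p_power p G \<beta>)"
  using assms by (subst p_power.simps) auto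

definition p_power_inf :: "'k::wellorder itself \<Rightarrow> nat \<Rightarrow> (rat, 'a) module \<Rightarrow> 'a set" where
  "p_power_inf _ p G = (\<Inter>\<alpha>::'k. p_power p G \<alpha>)"

lemma p_power_decreasing:
  fixes \<alpha> \<beta> :: "'k::wellorder"
  assumes p: "prime p" and G: "Module.module (Z_loc p) G"
  shows "\<alpha> < \<beta> \<Longrightarrow> p_power p G \<beta> \<subseteq> p_mult p G (p_power p G \<alpha>)"
    and "p_mult p G (p_power p G \<beta>) \<subseteq> p_power p G \<beta>"
proof -
  have pin: "of_nat p \<in> carrier (Z_loc p)"
  proof -
    have "\<not> int p dvd 1" using p by (simp add: prime_nat_iff)
    from Z_locI[OF this, of "int p"] show ?thesis by simp
  qed
  have p_mult_mono: "p_mult p G S \<subseteq> p_mult p G T" if "S \<subseteq> T" for S T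
    using that by (auto simp: p_mult_def)
  have *: "p_mult p G (p_power p G \<beta>) \<subseteq> p_power p G \<beta> \<and>
        (\<forall>\<alpha><\<beta>. p_power p G \<beta> \<subseteq> p_mult p G (p_power p G \<alpha>))" for \<beta> :: 'k
  proof (induction \<beta> rule: less_induct)
    case (less \<beta>)
    have sub: "p_power p G \<gamma> \<subseteq> p_power p G \<alpha>" if "\<alpha> \<le> \<gamma>" "\<gamma> < \<beta>" for \<alpha> \<gamma>
      using less.IH[OF \<open>\<gamma> < \<beta>\<close>] less.IH[of \<alpha>] that by (cases "\<alpha> = \<gamma>") force+
    consider "\<And>\<gamma>. \<not> \<gamma> < \<beta>" | \<gamma> where "is_pred \<gamma> \<beta>"
      | \<gamma> where "\<gamma> < \<beta>" "\<And>\<gamma>. \<not> is_pred \<gamma> \<beta>"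
      by blast
    then show ?case
    proof cases
      case 1
      then show ?thesis
        using Module.module.smult_closed[OF G pin] by (auto simp: p_power_zero p_mult_def)
    next
      case (2 \<gamma>)
      then have "\<gamma> < \<beta>" and le: "\<alpha> \<le> \<gamma>" if "\<alpha> < \<beta>" for \<alpha>
        using that by (auto simp: is_pred_def)
      have "\<gamma> < \<beta>" using 2 by (simp add: is_pred_def)
      from less.IH[OF this] le sub[OF _ this] show ?thesis
        unfolding p_power_Suc[OF 2] by (auto intro!: p_mult_mono dest: p_mult_mono)
    next
      case (3 \<gamma>)
      have lim: "p_power p G \<beta> = (\<Inter>\<gamma>\<in>{..<\<beta>}. p_power p G \<gamma>)"
        by (rule p_power_limit[OF 3])
      have "p_power p G \<beta> \<subseteq> p_mult p G (p_power p G \<alpha>)" if "\<alpha> < \<beta>" for \<alpha>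
      proof -
        from 3(2)[of \<alpha>] that obtain \<delta> where "\<alpha> < \<delta>" "\<delta> < \<beta>"
          by (auto simp: is_pred_def not_le)
        then show ?thesis
          using less.IH[of \<delta>] unfolding lim by blast
      qed
      moreover have "p_mult p G (p_power p G \<beta>) \<subseteq> p_power p G \<beta>"
        using less.IH p_mult_mono[of "p_power p G \<beta>"] unfolding lim by blast
      ultimately show ?thesis by blast
    qed
  qed
  from *[of \<beta>]
  show "\<alpha> < \<beta> \<Longrightarrow> p_power p G \<beta> \<subseteq> p_mult p G (p_power p G \<alpha>)"
    and "p_mult p G (p_power p G \<beta>) \<subseteq> p_power p G \<beta>"
    by auto
qed

text \<open>
  The descending chain becomes stationary at an ordinal of the type, so nothing is lost by forming
  $p^\infty G$ as the intersection over this type only.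
\<close>

lemma p_power_stable:
  fixes G :: "(rat, 'a) module" and e :: "'a \<Rightarrow> 'c"
  assumes p: "prime p" and G: "Module.module (Z_loc p) G" and e: "inj e"
  obtains \<alpha> :: "'c ordinal"
  where "p_mult p G (p_power p G \<alpha>) = p_power p G \<alpha>"
    and "p_power_inf TYPE('c ordinal) p G = p_power p G \<alpha>"
proof -
  have "\<exists>\<alpha> :: 'c ordinal. p_power p G \<alpha> \<subseteq> p_mult p G (p_power p G \<alpha>)"
  proof (rule ccontr)
    assume "\<not> ?thesis"
    then have "\<exists>x. x \<in> p_power p G \<alpha> - p_mult p G (p_power p G \<alpha>)" for \<alpha> :: "'c ordinal"
      by blast
    then obtain x where x: "x \<alpha> \<in> p_power p G \<alpha> - p_mult p G (p_power p G \<alpha>)"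
      for \<alpha> :: "'c ordinal"
      by metis
    have "x \<alpha> \<noteq> x \<beta>" if "\<alpha> < \<beta>" for \<alpha> \<beta>
      using x[of \<alpha>] x[of \<beta>] p_power_decreasing(1)[OF p G, OF that] by auto
    then have "inj x"
      by (metis injI neqE)
    with e have "inj (e \<circ> x)"
      by (rule inj_compose)
    then have "surj (inv_into UNIV (e \<circ> x))"
      by (rule inj_imp_surj_inv)
    then show False
      using not_surj_ordinal by blast
  qed
  then obtain \<alpha> :: "'c ordinal" where
    \<alpha>: "p_power p G \<alpha> \<subseteq> p_mult p G (p_power p G \<alpha>)" ..
  have le: "p_power p G \<alpha> \<subseteq> p_power p G \<beta>" for \<beta> :: "'c ordinal"
  proof (induction \<beta> rule: less_induct)
    case (less \<beta>)
    consider "\<And>\<gamma>. \<not> \<gamma> < \<beta>" | \<gamma> where "is_pred \<gamma> \<beta>"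
      | \<gamma> where "\<gamma> < \<beta>" "\<And>\<gamma>. \<not> is_pred \<gamma> \<beta>"
      by blast
    then show ?case
    proof cases
      case 1
      then have "\<beta> \<le> \<alpha>" using not_le by blast
      then show ?thesis
        using p_power_decreasing(1)[OF p G, of \<beta> \<alpha>] p_power_decreasing(2)[OF p G, of \<beta>]
        by (cases "\<beta> = \<alpha>") (auto simp: order_less_le)
    next
      case (2 \<gamma>)
      then have "p_power p G \<alpha> \<subseteq> p_power p G \<gamma>"
        using less.IH by (simp add: is_pred_def)
      with \<alpha> show ?thesis
        unfolding p_power_Suc[OF 2] by (auto simp: p_mult_def)
    next
      case (3 \<gamma>)
      show ?thesis
        unfolding p_power_limit[OF 3] using less.IH by blast
    qed
  qed
  have mult: "p_mult p G (p_power p G \<alpha>) = p_power p G \<alpha>"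
  proof
    show "p_power p G \<alpha> \<subseteq> p_mult p G (p_power p G \<alpha>)" by fact
    show "p_mult p G (p_power p G \<alpha>) \<subseteq> p_power p G \<alpha>"
      by (rule p_power_decreasing(2)[OF p G])
  qed
  moreover have "p_power_inf TYPE('c ordinal) p G = p_power p G \<alpha>"
    using le unfolding p_power_inf_def by blast
  ultimately show ?thesis by (rule that)
qed

text \<open>
  By \<open>p_power_Suc\<close>, $p^{\alpha+1} G$ is \<open>p_mult p G (p_power p G \<alpha>)\<close>; it is written in the
  latter form throughout.
\<close>

definition height :: "nat \<Rightarrow> (rat, 'a) module \<Rightarrow> 'a \<Rightarrow> 'k::wellorder height" where
  "height p G x =
     (if \<exists>\<alpha>::'k. x \<in> p_power p G \<alpha> - p_mult p G (p_power p G \<alpha>)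
      then Ord (THE \<alpha>. x \<in> p_power p G \<alpha> - p_mult p G (p_power p G \<alpha>))
      else Infty)"

definition ulm_seq :: "nat \<Rightarrow> (rat, 'a) module \<Rightarrow> 'a \<Rightarrow> nat \<Rightarrow> 'k::wellorder height" where
  "ulm_seq p G x = (\<lambda>i. height p G (of_nat p ^ i \<odot>\<^bsub>G\<^esub> x))"

text \<open>
  The relation is taken on all sequences. A class that contains no sequence \<open>ulm_seq p G x\<close>
  contributes $0$ to the invariant \<open>w_hat\<close> below.
\<close>

definition ulm_equiv :: "((nat \<Rightarrow> 'k height) \<times> (nat \<Rightarrow> 'k height)) set" where
  "ulm_equiv = {(u, v). \<exists>m n. 0 < m \<and> 0 < n \<and> (\<forall>i. u (i + n) = v (i + m))}"

lemma equiv_ulm_equiv: "equiv UNIV (ulm_equiv :: ((nat \<Rightarrow> 'k height) \<times> _) set)"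
proof (rule equivI)
  show "refl (ulm_equiv :: ((nat \<Rightarrow> 'k height) \<times> _) set)"
    by (auto simp: refl_on_def ulm_equiv_def)
  show "sym (ulm_equiv :: ((nat \<Rightarrow> 'k height) \<times> _) set)"
    unfolding sym_def ulm_equiv_def by clarsimp metis
  show "trans (ulm_equiv :: ((nat \<Rightarrow> 'k height) \<times> _) set)"
  proof (rule transI)
    fix u v w :: "nat \<Rightarrow> 'k height"
    assume "(u, v) \<in> ulm_equiv" "(v, w) \<in> ulm_equiv"
    then obtain m n m' n' where *: "0 < m" "0 < n" "\<And>i. u (i + n) = v (i + m)"
      "0 < m'" "0 < n'" "\<And>i. v (i + n') = w (i + m')"
      by (auto simp: ulm_equiv_def)
    have "u (i + (n' + n)) = w (i + (m + m'))" for i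
      using *(3)[of "i + n'"] *(6)[of "i + m"] by (simp add: ac_simps)
    moreover have "0 < m + m'" "0 < n' + n"
      using *(1,2) by simp_all
    ultimately show "(u, w) \<in> ulm_equiv"
      unfolding ulm_equiv_def by blast
  qed
qed simp


subsection \<open>The invariants \<open>u_hat\<close>\<close>

definition p_torsion :: "nat \<Rightarrow> (rat, 'a) module \<Rightarrow> 'a set \<Rightarrow> 'a set" where
  "p_torsion p G S = {x \<in> S. of_nat p \<odot>\<^bsub>G\<^esub> x = \<zero>\<^bsub>G\<^esub>}"

text \<open>
  A submodule \<open>V\<close> of \<open>G\<close> with $pV = 0$, as a vector space over \<open>residue_ring p\<close>.
  The multiplication of the underlying ring record plays no role.
\<close>

definition residue_space :: "(rat, 'a) module \<Rightarrow> 'a set \<Rightarrow> (int, 'a) module" where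
  "residue_space G V = \<lparr>carrier = V, monoid.mult = undefined, one = undefined,
     zero = \<zero>\<^bsub>G\<^esub>, add = add G, smult = (\<lambda>k x. of_int k \<odot>\<^bsub>G\<^esub> x)\<rparr>"

definition quotient_module :: "('r, 'a) module \<Rightarrow> 'a set \<Rightarrow> ('r, 'a set) module" where
  "quotient_module M W = \<lparr>carrier = a_rcosets\<^bsub>M\<^esub> W, monoid.mult = undefined, one = undefined,
     zero = W, add = set_add M, smult = (\<lambda>a C. \<Union>x\<in>C. W +>\<^bsub>M\<^esub> (a \<odot>\<^bsub>M\<^esub> x))\<rparr>"

text \<open>The minimum of the dimension and $\omega$; the value $\omega$ is represented by \<open>\<infinity>\<close>.\<close>

definition trunc_dim :: "'r ring \<Rightarrow> ('r, 'v) module \<Rightarrow> enat" where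
  "trunc_dim K V =
     (if vectorspace.fin_dim K V then enat (vectorspace.dim K V) else \<infinity>)"

fun u_hat :: "nat \<Rightarrow> (rat, 'a) module \<Rightarrow> 'k::wellorder height \<Rightarrow> enat" where
  "u_hat p G (Ord \<alpha>) =
     trunc_dim (residue_ring (int p))
       (quotient_module (residue_space G (p_torsion p G (p_power p G \<alpha>)))
         (p_torsion p G (p_mult p G (p_power p G \<alpha>))))"
| "u_hat p G Infty =
     trunc_dim (residue_ring (int p))
       (residue_space G (p_torsion p G (p_power_inf TYPE('k) p G)))"


subsection \<open>Partial decomposition bases and the invariants \<open>w_hat\<close>\<close>

text \<open>
  The type argument \<open>'k itself\<close> fixes the type of ordinals in which heights are computed.
  The elements \<open>x\<^sub>1, \<dots>, x\<^sub>n\<close> (with $n \geq 1$) of a linear combination are pairwise distinct.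
\<close>

definition decomposition_set ::
    "'k::wellorder itself \<Rightarrow> nat \<Rightarrow> (rat, 'a) module \<Rightarrow> 'a set \<Rightarrow> bool" where
  "decomposition_set _ p G X \<longleftrightarrow>
     X \<subseteq> carrier G \<and>
     \<not> LinearCombinations.module.lin_dep (Z_loc p) G X \<and>
     (\<forall>x\<in>X. \<forall>n::nat. 0 < n \<longrightarrow> of_nat n \<odot>\<^bsub>G\<^esub> x \<noteq> \<zero>\<^bsub>G\<^esub>) \<and>
     (\<forall>A a. finite A \<longrightarrow> A \<noteq> {} \<longrightarrow> A \<subseteq> X \<longrightarrow> a \<in> A \<rightarrow> carrier (Z_loc p) \<longrightarrow>
        (height p G (\<Oplus>\<^bsub>G\<^esub>x\<in>A. a x \<odot>\<^bsub>G\<^esub> x) :: 'k height) =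
          Min ((\<lambda>x. height p G (a x \<odot>\<^bsub>G\<^esub> x)) ` A))"

definition partial_decomposition_basis ::
    "'k::wellorder itself \<Rightarrow> nat \<Rightarrow> (rat, 'a) module \<Rightarrow> 'a set set \<Rightarrow> bool" where
  "partial_decomposition_basis T p G C \<longleftrightarrow>
     C \<noteq> {} \<and>
     (\<forall>X\<in>C. finite X \<and> decomposition_set T p G X) \<and>
     (\<forall>X\<in>C. \<forall>x\<in>carrier G. \<exists>Y\<in>C. X \<subseteq> Y \<and> x \<in> rational_hull p G (submodule_gen p G Y))"

definition closed_under_multiples :: "(rat, 'a) module \<Rightarrow> 'a set set \<Rightarrow> bool" where
  "closed_under_multiples G C \<longleftrightarrow>
     (\<forall>X\<in>C. \<forall>A a. A \<subseteq> X \<longrightarrow> A \<noteq> {} \<longrightarrow> (\<forall>x\<in>A. a x \<noteq> (0::int)) \<longrightarrow>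
        (\<lambda>x. of_int (a x) \<odot>\<^bsub>G\<^esub> x) ` A \<in> C)"

definition w_hat_wrt ::
    "nat \<Rightarrow> (rat, 'a) module \<Rightarrow> 'a set set \<Rightarrow> (nat \<Rightarrow> 'k::wellorder height) set \<Rightarrow> enat" where
  "w_hat_wrt p G C e =
     (let N = {card A | A X. X \<in> C \<and> finite A \<and> A \<subseteq> X \<and> (\<forall>x\<in>A. ulm_seq p G x \<in> e)}
      in if \<exists>n\<in>N. \<forall>m\<in>N. m \<le> n then enat (Max N) else \<infinity>)"

text \<open>
  The value of \<open>w_hat_wrt\<close> is the same for all partial decomposition bases of \<open>G\<close>, so
  the choice made here is immaterial.
\<close>

definition w_hat :: "nat \<Rightarrow> (rat, 'a) module \<Rightarrow> (nat \<Rightarrow> 'k::wellorder height) set \<Rightarrow> enat" where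
  "w_hat p G e = w_hat_wrt p G (SOME C. partial_decomposition_basis TYPE('k) p G C) e"


subsection \<open>Partial isomorphisms\<close>

text \<open>
  Maps between submodules are partial functions, so that inclusion of maps is \<open>\<subseteq>\<^sub>m\<close>.
\<close>

definition submodule_iso ::
    "nat \<Rightarrow> (rat, 'a) module \<Rightarrow> (rat, 'b) module \<Rightarrow> ('a \<rightharpoonup> 'b) \<Rightarrow> bool" where
  "submodule_iso p G H f \<longleftrightarrow>
     LinearCombinations.submodule (Z_loc p) (dom f) G \<and> LinearCombinations.submodule (Z_loc p) (ran f) H \<and> inj_on f (dom f) \<and>
     (\<lambda>x. the (f x)) \<in> LinearCombinations.module_hom (Z_loc p) (G\<lparr>carrier := dom f\<rparr>) (H\<lparr>carrier := ran f\<rparr>)"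

definition partial_isomorphism ::
    "nat \<Rightarrow> (rat, 'a) module \<Rightarrow> (rat, 'b) module \<Rightarrow> ('a \<rightharpoonup> 'b) set \<Rightarrow> bool" where
  "partial_isomorphism p G H I \<longleftrightarrow>
     I \<noteq> {} \<and> (\<forall>f\<in>I. submodule_iso p G H f) \<and>
     (\<forall>f\<in>I. \<forall>a\<in>carrier G. \<exists>g\<in>I. f \<subseteq>\<^sub>m g \<and> a \<in> dom g) \<and>
     (\<forall>f\<in>I. \<forall>b\<in>carrier H. \<exists>g\<in>I. f \<subseteq>\<^sub>m g \<and> b \<in> ran g)"

definition partially_isomorphic ::
    "nat \<Rightarrow> (rat, 'a) module \<Rightarrow> (rat, 'b) module \<Rightarrow> bool" where
  "partially_isomorphic p G H \<longleftrightarrow> (\<exists>I. partial_isomorphism p G H I)"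

definition height_preserving ::
    "'k::wellorder itself \<Rightarrow> nat \<Rightarrow> (rat, 'a) module \<Rightarrow> (rat, 'b) module \<Rightarrow> ('a \<rightharpoonup> 'b) \<Rightarrow> bool" where
  "height_preserving _ p G H f \<longleftrightarrow>
     (\<forall>x\<in>dom f. (height p H (the (f x)) :: 'k height) = height p G x)"

definition extension_system ::
    "'k::wellorder itself \<Rightarrow> nat \<Rightarrow> (rat, 'a) module \<Rightarrow> (rat, 'b) module \<Rightarrow>
      'a set set \<Rightarrow> 'b set set \<Rightarrow> 'a set \<Rightarrow> ('a \<Rightarrow> 'b) \<Rightarrow> ('a \<rightharpoonup> 'b) set" where
  "extension_system T p G H C C' X\<^sub>0 f\<^sub>0 =
     {f. \<exists>X\<in>C. \<exists>Y\<in>C'.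
        fin_gen_submodule p G (dom f) \<and> fin_gen_submodule p H (ran f) \<and>
        submodule_iso p G H f \<and> height_preserving T p G H f \<and>
        X \<subseteq> dom f \<and> dom f \<subseteq> rational_hull p G (submodule_gen p G X) \<and>
        Y \<subseteq> ran f \<and> ran f \<subseteq> rational_hull p H (submodule_gen p H Y) \<and>
        (\<lambda>x. the (f x)) ` X = Y \<and>
        X\<^sub>0 \<subseteq> X \<and> (\<forall>x\<in>X\<^sub>0. f x = Some (f\<^sub>0 x))}"

end

theory Submission
  imports Defs
begin

text \<open>
  A map between submodules is replaced by its graph, which makes forth and back the same argument.

  For the forward direction, a back-and-forth system preserves membership in each
  $p^\alpha$-submodule, hence heights, and therefore every property that says that some finite
  tuple exists with prescribed heights and with prescribed incongruences. The Ulm invariants have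
  this form because a finite-dimensional space over the prime field is determined by its number of
  elements. The Warfield invariants have this form because the number of members of a class $e$ in a
  partial decomposition basis is the rank of a suitable subquotient that does not mention the basis.

  For the converse, take a height-preserving isomorphism between finitely generated submodules that
  lie in the rational hulls of matching decomposition sets. If $x$ is not in the hull of $X$, enlarge
  $X$ inside the basis: equality of the Warfield invariants yields an unused partner of the same
  class for every new element of $X$, and after multiplication by powers of $p$ the two Ulm sequences
  agree and both multiples become proper modulo the finitely generated submodules, so the
  isomorphism extends. If $p x$ is in the domain, Kaplansky's argument applies: cosets of finitely
  generated submodules of this kind have elements of maximal height, and equality of the Ulm
  invariants provides the matching torsion element.
\<close>

section \<open>Localized integers and their modules\<close>

text \<open>The ring is a discrete valuation ring, and the recurring device is that
  \<open>1 - pp * r\<close> is a unit: a coefficient disturbed by a term of higher valuation leaves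
  heights unchanged. Since the ring is not complete, a coset might contain elements of ever greater
  height without a highest one. The hull of a decomposition set excludes this, because its
  coordinates force the only possible limit coefficient to lie in the ring itself. For a class with
  representative u, the subquotient consists of the elements whose Ulm sequence is eventually at
  least u, modulo those that after multiplication by some p^m become sums of elements lying
  infinitely often above the correspondingly shifted u. A coordinate that is eventually at least u
  either exceeds u infinitely often and is negligible, or finally agrees with u and belongs to the
  class; so exactly the basis members of the class are counted. Matching multiples instead of the
  basis members themselves cannot be avoided: a new member need not have maximal height modulo a
  finitely generated domain, but some power of p times it does. Hence the demand that bases be
  closed under multiples.\<close>

lemma Z_loc_iff: "r \<in> carrier (Z_loc p) \<longleftrightarrow> (\<exists>a b. \<not> int p dvd b \<and> r = of_int a / of_int b)"
  by (auto simp: Z_loc_def)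

locale zmod = Module.module "Z_loc p" G for p :: nat and G :: "(rat, 'a) module" (structure) +
  assumes prime: "prime p"
begin

abbreviation Zp :: "rat set" where "Zp \<equiv> carrier (Z_loc p)"
abbreviation pp :: rat where "pp \<equiv> of_nat p"
abbreviation sm :: "'a set \<Rightarrow> bool" where "sm S \<equiv> LinearCombinations.submodule (Z_loc p) S G"

lemma pp_nonzero [simp]: "pp \<noteq> 0" "p \<noteq> 0"
  using prime by auto

lemma p_gt1: "1 < p"
  using prime by (rule prime_gt_1_nat)

lemma Zp_0 [simp]: "0 \<in> Zp" and Zp_1 [simp]: "1 \<in> Zp"
  using R.zero_closed R.one_closed by simp_all

lemma Zp_add [simp]: "a \<in> Zp \<Longrightarrow> b \<in> Zp \<Longrightarrow> a + b \<in> Zp"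
  and Zp_mult [simp]: "a \<in> Zp \<Longrightarrow> b \<in> Zp \<Longrightarrow> a * b \<in> Zp"
  using R.add.m_closed[of a b] R.m_closed[of a b] by simp_all

lemma Zp_of_int [simp]: "of_int k \<in> Zp"
proof -
  have "\<not> int p dvd 1" using p_gt1 by simp
  then show ?thesis unfolding Z_loc_iff by (intro exI[of _ k] exI[of _ 1]) auto
qed

lemma Zp_of_nat [simp]: "of_nat k \<in> Zp"
  using Zp_of_int[of "int k"] by simp

lemma Zp_uminus [simp]: "a \<in> Zp \<Longrightarrow> - a \<in> Zp"
  using Zp_mult[OF Zp_of_int[of "-1"]] by simp

lemma Zp_diff [simp]: "a \<in> Zp \<Longrightarrow> b \<in> Zp \<Longrightarrow> a - b \<in> Zp"
  using Zp_add[of a "- b"] by simp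

lemma Zp_power [simp]: "a \<in> Zp \<Longrightarrow> a ^ n \<in> Zp"
  by (induction n) auto

lemma Z_loc_minus [simp]: "a \<in> Zp \<Longrightarrow> \<ominus>\<^bsub>Z_loc p\<^esub> a = - a"
  by (rule R.minus_equality) auto

text \<open>The p-adic valuation: the denominator is prime to p, so only the numerator can carry
  factors p, and after removing them the fraction can be turned upside down.\<close>

lemma Zp_decompose:
  assumes "r \<in> Zp" "r \<noteq> 0"
  obtains k u where "r = pp ^ k * u" "u \<in> Zp" "inverse u \<in> Zp" "u \<noteq> 0"
proof -
  obtain a b where ab: "\<not> int p dvd b" "r = of_int a / of_int b"
    using assms(1) unfolding Z_loc_iff by blast
  have "a \<noteq> 0" using assms(2) ab by auto
  moreover have "\<not> is_unit (int p)" using p_gt1 by simp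
  ultimately obtain a' where a': "a = int p ^ multiplicity (int p) a * a'" "\<not> int p dvd a'"
    by (rule multiplicity_decompose')
  have [simp]: "a' \<noteq> 0" "b \<noteq> 0" using a' ab by auto
  show ?thesis
  proof (rule that[of "multiplicity (int p) a" "of_int a' / of_int b"])
    show "r = pp ^ multiplicity (int p) a * (of_int a' / of_int b)"
      by (subst ab(2), subst a'(1)) simp
    show "of_int a' / of_int b \<in> Zp"
      unfolding Z_loc_iff using ab by blast
    have "inverse (of_int a' / of_int b) = (of_int b / of_int a' :: rat)" by simp
    then show "inverse (of_int a' / of_int b) \<in> Zp"
      unfolding Z_loc_iff using a' by blast
  qed auto
qed

text \<open>A denominator prime to p is invertible modulo \<open>p ^ m\<close>, so natural numbers
  represent all residues. The finite sets of representatives below come from here.\<close>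

lemma Zp_residue:
  assumes "r \<in> Zp"
  obtains q r' where "q < p ^ m" "r' \<in> Zp" "r = of_nat q + pp ^ m * r'"
proof -
  obtain a b where ab: "\<not> int p dvd b" "r = of_int a / of_int b"
    using assms(1) unfolding Z_loc_iff by blast
  have "coprime b (int p ^ m)"
    using ab(1) prime by (metis coprime_commute coprime_power_left_iff prime_imp_coprime prime_nat_int_transfer)
  then obtain c where c: "[b * c = 1] (mod (int p ^ m))"
    using cong_solve_coprime_int by blast
  define q where "q = (a * c) mod (int p ^ m)"
  have q: "0 \<le> q" "q < int p ^ m" unfolding q_def using p_gt1 by simp_all
  have "[b * q = b * (a * c)] (mod (int p ^ m))"
    unfolding q_def by (simp add: cong_def mod_mult_right_eq)
  also have "b * (a * c) = a * (b * c)" by simp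
  also have "[a * (b * c) = a * 1] (mod (int p ^ m))"
    by (intro cong_mult c) auto
  finally have "int p ^ m dvd a - b * q"
    by (simp add: cong_iff_dvd_diff dvd_diff_commute)
  then obtain t where t: "a - b * q = int p ^ m * t" by blast
  have b0: "b \<noteq> 0" using ab by auto
  have "of_int (a - b * q) = (pp ^ m * of_int t :: rat)"
    by (simp add: t)
  then have "(of_int a :: rat) = of_int b * of_int q + pp ^ m * of_int t" by simp
  then have "r = of_int q + pp ^ m * (of_int t / of_int b)"
    unfolding ab(2) using b0 by (simp add: field_simps)
  then have "r = of_nat (nat q) + pp ^ m * (of_int t / of_int b)" using q(1) by simp
  moreover have "nat q < p ^ m" using q by (metis nat_less_iff of_nat_power)
  moreover have "of_int t / of_int b \<in> Zp" unfolding Z_loc_iff using ab(1) by blast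
  ultimately show ?thesis by (intro that)
qed

text \<open>Comparison of valuations. The extra factor p in the second alternative records that the
  valuation is strictly larger there; this strictness is what later produces the units
  \<open>1 - pp * r\<close>.\<close>

lemma Zp_total:
  assumes "a \<in> Zp" "b \<in> Zp"
  shows "(\<exists>r\<in>Zp. a = b * r) \<or> (\<exists>r\<in>Zp. b = a * pp * r)"
proof (cases "a = 0 \<or> b = 0")
  case True
  then show ?thesis by (auto intro!: bexI[of _ 0])
next
  case False
  obtain k u where a: "a = pp ^ k * u" "u \<in> Zp" "inverse u \<in> Zp" "u \<noteq> 0"
    using Zp_decompose[OF assms(1)] False by blast
  obtain l v where b: "b = pp ^ l * v" "v \<in> Zp" "inverse v \<in> Zp" "v \<noteq> 0"
    using Zp_decompose[OF assms(2)] False by blast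
  show ?thesis
  proof (cases "l \<le> k")
    case True
    have "a = b * (pp ^ (k - l) * (u * inverse v))"
      using a b True by (simp add: power_diff field_simps)
    then show ?thesis using a b by (metis Zp_mult Zp_of_nat Zp_power)
  next
    case False
    then obtain j where j: "l = Suc (k + j)" by (metis not_le less_iff_Suc_add)
    have "b = a * pp * (pp ^ j * (v * inverse u))"
      using a b by (simp add: j power_add field_simps)
    then show ?thesis using a b by (metis Zp_mult Zp_of_nat Zp_power)
  qed
qed

lemma inverse_pp: "inverse pp \<notin> Zp"
proof
  assume "inverse pp \<in> Zp"
  then obtain a b where ab: "\<not> int p dvd b" "inverse pp = of_int a / of_int b"
    unfolding Z_loc_iff by blast
  then have "b \<noteq> 0" by auto
  with ab(2) have "of_int b = (of_int (a * int p) :: rat)" by (simp add: field_simps)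
  then have "b = a * int p" by (metis of_int_eq_iff)
  with ab(1) show False by simp
qed

lemma Zp_unit_cases:
  assumes "r \<in> Zp"
  obtains "inverse r \<in> Zp" "r \<noteq> 0" | r' where "r' \<in> Zp" "r = pp * r'"
proof (cases "r = 0")
  case True
  then show ?thesis using that(2)[of 0] by simp
next
  case False
  then obtain k u where *: "r = pp ^ k * u" "u \<in> Zp" "inverse u \<in> Zp" "u \<noteq> 0"
    using Zp_decompose[OF assms] by blast
  show ?thesis
  proof (cases k)
    case 0 then show ?thesis using that(1) * by simp
  next
    case (Suc n) then show ?thesis using that(2)[of "pp ^ n * u"] * by simp
  qed
qed

text \<open>Locality of the ring: if p divided \<open>1 - pp * r\<close>, it would divide 1. This
  lets a coefficient absorb a term of higher valuation without changing any height.\<close>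

lemma one_minus_unit:
  assumes "r \<in> Zp" shows "inverse (1 - pp * r) \<in> Zp" "1 - pp * r \<noteq> 0"
proof -
  have *: "1 - pp * r \<noteq> pp * r'" if "r' \<in> Zp" for r'
  proof
    assume "1 - pp * r = pp * r'"
    then have "inverse pp = r + r'" by (simp add: field_simps)
    then show False using inverse_pp assms that by simp
  qed
  then show "1 - pp * r \<noteq> 0" using Zp_0 by fastforce
  show "inverse (1 - pp * r) \<in> Zp"
    using assms * by (rule_tac Zp_unit_cases[of "1 - pp * r"]) auto
qed

lemma smult_assoc [simp]: "a \<in> Zp \<Longrightarrow> b \<in> Zp \<Longrightarrow> x \<in> carrier G \<Longrightarrow> a \<odot> (b \<odot> x) = (a * b) \<odot> x"
  using smult_assoc1[of a b x] by simp

lemma smult_swap: "a \<in> Zp \<Longrightarrow> b \<in> Zp \<Longrightarrow> x \<in> carrier G \<Longrightarrow> a \<odot> (b \<odot> x) = b \<odot> (a \<odot> x)"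
  by (simp add: mult.commute)

lemma smult_add: "a \<in> Zp \<Longrightarrow> b \<in> Zp \<Longrightarrow> x \<in> carrier G \<Longrightarrow> (a + b) \<odot> x = a \<odot> x \<oplus> b \<odot> x"
  using smult_l_distr[of a b x] by simp

lemma smult_uminus: "a \<in> Zp \<Longrightarrow> x \<in> carrier G \<Longrightarrow> (- a) \<odot> x = \<ominus> (a \<odot> x)"
  using smult_l_minus[of a x] by simp

lemma smult_diff: "a \<in> Zp \<Longrightarrow> b \<in> Zp \<Longrightarrow> x \<in> carrier G \<Longrightarrow> (a - b) \<odot> x = a \<odot> x \<ominus> b \<odot> x"
  using smult_add[of a "- b" x] by (simp add: smult_uminus M.minus_eq)

lemma smult_zero [simp]: "x \<in> carrier G \<Longrightarrow> 0 \<odot> x = \<zero>" "a \<in> Zp \<Longrightarrow> a \<odot> \<zero> = \<zero>"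
  and smult_1 [simp]: "x \<in> carrier G \<Longrightarrow> 1 \<odot> x = x"
  using smult_l_null[of x] smult_r_null[of a] smult_one[of x] by simp_all

lemma minus_zero [simp]: "\<ominus> \<zero> = \<zero>"
  using M.minus_equality[of \<zero> \<zero>] by simp

text \<open>Registers, next to the group laws, the rules that expand scalar multiples, so that the
  \<open>algebra\<close> method settles identities mixing sums, differences and scalars.\<close>

lemmas zmod_simprules
  [algebra zmod "zero G" "add G" "a_inv G" "a_minus G"] =
  M.a_closed M.zero_closed M.a_inv_closed M.minus_closed smult_closed
  M.a_assoc M.l_zero M.l_neg M.a_comm M.minus_eq
  M.r_zero M.r_neg M.r_neg2 M.r_neg1 M.minus_add M.minus_minus minus_zero M.a_lcomm
  smult_assoc smult_add smult_uminus smult_diff smult_r_distr smult_r_minus smult_zero smult_1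
  Zp_0 Zp_1 Zp_add Zp_mult Zp_of_nat Zp_uminus Zp_diff Zp_power

lemma minus_eq_zero_iff:
  assumes "x \<in> carrier G" "y \<in> carrier G" shows "x \<ominus> y = \<zero> \<longleftrightarrow> x = y"
proof
  assume 0: "x \<ominus> y = \<zero>"
  have "x = (x \<ominus> y) \<oplus> y" using assms by algebra
  then show "x = y" using 0 assms by simp
next
  assume "x = y"
  moreover have "y \<ominus> y = \<zero>" using assms(2) by algebra
  ultimately show "x \<ominus> y = \<zero>" by simp
qed

lemma smI:
  assumes "S \<subseteq> carrier G" "\<zero> \<in> S" "\<And>x y. x \<in> S \<Longrightarrow> y \<in> S \<Longrightarrow> x \<oplus> y \<in> S"
    "\<And>a x. a \<in> Zp \<Longrightarrow> x \<in> S \<Longrightarrow> a \<odot> x \<in> S"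
  shows "sm S"
  using assms module_axioms by (intro LinearCombinations.submodule.intro) auto

lemma sm_carrier: "sm S \<Longrightarrow> x \<in> S \<Longrightarrow> x \<in> carrier G"
  and sm_zero: "sm S \<Longrightarrow> \<zero> \<in> S"
  and sm_add: "sm S \<Longrightarrow> x \<in> S \<Longrightarrow> y \<in> S \<Longrightarrow> x \<oplus> y \<in> S"
  and sm_smult: "sm S \<Longrightarrow> a \<in> Zp \<Longrightarrow> x \<in> S \<Longrightarrow> a \<odot> x \<in> S"
  unfolding LinearCombinations.submodule_def by auto

lemma minus_smult: "x \<in> carrier G \<Longrightarrow> \<ominus> x = (-1) \<odot> x"
  by (simp add: smult_uminus)

lemma sm_uminus: "sm S \<Longrightarrow> x \<in> S \<Longrightarrow> \<ominus> x \<in> S"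
  using minus_smult sm_smult[of S "-1"] sm_carrier by fastforce

lemma sm_diff: "sm S \<Longrightarrow> x \<in> S \<Longrightarrow> y \<in> S \<Longrightarrow> x \<ominus> y \<in> S"
  by (simp add: M.minus_eq sm_add sm_uminus)

lemma sm_INT: "\<lbrakk>\<And>i. i \<in> A \<Longrightarrow> sm (S i); A \<noteq> {}\<rbrakk> \<Longrightarrow> sm (\<Inter>i\<in>A. S i)"
  by (rule smI) (auto intro: sm_zero sm_add sm_smult dest: sm_carrier)

end


section \<open>Heights\<close>

text \<open>The assumption says that the type of ordinals is long enough: the chain of submodules
  has become stationary within it. It is the only demand on the type besides being well-ordered, and
  \<open>p_power_stable\<close> provides it for the types of the theorem.\<close>

locale zmodk = zmod p G for p :: nat and G :: "(rat, 'a) module" (structure) +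
  fixes T :: "'k::wellorder itself"
  assumes inf_divisible: "p_mult p G (p_power_inf TYPE('k) p G) = p_power_inf TYPE('k) p G"
begin

abbreviation ht :: "'a \<Rightarrow> 'k height" where "ht x \<equiv> height p G x"

text \<open>Treats ordinals and infinity alike, so that every lower bound on a height becomes
  membership in one submodule; see \<open>ht_ge_iff\<close>.\<close>

definition pw :: "'k height \<Rightarrow> 'a set" where
  "pw c = (case c of Ord \<alpha> \<Rightarrow> p_power p G \<alpha> | Infty \<Rightarrow> p_power_inf TYPE('k) p G)"

lemma pw_simps: "pw (Ord \<alpha>) = p_power p G \<alpha>" "pw Infty = p_power_inf TYPE('k) p G"
  by (simp_all add: pw_def)

lemmas decreasing = p_power_decreasing[OF prime module_axioms]

lemma sm_p_mult: "sm S \<Longrightarrow> sm (p_mult p G S)"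
proof (rule smI)
  assume S: "sm S"
  note S' = sm_carrier[OF S] sm_add[OF S] sm_smult[OF S] sm_zero[OF S]
  show "p_mult p G S \<subseteq> carrier G" using S' by (auto simp: p_mult_def)
  show "\<zero> \<in> p_mult p G S" using S' by (auto simp: p_mult_def image_iff intro!: bexI[of _ \<zero>])
  show "x \<oplus> y \<in> p_mult p G S" if xy: "x \<in> p_mult p G S" "y \<in> p_mult p G S" for x y
  proof -
    obtain x' y' where *: "x' \<in> S" "y' \<in> S" "x = pp \<odot> x'" "y = pp \<odot> y'"
      using xy by (auto simp: p_mult_def)
    then have "x \<oplus> y = pp \<odot> (x' \<oplus> y')" using S' by (simp add: smult_r_distr)
    with * S' show ?thesis by (auto simp: p_mult_def)
  qed
  show "a \<odot> x \<in> p_mult p G S" if a: "a \<in> Zp" and x: "x \<in> p_mult p G S" for a x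
  proof -
    obtain x' where *: "x' \<in> S" "x = pp \<odot> x'"
      using x by (auto simp: p_mult_def)
    then have "a \<odot> x = pp \<odot> (a \<odot> x')" using S' a by (simp add: mult.commute)
    with * S' a show ?thesis unfolding p_mult_def by blast
  qed
qed

lemma sm_p_power: "sm (p_power p G (\<alpha> :: 'k))"
proof (induction \<alpha> rule: less_induct)
  case (less \<alpha>)
  consider "\<And>\<gamma>. \<not> \<gamma> < \<alpha>" | \<gamma> where "is_pred \<gamma> \<alpha>"
    | \<gamma> where "\<gamma> < \<alpha>" "\<And>\<gamma>. \<not> is_pred \<gamma> \<alpha>"
    by blast
  then show ?case
  proof cases
    case 1
    then show ?thesis by (simp add: p_power_zero smI)
  next
    case (2 \<gamma>)
    then have "\<gamma> < \<alpha>" by (simp add: is_pred_def)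
    then show ?thesis by (simp add: p_power_Suc[OF 2] sm_p_mult less)
  next
    case (3 \<gamma>)
    then show ?thesis unfolding p_power_limit[OF 3] by (intro sm_INT less) auto
  qed
qed

lemma sm_pw: "sm (pw c)"
  by (cases c) (auto simp: pw_simps p_power_inf_def intro: sm_p_power sm_INT)

lemma p_mult_mono: "S \<subseteq> S' \<Longrightarrow> p_mult p G S \<subseteq> p_mult p G S'"
  by (auto simp: p_mult_def)

lemma p_power_antimono: "(\<alpha> :: 'k) \<le> \<beta> \<Longrightarrow> p_power p G \<beta> \<subseteq> p_power p G \<alpha>"
  using decreasing(1)[of \<alpha> \<beta>] decreasing(2)[of \<alpha>] by (cases "\<alpha> = \<beta>") (auto simp: order_less_le)

lemma ht_unique:
  assumes "x \<in> p_power p G \<alpha> - p_mult p G (p_power p G \<alpha>)"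
    "x \<in> p_power p G \<beta> - p_mult p G (p_power p G (\<beta> :: 'k))"
  shows "\<alpha> = \<beta>"
  using decreasing(1)[of \<alpha> \<beta>] decreasing(1)[of \<beta> \<alpha>] assms by (cases \<alpha> \<beta> rule: linorder_cases) auto

lemma ht_eq_Ord:
  "ht x = Ord \<alpha> \<longleftrightarrow> x \<in> p_power p G \<alpha> - p_mult p G (p_power p G \<alpha>)"
proof (cases "\<exists>\<alpha>::'k. x \<in> p_power p G \<alpha> - p_mult p G (p_power p G \<alpha>)")
  case True
  then obtain \<beta> :: 'k where \<beta>: "x \<in> p_power p G \<beta> - p_mult p G (p_power p G \<beta>)" by blast
  then have "(THE \<beta>::'k. x \<in> p_power p G \<beta> - p_mult p G (p_power p G \<beta>)) = \<beta>"
    using ht_unique by blast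
  then have "ht x = Ord \<beta>" using True by (simp add: height_def)
  then show ?thesis using \<beta> ht_unique by auto
next
  case False
  then show ?thesis by (auto simp: height_def)
qed

lemma ht_eq_Infty:
  assumes "x \<in> carrier G"
  shows "ht x = Infty \<longleftrightarrow> x \<in> p_power_inf TYPE('k) p G"
proof
  assume "ht x = Infty"
  then have *: "x \<in> p_mult p G (p_power p G \<alpha>)" if "x \<in> p_power p G \<alpha>" for \<alpha> :: 'k
    using that ht_eq_Ord[of x \<alpha>] by auto
  have "x \<in> p_power p G \<alpha>" for \<alpha> :: 'k
  proof (induction \<alpha> rule: less_induct)
    case (less \<alpha>)
    consider "\<And>\<gamma>. \<not> \<gamma> < \<alpha>" | \<gamma> where "is_pred \<gamma> \<alpha>"
      | \<gamma> where "\<gamma> < \<alpha>" "\<And>\<gamma>. \<not> is_pred \<gamma> \<alpha>"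
      by blast
    then show ?case
    proof cases
      case 1
      then show ?thesis by (simp add: p_power_zero assms)
    next
      case (2 \<gamma>)
      then have "\<gamma> < \<alpha>" by (simp add: is_pred_def)
      then show ?thesis using * less by (simp add: p_power_Suc[OF 2])
    next
      case (3 \<gamma>)
      then show ?thesis unfolding p_power_limit[OF 3] using less by auto
    qed
  qed
  then show "x \<in> p_power_inf TYPE('k) p G" by (simp add: p_power_inf_def)
next
  assume x: "x \<in> p_power_inf TYPE('k) p G"
  have "x \<in> p_mult p G (p_power p G \<alpha>)" for \<alpha> :: 'k
  proof -
    have "p_power_inf TYPE('k) p G \<subseteq> p_power p G \<alpha>" by (auto simp: p_power_inf_def)
    from p_mult_mono[OF this] show ?thesis using x inf_divisible by auto
  qed
  then show "ht x = Infty" using ht_eq_Ord[of x] by (cases "ht x") auto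
qed

lemma ht_ge_iff:
  assumes "x \<in> carrier G" shows "c \<le> ht x \<longleftrightarrow> x \<in> pw c"
proof (cases "ht x")
  case Infty
  then have "x \<in> p_power_inf TYPE('k) p G" using ht_eq_Infty assms by simp
  then have "x \<in> pw c" by (cases c) (auto simp: pw_simps p_power_inf_def)
  then show ?thesis using Infty by simp
next
  case (Ord \<alpha>)
  then have x: "x \<in> p_power p G \<alpha> - p_mult p G (p_power p G \<alpha>)" using ht_eq_Ord by simp
  show ?thesis
  proof (cases c)
    case (Ord \<beta>)
    then show ?thesis using x \<open>ht x = Ord \<alpha>\<close> p_power_antimono[of \<beta> \<alpha>] decreasing(1)[of \<alpha> \<beta>]
      by (cases "\<beta> \<le> \<alpha>") (auto simp: pw_simps not_le)
  next
    case Infty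
    then show ?thesis using \<open>ht x = Ord \<alpha>\<close> ht_eq_Infty[OF assms] by (auto simp: pw_simps)
  qed
qed

lemma Ord_less_ht_iff:
  assumes "x \<in> carrier G" shows "Ord \<alpha> < ht x \<longleftrightarrow> x \<in> p_mult p G (p_power p G \<alpha>)"
proof -
  have "Ord \<alpha> < ht x \<longleftrightarrow> Ord \<alpha> \<le> ht x \<and> ht x \<noteq> Ord \<alpha>" by auto
  also have "\<dots> \<longleftrightarrow> x \<in> p_mult p G (p_power p G \<alpha>)"
    unfolding ht_ge_iff[OF assms] ht_eq_Ord pw_simps using decreasing(2)[of \<alpha>] by auto
  finally show ?thesis .
qed

lemma le_Infty [simp]: "(c :: 'k height) \<le> Infty"
  by simp

lemma Infty_le [simp]: "Infty \<le> (c :: 'k height) \<longleftrightarrow> c = Infty"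
  by (cases c) auto

lemma Ord_less_Infty [simp]: "Ord (\<alpha> :: 'k) < Infty"
  by (simp add: less_height_def)

lemma Ord_less_Ord [simp]: "Ord (\<alpha> :: 'k) < Ord \<beta> \<longleftrightarrow> \<alpha> < \<beta>"
  by (auto simp: less_height_def)

lemma ht_zero [simp]: "ht \<zero> = Infty"
  using ht_ge_iff[of \<zero> Infty] sm_zero[OF sm_pw, of Infty] by simp

lemma ht_add: "x \<in> carrier G \<Longrightarrow> y \<in> carrier G \<Longrightarrow> c \<le> ht x \<Longrightarrow> c \<le> ht y \<Longrightarrow> c \<le> ht (x \<oplus> y)"
  using sm_add[OF sm_pw] by (simp add: ht_ge_iff)

lemma ht_smult_ge: "x \<in> carrier G \<Longrightarrow> a \<in> Zp \<Longrightarrow> c \<le> ht x \<Longrightarrow> c \<le> ht (a \<odot> x)"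
  using sm_smult[OF sm_pw] by (simp add: ht_ge_iff)

lemma ht_smult: "x \<in> carrier G \<Longrightarrow> a \<in> Zp \<Longrightarrow> ht x \<le> ht (a \<odot> x)"
  by (rule ht_smult_ge) auto

lemma ht_smult_unit:
  assumes "x \<in> carrier G" "a \<in> Zp" "inverse a \<in> Zp" "a \<noteq> 0"
  shows "ht (a \<odot> x) = ht x"
proof (rule antisym)
  have "ht (a \<odot> x) \<le> ht (inverse a \<odot> (a \<odot> x))" by (rule ht_smult) (use assms in auto)
  then show "ht (a \<odot> x) \<le> ht x" using assms by simp
qed (use assms ht_smult in auto)

lemma ht_mult_unit:
  assumes "x \<in> carrier G" "a \<in> Zp" "inverse a \<in> Zp" "a \<noteq> 0" "b \<in> Zp"
  shows "ht ((b * a) \<odot> x) = ht (b \<odot> x)" "ht ((a * b) \<odot> x) = ht (b \<odot> x)"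
  using ht_smult_unit[of "b \<odot> x" a] assms by (simp_all add: mult.commute)

lemma ht_uminus [simp]: "x \<in> carrier G \<Longrightarrow> ht (\<ominus> x) = ht x"
  using ht_smult_unit[of x "-1"] by (simp add: minus_smult[symmetric])

lemma ht_diff: "x \<in> carrier G \<Longrightarrow> y \<in> carrier G \<Longrightarrow> c \<le> ht x \<Longrightarrow> c \<le> ht y \<Longrightarrow> c \<le> ht (x \<ominus> y)"
  by (simp add: M.minus_eq ht_add)

lemma ht_add_less:
  assumes "x \<in> carrier G" "y \<in> carrier G" "ht x < ht y"
  shows "ht (x \<oplus> y) = ht x"
proof (rule antisym)
  show "ht x \<le> ht (x \<oplus> y)" using assms by (intro ht_add) auto
  show "ht (x \<oplus> y) \<le> ht x"
  proof (rule ccontr)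
    assume "\<not> ?thesis"
    then have *: "ht x < ht (x \<oplus> y)" by simp
    define c where "c = min (ht (x \<oplus> y)) (ht y)"
    have "c \<le> ht ((x \<oplus> y) \<ominus> y)" using assms by (intro ht_diff) (auto simp: c_def)
    moreover have "(x \<oplus> y) \<ominus> y = x" using assms by algebra
    ultimately show False using * assms(3) by (simp add: c_def min_def split: if_splits)
  qed
qed

lemma ht_p_less: "x \<in> carrier G \<Longrightarrow> ht x = Ord \<alpha> \<Longrightarrow> Ord \<alpha> < ht (pp \<odot> x)"
  using Ord_less_ht_iff[of "pp \<odot> x" \<alpha>] ht_eq_Ord[of x \<alpha>] by (auto simp: p_mult_def)

lemma ht_p_less_ge: "x \<in> carrier G \<Longrightarrow> Ord \<alpha> \<le> ht x \<Longrightarrow> Ord \<alpha> < ht (pp \<odot> x)"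
proof (cases "ht x")
  case Infty
  then show "x \<in> carrier G \<Longrightarrow> ?thesis" using ht_smult[of x pp] by simp
next
  case (Ord \<beta>)
  assume "x \<in> carrier G" "Ord \<alpha> \<le> ht x"
  then show ?thesis using ht_p_less[of x \<beta>] Ord by (metis order_le_less_trans)
qed

lemma ht_p_divide:
  assumes "x \<in> carrier G" "Ord \<alpha> < ht x"
  obtains v where "v \<in> carrier G" "Ord \<alpha> \<le> ht v" "x = pp \<odot> v"
  using assms Ord_less_ht_iff[of x \<alpha>] ht_ge_iff[of _ "Ord \<alpha>"] sm_carrier[OF sm_p_power]
  by (auto simp: p_mult_def pw_simps)

lemma ht_p_divide_Infty:
  assumes "x \<in> carrier G" "ht x = Infty"
  obtains v where "v \<in> carrier G" "ht v = Infty" "x = pp \<odot> v"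
proof -
  have "x \<in> p_mult p G (p_power_inf TYPE('k) p G)"
    using assms ht_eq_Infty inf_divisible by simp
  then obtain v where v: "v \<in> pw Infty" "x = pp \<odot> v"
    by (auto simp: p_mult_def pw_simps)
  have vc: "v \<in> carrier G" using sm_carrier[OF sm_pw] v(1) by simp
  have "Infty \<le> ht v" using ht_ge_iff[OF vc] v(1) by blast
  then have "ht v = Infty" using Infty_le by blast
  with v vc show ?thesis by (intro that) auto
qed

text \<open>If \<alpha> were the last ordinal of the type, the intersection would be
  \<open>p_power p G \<alpha>\<close> and the height of x would be infinite. Kaplansky's step needs
  the successor of a height as an element of the type.\<close>

lemma ht_Ord_succ:
  assumes "x \<in> carrier G" "ht x = Ord \<alpha>"
  obtains \<alpha>' where "is_pred \<alpha> \<alpha>'"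
proof -
  have "\<exists>\<beta>. \<alpha> < \<beta>"
  proof (rule ccontr)
    assume "\<not> ?thesis"
    then have "p_power p G \<alpha> \<subseteq> p_power p G \<beta>" for \<beta> :: 'k
      using p_power_antimono[of \<beta> \<alpha>] by (meson not_le)
    then have "p_power p G \<alpha> \<subseteq> p_power_inf TYPE('k) p G"
      by (auto simp: p_power_inf_def)
    then have "x \<in> p_power_inf TYPE('k) p G" using assms(2) ht_eq_Ord by auto
    with ht_eq_Infty[OF assms(1)] assms(2) show False by simp
  qed
  then have "is_pred \<alpha> (LEAST \<beta>. \<alpha> < \<beta>)"
    unfolding is_pred_def by (metis LeastI_ex not_less_Least not_le)
  then show ?thesis by (rule that)
qed

lemma is_pred_less_iff: "is_pred \<alpha> \<alpha>' \<Longrightarrow> Ord \<alpha> < c \<longleftrightarrow> Ord \<alpha>' \<le> (c :: 'k height)"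
  by (cases c) (auto simp: is_pred_def not_le[symmetric])

end

section \<open>Spans, rational hulls and finite quotients\<close>

context zmod
begin

lemma sm_span: "A \<subseteq> carrier G \<Longrightarrow> sm (span A)"
  by (rule span_is_submodule)

lemma span_base: "A \<subseteq> carrier G \<Longrightarrow> x \<in> A \<Longrightarrow> x \<in> span A"
  using in_own_span by blast

lemma span_least: "sm N \<Longrightarrow> A \<subseteq> N \<Longrightarrow> span A \<subseteq> N"
  by (rule span_is_subset)

text \<open>The right-hand side describes a submodule containing the generators. Splitting off a
  single coefficient in this way drives the inductions over generators.\<close>

lemma span_insert_iff:
  assumes "x \<in> carrier G" "A \<subseteq> carrier G"
  shows "y \<in> span (insert x A) \<longleftrightarrow> (\<exists>r\<in>Zp. \<exists>s\<in>span A. y = r \<odot> x \<oplus> s)"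
proof
  note A = sm_carrier[OF sm_span[OF assms(2)]] sm_zero[OF sm_span[OF assms(2)]]
    sm_add[OF sm_span[OF assms(2)]] sm_smult[OF sm_span[OF assms(2)]]
  define N where "N = {y. \<exists>r\<in>Zp. \<exists>s\<in>span A. y = r \<odot> x \<oplus> s}"
  have "sm N"
  proof (rule smI)
    show "N \<subseteq> carrier G" using A assms by (auto simp: N_def)
    have "\<zero> = 0 \<odot> x \<oplus> \<zero>" using assms by simp
    then show "\<zero> \<in> N" unfolding N_def using A(2) Zp_0 by blast
    show "y \<oplus> z \<in> N" if yz: "y \<in> N" "z \<in> N" for y z
    proof -
      obtain r s r' s' where *: "r \<in> Zp" "s \<in> span A" "y = r \<odot> x \<oplus> s" "r' \<in> Zp" "s' \<in> span A" "z = r' \<odot> x \<oplus> s'"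
        using yz unfolding N_def by blast
      then have c: "s \<in> carrier G" "s' \<in> carrier G" using A by auto
      have "y \<oplus> z = (r + r') \<odot> x \<oplus> (s \<oplus> s')" unfolding *(3,6) using c assms *(1,4) by algebra
      then show ?thesis unfolding N_def using Zp_add[OF *(1,4)] A(3)[OF *(2,5)] by blast
    qed
    show "a \<odot> y \<in> N" if a: "a \<in> Zp" and y: "y \<in> N" for a y
    proof -
      obtain r s where *: "r \<in> Zp" "s \<in> span A" "y = r \<odot> x \<oplus> s"
        using y unfolding N_def by blast
      then have "s \<in> carrier G" using A by auto
      then have "a \<odot> y = (a * r) \<odot> x \<oplus> (a \<odot> s)" unfolding *(3) using assms *(1) a by algebra
      then show ?thesis unfolding N_def using Zp_mult[OF a *(1)] A(4)[OF a *(2)] by blast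
    qed
  qed
  moreover have "insert x A \<subseteq> N"
  proof
    fix z assume "z \<in> insert x A"
    then consider "z = x" | "z \<in> A" by blast
    then show "z \<in> N"
    proof cases
      case 1
      then have "z = 1 \<odot> x \<oplus> \<zero>" using assms by simp
      then show ?thesis unfolding N_def using A(2) Zp_1 by blast
    next
      case 2
      then have "z = 0 \<odot> x \<oplus> z" using assms by auto
      then show ?thesis unfolding N_def using span_base[OF assms(2) 2] Zp_0 by blast
    qed
  qed
  ultimately have "span (insert x A) \<subseteq> N" by (rule span_least)
  then show "y \<in> span (insert x A) \<Longrightarrow> \<exists>r\<in>Zp. \<exists>s\<in>span A. y = r \<odot> x \<oplus> s"
    by (auto simp: N_def)
next
  assume "\<exists>r\<in>Zp. \<exists>s\<in>span A. y = r \<odot> x \<oplus> s"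
  then obtain r s where *: "r \<in> Zp" "s \<in> span A" "y = r \<odot> x \<oplus> s" by blast
  have i: "insert x A \<subseteq> carrier G" using assms by auto
  have "s \<in> span (insert x A)" using *(2) span_is_monotone[of A "insert x A"] by auto
  then show "y \<in> span (insert x A)"
    using * span_base[OF i, of x] sm_add[OF sm_span[OF i]] sm_smult[OF sm_span[OF i]] by auto
qed

abbreviation hl :: "'a set \<Rightarrow> 'a set" where "hl K \<equiv> rational_hull p G K"

text \<open>Units can be divided out, so powers of p suffice as denominators; unlike arbitrary
  scalars they are linearly ordered by divisibility.\<close>

lemma hl_iff:
  assumes "sm K" shows "x \<in> hl K \<longleftrightarrow> x \<in> carrier G \<and> (\<exists>m. pp ^ m \<odot> x \<in> K)"
proof
  assume "x \<in> hl K"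
  then obtain a where a: "x \<in> carrier G" "a \<in> Zp" "a \<noteq> 0" "a \<odot> x \<in> K"
    by (auto simp: rational_hull_def)
  then obtain k u where *: "a = pp ^ k * u" "u \<in> Zp" "inverse u \<in> Zp" "u \<noteq> 0"
    using Zp_decompose by blast
  have "inverse u \<odot> (a \<odot> x) \<in> K" using sm_smult[OF assms *(3) a(4)] .
  also have "inverse u \<odot> (a \<odot> x) = (inverse u * a) \<odot> x" using a * by simp
  also have "inverse u * a = pp ^ k" using * by simp
  finally show "x \<in> carrier G \<and> (\<exists>m. pp ^ m \<odot> x \<in> K)" using a by blast
next
  assume "x \<in> carrier G \<and> (\<exists>m. pp ^ m \<odot> x \<in> K)"
  then show "x \<in> hl K"
    unfolding rational_hull_def using Zp_power[OF Zp_of_nat[of p]] by (auto intro!: bexI[of _ "pp ^ _"])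
qed

lemma hl_base: "sm K \<Longrightarrow> K \<subseteq> hl K"
  using hl_iff[of K] sm_carrier[of K] by (metis power_0 smult_1 subsetI)

lemma sm_hl:
  assumes K: "sm K" shows "sm (hl K)"
proof (rule smI)
  show "hl K \<subseteq> carrier G" using hl_iff[OF K] by auto
  show "\<zero> \<in> hl K" using hl_base[OF K] sm_zero[OF K] by auto
  show "x \<oplus> y \<in> hl K" if xy: "x \<in> hl K" "y \<in> hl K" for x y
  proof -
    obtain m n where *: "x \<in> carrier G" "y \<in> carrier G" "pp ^ m \<odot> x \<in> K" "pp ^ n \<odot> y \<in> K"
      using xy hl_iff[OF K] by auto
    have "pp ^ n \<odot> (pp ^ m \<odot> x) \<oplus> pp ^ m \<odot> (pp ^ n \<odot> y) \<in> K"
      by (intro sm_add[OF K] sm_smult[OF K] *) auto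
    also have "pp ^ n \<odot> (pp ^ m \<odot> x) \<oplus> pp ^ m \<odot> (pp ^ n \<odot> y) = pp ^ (m + n) \<odot> (x \<oplus> y)"
      using * by (simp add: smult_r_distr power_add mult.commute)
    finally show ?thesis using * hl_iff[OF K] by blast
  qed
  show "a \<odot> x \<in> hl K" if a: "a \<in> Zp" and x: "x \<in> hl K" for a x
  proof -
    obtain m where *: "x \<in> carrier G" "pp ^ m \<odot> x \<in> K"
      using x hl_iff[OF K] by auto
    have "a \<odot> (pp ^ m \<odot> x) \<in> K" by (rule sm_smult[OF K a *(2)])
    also have "a \<odot> (pp ^ m \<odot> x) = pp ^ m \<odot> (a \<odot> x)" using * a by (simp add: mult.commute)
    finally show ?thesis using * a hl_iff[OF K] by auto
  qed
qed

lemma hl_hl: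
  assumes K: "sm K" shows "hl (hl K) = hl K"
proof
  show "hl (hl K) \<subseteq> hl K"
  proof
    fix x assume "x \<in> hl (hl K)"
    then obtain m where m: "x \<in> carrier G" "pp ^ m \<odot> x \<in> hl K" using hl_iff[OF sm_hl[OF K]] by auto
    then obtain n where "pp ^ n \<odot> (pp ^ m \<odot> x) \<in> K" using hl_iff[OF K] by auto
    then show "x \<in> hl K" using m hl_iff[OF K] by (metis Zp_of_nat Zp_power power_add smult_assoc)
  qed
qed (rule hl_base[OF sm_hl[OF K]])

lemma hl_mono: "K \<subseteq> L \<Longrightarrow> hl K \<subseteq> hl L"
  by (auto simp: rational_hull_def)

text \<open>Each generator falls into K after multiplication by some \<open>p ^ m\<close>, so its
  coefficient matters only modulo \<open>p ^ m\<close>.\<close>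

lemma finite_span_mod:
  assumes "finite A" "sm K" "A \<subseteq> hl K"
  shows "\<exists>F. finite F \<and> F \<subseteq> span A \<and> (\<forall>s\<in>span A. \<exists>r\<in>F. s \<ominus> r \<in> K)"
  using assms(1,3)
proof (induction A)
  case empty
  then show ?case
    using sm_zero[OF assms(2)] by (intro exI[of _ "{\<zero>}"]) (auto simp: span_def lincomb_def M.minus_eq)
next
  case (insert x A)
  have hc: "hl K \<subseteq> carrier G" by (auto simp: rational_hull_def)
  have x: "x \<in> carrier G" and A: "A \<subseteq> carrier G" using insert.prems hc by auto
  obtain m where m: "pp ^ m \<odot> x \<in> K" using insert.prems hl_iff[OF assms(2)] by auto
  obtain F where F: "finite F" "F \<subseteq> span A" "\<And>s. s \<in> span A \<Longrightarrow> \<exists>r\<in>F. s \<ominus> r \<in> K"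
    using insert by auto
  define F' where "F' = (\<lambda>(q, r). of_nat q \<odot> x \<oplus> r) ` ({..<p ^ m} \<times> F)"
  have "F' \<subseteq> span (insert x A)"
  proof
    fix y assume "y \<in> F'"
    then obtain q r where "y = of_nat q \<odot> x \<oplus> r" "r \<in> F" by (auto simp: F'_def)
    then show "y \<in> span (insert x A)" unfolding span_insert_iff[OF x A] using F(2) Zp_of_nat[of q] by blast
  qed
  moreover have "finite F'" using F(1) by (simp add: F'_def)
  moreover have "\<exists>r\<in>F'. s \<ominus> r \<in> K" if s: "s \<in> span (insert x A)" for s
  proof -
    obtain c t where c: "c \<in> Zp" "t \<in> span A" "s = c \<odot> x \<oplus> t"
      using s span_insert_iff[OF x A] by blast
    obtain q c' where q: "q < p ^ m" "c' \<in> Zp" "c = of_nat q + pp ^ m * c'"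
      using Zp_residue[OF c(1)] by blast
    obtain r where r: "r \<in> F" "t \<ominus> r \<in> K" using F(3) c(2) by blast
    have tr: "t \<in> carrier G" "r \<in> carrier G"
      using c(2) r(1) F(2) sm_carrier[OF sm_span[OF A]] by auto
    have "s \<ominus> (of_nat q \<odot> x \<oplus> r) = c' \<odot> (pp ^ m \<odot> x) \<oplus> (t \<ominus> r)"
    proof -
      have "s \<ominus> (of_nat q \<odot> x \<oplus> r) = (c - of_nat q) \<odot> x \<oplus> (t \<ominus> r)"
        unfolding c(3) using c(1) x tr by algebra
      also have "c - of_nat q = c' * pp ^ m" using q by simp
      finally show ?thesis using q x by simp
    qed
    also have "\<dots> \<in> K" by (rule sm_add[OF assms(2) sm_smult[OF assms(2) q(2) m] r(2)])
    finally have "s \<ominus> (of_nat q \<odot> x \<oplus> r) \<in> K" .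
    moreover have "of_nat q \<odot> x \<oplus> r \<in> F'"
      unfolding F'_def using r(1) q(1) by (intro image_eqI[of _ _ "(q, r)"]) auto
    ultimately show ?thesis by blast
  qed
  ultimately show ?case by blast
qed

text \<open>
  The coefficients of a generator occurring in \<open>M\<close> form an ideal generated by a power of \<open>p\<close>, so each
  generator contributes at most \<open>p\<close> classes.
\<close>

lemma finite_elementary_quotient:
  assumes "finite A" "A \<subseteq> carrier G" "sm M" "M \<subseteq> span A" "sm N" "\<And>x. x \<in> M \<Longrightarrow> pp \<odot> x \<in> N"
  shows "\<exists>F. finite F \<and> (\<forall>x\<in>M. \<exists>r\<in>F. r \<in> carrier G \<and> x \<ominus> r \<in> N)"
  using assms(1,2,3,4,6)
proof (induction A arbitrary: M)
  case empty
  then have "M \<subseteq> {\<zero>}" by (auto simp: span_def lincomb_def)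
  then show ?case
    using sm_zero[OF assms(5)] by (intro exI[of _ "{\<zero>}"]) (auto simp: M.minus_eq)
next
  case (insert g A)
  have g: "g \<in> carrier G" and A: "A \<subseteq> carrier G" using insert.prems by auto
  note spc = sm_carrier[OF sm_span[OF A]]
  note spA = sm_zero[OF sm_span[OF A]] sm_add[OF sm_span[OF A]] sm_smult[OF sm_span[OF A]] sm_diff[OF sm_span[OF A]]
  note Mc = sm_carrier[OF \<open>sm M\<close>]
  define M' where "M' = M \<inter> span A"
  have "sm M'" unfolding M'_def
    using \<open>sm M\<close> sm_span[OF A] sm_INT[of "{M, span A}" id] by auto
  then obtain F where F: "finite F" "\<And>x. x \<in> M' \<Longrightarrow> \<exists>r\<in>F. r \<in> carrier G \<and> x \<ominus> r \<in> N"
    using insert.IH[OF A, of M'] insert.prems by (auto simp: M'_def)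
  \<comment> \<open>\<open>J k\<close> says that \<open>pp ^ k\<close> occurs as coefficient of g in
    some element of M. With the least such k, one element m0 of M suffices to cancel the
    g-coefficient of any other.\<close>
  define J where "J k \<longleftrightarrow> (\<exists>s\<in>span A. pp ^ k \<odot> g \<oplus> s \<in> M)" for k
  have J: "\<exists>k u. r = pp ^ k * u \<and> u \<in> Zp \<and> J k" if r: "r \<in> Zp" "r \<noteq> 0" "s \<in> span A" "r \<odot> g \<oplus> s \<in> M" for r s
  proof -
    obtain k u where *: "r = pp ^ k * u" "u \<in> Zp" "inverse u \<in> Zp" "u \<noteq> 0"
      using Zp_decompose[OF r(1,2)] by blast
    have "inverse u \<odot> (r \<odot> g \<oplus> s) \<in> M" by (rule sm_smult[OF \<open>sm M\<close> *(3) that(4)])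
    also have "inverse u \<odot> (r \<odot> g \<oplus> s) = pp ^ k \<odot> g \<oplus> inverse u \<odot> s"
    proof -
      have "inverse u \<odot> (r \<odot> g \<oplus> s) = (inverse u * r) \<odot> g \<oplus> inverse u \<odot> s"
        using *(3) that(1) spc[OF that(3)] g by (simp add: smult_r_distr)
      also have "inverse u * r = pp ^ k" using *(1,4) by simp
      finally show ?thesis .
    qed
    finally have "J k" unfolding J_def using spA(3)[OF *(3) that(3)] by blast
    then show ?thesis using * by blast
  qed
  show ?case
  proof (cases "\<exists>k. J k")
    case False
    have "M \<subseteq> M'"
    proof
      fix x assume x: "x \<in> M"
      then obtain r s where rs: "r \<in> Zp" "s \<in> span A" "x = r \<odot> g \<oplus> s"
        using insert.prems(3) span_insert_iff[OF g A] by blast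
      then have "r = 0" using J[of r s] False x by auto
      then show "x \<in> M'" unfolding M'_def using x rs g spc by simp
    qed
    then show ?thesis using F by blast
  next
    case True
    define k where "k = (LEAST k. J k)"
    have "J k" unfolding k_def using True by (rule LeastI_ex)
    then obtain s0 where s0: "s0 \<in> span A" "pp ^ k \<odot> g \<oplus> s0 \<in> M" unfolding J_def by blast
    define m0 where "m0 = pp ^ k \<odot> g \<oplus> s0"
    have m0: "m0 \<in> M" "m0 \<in> carrier G" using s0 Mc by (auto simp: m0_def)
    \<comment> \<open>Coefficients of m0 matter only modulo p, because p times m0 lies in N.\<close>
    define F' where "F' = (\<lambda>(q, r). of_nat q \<odot> m0 \<oplus> r) ` ({..<p} \<times> F)"
    have "\<exists>r\<in>F'. r \<in> carrier G \<and> x \<ominus> r \<in> N" if x: "x \<in> M" for x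
    proof -
      obtain r s where rs: "r \<in> Zp" "s \<in> span A" "x = r \<odot> g \<oplus> s"
        using insert.prems(3) span_insert_iff[OF g A] x by blast
      have "\<exists>q\<in>Zp. r = pp ^ k * q"
      proof (cases "r = 0")
        case False
        then obtain j u where ju: "r = pp ^ j * u" "u \<in> Zp" "J j" using J[of r s] rs x by auto
        then have "k \<le> j" unfolding k_def by (simp add: Least_le)
        then have "r = pp ^ k * (pp ^ (j - k) * u)" using ju by (simp flip: power_add mult.assoc)
        then show ?thesis using ju by (metis Zp_mult Zp_of_nat Zp_power)
      next
        case True
        then show ?thesis by (intro bexI[of _ 0]) auto
      qed
      then obtain q where q: "q \<in> Zp" "r = pp ^ k * q" by blast
      obtain q0 q1 where q01: "q0 < p" "q1 \<in> Zp" "q = of_nat q0 + pp * q1"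
        using Zp_residue[OF q(1), of 1] by auto
      have "x \<ominus> q \<odot> m0 \<in> M" using x m0 q by (intro sm_diff[OF \<open>sm M\<close>] sm_smult[OF \<open>sm M\<close>])
      moreover have sc: "s \<in> carrier G" "s0 \<in> carrier G" using rs s0 spc by auto
      moreover have "x \<ominus> q \<odot> m0 = s \<ominus> q \<odot> s0"
      proof -
        have "x \<ominus> q \<odot> m0 = (r - q * pp ^ k) \<odot> g \<oplus> (s \<ominus> q \<odot> s0)"
          unfolding rs(3) m0_def using rs(1) q(1) g sc by algebra
        then show ?thesis using q g sc by simp
      qed
      moreover have "s \<ominus> q \<odot> s0 \<in> span A" by (rule spA(4)[OF rs(2) spA(3)[OF q(1) s0(1)]])
      ultimately have "x \<ominus> q \<odot> m0 \<in> M'" unfolding M'_def by simp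
      then obtain f where f: "f \<in> F" "f \<in> carrier G" "(x \<ominus> q \<odot> m0) \<ominus> f \<in> N" using F by blast
      have xc: "x \<in> carrier G" using x Mc by blast
      have "q1 \<odot> (pp \<odot> m0) \<oplus> ((x \<ominus> q \<odot> m0) \<ominus> f) \<in> N"
        by (intro sm_add[OF assms(5) sm_smult[OF assms(5) q01(2)]] insert.prems(4) f m0)
      also have "q1 \<odot> (pp \<odot> m0) \<oplus> ((x \<ominus> q \<odot> m0) \<ominus> f) = (x \<ominus> (q - q1 * pp) \<odot> m0) \<ominus> f"
        using xc m0(2) q(1) q01(2) f(2) by algebra
      also have "q - q1 * pp = of_nat q0" using q01 by simp
      also have "(x \<ominus> of_nat q0 \<odot> m0) \<ominus> f = x \<ominus> (of_nat q0 \<odot> m0 \<oplus> f)"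
        using xc m0(2) f(2) by algebra
      finally have "x \<ominus> (of_nat q0 \<odot> m0 \<oplus> f) \<in> N" .
      moreover have "of_nat q0 \<odot> m0 \<oplus> f \<in> carrier G" using f(2) m0(2) by simp
      moreover have "of_nat q0 \<odot> m0 \<oplus> f \<in> F'"
        unfolding F'_def using f(1) q01(1) by (intro image_eqI[of _ _ "(q0, f)"]) auto
      ultimately show ?thesis by blast
    qed
    moreover have "finite F'" using F by (simp add: F'_def)
    ultimately show ?thesis by blast
  qed
qed

end


section \<open>Decomposition sets\<close>

context zmodk
begin

abbreviation dset :: "'a set \<Rightarrow> bool" where
  "dset X \<equiv> finite X \<and> decomposition_set T p G X"

lemma dset_carrier: "dset X \<Longrightarrow> X \<subseteq> carrier G"
  by (simp add: decomposition_set_def)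

lemma dset_subset: "dset X \<Longrightarrow> Y \<subseteq> X \<Longrightarrow> dset Y"
  unfolding decomposition_set_def lin_dep_def by (meson finite_subset order_trans subset_iff)

lemma lincomb_in_span: "finite A \<Longrightarrow> a \<in> A \<rightarrow> Zp \<Longrightarrow> lincomb a A \<in> span A"
  unfolding span_def by blast

lemma ht_lincomb_ge:
  assumes "finite A" "A \<subseteq> carrier G" "a \<in> A \<rightarrow> Zp" "\<And>x. x \<in> A \<Longrightarrow> c \<le> ht (a x \<odot> x)"
  shows "c \<le> ht (lincomb a A)"
  using assms
proof (induction A)
  case empty
  then show ?case by (simp add: lincomb_def)
next
  case (insert x A)
  then have "lincomb a (insert x A) = a x \<odot> x \<oplus> lincomb a A"
    using lincomb_insert[of A a x] by (auto simp: Pi_def)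
  moreover have "a x \<in> Zp" "x \<in> carrier G" "a \<in> A \<rightarrow> Zp" "A \<subseteq> carrier G" using insert.prems by auto
  ultimately show ?case using insert by (auto intro!: ht_add)
qed

lemma dset_lincomb_le:
  assumes X: "dset X" and a: "a \<in> X \<rightarrow> Zp" and x: "x \<in> X"
  shows "ht (lincomb a X) \<le> ht (a x \<odot> x)"
proof -
  have "ht (lincomb a X) = Min ((\<lambda>x. ht (a x \<odot> x)) ` X)"
    using X a x unfolding decomposition_set_def lincomb_def by blast
  then show ?thesis using X x by simp
qed

lemma dset_indep:
  assumes X: "dset X" and a: "a \<in> X \<rightarrow> Zp" and x: "x \<in> X" and 0: "lincomb a X = \<zero>"
  shows "a x = 0"
proof (rule ccontr)
  assume "a x \<noteq> 0"
  then have "lin_dep X" using lin_dep_crit[of X X a x] X a x 0 by simp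
  then show False using X unfolding decomposition_set_def by blast
qed

text \<open>A combination is never lower than its lowest term by \<open>ht_lincomb_ge\<close>, so
  one inequality is enough. Independence, applied to a family supported at one element, also gives
  infinite order.\<close>

lemma dsetI:
  assumes fin: "finite X" and X: "X \<subseteq> carrier G"
    and indep: "\<And>a x. a \<in> X \<rightarrow> Zp \<Longrightarrow> lincomb a X = \<zero> \<Longrightarrow> x \<in> X \<Longrightarrow> a x = 0"
    and le: "\<And>a x. a \<in> X \<rightarrow> Zp \<Longrightarrow> x \<in> X \<Longrightarrow> ht (lincomb a X) \<le> ht (a x \<odot> x)"
  shows "dset X"
proof -
  have "of_nat n \<odot> x \<noteq> \<zero>" if x: "x \<in> X" and n: "0 < n" for x and n :: nat
  proof
    assume 0: "of_nat n \<odot> x = \<zero>"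
    define a where "a y = (if y = x then of_nat n else 0 :: rat)" for y
    have "lincomb a X = a x \<odot> x \<oplus> lincomb a (X - {x})"
      using lincomb_del2[OF fin X _ x, of a] by (auto simp: a_def)
    also have "lincomb a (X - {x}) = lincomb (\<lambda>_. 0) (X - {x})"
      using X by (intro lincomb_cong) (auto simp: a_def)
    also have "\<dots> = \<zero>" using X unfolding lincomb_def by (intro M.add.finprod_one_eqI) auto
    finally have "lincomb a X = a x \<odot> x \<oplus> \<zero>" .
    moreover have "a x \<odot> x = \<zero>" using 0 by (simp add: a_def)
    ultimately have "lincomb a X = \<zero>" by simp
    then have "a x = 0" using indep[of a x] x by (auto simp: a_def)
    then show False using n by (simp add: a_def)
  qed
  moreover have "ht (\<Oplus>x\<in>A. a x \<odot> x) = Min ((\<lambda>x. ht (a x \<odot> x)) ` A)"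
    if A: "finite A" "A \<noteq> {}" "A \<subseteq> X" "a \<in> A \<rightarrow> Zp" for A a
  proof -
    \<comment> \<open>A combination over a subset becomes one over all of X by extending the
      coefficients by zero.\<close>
    define b where "b x = (if x \<in> A then a x else 0)" for x
    have b: "b \<in> X \<rightarrow> Zp" using A(4) by (auto simp: b_def)
    have Xs: "X = A \<union> (X - A)" using A by auto
    have "lincomb b (A \<union> (X - A)) = lincomb b A \<oplus> lincomb b (X - A)"
      using A X fin b by (intro lincomb_union) auto
    also have "lincomb b (X - A) = \<zero>" unfolding lincomb_def using X
      by (intro M.add.finprod_one_eqI) (auto simp: b_def)
    also have "lincomb b A = lincomb a A"
      using A X by (intro lincomb_cong) (auto simp: b_def)
    finally have eq: "lincomb b X = lincomb a A" using Xs A X by auto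
    have "ht (lincomb a A) = Min ((\<lambda>x. ht (a x \<odot> x)) ` A)"
    proof (rule antisym)
      show "Min ((\<lambda>x. ht (a x \<odot> x)) ` A) \<le> ht (lincomb a A)"
        using A X by (intro ht_lincomb_ge) auto
      have "ht (lincomb a A) \<le> ht (a x \<odot> x)" if x: "x \<in> A" for x
        using le[OF b, of x] eq x A(3) by (auto simp: b_def)
      then show "ht (lincomb a A) \<le> Min ((\<lambda>x. ht (a x \<odot> x)) ` A)" using A by simp
    qed
    then show ?thesis by (simp add: lincomb_def)
  qed
  moreover have "lin_indpt X" by (rule finite_lin_indpt2[OF fin X]) (use indep in auto)
  ultimately show ?thesis using fin X unfolding decomposition_set_def by auto
qed

lemma lincomb_insert_upd:
  assumes "finite B" "B \<subseteq> carrier G" "x \<in> carrier G" "x \<notin> B" "a \<in> B \<rightarrow> Zp" "c \<in> Zp"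
  shows "lincomb (a(x := c)) (insert x B) = c \<odot> x \<oplus> lincomb a B"
proof -
  have "lincomb (a(x := c)) (insert x B) = c \<odot> x \<oplus> lincomb (a(x := c)) B"
    using lincomb_insert[of B "a(x := c)" x] assms by (auto simp: Pi_def)
  also have "lincomb (a(x := c)) B = lincomb a B"
    using assms by (intro lincomb_cong) auto
  finally show ?thesis .
qed

text \<open>This is the form in which decomposition sets are used: passing to the x-coordinate, or
  to the part without x, never lowers the height.\<close>

lemma dset_split:
  assumes X: "dset X" and B: "B \<subseteq> X" and x: "x \<in> X" "x \<notin> B" and z: "z \<in> span B" and c: "c \<in> Zp"
  shows "ht (c \<odot> x \<oplus> z) \<le> ht (c \<odot> x)" "ht (c \<odot> x \<oplus> z) \<le> ht z"
    "c \<odot> x \<oplus> z = \<zero> \<Longrightarrow> c = 0"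
proof -
  have d: "dset (insert x B)" using dset_subset[OF X] B x by auto
  have fB: "finite B" "B \<subseteq> carrier G" "x \<in> carrier G" using B X x dset_carrier[OF X] finite_subset by auto
  obtain a where a: "a \<in> B \<rightarrow> Zp" "z = lincomb a B" using finite_in_span[OF fB(1,2) z] by auto
  have eq: "lincomb (a(x := c)) (insert x B) = c \<odot> x \<oplus> z"
    unfolding a(2) by (rule lincomb_insert_upd) (use fB x a c in auto)
  have P: "a(x := c) \<in> insert x B \<rightarrow> Zp" using a c by auto
  show 1: "ht (c \<odot> x \<oplus> z) \<le> ht (c \<odot> x)" using dset_lincomb_le[OF d P, of x] eq by simp
  show "c = 0" if "c \<odot> x \<oplus> z = \<zero>" using dset_indep[OF d P, of x] eq that by simp
  have zc: "z \<in> carrier G" using z sm_carrier[OF sm_span[OF fB(2)]] by blast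
  have "ht (c \<odot> x \<oplus> z) \<le> ht ((c \<odot> x \<oplus> z) \<ominus> c \<odot> x)"
    using 1 zc fB c by (intro ht_diff) auto
  also have "(c \<odot> x \<oplus> z) \<ominus> c \<odot> x = z" using zc fB(3) c by algebra
  finally show "ht (c \<odot> x \<oplus> z) \<le> ht z" .
qed

lemma dset_insert:
  assumes B: "dset B" and x: "x \<in> carrier G" "x \<notin> B"
    and indep: "\<And>c z. c \<in> Zp \<Longrightarrow> z \<in> span B \<Longrightarrow> c \<odot> x \<oplus> z = \<zero> \<Longrightarrow> c = 0"
    and le: "\<And>c z. c \<in> Zp \<Longrightarrow> z \<in> span B \<Longrightarrow> ht (c \<odot> x \<oplus> z) \<le> ht (c \<odot> x)"
  shows "dset (insert x B)"
proof (rule dsetI)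
  have fB: "finite B" "B \<subseteq> carrier G" using B dset_carrier by auto
  show "finite (insert x B)" "insert x B \<subseteq> carrier G" using fB x by auto
  fix a y assume a: "a \<in> insert x B \<rightarrow> Zp" and y: "y \<in> insert x B"
  then have ax: "a x \<in> Zp" and aB: "a \<in> B \<rightarrow> Zp" by auto
  have eq: "lincomb a (insert x B) = a x \<odot> x \<oplus> lincomb a B"
    using lincomb_insert_upd[OF fB x aB ax] by simp
  have z: "lincomb a B \<in> span B" "lincomb a B \<in> carrier G"
    using fB aB lincomb_in_span by auto
  have le1: "ht (a x \<odot> x \<oplus> lincomb a B) \<le> ht (a x \<odot> x)" using le ax z by blast
  show "ht (lincomb a (insert x B)) \<le> ht (a y \<odot> y)"
  proof (cases "y = x")
    case True then show ?thesis using le1 eq by simp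
  next
    case False
    have "ht (a x \<odot> x \<oplus> lincomb a B) \<le> ht ((a x \<odot> x \<oplus> lincomb a B) \<ominus> a x \<odot> x)"
      using le1 z x ax by (intro ht_diff) auto
    also have "(a x \<odot> x \<oplus> lincomb a B) \<ominus> a x \<odot> x = lincomb a B" using z(2) x(1) ax by algebra
    also have "ht (lincomb a B) \<le> ht (a y \<odot> y)" using dset_lincomb_le[OF B aB] y False by auto
    finally show ?thesis using eq by simp
  qed
  assume 0: "lincomb a (insert x B) = \<zero>"
  then have "a x = 0" using indep[OF ax z(1)] eq by simp
  moreover from this have "lincomb a B = \<zero>" using 0 eq z x by simp
  ultimately show "a y = 0" using dset_indep[OF B aB] y by auto
qed

text \<open>The multiples are inserted one by one. The span of those already present lies in the
  span of the original elements, so \<open>dset_split\<close> for X applies; a repetition among them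
  would be a relation in which the coefficient of x does not vanish.\<close>

lemma dset_multiples:
  assumes X: "dset X" and A: "A \<subseteq> X" and k: "\<And>x. x \<in> A \<Longrightarrow> k x \<in> Zp \<and> k x \<noteq> 0"
  shows "dset ((\<lambda>x. k x \<odot> x) ` A)" "inj_on (\<lambda>x. k x \<odot> x) A"
proof -
  have "finite A" using A X finite_subset by auto
  then have "dset ((\<lambda>x. k x \<odot> x) ` A) \<and> inj_on (\<lambda>x. k x \<odot> x) A" using A k
  proof (induction A)
    case empty
    have "dset {}" by (rule dset_subset[OF X]) auto
    then show ?case by simp
  next
    case (insert x A)
    define B where "B = (\<lambda>x. k x \<odot> x) ` A"
    have IH: "dset B" "inj_on (\<lambda>x. k x \<odot> x) A" using insert unfolding B_def by auto
    have x: "x \<in> X" "x \<in> carrier G" "k x \<in> Zp" "k x \<noteq> 0" and AX: "A \<subseteq> X" "A \<subseteq> carrier G"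
      using insert.prems dset_carrier[OF X] by auto
    have "k y \<odot> y \<in> span A" if "y \<in> A" for y
      using sm_smult[OF sm_span[OF AX(2)] _ span_base[OF AX(2) that]] insert.prems(2)[of y] that by blast
    then have "B \<subseteq> span A" unfolding B_def by blast
    then have B: "span B \<subseteq> span A" using span_least[OF sm_span[OF AX(2)]] by blast
    have *: "c \<odot> (k x \<odot> x) = (c * k x) \<odot> x" if "c \<in> Zp" for c using that x by simp
    have kx: "k x \<odot> x \<notin> B"
    proof
      assume "k x \<odot> x \<in> B"
      then have s: "\<ominus> (k x \<odot> x) \<in> span A"
        using \<open>B \<subseteq> span A\<close> sm_uminus[OF sm_span[OF AX(2)]] by auto
      have "k x \<odot> x \<oplus> \<ominus> (k x \<odot> x) = \<zero>" using x(2,3) by algebra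
      then show False using dset_split(3)[OF X AX(1) x(1) insert.hyps(2) s x(3)] x(4) by simp
    qed
    have "dset (insert (k x \<odot> x) B)"
    proof (rule dset_insert[OF IH(1) _ kx])
      show "k x \<odot> x \<in> carrier G" using x by simp
      fix c z assume c: "c \<in> Zp" and z: "z \<in> span B"
      have z': "z \<in> span A" using z B by blast
      note s = dset_split[OF X AX(1) x(1) insert.hyps(2) z', of "c * k x"]
      show "ht (c \<odot> (k x \<odot> x) \<oplus> z) \<le> ht (c \<odot> (k x \<odot> x))" using s c x by simp
      show "c = 0" if "c \<odot> (k x \<odot> x) \<oplus> z = \<zero>" using s(3) that c x by simp
    qed
    then show ?case using IH kx unfolding B_def by auto
  qed
  then show "dset ((\<lambda>x. k x \<odot> x) ` A)" "inj_on (\<lambda>x. k x \<odot> x) A" by auto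
qed

lemma finite_attains_max:
  fixes f :: "'i \<Rightarrow> 'k height"
  assumes "finite A" "A \<noteq> {}"
  obtains m where "m \<in> A" "\<And>x. x \<in> A \<Longrightarrow> f x \<le> f m"
proof -
  have "Max (f ` A) \<in> f ` A" using assms by (intro Max_in) auto
  then obtain m where m: "m \<in> A" "Max (f ` A) = f m" by auto
  have "f x \<le> f m" if "x \<in> A" for x using assms(1) that unfolding m(2)[symmetric] by simp
  with m(1) show thesis by (rule that)
qed

text \<open>If every value is at most \<open>ht (r \<odot> x)\<close>, then changing c by a multiple
  of r does not decrease \<open>hh c\<close>, so the maximum is taken over the finitely many
  residues modulo the p-part of r.\<close>

lemma max_over_residues:
  assumes hh: "\<And>c c'. c \<in> Zp \<Longrightarrow> c' \<in> Zp \<Longrightarrow> min (hh c) (ht ((c - c') \<odot> x)) \<le> hh c'"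
    and r: "r \<in> Zp" "r \<noteq> 0" and le: "\<And>c. c \<in> Zp \<Longrightarrow> hh c \<le> ht (r \<odot> x)" and x: "x \<in> carrier G"
  shows "\<exists>b\<in>Zp. \<forall>c\<in>Zp. hh c \<le> (hh b :: 'k height)"
proof -
  obtain j u where j: "r = pp ^ j * u" "u \<in> Zp" "inverse u \<in> Zp" "u \<noteq> 0"
    using Zp_decompose[OF r] by blast
  then have htr: "ht (r \<odot> x) = ht (pp ^ j \<odot> x)" using ht_mult_unit(1)[OF x j(2-4)] by simp
  have "{..<p ^ j} \<noteq> {}" by (auto simp: lessThan_empty_iff)
  then obtain q where q: "\<And>q'. q' \<in> {..<p ^ j} \<Longrightarrow> hh (of_nat q') \<le> hh (of_nat q)"
    using finite_attains_max[of "{..<p ^ j}" "\<lambda>q. hh (of_nat q)"] by blast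
  have "hh c \<le> hh (of_nat q)" if c: "c \<in> Zp" for c
  proof -
    obtain q' c' where q': "q' < p ^ j" "c' \<in> Zp" "c = of_nat q' + pp ^ j * c'"
      using Zp_residue[OF c] by blast
    have "ht (pp ^ j \<odot> x) \<le> ht (c' \<odot> (pp ^ j \<odot> x))" using q' x by (intro ht_smult) auto
    also have "\<dots> = ht ((c - of_nat q') \<odot> x)" using q' x by (simp add: mult.commute)
    finally have "hh c \<le> hh (of_nat q')" using hh[OF c, of "of_nat q'"] le[OF c] htr
      by (auto simp: min_def split: if_splits)
    also have "\<dots> \<le> hh (of_nat q)" using q[of q'] q'(1) by simp
    finally show ?thesis .
  qed
  then show ?thesis by (intro bexI[of _ "of_nat q"]) auto
qed

text \<open>Induction on B. For a fixed coefficient c of x the induction hypothesis gives a best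
  element, whose height is called \<open>hh c\<close>; the difficulty is to find a maximum over the
  infinitely many c. Without one, \<open>hh\<close> outgrows every \<open>ht (r \<odot> x)\<close>
  with r nonzero. This forces the coefficient that cancels the x-coordinate of y to lie in the ring,
  and that coefficient then turns out to be at least as good as one chosen to beat it.\<close>

lemma dset_coset_max:
  assumes X: "dset X" and "B \<subseteq> X" "y \<in> hl (span X)"
  shows "\<exists>z\<in>span B. \<forall>z'\<in>span B. ht (y \<oplus> z') \<le> ht (y \<oplus> z)"
proof -
  have Xc: "X \<subseteq> carrier G" by (rule dset_carrier[OF X])
  note sX = sm_span[OF Xc]
  have "finite B" using assms finite_subset by auto
  then show ?thesis using assms(2,3)
  proof (induction B arbitrary: y)
    case empty
    then show ?case by (auto simp: span_def lincomb_def)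
  next
    case (insert x B)
    have x: "x \<in> X" "x \<in> carrier G" and BX: "B \<subseteq> X" "B \<subseteq> carrier G" using insert.prems Xc by auto
    have y: "y \<in> carrier G" "y \<in> hl (span X)" using insert.prems hl_iff[OF sX] by auto
    note sB = sm_span[OF BX(2)]
    note Bc = sm_carrier[OF sB]
    have xh: "c \<odot> x \<in> hl (span X)" if "c \<in> Zp" for c
      using that sm_smult[OF sm_hl[OF sX]] hl_base[OF sX] span_base[OF Xc x(1)] by blast
    have "\<exists>z\<in>span B. \<forall>z'\<in>span B. ht ((y \<oplus> c \<odot> x) \<oplus> z') \<le> ht ((y \<oplus> c \<odot> x) \<oplus> z)" if "c \<in> Zp" for c
      using insert.IH[OF BX(1), of "y \<oplus> c \<odot> x"] y xh[OF that] sm_add[OF sm_hl[OF sX]] by blast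
    then obtain zc where zc: "\<And>c. c \<in> Zp \<Longrightarrow> zc c \<in> span B"
      and zmax: "\<And>c z'. c \<in> Zp \<Longrightarrow> z' \<in> span B \<Longrightarrow> ht ((y \<oplus> c \<odot> x) \<oplus> z') \<le> ht ((y \<oplus> c \<odot> x) \<oplus> zc c)"
      by metis
    have zcc: "zc c \<in> carrier G" if "c \<in> Zp" for c using zc[OF that] Bc by blast
    define hh where "hh c = ht ((y \<oplus> c \<odot> x) \<oplus> zc c)" for c
    \<comment> \<open>Two best elements differ by \<open>(c - c') \<odot> x\<close> modulo
      \<open>span B\<close>, so if both are high then this multiple of x is high.\<close>
    have K1: "min (hh c) (hh c') \<le> ht ((c - c') \<odot> x)" if c: "c \<in> Zp" "c' \<in> Zp" for c c'
    proof -
      have "min (hh c) (hh c') \<le> ht (((y \<oplus> c \<odot> x) \<oplus> zc c) \<ominus> ((y \<oplus> c' \<odot> x) \<oplus> zc c'))"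
        unfolding hh_def using c y x zcc by (intro ht_diff) auto
      also have "((y \<oplus> c \<odot> x) \<oplus> zc c) \<ominus> ((y \<oplus> c' \<odot> x) \<oplus> zc c') = (c - c') \<odot> x \<oplus> (zc c \<ominus> zc c')"
        using y(1) x(2) zcc[OF c(1)] zcc[OF c(2)] c by algebra
      also have "ht \<dots> \<le> ht ((c - c') \<odot> x)"
        by (rule dset_split(1)[OF X BX(1) x(1) insert.hyps(2)]) (use sm_diff[OF sB] zc c in auto)
      finally show ?thesis .
    qed
    have K2: "min (hh c) (ht ((c - c') \<odot> x)) \<le> hh c'" if c: "c \<in> Zp" "c' \<in> Zp" for c c'
    proof -
      have "min (hh c) (ht ((c - c') \<odot> x)) \<le> ht (((y \<oplus> c \<odot> x) \<oplus> zc c) \<ominus> (c - c') \<odot> x)"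
        unfolding hh_def using c y x zcc by (intro ht_diff) auto
      also have "((y \<oplus> c \<odot> x) \<oplus> zc c) \<ominus> (c - c') \<odot> x = (y \<oplus> c' \<odot> x) \<oplus> zc c"
        using y(1) x(2) zcc[OF c(1)] c by algebra
      also have "ht \<dots> \<le> hh c'" unfolding hh_def using zmax[OF c(2) zc[OF c(1)]] .
      finally show ?thesis .
    qed
    obtain m where m: "pp ^ m \<odot> y \<in> span X" using y hl_iff[OF sX] by auto
    have Xx: "X - {x} \<subseteq> X" "X - {x} \<subseteq> carrier G" "insert x (X - {x}) = X" using Xc x by auto
    obtain d w where dw: "d \<in> Zp" "w \<in> span (X - {x})" "pp ^ m \<odot> y = d \<odot> x \<oplus> w"
      using m span_insert_iff[OF x(2) Xx(2)] Xx(3) by auto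
    have wc: "w \<in> carrier G" using dw sm_carrier[OF sm_span[OF Xx(2)]] by blast
    \<comment> \<open>\<open>d + pp ^ m * c\<close> is the x-coordinate of \<open>pp ^ m\<close>
      times the best element for c, and an element is no higher than its coordinates.\<close>
    have K3: "hh c \<le> ht ((d + pp ^ m * c) \<odot> x)" if c: "c \<in> Zp" for c
    proof -
      have "hh c \<le> ht (pp ^ m \<odot> ((y \<oplus> c \<odot> x) \<oplus> zc c))"
        unfolding hh_def using c y x zcc by (intro ht_smult) auto
      also have "pp ^ m \<odot> ((y \<oplus> c \<odot> x) \<oplus> zc c) = pp ^ m \<odot> y \<oplus> ((pp ^ m * c) \<odot> x \<oplus> pp ^ m \<odot> zc c)"
        using y(1) x(2) zcc[OF c] c by algebra
      also have "\<dots> = (d + pp ^ m * c) \<odot> x \<oplus> (w \<oplus> pp ^ m \<odot> zc c)"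
        unfolding dw(3) using wc dw(1) x(2) zcc[OF c] c by algebra
      also have "ht \<dots> \<le> ht ((d + pp ^ m * c) \<odot> x)"
      proof (rule dset_split(1)[OF X Xx(1) x(1)])
        have "zc c \<in> span (X - {x})"
          using zc[OF c] span_is_monotone[of B "X - {x}"] BX(1) insert.hyps(2) by blast
        then show "w \<oplus> pp ^ m \<odot> zc c \<in> span (X - {x})"
          using dw sm_add[OF sm_span[OF Xx(2)]] sm_smult[OF sm_span[OF Xx(2)]] by simp
      qed (use dw c in auto)
      finally show ?thesis .
    qed
    have max: "\<exists>b\<in>Zp. \<forall>c\<in>Zp. hh c \<le> hh b"
    proof (rule ccontr)
      assume no: "\<not> ?thesis"
      \<comment> \<open>By \<open>max_over_residues\<close>, if there is no maximum then no
        \<open>ht (r \<odot> x)\<close> with r nonzero is an upper bound for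
        \<open>hh\<close>.\<close>
      have case2: "\<exists>c\<in>Zp. ht (r \<odot> x) < hh c" if r: "r \<in> Zp" "r \<noteq> 0" for r
        using max_over_residues[OF K2 r _ x(2)] no by (meson not_le)
      obtain c0 where c0: "c0 \<in> Zp" "ht (pp ^ m \<odot> x) < hh c0" using case2[of "pp ^ m"] by auto
      \<comment> \<open>The x-coordinate of y is d divided by p^m. Were it not in the ring, K3 would
        bound \<open>hh c0\<close> by \<open>ht (pp ^ m \<odot> x)\<close>, which c0 was chosen to
        exceed.\<close>
      have "\<exists>e\<in>Zp. d = pp ^ m * e"
      proof -
        have "d + pp ^ m * c0 \<in> Zp" "pp ^ m \<in> Zp" using dw(1) c0(1) by simp_all
        from Zp_total[OF this] consider r where "r \<in> Zp" "d + pp ^ m * c0 = pp ^ m * r"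
          | r where "r \<in> Zp" "pp ^ m = (d + pp ^ m * c0) * pp * r"
          by blast
        then show ?thesis
        proof cases
          case 1
          then have "d = pp ^ m * (r - c0)" by (simp add: algebra_simps)
          moreover have "r - c0 \<in> Zp" using 1(1) c0(1) by simp
          ultimately show ?thesis ..
        next
          case 2
          have "ht ((d + pp ^ m * c0) \<odot> x) \<le> ht ((pp * r) \<odot> ((d + pp ^ m * c0) \<odot> x))"
            using 2(1) dw(1) c0(1) x(2) by (intro ht_smult) auto
          also have "(pp * r) \<odot> ((d + pp ^ m * c0) \<odot> x) = ((d + pp ^ m * c0) * pp * r) \<odot> x"
            using 2(1) dw(1) c0(1) x(2) by (simp add: ac_simps)
          also have "ht \<dots> < hh c0" unfolding 2(2)[symmetric] by (rule c0(2))
          finally show ?thesis using K3[OF c0(1)] by simp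
        qed
      qed
      then obtain e where e: "e \<in> Zp" "d = pp ^ m * e" by blast
      define b where "b = - e"
      have b: "b \<in> Zp" using e by (simp add: b_def)
      have K3': "hh c \<le> ht ((pp ^ m * (c - b)) \<odot> x)" if "c \<in> Zp" for c
        using K3[OF that] by (simp add: e(2) b_def algebra_simps)
      obtain c1 where c1: "c1 \<in> Zp" "hh b < hh c1" using no b by (meson not_le)
      define D where "D = c1 - b"
      have D: "D \<in> Zp" "D \<noteq> 0" using c1 b by (auto simp: D_def)
      \<comment> \<open>The third condition makes c2 strictly closer to b than c1 is: by K3' the
        valuation of \<open>c2 - b\<close> must exceed that of D. Therefore \<open>c1 - c2\<close>
        is a unit times D, and K1 and K2 carry the height of c1 over to b.\<close>
      obtain c2 where c2: "c2 \<in> Zp" "hh c1 < hh c2" "ht ((pp ^ m * D) \<odot> x) < hh c2"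
      proof -
        obtain ca where ca: "ca \<in> Zp" "hh c1 < hh ca" using no c1 by (meson not_le)
        obtain cb where cb: "cb \<in> Zp" "ht ((pp ^ m * D) \<odot> x) < hh cb" using case2[of "pp ^ m * D"] D by auto
        show ?thesis using that[OF ca] that[OF cb(1)] ca cb by (cases "hh ca \<le> hh cb") auto
      qed
      have "\<exists>r\<in>Zp. c2 - b = D * pp * r"
      proof -
        have False if r: "r \<in> Zp" "D = (c2 - b) * r" for r
        proof -
          have "ht ((pp ^ m * (c2 - b)) \<odot> x) \<le> ht (r \<odot> ((pp ^ m * (c2 - b)) \<odot> x))"
            using r c2 b x by (intro ht_smult) auto
          also have "r \<odot> ((pp ^ m * (c2 - b)) \<odot> x) = (pp ^ m * D) \<odot> x"
            using r(1) c2 b x by (simp add: r(2) ac_simps)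
          finally show False using K3'[OF c2(1)] c2(3) by simp
        qed
        moreover have "c2 - b \<in> Zp" using c2(1) b by simp
        ultimately show ?thesis using Zp_total[OF D(1), of "c2 - b"] by blast
      qed
      then obtain r where r: "r \<in> Zp" "c2 - b = D * pp * r" by blast
      have "c1 - c2 = D * (1 - pp * r)" using r(2) by (simp add: D_def algebra_simps)
      then have "ht ((c1 - c2) \<odot> x) = ht (D \<odot> x)"
        using ht_mult_unit(1)[OF x(2) _ one_minus_unit[OF r(1)] D(1)] r(1) by simp
      then have "hh c1 \<le> ht (D \<odot> x)" using K1[OF c1(1) c2(1)] c2(2) by simp
      then have "hh c1 \<le> hh b" using K2[OF c1(1) b] by (simp add: D_def)
      with c1 show False by simp
    qed
    then obtain b where b: "b \<in> Zp" "\<And>c. c \<in> Zp \<Longrightarrow> hh c \<le> hh b" by blast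
    have "b \<odot> x \<oplus> zc b \<in> span (insert x B)" unfolding span_insert_iff[OF x(2) BX(2)] using b zc by blast
    moreover have "ht (y \<oplus> z') \<le> ht (y \<oplus> (b \<odot> x \<oplus> zc b))" if z': "z' \<in> span (insert x B)" for z'
    proof -
      obtain c s where c: "c \<in> Zp" "s \<in> span B" "z' = c \<odot> x \<oplus> s"
        using z' span_insert_iff[OF x(2) BX(2)] by blast
      have "y \<oplus> z' = (y \<oplus> c \<odot> x) \<oplus> s" unfolding c(3) using y x c(1) Bc[OF c(2)] by (simp add: M.a_assoc)
      then have "ht (y \<oplus> z') \<le> hh c" using zmax[OF c(1,2)] by (simp add: hh_def)
      also have "\<dots> \<le> hh b" using b c by blast
      also have "hh b = ht (y \<oplus> (b \<odot> x \<oplus> zc b))"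
        unfolding hh_def using y x b zcc[OF b(1)] by (simp add: M.a_assoc)
      finally show ?thesis .
    qed
    ultimately show ?case by blast
  qed
qed

text \<open>Modulo \<open>span X\<close> the group \<open>span A\<close> has finitely many classes,
  and on each class \<open>dset_coset_max\<close> supplies the highest element.\<close>

lemma fg_coset_max:
  assumes X: "dset X" and A: "finite A" "A \<subseteq> hl (span X)" "X \<subseteq> span A" and y: "y \<in> hl (span X)"
  shows "\<exists>z\<in>span A. \<forall>z'\<in>span A. ht (y \<oplus> z') \<le> ht (y \<oplus> z)"
proof -
  have Xc: "X \<subseteq> carrier G" by (rule dset_carrier[OF X])
  note sX = sm_span[OF Xc]
  have Ac: "A \<subseteq> carrier G" using A hl_iff[OF sX] by auto
  note sA = sm_span[OF Ac]
  have XA: "span X \<subseteq> span A" using span_least[OF sA A(3)] .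
  have Ah: "span A \<subseteq> hl (span X)" using span_least[OF sm_hl[OF sX] A(2)] .
  obtain F where F: "finite F" "F \<subseteq> span A" "\<And>s. s \<in> span A \<Longrightarrow> \<exists>r\<in>F. s \<ominus> r \<in> span X"
    using finite_span_mod[OF A(1) sX A(2)] by blast
  have "\<exists>z\<in>span X. \<forall>z'\<in>span X. ht ((y \<oplus> r) \<oplus> z') \<le> ht ((y \<oplus> r) \<oplus> z)" if "r \<in> F" for r
    using dset_coset_max[OF X order_refl] sm_add[OF sm_hl[OF sX] y] Ah F(2) that by blast
  then obtain z where z: "\<And>r. r \<in> F \<Longrightarrow> z r \<in> span X"
    and zmax: "\<And>r z'. r \<in> F \<Longrightarrow> z' \<in> span X \<Longrightarrow> ht ((y \<oplus> r) \<oplus> z') \<le> ht ((y \<oplus> r) \<oplus> z r)"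
    by metis
  have ne: "F \<noteq> {}" using F(3)[OF sm_zero[OF sA]] by auto
  define h where "h r = ht ((y \<oplus> r) \<oplus> z r)" for r
  obtain r0 where r0: "r0 \<in> F" and r0max: "\<And>r. r \<in> F \<Longrightarrow> h r \<le> h r0"
    using finite_attains_max[OF F(1) ne, of h] by blast
  have yc: "y \<in> carrier G" using y hl_iff[OF sX] by auto
  have "r0 \<oplus> z r0 \<in> span A" using sm_add[OF sA] F(2) r0 z[OF r0] XA by blast
  moreover have "ht (y \<oplus> s) \<le> ht (y \<oplus> (r0 \<oplus> z r0))" if s: "s \<in> span A" for s
  proof -
    obtain r where r: "r \<in> F" "s \<ominus> r \<in> span X" using F(3)[OF s] by blast
    have c: "s \<in> carrier G" "r \<in> carrier G" "r0 \<in> carrier G" "z r0 \<in> carrier G"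
      using s r r0 F(2) z[OF r0] sm_carrier[OF sA] sm_carrier[OF sX] by auto
    have "y \<oplus> s = (y \<oplus> r) \<oplus> (s \<ominus> r)" using yc c by algebra
    then have "ht (y \<oplus> s) \<le> h r" unfolding h_def using zmax[OF r] by simp
    also have "h r \<le> h r0" by (rule r0max[OF r(1)])
    also have "\<dots> = ht (y \<oplus> (r0 \<oplus> z r0))" unfolding h_def using yc c by (simp add: M.a_assoc)
    finally show ?thesis .
  qed
  ultimately show ?thesis by blast
qed

text \<open>The power of p is taken with valuation strictly above that of every nonzero
  \<open>b r\<close>, as the extra factor \<open>pp\<close> records.\<close>

lemma Zp_common_multiple:
  assumes "finite F" "\<And>r. r \<in> F \<Longrightarrow> b r \<in> Zp"
  shows "\<exists>k. \<forall>r\<in>F. b r = 0 \<or> (\<exists>c\<in>Zp. pp ^ k = b r * pp * c)"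
  using assms
proof (induction F)
  case (insert r F)
  then obtain k where k: "\<forall>r\<in>F. b r = 0 \<or> (\<exists>c\<in>Zp. pp ^ k = b r * pp * c)" by auto
  obtain l where l: "b r = 0 \<or> (\<exists>c\<in>Zp. pp ^ l = b r * pp * c)"
  proof (cases "b r = 0")
    case False
    then obtain l u where "b r = pp ^ l * u" "u \<in> Zp" "inverse u \<in> Zp" "u \<noteq> 0"
      using Zp_decompose insert.prems by blast
    then have "pp ^ Suc l = b r * pp * inverse u" by simp
    then show ?thesis using that \<open>inverse u \<in> Zp\<close> by blast
  qed (use that in blast)
  have step: "\<exists>c\<in>Zp. pp ^ (i + j) = b s * pp * c" if h: "\<exists>c\<in>Zp. pp ^ i = b s * pp * c" for i j s
  proof -
    obtain c where c: "c \<in> Zp" "pp ^ i = b s * pp * c" using h by blast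
    have "pp ^ (i + j) = b s * pp * (c * pp ^ j)" unfolding power_add c(2) by (simp only: mult.assoc)
    then show ?thesis using c by (intro bexI[of _ "c * pp ^ j"]) auto
  qed
  have "b s = 0 \<or> (\<exists>c\<in>Zp. pp ^ (k + l) = b s * pp * c)" if "s \<in> insert r F" for s
  proof (cases "s = r")
    case True
    then show ?thesis using l step[of l r k] by (auto simp: add.commute)
  next
    case False
    then show ?thesis using k step[of k s l] that by auto
  qed
  then show ?case by blast
qed simp

text \<open>For each of the finitely many classes r of \<open>span A\<close> modulo
  \<open>span X\<close>, take the highest element of the coset of r modulo
  \<open>span (insert x X)\<close> and let \<open>b r\<close> be its coefficient of x. If k exceeds
  the valuations of the nonzero \<open>b r\<close>, then for every c divisible by
  \<open>pp ^ k\<close> the multiple \<open>(c - b r) \<odot> x\<close> is no higher than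
  \<open>c \<odot> x\<close>. An element s + cx higher than cx would contradict this after
  subtracting the highest element of the coset.\<close>

lemma dset_fg_split:
  assumes X: "dset (insert x X)" and xX: "x \<notin> X"
    and A: "finite A" "A \<subseteq> hl (span X)" "X \<subseteq> span A"
  shows "\<exists>k. \<forall>s\<in>span A. \<forall>b\<in>Zp. ht (s \<oplus> (pp ^ k * b) \<odot> x) \<le> ht ((pp ^ k * b) \<odot> x)"
proof -
  have Xc: "X \<subseteq> carrier G" "x \<in> carrier G" "insert x X \<subseteq> carrier G" using dset_carrier[OF X] by auto
  note sX = sm_span[OF Xc(1)]
  have Ac: "A \<subseteq> carrier G" using A hl_iff[OF sX] by auto
  note sA = sm_span[OF Ac]
  have Ah: "span A \<subseteq> hl (span X)" using span_least[OF sm_hl[OF sX] A(2)] .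
  have Ah': "span A \<subseteq> hl (span (insert x X))"
    using Ah hl_mono[OF span_is_monotone[of X "insert x X"]] by auto
  obtain F where F: "finite F" "F \<subseteq> span A" "\<And>s. s \<in> span A \<Longrightarrow> \<exists>r\<in>F. s \<ominus> r \<in> span X"
    using finite_span_mod[OF A(1) sX A(2)] by blast
  define P where "P r b w \<longleftrightarrow> b \<in> Zp \<and> w \<in> span X \<and>
    (\<forall>z'\<in>span (insert x X). ht (r \<oplus> z') \<le> ht (r \<oplus> (b \<odot> x \<oplus> w)))" for r b w
  have "\<exists>b w. P r b w" if "r \<in> F" for r
  proof -
    have "r \<in> hl (span (insert x X))" using Ah' F(2) that by blast
    from dset_coset_max[OF X order_refl this]
    obtain z where z: "z \<in> span (insert x X)" "\<forall>z'\<in>span (insert x X). ht (r \<oplus> z') \<le> ht (r \<oplus> z)" ..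
    obtain b w where bw: "b \<in> Zp" "w \<in> span X" "z = b \<odot> x \<oplus> w"
      using z(1) span_insert_iff[OF Xc(2,1)] by auto
    have "P r b w" unfolding P_def using bw(1,2) z(2) unfolding bw(3) by (intro conjI)
    then show ?thesis by blast
  qed
  then obtain b w where P: "\<And>r. r \<in> F \<Longrightarrow> P r (b r) (w r)" by metis
  have b: "b r \<in> Zp" and w: "w r \<in> span X" if "r \<in> F" for r
    using P[OF that] by (simp_all add: P_def)
  have max: "ht (r \<oplus> z') \<le> ht (r \<oplus> (b r \<odot> x \<oplus> w r))"
    if "r \<in> F" "z' \<in> span (insert x X)" for r z'
    using P[OF that(1)] that(2) by (simp add: P_def)
  obtain k where k: "\<forall>r\<in>F. b r = 0 \<or> (\<exists>c\<in>Zp. pp ^ k = b r * pp * c)"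
    using Zp_common_multiple[OF F(1), of b] b by blast
  have "ht (s \<oplus> (pp ^ k * a) \<odot> x) \<le> ht ((pp ^ k * a) \<odot> x)" if s: "s \<in> span A" and a: "a \<in> Zp" for s a
  proof (rule ccontr)
    define c where "c = pp ^ k * a"
    have cZ: "c \<in> Zp" using a by (simp add: c_def)
    assume "\<not> ht (s \<oplus> (pp ^ k * a) \<odot> x) \<le> ht ((pp ^ k * a) \<odot> x)"
    then have less: "ht (c \<odot> x) < ht (s \<oplus> c \<odot> x)" by (simp add: c_def)
    obtain r where r: "r \<in> F" "s \<ominus> r \<in> span X" using F(3)[OF s] by blast
    have cc: "s \<in> carrier G" "r \<in> carrier G" "w r \<in> carrier G"
      using s r F(2) w[OF r(1)] sm_carrier[OF sA] sm_carrier[OF sX] by auto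
    have "s \<oplus> c \<odot> x = r \<oplus> (c \<odot> x \<oplus> (s \<ominus> r))" using cc Xc(2) cZ by algebra
    moreover have "c \<odot> x \<oplus> (s \<ominus> r) \<in> span (insert x X)"
      unfolding span_insert_iff[OF Xc(2,1)] using cZ r by blast
    ultimately have le: "ht (s \<oplus> c \<odot> x) \<le> ht (r \<oplus> (b r \<odot> x \<oplus> w r))" using max[OF r(1)] by simp
    have "ht (s \<oplus> c \<odot> x) \<le> ht ((s \<oplus> c \<odot> x) \<ominus> (r \<oplus> (b r \<odot> x \<oplus> w r)))"
      using le cc Xc cZ b[OF r(1)] by (intro ht_diff) auto
    also have "(s \<oplus> c \<odot> x) \<ominus> (r \<oplus> (b r \<odot> x \<oplus> w r)) = (c - b r) \<odot> x \<oplus> ((s \<ominus> r) \<ominus> w r)"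
      using cc Xc(2) cZ b[OF r(1)] by algebra
    also have "ht \<dots> \<le> ht ((c - b r) \<odot> x)"
      by (rule dset_split(1)[OF X _ _ xX]) (use sm_diff[OF sX r(2) w[OF r(1)]] cZ b[OF r(1)] in auto)
    finally have l2: "ht (c \<odot> x) < ht ((c - b r) \<odot> x)" using less by simp
    show False
    proof (cases "b r = 0")
      case True
      then show False using l2 by simp
    next
      case False
      then obtain c' where c': "c' \<in> Zp" "pp ^ k = b r * pp * c'" using k r(1) by blast
      \<comment> \<open>The coefficient c is a multiple of p times \<open>b r\<close>, so
        \<open>c - b r\<close> is \<open>b r\<close> times a unit, and its multiple of x has the
        height of \<open>b r \<odot> x\<close>, which is at most that of
        \<open>c \<odot> x\<close>.\<close>
      have ca: "c = (c' * a * pp) * b r" unfolding c_def c'(2) by (simp only: ac_simps)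
      then have e: "c - b r = (- b r) * (1 - pp * (c' * a))" by (simp add: algebra_simps)
      have "ht ((c - b r) \<odot> x) = ht ((- b r) \<odot> x)"
        unfolding e by (rule ht_mult_unit(1)[OF Xc(2) _ one_minus_unit]) (use b[OF r(1)] c'(1) a in auto)
      also have "\<dots> = ht (b r \<odot> x)" using b[OF r(1)] Xc(2) by (simp add: smult_uminus)
      also have "\<dots> \<le> ht ((c' * a * pp) \<odot> (b r \<odot> x))" using b[OF r(1)] Xc(2) c'(1) a by (intro ht_smult) auto
      also have "(c' * a * pp) \<odot> (b r \<odot> x) = c \<odot> x" unfolding ca using b[OF r(1)] Xc(2) c'(1) a by simp
      finally show False using l2 by simp
    qed
  qed
  then show ?thesis by (intro exI[of _ k] ballI)
qed

end


section \<open>Kaplansky's extension step\<close>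

text \<open>A lower bound on the number of classes of P modulo Q, phrased through a finite tuple of
  elements instead of cosets, so that back-and-forth systems can transport it.\<close>

definition incong :: "(rat, 'a) module \<Rightarrow> 'a set \<Rightarrow> 'a set \<Rightarrow> nat \<Rightarrow> bool" where
  "incong G P Q n \<longleftrightarrow> (\<exists>F\<subseteq>P. finite F \<and> card F = n \<and> (\<forall>a\<in>F. \<forall>b\<in>F. a \<noteq> b \<longrightarrow> a \<ominus>\<^bsub>G\<^esub> b \<notin> Q))"

text \<open>
  A height-preserving isomorphism between submodules is treated as its graph, which makes the
  situation symmetric in the two modules.
\<close>

definition height_iso ::
    "nat \<Rightarrow> (rat, 'a) module \<Rightarrow> (rat, 'b) module \<Rightarrow> 'k::wellorder itself \<Rightarrow> ('a \<times> 'b) set \<Rightarrow> bool" where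
  "height_iso p G H T \<Phi> \<longleftrightarrow>
     \<Phi> \<subseteq> carrier G \<times> carrier H \<and> (\<zero>\<^bsub>G\<^esub>, \<zero>\<^bsub>H\<^esub>) \<in> \<Phi> \<and>
     (\<forall>s t s' t'. (s, t) \<in> \<Phi> \<longrightarrow> (s', t') \<in> \<Phi> \<longrightarrow> (s \<oplus>\<^bsub>G\<^esub> s', t \<oplus>\<^bsub>H\<^esub> t') \<in> \<Phi>) \<and>
     (\<forall>r s t. r \<in> carrier (Z_loc p) \<longrightarrow> (s, t) \<in> \<Phi> \<longrightarrow> (r \<odot>\<^bsub>G\<^esub> s, r \<odot>\<^bsub>H\<^esub> t) \<in> \<Phi>) \<and>
     (\<forall>s t. (s, t) \<in> \<Phi> \<longrightarrow> (s = \<zero>\<^bsub>G\<^esub> \<longleftrightarrow> t = \<zero>\<^bsub>H\<^esub>)) \<and>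
     (\<forall>s t. (s, t) \<in> \<Phi> \<longrightarrow> (height p G s :: 'k height) = height p H t)"

lemma height_isoD:
  fixes T :: "'k::wellorder itself"
  assumes "height_iso p G H T \<Phi>"
  shows "\<Phi> \<subseteq> carrier G \<times> carrier H" and "(\<zero>\<^bsub>G\<^esub>, \<zero>\<^bsub>H\<^esub>) \<in> \<Phi>"
    and "\<forall>s t s' t'. (s, t) \<in> \<Phi> \<longrightarrow> (s', t') \<in> \<Phi> \<longrightarrow> (s \<oplus>\<^bsub>G\<^esub> s', t \<oplus>\<^bsub>H\<^esub> t') \<in> \<Phi>"
    and "\<forall>r s t. r \<in> carrier (Z_loc p) \<longrightarrow> (s, t) \<in> \<Phi> \<longrightarrow> (r \<odot>\<^bsub>G\<^esub> s, r \<odot>\<^bsub>H\<^esub> t) \<in> \<Phi>"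
    and "\<forall>s t. (s, t) \<in> \<Phi> \<longrightarrow> (s = \<zero>\<^bsub>G\<^esub> \<longleftrightarrow> t = \<zero>\<^bsub>H\<^esub>)"
    and "\<forall>s t. (s, t) \<in> \<Phi> \<longrightarrow> (height p G s :: 'k height) = height p H t"
proof -
  note D = assms[unfolded height_iso_def]
  note D2 = D[THEN conjunct2]
  note D3 = D2[THEN conjunct2]
  note D4 = D3[THEN conjunct2]
  note D5 = D4[THEN conjunct2]
  show "\<Phi> \<subseteq> carrier G \<times> carrier H" by (rule D[THEN conjunct1])
  show "(\<zero>\<^bsub>G\<^esub>, \<zero>\<^bsub>H\<^esub>) \<in> \<Phi>" by (rule D2[THEN conjunct1])
  show "\<forall>s t s' t'. (s, t) \<in> \<Phi> \<longrightarrow> (s', t') \<in> \<Phi> \<longrightarrow> (s \<oplus>\<^bsub>G\<^esub> s', t \<oplus>\<^bsub>H\<^esub> t') \<in> \<Phi>" by (rule D3[THEN conjunct1])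
  show "\<forall>r s t. r \<in> carrier (Z_loc p) \<longrightarrow> (s, t) \<in> \<Phi> \<longrightarrow> (r \<odot>\<^bsub>G\<^esub> s, r \<odot>\<^bsub>H\<^esub> t) \<in> \<Phi>" by (rule D4[THEN conjunct1])
  show "\<forall>s t. (s, t) \<in> \<Phi> \<longrightarrow> (s = \<zero>\<^bsub>G\<^esub> \<longleftrightarrow> t = \<zero>\<^bsub>H\<^esub>)" by (rule D5[THEN conjunct1])
  show "\<forall>s t. (s, t) \<in> \<Phi> \<longrightarrow> (height p G s :: 'k height) = height p H t" by (rule D5[THEN conjunct2])
qed

lemma height_iso_converse:
  fixes T :: "'k::wellorder itself"
  assumes "height_iso p G H T \<Phi>" shows "height_iso p H G T (\<Phi>\<inverse>)"
  unfolding height_iso_def converse_iff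
proof (intro conjI allI impI)
  note D = height_isoD[OF assms]
  show "\<Phi>\<inverse> \<subseteq> carrier H \<times> carrier G" using D(1) by auto
  show "(\<zero>\<^bsub>G\<^esub>, \<zero>\<^bsub>H\<^esub>) \<in> \<Phi>" by (rule D(2))
  fix s t assume st: "(t, s) \<in> \<Phi>"
  show "(t \<oplus>\<^bsub>G\<^esub> t', s \<oplus>\<^bsub>H\<^esub> s') \<in> \<Phi>" if "(t', s') \<in> \<Phi>" for s' t' using D(3) st that by simp
  show "(r \<odot>\<^bsub>G\<^esub> t, r \<odot>\<^bsub>H\<^esub> s) \<in> \<Phi>" if "r \<in> carrier (Z_loc p)" for r using D(4) st that by simp
  show "(s = \<zero>\<^bsub>H\<^esub>) = (t = \<zero>\<^bsub>G\<^esub>)" using D(5) st by simp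
  show "(height p H s :: 'k height) = height p G t" using D(6) st by simp
qed

locale zpair = G?: zmodk p G T + H: zmodk p H T
  for p :: nat and G :: "(rat, 'a) module" (structure) and H :: "(rat, 'b) module"
    and T :: "'k::wellorder itself"
begin

text \<open>Interpreting the locale with G and H exchanged, as \<open>sw\<close>, turns every
  statement about the domain or the forth property into one about the range or the back
  property.\<close>

lemma swap: "zpair TYPE('k) p H G"
  by unfold_locales

abbreviation iso :: "('a \<times> 'b) set \<Rightarrow> bool" where "iso \<Phi> \<equiv> height_iso p G H T \<Phi>"

lemma iso_carrier: assumes "iso \<Phi>" "(s, t) \<in> \<Phi>" shows "s \<in> carrier G" "t \<in> carrier H"
  using height_isoD(1)[OF assms(1)] assms(2) by auto

lemma iso_zero: "iso \<Phi> \<Longrightarrow> (\<zero>, \<zero>\<^bsub>H\<^esub>) \<in> \<Phi>"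
  by (rule height_isoD(2))

lemma iso_add: "iso \<Phi> \<Longrightarrow> (s, t) \<in> \<Phi> \<Longrightarrow> (s', t') \<in> \<Phi> \<Longrightarrow> (s \<oplus> s', t \<oplus>\<^bsub>H\<^esub> t') \<in> \<Phi>"
  using height_isoD(3)[of p G H T \<Phi>] by simp

lemma iso_smult: "iso \<Phi> \<Longrightarrow> r \<in> Zp \<Longrightarrow> (s, t) \<in> \<Phi> \<Longrightarrow> (r \<odot> s, r \<odot>\<^bsub>H\<^esub> t) \<in> \<Phi>"
  using height_isoD(4)[of p G H T \<Phi>] by simp

lemma iso_eq_zero: "iso \<Phi> \<Longrightarrow> (s, t) \<in> \<Phi> \<Longrightarrow> s = \<zero> \<longleftrightarrow> t = \<zero>\<^bsub>H\<^esub>"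
  using height_isoD(5)[of p G H T \<Phi>] by simp

lemma iso_height: "iso \<Phi> \<Longrightarrow> (s, t) \<in> \<Phi> \<Longrightarrow> H.ht t = ht s"
  using height_isoD(6)[of p G H T \<Phi>] by simp

lemma iso_uminus: "iso \<Phi> \<Longrightarrow> (s, t) \<in> \<Phi> \<Longrightarrow> (\<ominus> s, \<ominus>\<^bsub>H\<^esub> t) \<in> \<Phi>"
  using iso_smult[of \<Phi> "-1" s t] iso_carrier[of \<Phi> s t]
  by (simp add: G.minus_smult[symmetric] H.minus_smult[symmetric])

lemma iso_diff: "iso \<Phi> \<Longrightarrow> (s, t) \<in> \<Phi> \<Longrightarrow> (s', t') \<in> \<Phi> \<Longrightarrow> (s \<ominus> s', t \<ominus>\<^bsub>H\<^esub> t') \<in> \<Phi>"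
  unfolding a_minus_def by (intro iso_add iso_uminus)

text \<open>The clause that zero corresponds exactly to zero, applied to a difference, yields
  single-valuedness here and injectivity for the converse relation.\<close>

lemma iso_fun:
  assumes "iso \<Phi>" "(s, t) \<in> \<Phi>" "(s, t') \<in> \<Phi>" shows "t = t'"
proof -
  have c: "s \<in> carrier G" "t \<in> carrier H" "t' \<in> carrier H" using assms iso_carrier by blast+
  have "(s \<ominus> s, t \<ominus>\<^bsub>H\<^esub> t') \<in> \<Phi>" using assms by (intro iso_diff)
  moreover have "s \<ominus> s = \<zero>" using c(1) by algebra
  ultimately have "t \<ominus>\<^bsub>H\<^esub> t' = \<zero>\<^bsub>H\<^esub>" using iso_eq_zero[OF assms(1)] by metis
  then show ?thesis using c H.minus_eq_zero_iff by simp
qed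

lemma iso_inj:
  assumes "iso \<Phi>" "(s, t) \<in> \<Phi>" "(s', t) \<in> \<Phi>" shows "s = s'"
proof -
  interpret sw: zpair p H G T by (rule swap)
  show ?thesis using sw.iso_fun[OF height_iso_converse[OF assms(1)]] assms by auto
qed

lemma sm_Domain: assumes \<Phi>: "iso \<Phi>" shows "G.sm (Domain \<Phi>)"
proof (rule G.smI)
  show "Domain \<Phi> \<subseteq> carrier G" using iso_carrier(1)[OF \<Phi>] by auto
  show "\<zero> \<in> Domain \<Phi>" using iso_zero[OF \<Phi>] by (rule DomainI)
  fix s assume "s \<in> Domain \<Phi>"
  then obtain t where st: "(s, t) \<in> \<Phi>" by blast
  show "r \<odot> s \<in> Domain \<Phi>" if "r \<in> Zp" for r using iso_smult[OF \<Phi> that st] by (rule DomainI)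
  fix s' assume "s' \<in> Domain \<Phi>"
  then obtain t' where st': "(s', t') \<in> \<Phi>" by blast
  show "s \<oplus> s' \<in> Domain \<Phi>" using iso_add[OF \<Phi> st st'] by (rule DomainI)
qed

lemma sm_Range: assumes \<Phi>: "iso \<Phi>" shows "H.sm (Range \<Phi>)"
proof -
  interpret sw: zpair p H G T by (rule swap)
  show ?thesis using sw.sm_Domain[OF height_iso_converse[OF \<Phi>]] by simp
qed

text \<open>For an additive relation closed under scalars, the one generated by it and the pair (x,
  y). No representation of an element has to be chosen; that the result is again a bijection is the
  content of \<open>ext_iso\<close>.\<close>

definition ext :: "('a \<times> 'b) set \<Rightarrow> 'a \<Rightarrow> 'b \<Rightarrow> ('a \<times> 'b) set" where
  "ext \<Phi> x y = {(s \<oplus> r \<odot> x, t \<oplus>\<^bsub>H\<^esub> r \<odot>\<^bsub>H\<^esub> y) | s t r. (s, t) \<in> \<Phi> \<and> r \<in> Zp}"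

lemma extI: "(s, t) \<in> \<Phi> \<Longrightarrow> r \<in> Zp \<Longrightarrow> (s \<oplus> r \<odot> x, t \<oplus>\<^bsub>H\<^esub> r \<odot>\<^bsub>H\<^esub> y) \<in> ext \<Phi> x y"
  unfolding ext_def by blast

lemma extE:
  assumes "(a, b) \<in> ext \<Phi> x y"
  obtains s t r where "(s, t) \<in> \<Phi>" "r \<in> Zp" "a = s \<oplus> r \<odot> x" "b = t \<oplus>\<^bsub>H\<^esub> r \<odot>\<^bsub>H\<^esub> y"
  using assms unfolding ext_def by blast

lemma ext_iso:
  assumes \<Phi>: "iso \<Phi>" and x: "x \<in> carrier G" and y: "y \<in> carrier H"
    and zero: "\<And>s t r. (s, t) \<in> \<Phi> \<Longrightarrow> r \<in> Zp \<Longrightarrow> s \<oplus> r \<odot> x = \<zero> \<longleftrightarrow> t \<oplus>\<^bsub>H\<^esub> r \<odot>\<^bsub>H\<^esub> y = \<zero>\<^bsub>H\<^esub>"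
    and height: "\<And>s t r. (s, t) \<in> \<Phi> \<Longrightarrow> r \<in> Zp \<Longrightarrow> H.ht (t \<oplus>\<^bsub>H\<^esub> r \<odot>\<^bsub>H\<^esub> y) = ht (s \<oplus> r \<odot> x)"
  shows "iso (ext \<Phi> x y)"
  unfolding height_iso_def
proof (intro conjI allI impI)
  note c = iso_carrier[OF \<Phi>]
  show "ext \<Phi> x y \<subseteq> carrier G \<times> carrier H" using c x y by (auto elim!: extE)
  show "(\<zero>, \<zero>\<^bsub>H\<^esub>) \<in> ext \<Phi> x y" using extI[OF iso_zero[OF \<Phi>] Zp_0, of x y] x y by simp
  fix a b assume ab: "(a, b) \<in> ext \<Phi> x y"
  obtain s t r where *: "(s, t) \<in> \<Phi>" "r \<in> Zp" "a = s \<oplus> r \<odot> x" "b = t \<oplus>\<^bsub>H\<^esub> r \<odot>\<^bsub>H\<^esub> y" using extE[OF ab] .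
  show "a = \<zero> \<longleftrightarrow> b = \<zero>\<^bsub>H\<^esub>" using zero * by simp
  show "ht a = H.ht b" using height * by simp
  show "(q \<odot> a, q \<odot>\<^bsub>H\<^esub> b) \<in> ext \<Phi> x y" if q: "q \<in> Zp" for q
  proof -
    have "q \<odot> a = q \<odot> s \<oplus> (q * r) \<odot> x" "q \<odot>\<^bsub>H\<^esub> b = q \<odot>\<^bsub>H\<^esub> t \<oplus>\<^bsub>H\<^esub> (q * r) \<odot>\<^bsub>H\<^esub> y"
      using * c[OF *(1)] x y q by (simp_all add: G.smult_r_distr H.smult_r_distr)
    then show ?thesis using extI[OF iso_smult[OF \<Phi> q *(1)], of "q * r" x y] q * by simp
  qed
  fix a' b' assume ab': "(a', b') \<in> ext \<Phi> x y"
  obtain s' t' r' where **: "(s', t') \<in> \<Phi>" "r' \<in> Zp" "a' = s' \<oplus> r' \<odot> x" "b' = t' \<oplus>\<^bsub>H\<^esub> r' \<odot>\<^bsub>H\<^esub> y" using extE[OF ab'] .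
  note cc = c[OF *(1)] c[OF **(1)]
  have "a \<oplus> a' = (s \<oplus> s') \<oplus> (r + r') \<odot> x" unfolding *(3) **(3) using cc x *(2) **(2) by algebra
  moreover have "b \<oplus>\<^bsub>H\<^esub> b' = (t \<oplus>\<^bsub>H\<^esub> t') \<oplus>\<^bsub>H\<^esub> (r + r') \<odot>\<^bsub>H\<^esub> y" unfolding *(4) **(4) using cc y *(2) **(2) by algebra
  ultimately show "(a \<oplus> a', b \<oplus>\<^bsub>H\<^esub> b') \<in> ext \<Phi> x y"
    using extI[OF iso_add[OF \<Phi> *(1) **(1)], of "r + r'" x y] *(2) **(2) by simp
qed

lemma ext_mem:
  assumes \<Phi>: "iso \<Phi>" and x: "x \<in> carrier G" and y: "y \<in> carrier H"
  shows "\<Phi> \<subseteq> ext \<Phi> x y" "(x, y) \<in> ext \<Phi> x y"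
proof -
  show "\<Phi> \<subseteq> ext \<Phi> x y"
  proof
    fix a assume "a \<in> \<Phi>"
    then obtain s t where st: "a = (s, t)" "(s, t) \<in> \<Phi>" by (cases a) auto
    then show "a \<in> ext \<Phi> x y" using extI[OF st(2) Zp_0, of x y] x y iso_carrier[OF \<Phi> st(2)] by simp
  qed
  show "(x, y) \<in> ext \<Phi> x y" using extI[OF iso_zero[OF \<Phi>] Zp_1, of x y] x y by simp
qed

lemma ext_Domain:
  assumes \<Phi>: "iso \<Phi>" and A: "A \<subseteq> carrier G" "Domain \<Phi> = G.span A" and x: "x \<in> carrier G" and y: "y \<in> carrier H"
  shows "Domain (ext \<Phi> x y) = G.span (insert x A)"
proof (intro equalityI subsetI)
  fix a assume "a \<in> Domain (ext \<Phi> x y)"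
  then obtain b where "(a, b) \<in> ext \<Phi> x y" by blast
  then obtain s t r where *: "(s, t) \<in> \<Phi>" "r \<in> Zp" "a = s \<oplus> r \<odot> x" by (rule extE)
  then have "s \<in> G.span A" using A by blast
  moreover have "a = r \<odot> x \<oplus> s" using * iso_carrier[OF \<Phi> *(1)] x by (simp add: G.M.a_comm)
  ultimately show "a \<in> G.span (insert x A)" unfolding G.span_insert_iff[OF x A(1)] using *(2) by blast
next
  fix a assume "a \<in> G.span (insert x A)"
  then obtain r s where *: "r \<in> Zp" "s \<in> G.span A" "a = r \<odot> x \<oplus> s" unfolding G.span_insert_iff[OF x A(1)] by blast
  then obtain t where t: "(s, t) \<in> \<Phi>" using A by blast
  have "a = s \<oplus> r \<odot> x" using * iso_carrier[OF \<Phi> t] x by (simp add: G.M.a_comm)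
  then show "a \<in> Domain (ext \<Phi> x y)" using extI[OF t *(1), of x y] by auto
qed

lemma ext_converse: "(zpair.ext p H G (\<Phi>\<inverse>) y x)\<inverse> = ext \<Phi> x y"
proof -
  interpret sw: zpair p H G T by (rule swap)
  show ?thesis unfolding sw.ext_def ext_def by auto
qed

lemma ext_Range:
  assumes \<Phi>: "iso \<Phi>" and B: "B \<subseteq> carrier H" "Range \<Phi> = H.span B" and x: "x \<in> carrier G" and y: "y \<in> carrier H"
  shows "Range (ext \<Phi> x y) = H.span (insert y B)"
proof -
  interpret sw: zpair p H G T by (rule swap)
  have "Domain (sw.ext (\<Phi>\<inverse>) y x) = H.span (insert y B)"
    by (rule sw.ext_Domain[OF height_iso_converse[OF \<Phi>] B(1) _ y x]) (use B in simp)
  then show ?thesis unfolding ext_converse[of \<Phi> y x, symmetric] by simp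
qed

text \<open>
  The counting argument in Kaplansky's extension step. If every element of \<open>P'[p]\<close> were congruent
  modulo \<open>Q'\<close> to an element of the range, then incongruent elements could be transported back to
  \<open>G\<close>, where \<open>x\<close> is a further incongruent element; so there would be arbitrarily many of
  them, but the range is finitely generated.
\<close>

lemma new_torsion_element:
  assumes \<Phi>: "iso \<Phi>" and B: "finite B" "B \<subseteq> carrier H" "Range \<Phi> = H.span B"
    and sm: "G.sm P" "G.sm Q" "H.sm P'" "H.sm Q'" and sub: "Q \<subseteq> P" "Q' \<subseteq> P'"
    and pres: "\<And>s t. (s, t) \<in> \<Phi> \<Longrightarrow> s \<in> P \<longleftrightarrow> t \<in> P'" "\<And>s t. (s, t) \<in> \<Phi> \<Longrightarrow> s \<in> Q \<longleftrightarrow> t \<in> Q'"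
      "\<And>s t. (s, t) \<in> \<Phi> \<Longrightarrow> s \<in> p_mult p G Q \<longleftrightarrow> t \<in> p_mult p H Q'"
    and count: "\<And>n. incong G (p_torsion p G P) Q n \<Longrightarrow> incong H (p_torsion p H P') Q' n"
    and x: "x \<in> p_torsion p G P" "\<And>s. s \<in> Domain \<Phi> \<Longrightarrow> x \<oplus> s \<notin> Q"
  obtains x' where "x' \<in> p_torsion p H P'" "\<And>t. t \<in> Range \<Phi> \<Longrightarrow> x' \<oplus>\<^bsub>H\<^esub> t \<notin> Q'"
proof -
  have "\<exists>x'\<in>p_torsion p H P'. \<forall>t\<in>Range \<Phi>. x' \<oplus>\<^bsub>H\<^esub> t \<notin> Q'"
  proof (rule ccontr)
    assume no: "\<not> ?thesis"
    \<comment> \<open>If h is congruent to -t modulo Q', then p t = p(h + t) lies in pQ', so the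
      preimage s of t satisfies p s = p b for some b in Q. The torsion element b - s of G will stand
      for h.\<close>
    define R where "R h s t b \<longleftrightarrow> (s, t) \<in> \<Phi> \<and> h \<oplus>\<^bsub>H\<^esub> t \<in> Q' \<and> b \<in> Q \<and> pp \<odot> s = pp \<odot> b \<and> pp \<odot>\<^bsub>H\<^esub> t \<in> p_mult p H Q'" for h s t b
    have pP': "h \<in> carrier H" "h \<in> P'" "pp \<odot>\<^bsub>H\<^esub> h = \<zero>\<^bsub>H\<^esub>" if "h \<in> p_torsion p H P'" for h
      using that H.sm_carrier[OF sm(3)] by (auto simp: p_torsion_def)
    have "\<exists>s t b. R h s t b" if h: "h \<in> p_torsion p H P'" for h
    proof -
      obtain t where t: "t \<in> Range \<Phi>" "h \<oplus>\<^bsub>H\<^esub> t \<in> Q'" using no h by blast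
      then obtain s where s: "(s, t) \<in> \<Phi>" by blast
      note c = iso_carrier[OF \<Phi> s] pP'(1)[OF h]
      have "pp \<odot>\<^bsub>H\<^esub> (h \<oplus>\<^bsub>H\<^esub> t) = pp \<odot>\<^bsub>H\<^esub> t" using c pP'(3)[OF h] by (simp add: H.smult_r_distr)
      then have pt: "pp \<odot>\<^bsub>H\<^esub> t \<in> p_mult p H Q'" using t(2) unfolding p_mult_def by (metis image_eqI)
      then have "pp \<odot> s \<in> p_mult p G Q" using pres(3)[OF iso_smult[OF \<Phi> _ s, of pp]] by simp
      then obtain b where "b \<in> Q" "pp \<odot> s = pp \<odot> b" by (auto simp: p_mult_def)
      then have "R h s t b" unfolding R_def using s t pt by simp
      then show ?thesis by blast
    qed
    then obtain s t b where R: "\<And>h. h \<in> p_torsion p H P' \<Longrightarrow> R h (s h) (t h) (b h)" by metis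
    have st: "(s h, t h) \<in> \<Phi>" and ht: "h \<oplus>\<^bsub>H\<^esub> t h \<in> Q'" and bQ: "b h \<in> Q" and ps: "pp \<odot> s h = pp \<odot> b h"
      and pt: "pp \<odot>\<^bsub>H\<^esub> t h \<in> p_mult p H Q'" if "h \<in> p_torsion p H P'" for h
      using R[OF that] by (simp_all add: R_def)
    have c: "h \<in> carrier H" "s h \<in> carrier G" "t h \<in> carrier H" "b h \<in> carrier G" if "h \<in> p_torsion p H P'" for h
      using pP'(1)[OF that] iso_carrier[OF \<Phi> st[OF that]] G.sm_carrier[OF sm(2) bQ[OF that]] by auto
    \<comment> \<open>Each h is congruent to -(t h) modulo Q', so incongruent elements have
      incongruent partners in the range.\<close>
    have key: "h \<ominus>\<^bsub>H\<^esub> h' \<in> Q'" if h: "h \<in> p_torsion p H P'" "h' \<in> p_torsion p H P'" and d: "t h \<ominus>\<^bsub>H\<^esub> t h' \<in> Q'" for h h'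
    proof -
      have "((h \<oplus>\<^bsub>H\<^esub> t h) \<ominus>\<^bsub>H\<^esub> (h' \<oplus>\<^bsub>H\<^esub> t h')) \<ominus>\<^bsub>H\<^esub> (t h \<ominus>\<^bsub>H\<^esub> t h') \<in> Q'"
        by (rule H.sm_diff[OF sm(4) H.sm_diff[OF sm(4) ht[OF h(1)] ht[OF h(2)]] d])
      also have "((h \<oplus>\<^bsub>H\<^esub> t h) \<ominus>\<^bsub>H\<^esub> (h' \<oplus>\<^bsub>H\<^esub> t h')) \<ominus>\<^bsub>H\<^esub> (t h \<ominus>\<^bsub>H\<^esub> t h') = h \<ominus>\<^bsub>H\<^esub> h'"
        using c(1,3)[OF h(1)] c(1,3)[OF h(2)] by algebra
      finally show ?thesis .
    qed
    define g where "g h = b h \<ominus> s h" for h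
    have gP: "g h \<in> p_torsion p G P" "g h \<in> carrier G" "g h \<oplus> s h = b h" if h: "h \<in> p_torsion p H P'" for h
    proof -
      have "t h \<in> P'"
      proof -
        have "(h \<oplus>\<^bsub>H\<^esub> t h) \<ominus>\<^bsub>H\<^esub> h \<in> P'" using ht[OF h] sub pP'(2)[OF h] by (intro H.sm_diff[OF sm(3)]) auto
        also have "(h \<oplus>\<^bsub>H\<^esub> t h) \<ominus>\<^bsub>H\<^esub> h = t h" using c(1,3)[OF h] by algebra
        finally show ?thesis .
      qed
      then have "s h \<in> P" using pres(1)[OF st[OF h]] by simp
      then have "g h \<in> P" unfolding g_def using bQ[OF h] sub by (intro G.sm_diff[OF sm(1)]) auto
      moreover have "pp \<odot> g h = pp \<odot> b h \<ominus> pp \<odot> s h" unfolding g_def using c(2,4)[OF h] by algebra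
      then have "pp \<odot> g h = \<zero>" unfolding ps[OF h] using c(2,4)[OF h] by (simp add: G.minus_eq_zero_iff)
      ultimately show "g h \<in> p_torsion p G P" by (simp add: p_torsion_def)
      show "g h \<in> carrier G" "g h \<oplus> s h = b h" unfolding g_def using c(2,4)[OF h] by (simp, algebra)
    qed
    have gkey: "h \<ominus>\<^bsub>H\<^esub> h' \<in> Q'" if h: "h \<in> p_torsion p H P'" "h' \<in> p_torsion p H P'" and d: "g h \<ominus> g h' \<in> Q" for h h'
    proof -
      have "(b h \<ominus> b h') \<ominus> (g h \<ominus> g h') \<in> Q"
        by (rule G.sm_diff[OF sm(2) G.sm_diff[OF sm(2) bQ[OF h(1)] bQ[OF h(2)]] d])
      also have "(b h \<ominus> b h') \<ominus> (g h \<ominus> g h') = s h \<ominus> s h'"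
        unfolding g_def using c(2,4)[OF h(1)] c(2,4)[OF h(2)] by algebra
      finally have "t h \<ominus>\<^bsub>H\<^esub> t h' \<in> Q'" using pres(2)[OF iso_diff[OF \<Phi> st[OF h(1)] st[OF h(2)]]] by simp
      then show ?thesis by (rule key[OF h])
    qed
    have xc: "x \<in> carrier G" using x(1) G.sm_carrier[OF sm(1)] by (auto simp: p_torsion_def)
    have many: "incong H (p_torsion p H P') Q' n" for n
    proof (induction n)
      case 0
      show ?case unfolding incong_def by (intro exI[of _ "{}"]) auto
    next
      case (Suc n)
      then obtain F where F: "F \<subseteq> p_torsion p H P'" "finite F" "card F = n"
        and inc: "\<And>a b. a \<in> F \<Longrightarrow> b \<in> F \<Longrightarrow> a \<noteq> b \<Longrightarrow> a \<ominus>\<^bsub>H\<^esub> b \<notin> Q'" unfolding incong_def by blast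
      have gne: "g h \<ominus> g h' \<notin> Q" if "h \<in> F" "h' \<in> F" "h \<noteq> h'" for h h'
        using gkey[of h h'] inc[OF that] F(1) that(1,2) by auto
      have inj: "inj_on g F"
      proof (rule inj_onI, rule ccontr)
        fix h h' assume h: "h \<in> F" "h' \<in> F" "g h = g h'" "h \<noteq> h'"
        then have "g h \<ominus> g h' = \<zero>" using gP(2)[of h] gP(2)[of h'] F(1) by (auto simp: G.minus_eq_zero_iff)
        then show False using gne[OF h(1,2,4)] G.sm_zero[OF sm(2)] by simp
      qed
      have xg: "x \<ominus> g h \<notin> Q" "g h \<ominus> x \<notin> Q" if "h \<in> F" for h
      proof -
        have h: "h \<in> p_torsion p H P'" using that F by auto
        show 1: "x \<ominus> g h \<notin> Q"
        proof
          assume "x \<ominus> g h \<in> Q"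
          then have "(x \<ominus> g h) \<oplus> (g h \<oplus> s h) \<in> Q" unfolding gP(3)[OF h] using bQ[OF h] by (rule G.sm_add[OF sm(2)])
          also have "(x \<ominus> g h) \<oplus> (g h \<oplus> s h) = x \<oplus> s h" using xc gP(2)[OF h] c(2)[OF h] by algebra
          finally show False using x(2)[of "s h"] st[OF h] by blast
        qed
        show "g h \<ominus> x \<notin> Q"
        proof
          assume "g h \<ominus> x \<in> Q"
          then have "\<ominus> (g h \<ominus> x) \<in> Q" by (rule G.sm_uminus[OF sm(2)])
          also have "\<ominus> (g h \<ominus> x) = x \<ominus> g h" using xc gP(2)[OF h] by algebra
          finally show False using 1 by simp
        qed
      qed
      have "x \<notin> g ` F"
      proof
        assume "x \<in> g ` F"
        then obtain h where h: "h \<in> F" "x = g h" by blast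
        then have "x \<ominus> g h = \<zero>" using xc by (simp add: G.minus_eq_zero_iff)
        then show False using xg(1)[OF h(1)] G.sm_zero[OF sm(2)] by simp
      qed
      then have "card (insert x (g ` F)) = Suc n" using F inj by (simp add: card_image)
      moreover have "insert x (g ` F) \<subseteq> p_torsion p G P" using x(1) gP(1) F(1) by auto
      moreover have "a \<ominus> b \<notin> Q" if ab: "a \<in> insert x (g ` F)" "b \<in> insert x (g ` F)" "a \<noteq> b" for a b
      proof -
        consider "a = x" "b \<in> g ` F" | "b = x" "a \<in> g ` F" | "a \<in> g ` F" "b \<in> g ` F" using ab by auto
        then show ?thesis
        proof cases
          case 1 then show ?thesis using xg by auto
        next
          case 2 then show ?thesis using xg by auto
        next
          case 3
          then obtain h h' where "h \<in> F" "h' \<in> F" "a = g h" "b = g h'" by auto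
          then show ?thesis using gne[of h h'] ab(3) by auto
        qed
      qed
      ultimately have "incong G (p_torsion p G P) Q (Suc n)"
        unfolding incong_def using F(2) by (intro exI[of _ "insert x (g ` F)"]) auto
      then show ?case by (rule count)
    qed
    \<comment> \<open>All \<open>t h\<close> lie in M, and p M is contained in pQ', so M meets only
      finitely many classes modulo pQ', a fortiori modulo Q'. By \<open>key\<close> this bounds the
      number of incongruent h.\<close>
    define M where "M = {u \<in> Range \<Phi>. pp \<odot>\<^bsub>H\<^esub> u \<in> p_mult p H Q'}"
    have smM: "H.sm M"
    proof (rule H.smI)
      note r = H.sm_carrier[OF sm_Range[OF \<Phi>]] H.sm_zero[OF sm_Range[OF \<Phi>]] H.sm_add[OF sm_Range[OF \<Phi>]] H.sm_smult[OF sm_Range[OF \<Phi>]]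
      note q = H.sm_zero[OF H.sm_p_mult[OF sm(4)]] H.sm_add[OF H.sm_p_mult[OF sm(4)]] H.sm_smult[OF H.sm_p_mult[OF sm(4)]]
      show "M \<subseteq> carrier H" using r by (auto simp: M_def)
      show "\<zero>\<^bsub>H\<^esub> \<in> M" using r q by (simp add: M_def)
      show "u \<oplus>\<^bsub>H\<^esub> v \<in> M" if "u \<in> M" "v \<in> M" for u v
        using that r q by (simp add: M_def H.smult_r_distr)
      show "a \<odot>\<^bsub>H\<^esub> u \<in> M" if "a \<in> Zp" "u \<in> M" for a u
      proof -
        have "a \<odot>\<^bsub>H\<^esub> (pp \<odot>\<^bsub>H\<^esub> u) \<in> p_mult p H Q'" using that q(3) by (simp add: M_def)
        also have "a \<odot>\<^bsub>H\<^esub> (pp \<odot>\<^bsub>H\<^esub> u) = pp \<odot>\<^bsub>H\<^esub> (a \<odot>\<^bsub>H\<^esub> u)" using that r(1) by (simp add: M_def mult.commute)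
        finally show ?thesis using that r by (simp add: M_def)
      qed
    qed
    have MB: "M \<subseteq> H.span B" by (auto simp: M_def B(3)[symmetric])
    have pM: "pp \<odot>\<^bsub>H\<^esub> u \<in> p_mult p H Q'" if "u \<in> M" for u using that by (simp add: M_def)
    obtain C where C: "finite C" "\<And>u. u \<in> M \<Longrightarrow> \<exists>r\<in>C. r \<in> carrier H \<and> u \<ominus>\<^bsub>H\<^esub> r \<in> p_mult p H Q'"
      using H.finite_elementary_quotient[OF B(1,2) smM MB H.sm_p_mult[OF sm(4)] pM] by blast
    have pQ: "p_mult p H Q' \<subseteq> Q'" using H.sm_smult[OF sm(4)] by (auto simp: p_mult_def)
    obtain F where F: "F \<subseteq> p_torsion p H P'" "finite F" "card F = Suc (card C)"
      and inc: "\<And>a b. a \<in> F \<Longrightarrow> b \<in> F \<Longrightarrow> a \<noteq> b \<Longrightarrow> a \<ominus>\<^bsub>H\<^esub> b \<notin> Q'" using many[of "Suc (card C)"] unfolding incong_def by blast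
    have "\<exists>r\<in>C. r \<in> carrier H \<and> t h \<ominus>\<^bsub>H\<^esub> r \<in> Q'" if "h \<in> F" for h
    proof -
      have "h \<in> p_torsion p H P'" using that F(1) by blast
      then have "t h \<in> M" using st pt by (auto simp: M_def)
      then show ?thesis using C(2) pQ by blast
    qed
    then obtain rho where rho: "\<And>h. h \<in> F \<Longrightarrow> rho h \<in> C \<and> rho h \<in> carrier H \<and> t h \<ominus>\<^bsub>H\<^esub> rho h \<in> Q'" by metis
    have "inj_on rho F"
    proof (rule inj_onI, rule ccontr)
      fix h h' assume h: "h \<in> F" "h' \<in> F" "rho h = rho h'" "h \<noteq> h'"
      have hp: "h \<in> p_torsion p H P'" "h' \<in> p_torsion p H P'" using h F by auto
      have "(t h \<ominus>\<^bsub>H\<^esub> rho h) \<ominus>\<^bsub>H\<^esub> (t h' \<ominus>\<^bsub>H\<^esub> rho h) \<in> Q'"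
        by (rule H.sm_diff[OF sm(4)]) (use rho[OF h(1)] rho[OF h(2)] h(3) in auto)
      also have "(t h \<ominus>\<^bsub>H\<^esub> rho h) \<ominus>\<^bsub>H\<^esub> (t h' \<ominus>\<^bsub>H\<^esub> rho h) = t h \<ominus>\<^bsub>H\<^esub> t h'"
      proof -
        have "rho h \<in> carrier H" using rho[OF h(1)] by simp
        then show ?thesis using c(3)[OF hp(1)] c(3)[OF hp(2)] by algebra
      qed
      finally show False using key[OF hp] inc[OF h(1,2,4)] by blast
    qed
    then have "card F \<le> card C" using rho C(1) by (intro card_inj_on_le) auto
    with F(3) show False by simp
  qed
  then show ?thesis using that by blast
qed

end

context zmodk
begin

text \<open>If x is not improved by adding s, the height of the sum depends on the two heights
  alone. This is why elements of maximal height in their cosets can be matched by height.\<close>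

lemma ht_add_proper:
  assumes "x \<in> carrier G" "s \<in> carrier G" "ht (x \<oplus> s) \<le> ht x"
  shows "ht (x \<oplus> s) = min (ht x) (ht s)"
proof (cases "ht s < ht x")
  case True
  then have "ht (s \<oplus> x) = ht s" using assms by (intro ht_add_less) auto
  then show ?thesis using True assms by (simp add: M.a_comm min_def)
next
  case False
  then have "ht x \<le> ht (x \<oplus> s)" using assms by (intro ht_add) auto
  with assms(3) have "ht (x \<oplus> s) = ht x" by (rule antisym)
  then show ?thesis using False by (simp add: min_def not_less)
qed

lemma sm_zero_set: "sm {\<zero>}"
  by (rule smI) auto

end

section \<open>Choosing the new pair in Kaplansky's step\<close>

context zpair
begin

text \<open>A multiple of x by a non-unit is a multiple of p x, which already has a partner. For a
  unit coefficient, scale it to one; then both sums have height equal to the minimum of matched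
  heights.\<close>

lemma ext_iso_torsion:
  assumes \<Phi>: "iso \<Phi>" and x: "x \<in> carrier G" and y: "y \<in> carrier H" and pxy: "(pp \<odot> x, pp \<odot>\<^bsub>H\<^esub> y) \<in> \<Phi>"
    and xn: "x \<notin> Domain \<Phi>" and yn: "y \<notin> Range \<Phi>" and h: "H.ht y = ht x"
    and xmax: "\<And>s. s \<in> Domain \<Phi> \<Longrightarrow> ht (x \<oplus> s) \<le> ht x"
    and ymax: "\<And>t. t \<in> Range \<Phi> \<Longrightarrow> H.ht (y \<oplus>\<^bsub>H\<^esub> t) \<le> H.ht y"
  shows "iso (ext \<Phi> x y)"
proof -
  have "(s \<oplus> r \<odot> x = \<zero> \<longleftrightarrow> t \<oplus>\<^bsub>H\<^esub> r \<odot>\<^bsub>H\<^esub> y = \<zero>\<^bsub>H\<^esub>) \<and> H.ht (t \<oplus>\<^bsub>H\<^esub> r \<odot>\<^bsub>H\<^esub> y) = ht (s \<oplus> r \<odot> x)"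
    if st: "(s, t) \<in> \<Phi>" and r: "r \<in> Zp" for s t r
  proof -
    note c = iso_carrier[OF \<Phi> st]
    from r show ?thesis
    proof (cases rule: Zp_unit_cases)
      case 1
      define q where "q = inverse r"
      have q: "q \<in> Zp" "inverse q \<in> Zp" "q \<noteq> 0" "q * r = 1" using 1 r by (auto simp: q_def)
      have st': "(q \<odot> s, q \<odot>\<^bsub>H\<^esub> t) \<in> \<Phi>" by (rule iso_smult[OF \<Phi> q(1) st])
      note c' = iso_carrier[OF \<Phi> st']
      have e: "q \<odot> (s \<oplus> r \<odot> x) = x \<oplus> q \<odot> s" "q \<odot>\<^bsub>H\<^esub> (t \<oplus>\<^bsub>H\<^esub> r \<odot>\<^bsub>H\<^esub> y) = y \<oplus>\<^bsub>H\<^esub> q \<odot>\<^bsub>H\<^esub> t"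
        using c x y q r by (simp_all add: G.smult_r_distr H.smult_r_distr G.M.a_comm H.M.a_comm)
      have "x \<oplus> q \<odot> s \<noteq> \<zero>"
      proof
        assume 0: "x \<oplus> q \<odot> s = \<zero>"
        have "x = (x \<oplus> q \<odot> s) \<ominus> q \<odot> s" using x c(1) q(1) by algebra
        then have "x = \<ominus> (q \<odot> s)" using 0 c' by (simp add: a_minus_def)
        then show False using xn G.sm_uminus[OF sm_Domain[OF \<Phi>], of "q \<odot> s"] st' by auto
      qed
      moreover have "y \<oplus>\<^bsub>H\<^esub> q \<odot>\<^bsub>H\<^esub> t \<noteq> \<zero>\<^bsub>H\<^esub>"
      proof
        assume 0: "y \<oplus>\<^bsub>H\<^esub> q \<odot>\<^bsub>H\<^esub> t = \<zero>\<^bsub>H\<^esub>"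
        have "y = (y \<oplus>\<^bsub>H\<^esub> q \<odot>\<^bsub>H\<^esub> t) \<ominus>\<^bsub>H\<^esub> q \<odot>\<^bsub>H\<^esub> t" using y c(2) q(1) by algebra
        then have "y = \<ominus>\<^bsub>H\<^esub> (q \<odot>\<^bsub>H\<^esub> t)" using 0 c' by (simp add: a_minus_def)
        then show False using yn H.sm_uminus[OF sm_Range[OF \<Phi>], of "q \<odot>\<^bsub>H\<^esub> t"] st' by auto
      qed
      ultimately have nz: "s \<oplus> r \<odot> x \<noteq> \<zero>" "t \<oplus>\<^bsub>H\<^esub> r \<odot>\<^bsub>H\<^esub> y \<noteq> \<zero>\<^bsub>H\<^esub>" using e q(1) by auto
      have "ht (s \<oplus> r \<odot> x) = ht (x \<oplus> q \<odot> s)"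
        using G.ht_smult_unit[of "s \<oplus> r \<odot> x" q] c x r q by (simp add: e(1))
      also have "\<dots> = min (ht x) (ht (q \<odot> s))"
        using xmax st' by (intro G.ht_add_proper x c'(1)) auto
      also have "\<dots> = min (H.ht y) (H.ht (q \<odot>\<^bsub>H\<^esub> t))" using h iso_height[OF \<Phi> st'] by simp
      also have "\<dots> = H.ht (y \<oplus>\<^bsub>H\<^esub> q \<odot>\<^bsub>H\<^esub> t)"
        using ymax st' by (intro H.ht_add_proper[symmetric] y c'(2)) auto
      also have "\<dots> = H.ht (t \<oplus>\<^bsub>H\<^esub> r \<odot>\<^bsub>H\<^esub> y)"
        using H.ht_smult_unit[of "t \<oplus>\<^bsub>H\<^esub> r \<odot>\<^bsub>H\<^esub> y" q] c y r q by (simp add: e(2))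
      finally show ?thesis using nz by simp
    next
      case (2 r')
      have "(s \<oplus> r' \<odot> (pp \<odot> x), t \<oplus>\<^bsub>H\<^esub> r' \<odot>\<^bsub>H\<^esub> (pp \<odot>\<^bsub>H\<^esub> y)) \<in> \<Phi>"
        by (intro iso_add[OF \<Phi>] iso_smult[OF \<Phi>] st pxy 2)
      also have "(s \<oplus> r' \<odot> (pp \<odot> x), t \<oplus>\<^bsub>H\<^esub> r' \<odot>\<^bsub>H\<^esub> (pp \<odot>\<^bsub>H\<^esub> y)) = (s \<oplus> r \<odot> x, t \<oplus>\<^bsub>H\<^esub> r \<odot>\<^bsub>H\<^esub> y)"
        using 2 x y by (simp add: mult.commute)
      finally have m: "(s \<oplus> r \<odot> x, t \<oplus>\<^bsub>H\<^esub> r \<odot>\<^bsub>H\<^esub> y) \<in> \<Phi>" .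
      show ?thesis using iso_eq_zero[OF \<Phi> m] iso_height[OF \<Phi> m] by simp
    qed
  qed
  then show ?thesis by (intro ext_iso[OF \<Phi> x y]) blast+
qed

lemma iso_pw:
  assumes \<Phi>: "iso \<Phi>" and st: "(s, t) \<in> \<Phi>"
  shows "s \<in> p_power p G \<alpha> \<longleftrightarrow> t \<in> p_power p H (\<alpha> :: 'k)"
    "s \<in> p_mult p G (p_power p G \<alpha>) \<longleftrightarrow> t \<in> p_mult p H (p_power p H (\<alpha> :: 'k))"
    "s \<in> p_power_inf TYPE('k) p G \<longleftrightarrow> t \<in> p_power_inf TYPE('k) p H"
  using G.ht_ge_iff[OF iso_carrier(1)[OF \<Phi> st], of "Ord \<alpha>"] H.ht_ge_iff[OF iso_carrier(2)[OF \<Phi> st], of "Ord \<alpha>"]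
    G.Ord_less_ht_iff[OF iso_carrier(1)[OF \<Phi> st], of \<alpha>] H.Ord_less_ht_iff[OF iso_carrier(2)[OF \<Phi> st], of \<alpha>]
    G.ht_eq_Infty[OF iso_carrier(1)[OF \<Phi> st]] H.ht_eq_Infty[OF iso_carrier(2)[OF \<Phi> st]]
    iso_height[OF \<Phi> st] by (simp_all add: G.pw_simps H.pw_simps)

text \<open>The partner y must satisfy p y = z, where z is the image of p x, and be of maximal
  height modulo the range with the height of x. For an ordinal height \<alpha> the danger is that
  solutions of p w = z of height at least \<alpha> include some that are too high. This can only
  happen if p(x + s) lies above \<alpha>+1 for some s with x + s still of height \<alpha>; then x +
  s exhibits a torsion element of G at level \<alpha> that is new modulo the domain, and its
  counterpart in H corrects w. The freedom to replace x by x + s serves exactly this case.\<close>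

lemma kaplansky_step_aux:
  assumes \<Phi>: "iso \<Phi>" and B: "finite B" "B \<subseteq> carrier H" "Range \<Phi> = H.span B"
    and countO: "\<And>\<alpha> n. incong G (p_torsion p G (p_power p G (\<alpha> :: 'k))) (p_mult p G (p_power p G \<alpha>)) n \<Longrightarrow>
      incong H (p_torsion p H (p_power p H \<alpha>)) (p_mult p H (p_power p H \<alpha>)) n"
    and countI: "\<And>n. incong G (p_torsion p G (p_power_inf TYPE('k) p G)) {\<zero>} n \<Longrightarrow>
      incong H (p_torsion p H (p_power_inf TYPE('k) p H)) {\<zero>\<^bsub>H\<^esub>} n"
    and x: "x \<in> carrier G" "x \<notin> Domain \<Phi>" and px: "pp \<odot> x \<in> Domain \<Phi>"
    and xmax: "\<And>s. s \<in> Domain \<Phi> \<Longrightarrow> ht (x \<oplus> s) \<le> ht x"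
  shows "\<exists>s y. s \<in> Domain \<Phi> \<and> y \<in> carrier H \<and> (pp \<odot> (x \<oplus> s), pp \<odot>\<^bsub>H\<^esub> y) \<in> \<Phi> \<and> ht (x \<oplus> s) = ht x \<and>
    y \<notin> Range \<Phi> \<and> H.ht y = ht x \<and> (\<forall>t\<in>Range \<Phi>. H.ht (y \<oplus>\<^bsub>H\<^esub> t) \<le> H.ht y)"
proof (cases "ht x")
  case Infty
  obtain z where z: "(pp \<odot> x, z) \<in> \<Phi>" using px by blast
  note zc = iso_carrier[OF \<Phi> z]
  have "ht (pp \<odot> x) = Infty" using G.ht_smult[of x pp] x Infty by simp
  then have "H.ht z = Infty" using iso_height[OF \<Phi> z] by simp
  then obtain w where w: "w \<in> carrier H" "H.ht w = Infty" "z = pp \<odot>\<^bsub>H\<^esub> w" using H.ht_p_divide_Infty[OF zc(2)] by blast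
  have "\<exists>y. y \<in> carrier H \<and> z = pp \<odot>\<^bsub>H\<^esub> y \<and> y \<notin> Range \<Phi> \<and> H.ht y = Infty"
  \<comment> \<open>If w is the image of some s, then p s = p x and x - s is a torsion element of
    infinite height not in the domain. A new torsion element of H then moves w out of the range
    without changing p w.\<close>
  proof (cases "w \<in> Range \<Phi>")
    case False then show ?thesis using w by blast
  next
    case True
    then obtain s where sw: "(s, w) \<in> \<Phi>" by blast
    note sc = iso_carrier[OF \<Phi> sw]
    have "(pp \<odot> s, z) \<in> \<Phi>" unfolding w(3) by (rule iso_smult[OF \<Phi> _ sw]) simp
    then have ps: "pp \<odot> s = pp \<odot> x" using iso_inj[OF \<Phi> _ z] by blast
    define t0 where "t0 = x \<ominus> s"
    have t0c: "t0 \<in> carrier G" using x sc by (simp add: t0_def)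
    have "Infty \<le> ht t0" unfolding t0_def using Infty iso_height[OF \<Phi> sw] w(2) x sc by (intro G.ht_diff) auto
    then have t0h: "ht t0 = Infty" using G.Infty_le by blast
    have "pp \<odot> t0 = pp \<odot> x \<ominus> pp \<odot> s" unfolding t0_def using x(1) sc(1) by algebra
    also have "\<dots> = \<zero>" unfolding ps using x by (simp add: G.minus_eq_zero_iff)
    finally have pt0: "pp \<odot> t0 = \<zero>" .
    have t0P: "t0 \<in> p_torsion p G (p_power_inf TYPE('k) p G)"
      unfolding p_torsion_def using G.ht_eq_Infty[OF t0c] t0h pt0 by simp
    have t0n: "t0 \<oplus> s' \<notin> {\<zero>}" if s': "s' \<in> Domain \<Phi>" for s'
    proof
      assume "t0 \<oplus> s' \<in> {\<zero>}"
      then have e0: "t0 \<oplus> s' = \<zero>" by simp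
      have s'c: "s' \<in> carrier G" using G.sm_carrier[OF sm_Domain[OF \<Phi>] s'] .
      have "x = (t0 \<oplus> s') \<oplus> (s \<ominus> s')" unfolding t0_def using x(1) sc(1) s'c by algebra
      then have "x = s \<ominus> s'" unfolding e0 using sc(1) s'c by simp
      moreover have "s \<ominus> s' \<in> Domain \<Phi>" using G.sm_diff[OF sm_Domain[OF \<Phi>] DomainI[OF sw] s'] .
      ultimately show False using x(2) by simp
    qed
    have smI: "G.sm (p_power_inf TYPE('k) p G)" "H.sm (p_power_inf TYPE('k) p H)"
      using G.sm_pw[of Infty] H.sm_pw[of Infty] by (simp_all add: G.pw_simps H.pw_simps)
    have sub: "{\<zero>} \<subseteq> p_power_inf TYPE('k) p G" "{\<zero>\<^bsub>H\<^esub>} \<subseteq> p_power_inf TYPE('k) p H"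
      using G.sm_zero[OF smI(1)] H.sm_zero[OF smI(2)] by auto
    have p0: "p_mult p G {\<zero>} = {\<zero>}" "p_mult p H {\<zero>\<^bsub>H\<^esub>} = {\<zero>\<^bsub>H\<^esub>}" by (simp_all add: p_mult_def)
    obtain x' where x': "x' \<in> p_torsion p H (p_power_inf TYPE('k) p H)" "\<And>t. t \<in> Range \<Phi> \<Longrightarrow> x' \<oplus>\<^bsub>H\<^esub> t \<notin> {\<zero>\<^bsub>H\<^esub>}"
    proof (rule new_torsion_element[OF \<Phi> B smI(1) G.sm_zero_set smI(2) H.sm_zero_set sub])
      fix s t assume st: "(s, t) \<in> \<Phi>"
      show "(s \<in> p_power_inf TYPE('k) p G) = (t \<in> p_power_inf TYPE('k) p H)" by (rule iso_pw(3)[OF \<Phi> st])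
      show "(s \<in> {\<zero>}) = (t \<in> {\<zero>\<^bsub>H\<^esub>})" using iso_eq_zero[OF \<Phi> st] by simp
      show "(s \<in> p_mult p G {\<zero>}) = (t \<in> p_mult p H {\<zero>\<^bsub>H\<^esub>})" unfolding p0 using iso_eq_zero[OF \<Phi> st] by simp
    qed (use countI t0P t0n in auto)
    have x'c: "x' \<in> carrier H" "pp \<odot>\<^bsub>H\<^esub> x' = \<zero>\<^bsub>H\<^esub>" "H.ht x' = Infty"
    proof -
      have m: "x' \<in> p_power_inf TYPE('k) p H" and z0: "pp \<odot>\<^bsub>H\<^esub> x' = \<zero>\<^bsub>H\<^esub>" using x'(1) by (auto simp: p_torsion_def)
      show c0: "x' \<in> carrier H" using H.sm_carrier[OF smI(2) m] .
      show "pp \<odot>\<^bsub>H\<^esub> x' = \<zero>\<^bsub>H\<^esub>" by (rule z0)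
      show "H.ht x' = Infty" using H.ht_eq_Infty[OF c0] m by simp
    qed
    have "Infty \<le> H.ht (w \<oplus>\<^bsub>H\<^esub> x')" using w x'c by (intro H.ht_add) auto
    then have "H.ht (w \<oplus>\<^bsub>H\<^esub> x') = Infty" using H.Infty_le by blast
    moreover have "w \<oplus>\<^bsub>H\<^esub> x' \<notin> Range \<Phi>"
    proof
      assume "w \<oplus>\<^bsub>H\<^esub> x' \<in> Range \<Phi>"
      from H.sm_diff[OF sm_Range[OF \<Phi>] True this] have "w \<ominus>\<^bsub>H\<^esub> (w \<oplus>\<^bsub>H\<^esub> x') \<in> Range \<Phi>" .
      moreover have "x' \<oplus>\<^bsub>H\<^esub> (w \<ominus>\<^bsub>H\<^esub> (w \<oplus>\<^bsub>H\<^esub> x')) = \<zero>\<^bsub>H\<^esub>" using x'c(1) w(1) by algebra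
      ultimately show False using x'(2) by blast
    qed
    moreover have "pp \<odot>\<^bsub>H\<^esub> (w \<oplus>\<^bsub>H\<^esub> x') = z" using w x'c by (simp add: H.smult_r_distr)
    moreover have "w \<oplus>\<^bsub>H\<^esub> x' \<in> carrier H" using w x'c by simp
    ultimately show ?thesis by (intro exI[of _ "w \<oplus>\<^bsub>H\<^esub> x'"]) simp
  qed
  then obtain y where y: "y \<in> carrier H" "z = pp \<odot>\<^bsub>H\<^esub> y" "y \<notin> Range \<Phi>" "H.ht y = Infty" by blast
  have "\<zero> \<in> Domain \<Phi>" using G.sm_zero[OF sm_Domain[OF \<Phi>]] .
  then show ?thesis using y z x Infty by (intro exI[of _ \<zero>] exI[of _ y]) simp
next
  case (Ord \<alpha>)
  obtain \<alpha>' where pred: "is_pred \<alpha> \<alpha>'" using G.ht_Ord_succ[OF x(1) Ord] .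
  note pl = G.is_pred_less_iff[OF pred]
  have lt: "\<alpha> < \<alpha>'" using pred by (simp add: is_pred_def)
  have notge: "H.ht u \<le> Ord \<alpha>" if "\<not> Ord \<alpha>' \<le> H.ht u" for u using that pl by (metis not_le)
  show ?thesis
  proof (cases "\<exists>s\<in>Domain \<Phi>. ht (x \<oplus> s) = Ord \<alpha> \<and> Ord \<alpha>' < ht (pp \<odot> (x \<oplus> s))")
    case True
    then obtain s where s: "s \<in> Domain \<Phi>" "ht (x \<oplus> s) = Ord \<alpha>" "Ord \<alpha>' < ht (pp \<odot> (x \<oplus> s))" by blast
    have sc: "s \<in> carrier G" using G.sm_carrier[OF sm_Domain[OF \<Phi>] s(1)] .
    define u where "u = x \<oplus> s"
    have u: "u \<in> carrier G" "ht u = Ord \<alpha>" "Ord \<alpha>' < ht (pp \<odot> u)" using s sc x by (auto simp: u_def)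
    have umax: "ht (u \<oplus> s') \<le> Ord \<alpha>" if s': "s' \<in> Domain \<Phi>" for s'
    proof -
      have "u \<oplus> s' = x \<oplus> (s \<oplus> s')" unfolding u_def using x sc G.sm_carrier[OF sm_Domain[OF \<Phi>] s'] by (simp add: G.M.a_assoc)
      then show ?thesis using xmax[OF G.sm_add[OF sm_Domain[OF \<Phi>] s(1) s']] Ord by simp
    qed
    obtain v where v: "v \<in> carrier G" "Ord \<alpha>' \<le> ht v" "pp \<odot> u = pp \<odot> v"
      using G.ht_p_divide[OF _ u(3)] u(1) by auto
    \<comment> \<open>u and v have the same multiple by p while v lies in
      \<open>p_power p G \<alpha>'\<close>. Hence u - v is torsion at level \<alpha>, and a
      translate of it by the domain inside \<open>p_power p G \<alpha>'\<close> would give a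
      translate of u higher than \<alpha>.\<close>
    define t0 where "t0 = u \<ominus> v"
    have t0c: "t0 \<in> carrier G" using u v by (simp add: t0_def)
    have "pp \<odot> t0 = pp \<odot> u \<ominus> pp \<odot> v" unfolding t0_def using u(1) v(1) by algebra
    also have "\<dots> = \<zero>" unfolding v(3) using v by (simp add: G.minus_eq_zero_iff)
    finally have pt0: "pp \<odot> t0 = \<zero>" .
    have va: "Ord \<alpha> \<le> ht v" using v(2) pl[of "ht v"] by simp
    have "Ord \<alpha> \<le> ht t0" unfolding t0_def using u v(1) va by (intro G.ht_diff) auto
    then have t0P: "t0 \<in> p_torsion p G (p_power p G \<alpha>)"
      unfolding p_torsion_def using G.ht_ge_iff[OF t0c, of "Ord \<alpha>"] pt0 by (simp add: G.pw_simps)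
    have Q: "p_mult p G (p_power p G \<alpha>) = p_power p G \<alpha>'" "p_mult p H (p_power p H \<alpha>) = p_power p H \<alpha>'"
      by (simp_all only: p_power_Suc[OF pred])
    have t0n: "t0 \<oplus> s' \<notin> p_power p G \<alpha>'" if s': "s' \<in> Domain \<Phi>" for s'
    proof
      assume m: "t0 \<oplus> s' \<in> p_power p G \<alpha>'"
      have s'c: "s' \<in> carrier G" using G.sm_carrier[OF sm_Domain[OF \<Phi>] s'] .
      have "Ord \<alpha>' \<le> ht (t0 \<oplus> s')" using m G.ht_ge_iff[of "t0 \<oplus> s'" "Ord \<alpha>'"] t0c s'c by (simp add: G.pw_simps)
      then have "Ord \<alpha>' \<le> ht ((t0 \<oplus> s') \<oplus> v)" using v t0c s'c by (intro G.ht_add[of "t0 \<oplus> s'" v]) auto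
      also have "(t0 \<oplus> s') \<oplus> v = u \<oplus> s'" unfolding t0_def using u(1) v(1) s'c by algebra
      also have "ht (u \<oplus> s') \<le> Ord \<alpha>" by (rule umax[OF s'])
      finally show False using lt by simp
    qed
    have sub: "p_power p G \<alpha>' \<subseteq> p_power p G \<alpha>" "p_power p H \<alpha>' \<subseteq> p_power p H \<alpha>"
      using G.p_power_antimono[of \<alpha> \<alpha>'] H.p_power_antimono[of \<alpha> \<alpha>'] lt by auto
    obtain x' where x': "x' \<in> p_torsion p H (p_power p H \<alpha>)" "\<And>t. t \<in> Range \<Phi> \<Longrightarrow> x' \<oplus>\<^bsub>H\<^esub> t \<notin> p_power p H \<alpha>'"
    proof (rule new_torsion_element[OF \<Phi> B G.sm_p_power G.sm_p_power H.sm_p_power H.sm_p_power sub])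
      fix s t assume st: "(s, t) \<in> \<Phi>"
      show "(s \<in> p_power p G \<alpha>) = (t \<in> p_power p H \<alpha>)" "(s \<in> p_power p G \<alpha>') = (t \<in> p_power p H \<alpha>')"
        "(s \<in> p_mult p G (p_power p G \<alpha>')) = (t \<in> p_mult p H (p_power p H \<alpha>'))" by (rule iso_pw[OF \<Phi> st])+
    next
      fix n show "incong G (p_torsion p G (p_power p G \<alpha>)) (p_power p G \<alpha>') n \<Longrightarrow>
        incong H (p_torsion p H (p_power p H \<alpha>)) (p_power p H \<alpha>') n" using countO[of \<alpha> n] unfolding Q .
    qed (use t0P t0n in auto)
    have x'm: "x' \<in> p_power p H \<alpha>" "pp \<odot>\<^bsub>H\<^esub> x' = \<zero>\<^bsub>H\<^esub>" using x'(1) by (auto simp: p_torsion_def)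
    have x'c: "x' \<in> carrier H" using H.sm_carrier[OF H.sm_p_power x'm(1)] .
    have x'h: "Ord \<alpha> \<le> H.ht x'" using H.ht_ge_iff[OF x'c, of "Ord \<alpha>"] x'm by (simp add: H.pw_simps)
    obtain z where z: "(pp \<odot> u, z) \<in> \<Phi>"
    proof -
      have "pp \<odot> u = pp \<odot> x \<oplus> pp \<odot> s" unfolding u_def using x(1) sc by (simp add: G.smult_r_distr)
      moreover have "pp \<odot> x \<oplus> pp \<odot> s \<in> Domain \<Phi>"
        by (intro G.sm_add[OF sm_Domain[OF \<Phi>]] G.sm_smult[OF sm_Domain[OF \<Phi>]] px s(1)) simp
      ultimately show ?thesis using that by auto
    qed
    have "Ord \<alpha>' < H.ht z" using iso_height[OF \<Phi> z] u(3) by simp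
    then obtain w where w: "w \<in> carrier H" "Ord \<alpha>' \<le> H.ht w" "z = pp \<odot>\<^bsub>H\<^esub> w"
      using H.ht_p_divide[OF iso_carrier(2)[OF \<Phi> z]] by blast
    define y where "y = w \<oplus>\<^bsub>H\<^esub> x'"
    have y: "y \<in> carrier H" "pp \<odot>\<^bsub>H\<^esub> y = z" using w x'c x'm by (simp_all add: y_def H.smult_r_distr)
    have ymax: "H.ht (y \<oplus>\<^bsub>H\<^esub> t) \<le> Ord \<alpha>" if t: "t \<in> Range \<Phi>" for t
    proof (rule notge, rule notI)
      assume h: "Ord \<alpha>' \<le> H.ht (y \<oplus>\<^bsub>H\<^esub> t)"
      have tc: "t \<in> carrier H" using H.sm_carrier[OF sm_Range[OF \<Phi>] t] .
      have "Ord \<alpha>' \<le> H.ht ((y \<oplus>\<^bsub>H\<^esub> t) \<ominus>\<^bsub>H\<^esub> w)" using h w y tc by (intro H.ht_diff) auto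
      also have "(y \<oplus>\<^bsub>H\<^esub> t) \<ominus>\<^bsub>H\<^esub> w = x' \<oplus>\<^bsub>H\<^esub> t" unfolding y_def using w(1) x'c tc by algebra
      finally have "x' \<oplus>\<^bsub>H\<^esub> t \<in> p_power p H \<alpha>'" using H.ht_ge_iff[of "x' \<oplus>\<^bsub>H\<^esub> t" "Ord \<alpha>'"] x'c tc by (simp add: H.pw_simps)
      then show False using x'(2)[OF t] by simp
    qed
    have "Ord \<alpha> \<le> H.ht w" using w(2) pl[of "H.ht w"] by simp
    then have "Ord \<alpha> \<le> H.ht y" unfolding y_def using w x'c x'h by (intro H.ht_add) auto
    moreover have "H.ht y \<le> Ord \<alpha>" using ymax[OF H.sm_zero[OF sm_Range[OF \<Phi>]]] y by simp
    ultimately have yh: "H.ht y = Ord \<alpha>" by simp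
    have yn: "y \<notin> Range \<Phi>"
    proof
      assume "y \<in> Range \<Phi>"
      from ymax[OF H.sm_uminus[OF sm_Range[OF \<Phi>] this]] have "H.ht (y \<oplus>\<^bsub>H\<^esub> \<ominus>\<^bsub>H\<^esub> y) \<le> Ord \<alpha>" .
      moreover have "y \<oplus>\<^bsub>H\<^esub> \<ominus>\<^bsub>H\<^esub> y = \<zero>\<^bsub>H\<^esub>" using y(1) by algebra
      ultimately show False by simp
    qed
    show ?thesis
      using s(1) y z yh yn ymax u(2) Ord unfolding u_def[symmetric]
      by (intro exI[of _ s] exI[of _ y]) (simp add: u_def)
  next
    case False
    obtain z where z: "(pp \<odot> x, z) \<in> \<Phi>" using px by blast
    have "Ord \<alpha> < ht (pp \<odot> x)" using G.ht_p_less[OF x(1) Ord] .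
    then have "Ord \<alpha> < H.ht z" using iso_height[OF \<Phi> z] by simp
    then obtain w where w: "w \<in> carrier H" "Ord \<alpha> \<le> H.ht w" "z = pp \<odot>\<^bsub>H\<^esub> w"
      using H.ht_p_divide[OF iso_carrier(2)[OF \<Phi> z]] by blast
    \<comment> \<open>A translate of w that is too high would have a p-multiple above \<alpha>';
      pulled back to G, this is precisely the situation excluded in the present case.\<close>
    have wmax: "H.ht (w \<oplus>\<^bsub>H\<^esub> t) \<le> Ord \<alpha>" if t: "t \<in> Range \<Phi>" for t
    proof (rule notge, rule notI)
      assume h: "Ord \<alpha>' \<le> H.ht (w \<oplus>\<^bsub>H\<^esub> t)"
      obtain s where st: "(s, t) \<in> \<Phi>" using t by blast
      note c = iso_carrier[OF \<Phi> st]
      have h1: "Ord \<alpha> \<le> H.ht (w \<oplus>\<^bsub>H\<^esub> t)" using h pl[of "H.ht (w \<oplus>\<^bsub>H\<^esub> t)"] by simp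
      have "Ord \<alpha> \<le> H.ht ((w \<oplus>\<^bsub>H\<^esub> t) \<ominus>\<^bsub>H\<^esub> w)" using h1 w c by (intro H.ht_diff) auto
      also have "(w \<oplus>\<^bsub>H\<^esub> t) \<ominus>\<^bsub>H\<^esub> w = t" using w(1) c(2) by algebra
      finally have hs: "Ord \<alpha> \<le> ht s" using iso_height[OF \<Phi> st] by simp
      have "Ord \<alpha> \<le> ht (x \<oplus> s)" using hs x c Ord by (intro G.ht_add) auto
      then have xs: "ht (x \<oplus> s) = Ord \<alpha>" using xmax[OF DomainI[OF st]] Ord by simp
      have m: "(pp \<odot> x \<oplus> pp \<odot> s, z \<oplus>\<^bsub>H\<^esub> pp \<odot>\<^bsub>H\<^esub> t) \<in> \<Phi>" by (intro iso_add[OF \<Phi> z] iso_smult[OF \<Phi> _ st]) simp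
      have "Ord \<alpha>' < H.ht (pp \<odot>\<^bsub>H\<^esub> (w \<oplus>\<^bsub>H\<^esub> t))" using h w c by (intro H.ht_p_less_ge) auto
      also have "pp \<odot>\<^bsub>H\<^esub> (w \<oplus>\<^bsub>H\<^esub> t) = z \<oplus>\<^bsub>H\<^esub> pp \<odot>\<^bsub>H\<^esub> t" using w c by (simp add: H.smult_r_distr)
      also have "H.ht \<dots> = ht (pp \<odot> x \<oplus> pp \<odot> s)" by (rule iso_height[OF \<Phi> m])
      also have "pp \<odot> x \<oplus> pp \<odot> s = pp \<odot> (x \<oplus> s)" using x c by (simp add: G.smult_r_distr)
      finally show False using False xs DomainI[OF st] by blast
    qed
    have "H.ht w \<le> Ord \<alpha>" using wmax[OF H.sm_zero[OF sm_Range[OF \<Phi>]]] w by simp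
    then have wh: "H.ht w = Ord \<alpha>" using w by simp
    have wn: "w \<notin> Range \<Phi>"
    proof
      assume "w \<in> Range \<Phi>"
      from wmax[OF H.sm_uminus[OF sm_Range[OF \<Phi>] this]] have "H.ht (w \<oplus>\<^bsub>H\<^esub> \<ominus>\<^bsub>H\<^esub> w) \<le> Ord \<alpha>" .
      moreover have "w \<oplus>\<^bsub>H\<^esub> \<ominus>\<^bsub>H\<^esub> w = \<zero>\<^bsub>H\<^esub>" using w(1) by algebra
      ultimately show False by simp
    qed
    have "\<zero> \<in> Domain \<Phi>" using G.sm_zero[OF sm_Domain[OF \<Phi>]] .
    then show ?thesis using w z x wh wn wmax Ord by (intro exI[of _ \<zero>] exI[of _ w]) simp
  qed
qed

text \<open>First a is replaced by a highest element of its coset modulo the domain, which exists by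
  \<open>fg_coset_max\<close>; a differs from it by an element of the domain and so is recovered.
  The last two facts about p x and p y keep the extension inside the rational hulls.\<close>

lemma kaplansky_step:
  assumes \<Phi>: "iso \<Phi>" and X: "G.dset X"
    and A: "finite A" "A \<subseteq> carrier G" "Domain \<Phi> = G.span A" "X \<subseteq> Domain \<Phi>" "Domain \<Phi> \<subseteq> G.hl (G.span X)"
    and B: "finite B" "B \<subseteq> carrier H" "Range \<Phi> = H.span B"
    and countO: "\<And>\<alpha> n. incong G (p_torsion p G (p_power p G (\<alpha> :: 'k))) (p_mult p G (p_power p G \<alpha>)) n \<Longrightarrow>
      incong H (p_torsion p H (p_power p H \<alpha>)) (p_mult p H (p_power p H \<alpha>)) n"
    and countI: "\<And>n. incong G (p_torsion p G (p_power_inf TYPE('k) p G)) {\<zero>} n \<Longrightarrow>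
      incong H (p_torsion p H (p_power_inf TYPE('k) p H)) {\<zero>\<^bsub>H\<^esub>} n"
    and a: "a \<in> carrier G" "pp \<odot> a \<in> Domain \<Phi>" "a \<notin> Domain \<Phi>"
  obtains x y where "x \<in> carrier G" "y \<in> carrier H" "iso (ext \<Phi> x y)" "a \<in> Domain (ext \<Phi> x y)"
    "pp \<odot> x \<in> Domain \<Phi>" "pp \<odot>\<^bsub>H\<^esub> y \<in> Range \<Phi>"
proof -
  have Xc: "X \<subseteq> carrier G" by (rule G.dset_carrier[OF X])
  note sX = G.sm_span[OF Xc]
  note D = G.sm_carrier[OF sm_Domain[OF \<Phi>]] G.sm_add[OF sm_Domain[OF \<Phi>]] G.sm_diff[OF sm_Domain[OF \<Phi>]]
  have "pp ^ 1 \<odot> a \<in> G.hl (G.span X)" using a A by auto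
  then have "a \<in> G.hl (G.hl (G.span X))" using a(1) unfolding G.hl_iff[OF G.sm_hl[OF sX]] by blast
  then have ah: "a \<in> G.hl (G.span X)" unfolding G.hl_hl[OF sX] .
  have Ah: "A \<subseteq> G.hl (G.span X)" using A G.span_base[OF A(2)] by auto
  obtain s0 where s0: "s0 \<in> Domain \<Phi>" "\<And>s. s \<in> Domain \<Phi> \<Longrightarrow> ht (a \<oplus> s) \<le> ht (a \<oplus> s0)"
    using G.fg_coset_max[OF X A(1) Ah _ ah] A(3,4) by auto
  define x0 where "x0 = a \<oplus> s0"
  have x0: "x0 \<in> carrier G" using a s0 D(1) by (simp add: x0_def)
  have nD: "a \<oplus> s \<notin> Domain \<Phi>" if s: "s \<in> Domain \<Phi>" for s
  proof
    assume "a \<oplus> s \<in> Domain \<Phi>"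
    from D(3)[OF this s] have "(a \<oplus> s) \<ominus> s \<in> Domain \<Phi>" .
    also have "(a \<oplus> s) \<ominus> s = a" using a(1) D(1)[OF s] by algebra
    finally show False using a(3) by simp
  qed
  have x0max: "ht (x0 \<oplus> s) \<le> ht x0" if s: "s \<in> Domain \<Phi>" for s
  proof -
    have "x0 \<oplus> s = a \<oplus> (s0 \<oplus> s)" unfolding x0_def using a D(1)[OF s0(1)] D(1)[OF s] by (simp add: G.M.a_assoc)
    then show ?thesis using s0(2)[OF D(2)[OF s0(1) s]] by (simp add: x0_def)
  qed
  have px0: "pp \<odot> x0 \<in> Domain \<Phi>"
  proof -
    have "pp \<odot> a \<oplus> pp \<odot> s0 \<in> Domain \<Phi>"
      by (intro D(2) a(2) G.sm_smult[OF sm_Domain[OF \<Phi>] _ s0(1)]) simp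
    then show ?thesis unfolding x0_def using a D(1)[OF s0(1)] by (simp add: G.smult_r_distr)
  qed
  have "x0 \<notin> Domain \<Phi>" unfolding x0_def by (rule nD[OF s0(1)])
  from kaplansky_step_aux[OF \<Phi> B countO countI x0 this px0 x0max]
  obtain s y where s: "s \<in> Domain \<Phi>" and y: "y \<in> carrier H" and pxy: "(pp \<odot> (x0 \<oplus> s), pp \<odot>\<^bsub>H\<^esub> y) \<in> \<Phi>"
    and hx: "ht (x0 \<oplus> s) = ht x0" and yn: "y \<notin> Range \<Phi>" and hy: "H.ht y = ht x0"
    and ymax: "\<forall>t\<in>Range \<Phi>. H.ht (y \<oplus>\<^bsub>H\<^esub> t) \<le> H.ht y" by blast
  define x where "x = x0 \<oplus> s"
  have x: "x \<in> carrier G" using x0 D(1)[OF s] by (simp add: x_def)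
  have xa: "x = a \<oplus> (s0 \<oplus> s)" unfolding x_def x0_def using a D(1)[OF s0(1)] D(1)[OF s] by (simp add: G.M.a_assoc)
  have ss: "s0 \<oplus> s \<in> Domain \<Phi>" by (rule D(2)[OF s0(1) s])
  have xmax: "ht (x \<oplus> s') \<le> ht x" if s': "s' \<in> Domain \<Phi>" for s'
  proof -
    have "x \<oplus> s' = x0 \<oplus> (s \<oplus> s')" unfolding x_def using x0 D(1)[OF s] D(1)[OF s'] by (simp add: G.M.a_assoc)
    then show ?thesis using x0max[OF D(2)[OF s s']] hx by (simp add: x_def)
  qed
  have xn: "x \<notin> Domain \<Phi>" unfolding xa by (rule nD[OF ss])
  have iso: "iso (ext \<Phi> x y)"
    by (rule ext_iso_torsion[OF \<Phi> x y _ xn yn]) (use pxy hx hy xmax ymax in \<open>auto simp: x_def\<close>)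
  have "x \<in> Domain (ext \<Phi> x y)" using ext_mem(2)[OF \<Phi> x y] by blast
  moreover have "s0 \<oplus> s \<in> Domain (ext \<Phi> x y)" using ext_mem(1)[OF \<Phi> x y] ss by blast
  ultimately have "x \<ominus> (s0 \<oplus> s) \<in> Domain (ext \<Phi> x y)" by (rule G.sm_diff[OF sm_Domain[OF iso]])
  also have "x \<ominus> (s0 \<oplus> s) = a" unfolding xa using a(1) D(1)[OF s0(1)] D(1)[OF s] by algebra
  finally have "a \<in> Domain (ext \<Phi> x y)" .
  moreover have "pp \<odot> x \<in> Domain \<Phi>" "pp \<odot>\<^bsub>H\<^esub> y \<in> Range \<Phi>" using pxy unfolding x_def by blast+
  ultimately show ?thesis using that[OF x y iso] by blast
qed

end


section \<open>Warfield invariants\<close>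

lemma ulm_class_iff:
  assumes "e \<in> (UNIV :: (nat \<Rightarrow> 'k height) set) // ulm_equiv" "u \<in> e"
  shows "v \<in> e \<longleftrightarrow> (u, v) \<in> ulm_equiv"
proof -
  obtain w where w: "e = ulm_equiv `` {w}" using assms(1) by (auto elim: quotientE)
  have "(w, u) \<in> ulm_equiv" using assms(2) w by simp
  then have "e = ulm_equiv `` {u}" unfolding w by (rule equiv_class_eq[OF equiv_ulm_equiv])
  then show ?thesis by simp
qed

text \<open>The shifts may be zero here; raising both by one produces the positive shifts demanded
  by the relation.\<close>

lemma ulm_equivI:
  assumes "\<And>i. u (i + a) = v (i + b)" shows "(u, v) \<in> ulm_equiv"
proof -
  have "u (i + Suc a) = v (i + Suc b)" for i using assms[of "Suc i"] by simp
  then have "0 < Suc b \<and> 0 < Suc a \<and> (\<forall>i. u (i + Suc a) = v (i + Suc b))" by simp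
  then show ?thesis unfolding ulm_equiv_def by blast
qed

section \<open>The rank attached to a class of Ulm sequences\<close>

context zmodk
begin

abbreviation ulm :: "'a \<Rightarrow> nat \<Rightarrow> 'k height" where "ulm x \<equiv> ulm_seq p G x"

lemma ulm_pp: "x \<in> carrier G \<Longrightarrow> ulm (pp ^ k \<odot> x) i = ulm x (i + k)"
  by (simp add: ulm_seq_def power_add)

lemma lincomb_add:
  assumes "finite A" "A \<subseteq> carrier G" "a \<in> A \<rightarrow> Zp" "b \<in> A \<rightarrow> Zp"
  shows "lincomb (\<lambda>x. a x + b x) A = lincomb a A \<oplus> lincomb b A"
  using assms
proof (induction A)
  case empty
  then show ?case by (simp add: lincomb_def)
next
  case (insert x A)
  then have x: "x \<in> carrier G" "a x \<in> Zp" "b x \<in> Zp" and A: "A \<subseteq> carrier G" "a \<in> A \<rightarrow> Zp" "b \<in> A \<rightarrow> Zp" by auto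
  have ab: "(\<lambda>x. a x + b x) \<in> A \<rightarrow> Zp" using A by (simp add: Pi_iff)
  note c = lincomb_closed[OF A(1,2)] lincomb_closed[OF A(1,3)]
  have 1: "lincomb f (insert x A) = f x \<odot> x \<oplus> lincomb f A" if "f x \<in> Zp" "f \<in> A \<rightarrow> Zp" for f
    using lincomb_insert_upd[OF insert.hyps(1) A(1) x(1) insert.hyps(2) that(2,1)] by simp
  have "lincomb (\<lambda>x. a x + b x) (insert x A) = (a x + b x) \<odot> x \<oplus> lincomb (\<lambda>x. a x + b x) A"
    using x ab by (intro 1) auto
  also have "lincomb (\<lambda>x. a x + b x) A = lincomb a A \<oplus> lincomb b A" using insert.IH A by simp
  also have "(a x + b x) \<odot> x \<oplus> (lincomb a A \<oplus> lincomb b A) = (a x \<odot> x \<oplus> lincomb a A) \<oplus> (b x \<odot> x \<oplus> lincomb b A)"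
    using c x by algebra
  also have "\<dots> = lincomb a (insert x A) \<oplus> lincomb b (insert x A)"
    using 1[OF x(2) A(2)] 1[OF x(3) A(3)] by simp
  finally show ?case .
qed

lemma lincomb_scale:
  assumes "A \<subseteq> carrier G" "a \<in> A \<rightarrow> Zp" "c \<in> Zp"
  shows "lincomb (\<lambda>x. c * a x) A = c \<odot> lincomb a A"
  using lincomb_smult[OF assms] by simp

text \<open>Gaussian elimination over the valuation ring, with a pivot of least valuation in each column.\<close>

lemma primitive_relation:
  assumes "finite E" "finite I" "card E < card I" "\<And>i l. i \<in> I \<Longrightarrow> l \<in> E \<Longrightarrow> a i l \<in> Zp"
  shows "\<exists>c i0. (\<forall>i\<in>I. c i \<in> Zp) \<and> i0 \<in> I \<and> c i0 = 1 \<and> (\<forall>l\<in>E. (\<Sum>i\<in>I. c i * a i l) = 0)"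
  using assms
proof (induction E arbitrary: I a)
  case empty
  then obtain i0 where "i0 \<in> I" by (metis card.empty ex_in_conv less_irrefl)
  then show ?case by (intro exI[of _ "\<lambda>_. 1"] exI[of _ i0]) auto
next
  case (insert l E)
  have aZ: "a i l \<in> Zp" if "i \<in> I" for i using insert.prems(3)[OF that] by simp
  have "\<exists>i0\<in>I. \<forall>i\<in>I. \<exists>q\<in>Zp. a i l = a i0 l * q"
  proof -
    have "\<exists>i0\<in>J. \<forall>i\<in>J. \<exists>q\<in>Zp. a i l = a i0 l * q" if "finite J" "J \<noteq> {}" "J \<subseteq> I" for J
      using that
    proof (induction J rule: finite_ne_induct)
      case (singleton i)
      have "a i l = a i l * 1" by simp
      then show ?case using Zp_1 by blast
    next
      case (insert i J)
      then obtain i0 where i0: "i0 \<in> J" "\<forall>i\<in>J. \<exists>q\<in>Zp. a i l = a i0 l * q" by auto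
      have Z: "a i l \<in> Zp" "a i0 l \<in> Zp" using aZ insert.prems i0 by auto
      from Zp_total[OF Z] show ?case
      proof
        assume "\<exists>q\<in>Zp. a i l = a i0 l * q"
        then show ?thesis using i0 by (intro bexI[of _ i0]) auto
      next
        assume "\<exists>r\<in>Zp. a i0 l = a i l * pp * r"
        then obtain r where r: "r \<in> Zp" "a i0 l = a i l * (pp * r)" by (auto simp: mult.assoc)
        have "\<exists>q\<in>Zp. a k l = a i l * q" if k: "k \<in> insert i J" for k
        proof (cases "k = i")
          case True
          then show ?thesis by (intro bexI[of _ 1]) auto
        next
          case False
          then obtain q where q: "q \<in> Zp" "a k l = a i0 l * q" using i0 k by auto
          then have "a k l = a i l * (pp * r * q)" unfolding q(2) r(2) by simp
          then show ?thesis using q r by (intro bexI[of _ "pp * r * q"]) auto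
        qed
        then show ?thesis by (intro bexI[of _ i]) auto
      qed
    qed
    moreover have "I \<noteq> {}" using insert.prems by auto
    ultimately show ?thesis using insert.prems(1) by blast
  qed
  then obtain i0 where i0: "i0 \<in> I" "\<forall>i\<in>I. \<exists>q\<in>Zp. a i l = a i0 l * q" by blast
  then obtain q where q: "\<And>i. i \<in> I \<Longrightarrow> q i \<in> Zp" "\<And>i. i \<in> I \<Longrightarrow> a i l = a i0 l * q i" by metis
  define I' where "I' = I - {i0}"
  have I': "finite I'" "I = insert i0 I'" "i0 \<notin> I'" "I' \<subseteq> I" using i0 insert.prems by (auto simp: I'_def)
  have "card E < card I'" using insert.prems insert.hyps I' by simp
  moreover have "a i k - q i * a i0 k \<in> Zp" if "i \<in> I'" "k \<in> E" for i k
    using that insert.prems(3) q(1) I'(4) i0(1) by (intro Zp_diff Zp_mult) auto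
  ultimately obtain c i1 where c: "\<forall>i\<in>I'. c i \<in> Zp" "i1 \<in> I'" "c i1 = 1"
    "\<forall>k\<in>E. (\<Sum>i\<in>I'. c i * (a i k - q i * a i0 k)) = 0"
    using insert.IH[OF I'(1), of "\<lambda>i k. a i k - q i * a i0 k"] by blast
  \<comment> \<open>The pivot receives the coefficient that undoes the subtraction of pivot
    multiples from the other rows. The index i1 is different from the pivot, so the coefficient one
    survives the induction.\<close>
  define d where "d i = (if i = i0 then - (\<Sum>i\<in>I'. c i * q i) else c i)" for i
  have sumZ: "(\<Sum>i\<in>I'. c i * q i) \<in> Zp" if "J \<subseteq> I'" for J
  proof -
    have "(\<Sum>i\<in>K. c i * q i) \<in> Zp" if "K \<subseteq> I'" for K
      using finite_subset[OF that I'(1)] that c(1) q(1) I'(4) by (induction K rule: finite_induct) auto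
    then show ?thesis by blast
  qed
  have dI': "(\<Sum>i\<in>I'. d i * f i) = (\<Sum>i\<in>I'. c i * f i)" for f
    using I'(3) by (intro sum.cong) (auto simp: d_def)
  have dsum: "(\<Sum>i\<in>I. d i * f i) = (\<Sum>i\<in>I'. c i * (f i - q i * f i0))" for f
    unfolding I'(2) using I'(1,3)
    by (simp add: dI') (simp add: d_def sum_distrib_right sum_distrib_left sum_subtractf algebra_simps)
  have "\<forall>i\<in>I. d i \<in> Zp" using c(1) sumZ[of I'] by (auto simp: d_def I'(2))
  moreover have "d i1 = 1" "i1 \<in> I" using c I' by (auto simp: d_def)
  moreover have "(\<Sum>i\<in>I. d i * a i k) = 0" if "k \<in> insert l E" for k
  proof (cases "k = l")
    case True
    have "a i l - q i * a i0 l = 0" if "i \<in> I'" for i using q(2)[of i] that I'(4) by (auto simp: mult.commute)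
    then show ?thesis unfolding dsum True by simp
  next
    case False
    then show ?thesis unfolding dsum using c(4) that by auto
  qed
  ultimately show ?case by blast
qed

lemma common_exponent:
  assumes "finite D" "D \<subseteq> hl K" "sm K"
  shows "\<exists>r. \<forall>d\<in>D. pp ^ r \<odot> d \<in> K"
  using assms(1,2)
proof (induction D)
  case (insert d D)
  then obtain r where r: "\<forall>d\<in>D. pp ^ r \<odot> d \<in> K" by auto
  obtain m where m: "d \<in> carrier G" "pp ^ m \<odot> d \<in> K" using insert.prems hl_iff[OF assms(3)] by auto
  have "pp ^ (r + m) \<odot> x \<in> K" if x: "x \<in> insert d D" for x
  proof (cases "x = d")
    case True
    have "pp ^ r \<odot> (pp ^ m \<odot> d) \<in> K" by (intro sm_smult[OF assms(3)] m) simp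
    then show ?thesis using m True by (simp add: power_add)
  next
    case False
    then have "pp ^ r \<odot> x \<in> K" using r x by simp
    from sm_smult[OF assms(3) _ this, of "pp ^ m"] have "pp ^ m \<odot> (pp ^ r \<odot> x) \<in> K" by simp
    moreover have "x \<in> carrier G" using x insert.prems hl_iff[OF assms(3)] by auto
    ultimately show ?thesis by (simp add: power_add mult.commute)
  qed
  then show ?case by blast
qed simp

abbreviation pdb :: "'a set set \<Rightarrow> bool" where "pdb C \<equiv> partial_decomposition_basis T p G C"

lemma pdb_dset: "pdb C \<Longrightarrow> X \<in> C \<Longrightarrow> dset X"
  unfolding partial_decomposition_basis_def by blast

lemma pdb_extend:
  assumes C: "pdb C" and D: "finite D" "D \<subseteq> carrier G" and X: "X \<in> C"
  shows "\<exists>Y\<in>C. X \<subseteq> Y \<and> D \<subseteq> hl (span Y)"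
  using D
proof (induction D)
  case empty
  then show ?case using X by auto
next
  case (insert d D)
  then obtain Y where Y: "Y \<in> C" "X \<subseteq> Y" "D \<subseteq> hl (span Y)" by auto
  have "\<exists>Z\<in>C. Y \<subseteq> Z \<and> d \<in> hl (span Z)"
    using C Y(1) insert.prems unfolding partial_decomposition_basis_def by simp
  then obtain Z where Z: "Z \<in> C" "Y \<subseteq> Z" "d \<in> hl (span Z)" by blast
  have "hl (span Y) \<subseteq> hl (span Z)" by (intro hl_mono span_is_monotone Z)
  then show ?case using Y Z by (intro bexI[of _ Z]) auto
qed

text \<open>The counterpart of Warfield's submodule G(u), with the comparison required only
  eventually because a class of Ulm sequences ignores initial segments.\<close>

definition dominates :: "(nat \<Rightarrow> 'k height) \<Rightarrow> 'a set" where
  "dominates u = {x \<in> carrier G. \<exists>m. \<forall>j\<ge>m. u j \<le> ht (pp ^ j \<odot> x)}"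

definition exceeds :: "(nat \<Rightarrow> 'k height) \<Rightarrow> nat \<Rightarrow> 'a set" where
  "exceeds u m = {y \<in> carrier G. \<forall>i. \<exists>j\<ge>i. u (j + m) < ht (pp ^ j \<odot> y)}"

text \<open>The denominator \<open>pp ^ m\<close> and the shift in \<open>exceeds\<close> go
  together. For eventually infinite u these are exactly the torsion elements.\<close>

definition neglig :: "(nat \<Rightarrow> 'k height) \<Rightarrow> 'a set" where
  "neglig u = {x \<in> carrier G. \<exists>m. pp ^ m \<odot> x \<in> span (exceeds u m)}"

text \<open>
  \<^term>\<open>ulm_rank n u\<close> says that the Warfield invariant of the class of \<^term>\<open>u\<close> is at least
  \<^term>\<open>n\<close>; it does not refer to a partial decomposition basis and is visibly preserved by partial
  isomorphisms. Independence is required with a coefficient equal to one, that is, over the residue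
  field, except that for eventually infinite \<^term>\<open>u\<close> it amounts to linear independence.
\<close>

definition ulm_rank :: "nat \<Rightarrow> (nat \<Rightarrow> 'k height) \<Rightarrow> bool" where
  "ulm_rank n u \<longleftrightarrow> (\<exists>Z. finite Z \<and> card Z = n \<and> Z \<subseteq> dominates u \<and>
     (\<forall>z\<in>Z. \<forall>s\<in>span (Z - {z}). z \<oplus> s \<notin> neglig u))"

lemma exceeds_carrier: "exceeds u m \<subseteq> carrier G"
  by (auto simp: exceeds_def)

text \<open>Each member agrees with one fixed sequence of the class after suitable shifts. Taking
  the largest shift of that sequence makes a single tail serve for all of the finitely many
  members.\<close>

lemma ulm_common_tail:
  assumes e: "e \<in> UNIV // ulm_equiv" and A: "finite A" "A \<subseteq> carrier G" "\<And>x. x \<in> A \<Longrightarrow> ulm x \<in> e"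
  shows "\<exists>u\<in>e. \<exists>k. \<forall>x\<in>A. ulm (pp ^ k x \<odot> x) = u"
proof -
  obtain v where v: "v \<in> e" using e by (metis equiv_ulm_equiv in_quotient_imp_non_empty ex_in_conv)
  have "\<exists>n m. \<forall>i. v (i + n) = ulm x (i + m)" if "x \<in> A" for x
    using A(3)[OF that] ulm_class_iff[OF e v] unfolding ulm_equiv_def by auto
  then obtain n m where nm: "\<And>x i. x \<in> A \<Longrightarrow> v (i + n x) = ulm x (i + m x)" by metis
  define N where "N = Max (insert 0 (n ` A))"
  have N: "n x \<le> N" if "x \<in> A" for x using A(1) that by (simp add: N_def)
  define u where "u i = v (i + N)" for i
  have "(v, u) \<in> ulm_equiv" by (rule ulm_equivI[of _ N _ 0]) (simp add: u_def)
  then have "u \<in> e" using ulm_class_iff[OF e v] by simp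
  moreover have "ulm (pp ^ (m x + (N - n x)) \<odot> x) = u" if x: "x \<in> A" for x
  proof
    fix i
    have "ulm (pp ^ (m x + (N - n x)) \<odot> x) i = ulm x ((i + (N - n x)) + m x)"
      using A(2) x by (subst ulm_pp) (auto simp: ac_simps)
    also have "\<dots> = v ((i + (N - n x)) + n x)" using nm[OF x] by simp
    also have "\<dots> = u i" using N[OF x] by (simp add: u_def)
    finally show "ulm (pp ^ (m x + (N - n x)) \<odot> x) i = u i" .
  qed
  ultimately show ?thesis by (intro bexI[of _ u] exI[of _ "\<lambda>x. m x + (N - n x)"]) auto
qed

text \<open>
  The \<^term>\<open>x\<close>-coordinate of an element of \<^term>\<open>exceeds u m\<close> is divisible by a higher power of \<open>p\<close>
  than that of \<open>p ^ (m + k) \<odot> x\<close>.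
\<close>

lemma not_negligible:
  assumes C: "pdb C" and X: "X \<in> C" "x \<in> X" and k: "ulm (pp ^ k \<odot> x) = u" and s: "s \<in> span (X - {x})"
  shows "pp ^ k \<odot> x \<oplus> s \<notin> neglig u"
proof
  assume "pp ^ k \<odot> x \<oplus> s \<in> neglig u"
  then obtain m where m: "pp ^ m \<odot> (pp ^ k \<odot> x \<oplus> s) \<in> span (exceeds u m)" by (auto simp: neglig_def)
  then obtain D a where D: "finite D" "D \<subseteq> exceeds u m" "a \<in> D \<rightarrow> Zp" "pp ^ m \<odot> (pp ^ k \<odot> x \<oplus> s) = lincomb a D"
    unfolding span_def by auto
  have Dc: "D \<subseteq> carrier G" using D(2) exceeds_carrier by blast
  obtain Y where Y: "Y \<in> C" "X \<subseteq> Y" "D \<subseteq> hl (span Y)" using pdb_extend[OF C D(1) Dc X(1)] by blast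
  have dY: "dset Y" by (rule pdb_dset[OF C Y(1)])
  have Yc: "Y \<subseteq> carrier G" by (rule dset_carrier[OF dY])
  have x: "x \<in> Y" "x \<in> carrier G" using X Y Yc by auto
  define Y' where "Y' = Y - {x}"
  have Y': "Y' \<subseteq> Y" "Y' \<subseteq> carrier G" "x \<notin> Y'" "Y = insert x Y'" using Yc x by (auto simp: Y'_def)
  note sY' = sm_span[OF Y'(2)]
  have sY: "s \<in> span Y'" using s span_is_monotone[of "X - {x}" Y'] Y(2) by (auto simp: Y'_def)
  have sc: "s \<in> carrier G" using sm_carrier[OF sY' sY] .
  \<comment> \<open>The elements whose x-coordinate, computed after multiplication by
    \<open>pp ^ r\<close>, has at least one factor p more than that of
    \<open>pp ^ (m + k) \<odot> x\<close> would have.\<close>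
  define K where "K = {y \<in> carrier G. \<exists>r. \<exists>b\<in>Zp. \<exists>w\<in>span Y'. pp ^ r \<odot> y = (pp ^ (r + m + k) * (pp * b)) \<odot> x \<oplus> w}"
  have KI: "y \<in> K" if "y \<in> carrier G" "b \<in> Zp" "w \<in> span Y'" "pp ^ r \<odot> y = (pp ^ (r + m + k) * (pp * b)) \<odot> x \<oplus> w" for y r b w
    using that unfolding K_def by blast
  have smK: "sm K"
  proof (rule smI)
    show "K \<subseteq> carrier G" by (auto simp: K_def)
    show "\<zero> \<in> K" by (rule KI[of _ 0 \<zero> 0]) (use x sm_zero[OF sY'] in auto)
    fix y assume "y \<in> K"
    then obtain r b w where y: "y \<in> carrier G" "b \<in> Zp" "w \<in> span Y'" "pp ^ r \<odot> y = (pp ^ (r + m + k) * (pp * b)) \<odot> x \<oplus> w"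
      unfolding K_def by blast
    note wc = sm_carrier[OF sY' y(3)]
    show "q \<odot> y \<in> K" if q: "q \<in> Zp" for q
    proof (rule KI[of _ "q * b" "q \<odot> w" r])
      have "pp ^ r \<odot> (q \<odot> y) = q \<odot> (pp ^ r \<odot> y)" by (rule smult_swap) (use q y(1) in auto)
      also have "\<dots> = (q * (pp ^ (r + m + k) * (pp * b))) \<odot> x \<oplus> q \<odot> w"
        unfolding y(4) using x y(2) wc q by (simp add: smult_r_distr)
      also have "q * (pp ^ (r + m + k) * (pp * b)) = pp ^ (r + m + k) * (pp * (q * b))" by simp
      finally show "pp ^ r \<odot> (q \<odot> y) = (pp ^ (r + m + k) * (pp * (q * b))) \<odot> x \<oplus> q \<odot> w" .
    qed (use q y sm_smult[OF sY'] in auto)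
    fix y' assume "y' \<in> K"
    then obtain r' b' w' where y': "y' \<in> carrier G" "b' \<in> Zp" "w' \<in> span Y'" "pp ^ r' \<odot> y' = (pp ^ (r' + m + k) * (pp * b')) \<odot> x \<oplus> w'"
      unfolding K_def by blast
    note wc' = sm_carrier[OF sY' y'(3)]
    show "y \<oplus> y' \<in> K"
    proof (rule KI[of _ "b + b'" "pp ^ r' \<odot> w \<oplus> pp ^ r \<odot> w'" "r + r'"])
      have "pp ^ (r + r') \<odot> (y \<oplus> y') = pp ^ r' \<odot> (pp ^ r \<odot> y) \<oplus> pp ^ r \<odot> (pp ^ r' \<odot> y')"
        using y(1) y'(1) by (simp add: smult_r_distr power_add mult.commute)
      also have "\<dots> = (pp ^ r' * (pp ^ (r + m + k) * (pp * b)) + pp ^ r * (pp ^ (r' + m + k) * (pp * b'))) \<odot> x \<oplus> (pp ^ r' \<odot> w \<oplus> pp ^ r \<odot> w')"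
        unfolding y(4) y'(4) using x(2) y(2) y'(2) wc wc' by algebra
      also have "pp ^ r' * (pp ^ (r + m + k) * (pp * b)) + pp ^ r * (pp ^ (r' + m + k) * (pp * b')) = pp ^ (r + r' + m + k) * (pp * (b + b'))"
        by (simp add: power_add algebra_simps)
      finally show "pp ^ (r + r') \<odot> (y \<oplus> y') = (pp ^ (r + r' + m + k) * (pp * (b + b'))) \<odot> x \<oplus> (pp ^ r' \<odot> w \<oplus> pp ^ r \<odot> w')" .
    qed (use y y' sm_smult[OF sY'] sm_add[OF sY'] in auto)
  qed
  have "D \<subseteq> K"
  proof
    fix d assume d: "d \<in> D"
    then have dc: "d \<in> carrier G" using Dc by blast
    obtain r where r: "pp ^ r \<odot> d \<in> span Y" using d Y(3) hl_iff[OF sm_span[OF Yc]] by blast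
    obtain b w where bw: "b \<in> Zp" "w \<in> span Y'" "pp ^ r \<odot> d = b \<odot> x \<oplus> w"
      using r span_insert_iff[OF x(2) Y'(2)] Y'(4) by auto
    have "pp ^ (r + m + k) \<in> Zp" by simp
    from Zp_total[OF this bw(1)] show "d \<in> K"
    proof
      \<comment> \<open>Here the x-coordinate b of \<open>pp ^ r \<odot> d\<close> divides
        \<open>pp ^ (r + m + k)\<close>. Then for j at least r the height of
        \<open>pp ^ j \<odot> d\<close> is at most that of a multiple of x of height
        \<open>u (j + m)\<close>, so d cannot exceed u infinitely often.\<close>
      assume "\<exists>q\<in>Zp. pp ^ (r + m + k) = b * q"
      then obtain q where q: "q \<in> Zp" "pp ^ (r + m + k) = b * q" by blast
      obtain j where j: "j \<ge> r" "u (j + m) < ht (pp ^ j \<odot> d)" using d D(2) unfolding exceeds_def by blast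
      define i where "i = j - r"
      have ji: "j = i + r" using j(1) by (simp add: i_def)
      have "pp ^ j \<odot> d = pp ^ i \<odot> (pp ^ r \<odot> d)" using dc by (simp add: ji power_add)
      also have "\<dots> = (pp ^ i * b) \<odot> x \<oplus> pp ^ i \<odot> w"
        unfolding bw(3) using x bw(1) sm_carrier[OF sY' bw(2)] by (simp add: smult_r_distr)
      also have "ht \<dots> \<le> ht ((pp ^ i * b) \<odot> x)"
        by (rule dset_split(1)[OF dY Y'(1) x(1) Y'(3)]) (use bw sm_smult[OF sY'] in auto)
      also have "\<dots> \<le> ht (q \<odot> ((pp ^ i * b) \<odot> x))" using q x bw by (intro ht_smult) auto
      also have "q \<odot> ((pp ^ i * b) \<odot> x) = (pp ^ i * (b * q)) \<odot> x" using q(1) x bw(1) by (simp add: ac_simps)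
      also have "\<dots> = pp ^ (i + r + m) \<odot> (pp ^ k \<odot> x)" unfolding q(2)[symmetric] using x by (simp add: power_add ac_simps)
      also have "ht \<dots> = u (j + m)" unfolding k[symmetric] ulm_seq_def by (simp add: ji)
      finally show ?thesis using j(2) by simp
    next
      assume "\<exists>q\<in>Zp. b = pp ^ (r + m + k) * pp * q"
      then obtain q where q: "q \<in> Zp" "b = pp ^ (r + m + k) * (pp * q)" by (auto simp: mult.assoc)
      show ?thesis by (rule KI[OF dc q(1) bw(2)]) (use bw(3) q(2) in simp)
    qed
  qed
  then have "span D \<subseteq> K" by (rule span_least[OF smK])
  then have "pp ^ m \<odot> (pp ^ k \<odot> x \<oplus> s) \<in> K" using D lincomb_in_span by auto
  then obtain r b w where b: "b \<in> Zp" "w \<in> span Y'"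
    "pp ^ r \<odot> (pp ^ m \<odot> (pp ^ k \<odot> x \<oplus> s)) = (pp ^ (r + m + k) * (pp * b)) \<odot> x \<oplus> w"
    unfolding K_def by blast
  note wc = sm_carrier[OF sY' b(2)]
  \<comment> \<open>The x-coordinate of the element multiplied by \<open>pp ^ (r + m)\<close> is f
    by direct computation, and f times \<open>pp * b\<close> by membership in K. Their difference
    f(1 - pb) is not zero.\<close>
  define f where "f = pp ^ (r + m + k)"
  have f: "f \<in> Zp" "f \<noteq> 0" by (simp_all add: f_def)
  have "pp ^ r \<odot> (pp ^ m \<odot> (pp ^ k \<odot> x \<oplus> s)) = f \<odot> x \<oplus> pp ^ (r + m) \<odot> s"
    using x sc by (simp add: smult_r_distr power_add f_def ac_simps)
  then have e: "f \<odot> x \<oplus> pp ^ (r + m) \<odot> s = (f * (pp * b)) \<odot> x \<oplus> w" using b(3) by (simp add: f_def)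
  have "(f - f * (pp * b)) \<odot> x \<oplus> (pp ^ (r + m) \<odot> s \<ominus> w)
      = (f \<odot> x \<oplus> pp ^ (r + m) \<odot> s) \<ominus> ((f * (pp * b)) \<odot> x \<oplus> w)"
    using x(2) sc wc f(1) b(1) by algebra
  also have "\<dots> = \<zero>" unfolding e using x(2) wc f(1) b(1) by (simp add: minus_eq_zero_iff)
  finally have 0: "(f - f * (pp * b)) \<odot> x \<oplus> (pp ^ (r + m) \<odot> s \<ominus> w) = \<zero>" .
  have w': "pp ^ (r + m) \<odot> s \<ominus> w \<in> span Y'" by (intro sm_diff[OF sY'] sm_smult[OF sY'] sY b(2)) simp
  have "f - f * (pp * b) = 0"
    by (rule dset_split(3)[OF dY Y'(1) x(1) Y'(3) w' _ 0]) (use f(1) b(1) in simp)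
  then have "f * (1 - pp * b) = 0" by (simp add: algebra_simps)
  then show False using f(2) one_minus_unit(2)[OF b(1)] by simp
qed

text \<open>Scaling the members of A to a common Ulm sequence u gives the required tuple. A
  combination of the other scaled members avoids x, so \<open>not_negligible\<close>
  applies.\<close>

lemma pdb_ulm_rank:
  assumes C: "pdb C" and X: "X \<in> C" and A: "A \<subseteq> X" "\<And>x. x \<in> A \<Longrightarrow> ulm x \<in> e" and e: "e \<in> UNIV // ulm_equiv"
  shows "\<exists>u\<in>e. ulm_rank (card A) u"
proof -
  have dX: "dset X" by (rule pdb_dset[OF C X])
  have Ac: "finite A" "A \<subseteq> carrier G" using dset_carrier[OF dX] dX A(1) finite_subset by auto
  obtain u k where u: "u \<in> e" "\<And>x. x \<in> A \<Longrightarrow> ulm (pp ^ k x \<odot> x) = u"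
    using ulm_common_tail[OF e Ac A(2)] by blast
  define f where "f x = pp ^ k x \<odot> x" for x
  have inj: "inj_on f A" unfolding f_def by (rule dset_multiples(2)[OF dX A(1)]) simp
  have "card (f ` A) = card A" by (rule card_image[OF inj])
  moreover have "f ` A \<subseteq> dominates u"
  proof
    fix z assume "z \<in> f ` A"
    then obtain x where x: "x \<in> A" "z = f x" by blast
    have "u j \<le> ht (pp ^ j \<odot> z)" for j
      using u(2)[OF x(1)] unfolding x(2) f_def[symmetric] ulm_seq_def by (auto simp: fun_eq_iff)
    then show "z \<in> dominates u" using x Ac by (auto simp: dominates_def f_def)
  qed
  moreover have "z \<oplus> s \<notin> neglig u" if z: "z \<in> f ` A" and s: "s \<in> span (f ` A - {z})" for z s
  proof -
    obtain x where x: "x \<in> A" "z = f x" using z by blast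
    have Xx: "X - {x} \<subseteq> carrier G" using dset_carrier[OF dX] by auto
    have "f ` A - {z} \<subseteq> span (X - {x})"
    proof
      fix y assume "y \<in> f ` A - {z}"
      then obtain x' where x': "x' \<in> A" "y = f x'" "x' \<noteq> x" using x by blast
      then have "x' \<in> span (X - {x})" using A(1) by (intro span_base[OF Xx]) auto
      then show "y \<in> span (X - {x})" unfolding x'(2) f_def by (intro sm_smult[OF sm_span[OF Xx]]) auto
    qed
    then have "s \<in> span (X - {x})" using s span_least[OF sm_span[OF Xx]] by blast
    then show ?thesis unfolding x(2) f_def using not_negligible[OF C X _ u(2)[OF x(1)]] x(1) A(1) by blast
  qed
  ultimately have "ulm_rank (card A) u"
    unfolding ulm_rank_def using Ac(1) by (intro exI[of _ "f ` A"]) auto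
  then show ?thesis using u(1) by blast
qed

text \<open>If the enlarged basis member Y had fewer than n elements of the class, a primitive
  relation would kill all coordinates in these and yield a combination v with coefficient one at
  some z0. The remaining coordinates lie outside the class and dominate u, hence exceed it
  infinitely often; so v is negligible, against the choice of Z. Retaining Y0 inside Y is what later
  makes a new partner available.\<close>

lemma ulm_rank_pdb:
  assumes C: "pdb C" and Y0: "Y0 \<in> C" and r: "ulm_rank n u" and e: "e \<in> UNIV // ulm_equiv" "u \<in> e"
  shows "\<exists>Y\<in>C. Y0 \<subseteq> Y \<and> n \<le> card {x \<in> Y. ulm x \<in> e}"
proof -
  obtain Z where Z: "finite Z" "card Z = n" "Z \<subseteq> dominates u"
    and indep: "\<And>z s. z \<in> Z \<Longrightarrow> s \<in> span (Z - {z}) \<Longrightarrow> z \<oplus> s \<notin> neglig u"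
    using r unfolding ulm_rank_def by blast
  have Zc: "Z \<subseteq> carrier G" using Z(3) by (auto simp: dominates_def)
  obtain Y where Y: "Y \<in> C" "Y0 \<subseteq> Y" "Z \<subseteq> hl (span Y)" using pdb_extend[OF C Z(1) Zc Y0] by blast
  have dY: "dset Y" by (rule pdb_dset[OF C Y(1)])
  have Yc: "Y \<subseteq> carrier G" and Yf: "finite Y" using dset_carrier[OF dY] dY by auto
  note sY = sm_span[OF Yc]
  define E where "E = {x \<in> Y. ulm x \<in> e}"
  have Ef: "finite E" "E \<subseteq> Y" using Yf by (auto simp: E_def)
  have "n \<le> card E"
  proof (rule ccontr)
    assume "\<not> n \<le> card E"
    then have less: "card E < card Z" using Z(2) by simp
    obtain r where r: "\<And>z. z \<in> Z \<Longrightarrow> pp ^ r \<odot> z \<in> span Y" using common_exponent[OF Z(1) Y(3) sY] by blast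
    have "\<exists>a. a \<in> Y \<rightarrow> Zp \<and> lincomb a Y = pp ^ r \<odot> z" if "z \<in> Z" for z
      using finite_in_span[OF Yf Yc r[OF that]] by blast
    then obtain a where a: "\<And>z. z \<in> Z \<Longrightarrow> a z \<in> Y \<rightarrow> Zp" "\<And>z. z \<in> Z \<Longrightarrow> lincomb (a z) Y = pp ^ r \<odot> z" by metis
    have aZ: "a z x \<in> Zp" if "z \<in> Z" "x \<in> Y" for z x using a(1)[OF that(1)] that(2) by (rule Pi_mem)
    obtain c z0 where c: "\<forall>z\<in>Z. c z \<in> Zp" "z0 \<in> Z" "c z0 = 1" "\<forall>x\<in>E. (\<Sum>z\<in>Z. c z * a z x) = 0"
      using primitive_relation[OF Ef(1) Z(1) less, of a] aZ Ef(2) by blast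
    have cP: "c \<in> Z \<rightarrow> Zp" using c(1) by auto
    \<comment> \<open>The coordinate at x of \<open>pp ^ r\<close> times the combination of Z' with
      coefficients c; the factor \<open>pp ^ r\<close> moves all of Z into
      \<open>span Y\<close>.\<close>
    define \<beta> where "\<beta> Z' x = (\<Sum>z\<in>Z'. c z * a z x)" for Z' x
    have \<beta>lin: "lincomb (\<beta> Z') Y = pp ^ r \<odot> lincomb c Z' \<and> \<beta> Z' \<in> Y \<rightarrow> Zp" if "Z' \<subseteq> Z" for Z'
      using finite_subset[OF that Z(1)] that
    proof (induction Z')
      case empty
      have "lincomb (\<beta> {}) Y = \<zero>" unfolding lincomb_def using Yc
        by (intro M.add.finprod_one_eqI) (auto simp: \<beta>_def)
      then show ?case by (auto simp: lincomb_def \<beta>_def)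
    next
      case (insert z Z')
      then have z: "z \<in> Z" "z \<in> carrier G" "c z \<in> Zp" and Z': "Z' \<subseteq> Z" "Z' \<subseteq> carrier G" "c \<in> Z' \<rightarrow> Zp"
        using Zc c(1) by auto
      have b: "\<beta> (insert z Z') = (\<lambda>x. c z * a z x + \<beta> Z' x)" using insert.hyps by (auto simp: \<beta>_def)
      have IH: "lincomb (\<beta> Z') Y = pp ^ r \<odot> lincomb c Z'" "\<beta> Z' \<in> Y \<rightarrow> Zp" using insert.IH[OF Z'(1)] by auto
      have ca: "(\<lambda>x. c z * a z x) \<in> Y \<rightarrow> Zp" using z aZ by auto
      have lc: "lincomb c Z' \<in> carrier G" using Z' by simp
      have "lincomb (\<beta> (insert z Z')) Y = lincomb (\<lambda>x. c z * a z x) Y \<oplus> lincomb (\<beta> Z') Y"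
        unfolding b by (rule lincomb_add[OF Yf Yc ca IH(2)])
      also have "lincomb (\<lambda>x. c z * a z x) Y = c z \<odot> (pp ^ r \<odot> z)"
        using lincomb_scale[OF Yc a(1)[OF z(1)] z(3)] a(2)[OF z(1)] by simp
      also have "c z \<odot> (pp ^ r \<odot> z) \<oplus> lincomb (\<beta> Z') Y = pp ^ r \<odot> (c z \<odot> z \<oplus> lincomb c Z')"
        unfolding IH(1) using z lc by (simp add: smult_r_distr mult.commute)
      also have "c z \<odot> z \<oplus> lincomb c Z' = lincomb c (insert z Z')"
        using lincomb_insert_upd[OF insert.hyps(1) Z'(2) z(2) insert.hyps(2) Z'(3) z(3)] by simp
      finally show ?case using ca IH(2) unfolding b by (auto simp: Pi_iff)
    qed
    define v where "v = lincomb c Z"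
    have vc: "v \<in> carrier G" unfolding v_def using Zc cP by simp
    have b: "lincomb (\<beta> Z) Y = pp ^ r \<odot> v" "\<beta> Z \<in> Y \<rightarrow> Zp" using \<beta>lin[OF order_refl] by (auto simp: v_def)
    have bE: "\<beta> Z x = 0" if "x \<in> E" for x using c(4) that by (simp add: \<beta>_def)
    have dom: "\<exists>J. \<forall>j\<ge>J. u (j + r) \<le> ht (pp ^ (j + r) \<odot> v)"
    proof -
      have "\<exists>M. \<forall>z\<in>Z'. \<forall>j\<ge>M. u j \<le> ht (pp ^ j \<odot> z)" if "finite Z'" "Z' \<subseteq> Z" for Z'
        using that
      proof (induction Z')
        case (insert z Z')
        then obtain M where M: "\<forall>z\<in>Z'. \<forall>j\<ge>M. u j \<le> ht (pp ^ j \<odot> z)" by auto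
        obtain m where "\<forall>j\<ge>m. u j \<le> ht (pp ^ j \<odot> z)" using insert.prems Z(3) by (auto simp: dominates_def)
        then show ?case using M by (intro exI[of _ "max M m"]) auto
      qed simp
      then obtain M where M: "\<forall>z\<in>Z. \<forall>j\<ge>M. u j \<le> ht (pp ^ j \<odot> z)" using Z(1) by blast
      have "u (j + r) \<le> ht (pp ^ (j + r) \<odot> v)" if "j \<ge> M" for j
      proof -
        have "u (j + r) \<le> ht (lincomb (\<lambda>z. pp ^ (j + r) * c z) Z)"
        proof (rule ht_lincomb_ge[OF Z(1) Zc])
          fix z assume z: "z \<in> Z"
          have "u (j + r) \<le> ht (pp ^ (j + r) \<odot> z)" using M z that by simp
          also have "\<dots> \<le> ht (c z \<odot> (pp ^ (j + r) \<odot> z))" using c(1) z Zc by (intro ht_smult) auto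
          also have "c z \<odot> (pp ^ (j + r) \<odot> z) = (pp ^ (j + r) * c z) \<odot> z" using c(1) z Zc by (simp add: mult.commute subset_iff)
          finally show "u (j + r) \<le> ht ((pp ^ (j + r) * c z) \<odot> z)" .
        qed (use c(1) in auto)
        then show ?thesis unfolding v_def using lincomb_scale[OF Zc cP, of "pp ^ (j + r)"] by simp
      qed
      then show ?thesis by blast
    qed
    have "lincomb (\<beta> Z) Y \<in> span (exceeds u r)"
    proof -
      note sN = sm_span[OF exceeds_carrier[of u r]]
      have each: "\<beta> Z x \<odot> x \<in> span (exceeds u r)" if x: "x \<in> Y" for x
      proof (cases "\<beta> Z x = 0")
        case True
        then show ?thesis using x Yc sm_zero[OF sN] by auto
      next
        case False
        have xc: "x \<in> carrier G" and bx: "\<beta> Z x \<in> Zp" using x Yc b(2) by auto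
        obtain s q where q: "\<beta> Z x = pp ^ s * q" "q \<in> Zp" "inverse q \<in> Zp" "q \<noteq> 0"
          using Zp_decompose[OF bx False] by blast
        have htq: "ht (pp ^ j \<odot> (\<beta> Z x \<odot> x)) = ht (pp ^ (j + s) \<odot> x)" for j
        proof -
          have "pp ^ j \<odot> (\<beta> Z x \<odot> x) = (pp ^ (j + s) * q) \<odot> x" using bx xc q(2) by (simp add: q(1) power_add mult.assoc)
          then show ?thesis using ht_mult_unit(1)[OF xc q(2-4), of "pp ^ (j + s)"] by simp
        qed
        \<comment> \<open>Each coordinate of v is eventually at least the shifted u, by
          \<open>dom\<close>. If it were not infinitely often strictly above, it would finally agree
          with u, and x would belong to E, where the coordinates vanish.\<close>
        have "\<beta> Z x \<odot> x \<in> exceeds u r"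
        proof (rule ccontr)
          assume "\<beta> Z x \<odot> x \<notin> exceeds u r"
          then obtain i where i: "\<And>j. j \<ge> i \<Longrightarrow> ht (pp ^ j \<odot> (\<beta> Z x \<odot> x)) \<le> u (j + r)"
            using xc bx unfolding exceeds_def by (auto simp: not_less)
          obtain J where J: "\<And>j. j \<ge> J \<Longrightarrow> u (j + r) \<le> ht (pp ^ (j + r) \<odot> v)" using dom by blast
          have eq: "ulm x (j + s) = u (j + r)" if j: "j \<ge> max i J" for j
          proof (rule antisym)
            show "ulm x (j + s) \<le> u (j + r)" using i[of j] j htq[of j] by (simp add: ulm_seq_def)
            have "u (j + r) \<le> ht (pp ^ (j + r) \<odot> v)" using J j by simp
            also have "pp ^ (j + r) \<odot> v = pp ^ j \<odot> lincomb (\<beta> Z) Y" unfolding b(1) using vc by (simp add: power_add)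
            also have "\<dots> = lincomb (\<lambda>x. pp ^ j * \<beta> Z x) Y" using lincomb_scale[OF Yc b(2), of "pp ^ j"] by simp
            also have "ht \<dots> \<le> ht ((pp ^ j * \<beta> Z x) \<odot> x)"
              by (rule dset_lincomb_le[OF dY _ x]) (use b(2) in \<open>auto simp: Pi_iff\<close>)
            also have "\<dots> = ulm x (j + s)" using htq[of j] bx xc by (simp add: ulm_seq_def)
            finally show "u (j + r) \<le> ulm x (j + s)" .
          qed
          have "(u, ulm x) \<in> ulm_equiv"
          proof (rule ulm_equivI)
            fix i' show "u (i' + (max i J + r)) = ulm x (i' + (max i J + s))"
              using eq[of "i' + max i J"] by (simp add: ac_simps)
          qed
          then have "x \<in> E" using x ulm_class_iff[OF e] by (simp add: E_def)
          then show False using bE False by simp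
        qed
        then show ?thesis by (rule span_base[OF exceeds_carrier])
      qed
      have "lincomb (\<beta> Z) Y' \<in> span (exceeds u r)" if "Y' \<subseteq> Y" for Y'
        using finite_subset[OF that Yf] that
      proof (induction Y')
        case empty
        then show ?case using sm_zero[OF sN] by (simp add: lincomb_def)
      next
        case (insert x Y')
        then have *: "x \<in> Y" "x \<in> carrier G" "Y' \<subseteq> Y" "Y' \<subseteq> carrier G" "\<beta> Z \<in> Y' \<rightarrow> Zp" "\<beta> Z x \<in> Zp" using Yc b(2) by auto
        have "lincomb (\<beta> Z) (insert x Y') = \<beta> Z x \<odot> x \<oplus> lincomb (\<beta> Z) Y'"
          using lincomb_insert_upd[OF insert.hyps(1) *(4,2) insert.hyps(2) *(5,6)] by simp
        then show ?case using sm_add[OF sN each[OF *(1)] insert.IH[OF *(3)]] by simp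
      qed
      then show ?thesis by blast
    qed
    then have "v \<in> neglig u" unfolding neglig_def using vc b(1) by auto
    moreover have "v = z0 \<oplus> lincomb c (Z - {z0})"
      unfolding v_def using lincomb_del2[OF Z(1) Zc cP c(2)] c(2,3) Zc by auto
    moreover have "lincomb c (Z - {z0}) \<in> span (Z - {z0})"
      using Z(1) cP by (intro lincomb_in_span) auto
    ultimately show False using indep[OF c(2)] by simp
  qed
  then show ?thesis using Y unfolding E_def by blast
qed

end


section \<open>Invariance under partial isomorphisms\<close>

definition graph :: "('a \<rightharpoonup> 'b) \<Rightarrow> ('a \<times> 'b) set" where
  "graph f = {(x, y). f x = Some y}"

definition map_of_graph :: "('a \<times> 'b) set \<Rightarrow> ('a \<rightharpoonup> 'b)" where
  "map_of_graph \<Phi> x = (if x \<in> Domain \<Phi> then Some (SOME y. (x, y) \<in> \<Phi>) else None)"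

lemma graph_iff: "(x, y) \<in> graph f \<longleftrightarrow> f x = Some y"
  by (simp add: graph_def)

lemma Domain_graph: "Domain (graph f) = dom f" and Range_graph: "Range (graph f) = ran f"
  by (auto simp: graph_def ran_def)

lemma graph_map_of_graph:
  assumes "\<And>x y y'. (x, y) \<in> \<Phi> \<Longrightarrow> (x, y') \<in> \<Phi> \<Longrightarrow> y = y'"
  shows "graph (map_of_graph \<Phi>) = \<Phi>"
proof -
  have "map_of_graph \<Phi> x = Some y \<longleftrightarrow> (x, y) \<in> \<Phi>" for x y
  proof
    assume "map_of_graph \<Phi> x = Some y"
    then have "x \<in> Domain \<Phi>" "y = (SOME y. (x, y) \<in> \<Phi>)" by (auto simp: map_of_graph_def split: if_splits)
    then show "(x, y) \<in> \<Phi>" by (metis DomainE someI)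
  next
    assume xy: "(x, y) \<in> \<Phi>"
    then have "(x, SOME y. (x, y) \<in> \<Phi>) \<in> \<Phi>" by (rule someI)
    then have "(SOME y. (x, y) \<in> \<Phi>) = y" by (rule assms[OF _ xy])
    then show "map_of_graph \<Phi> x = Some y" using xy by (auto simp: map_of_graph_def)
  qed
  then show ?thesis by (auto simp: graph_def)
qed

lemma map_le_graph: "f \<subseteq>\<^sub>m g \<longleftrightarrow> graph f \<subseteq> graph g"
  unfolding map_le_def graph_def by (auto simp: dom_def)

text \<open>Heights are left out because partial isomorphisms are only assumed to be algebraic;
  their preservation is derived in \<open>bfI_alg\<close>.\<close>

definition alg_iso :: "nat \<Rightarrow> (rat, 'a) module \<Rightarrow> (rat, 'b) module \<Rightarrow> ('a \<times> 'b) set \<Rightarrow> bool" where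
  "alg_iso p G H \<Phi> \<longleftrightarrow>
     \<Phi> \<subseteq> carrier G \<times> carrier H \<and> (\<zero>\<^bsub>G\<^esub>, \<zero>\<^bsub>H\<^esub>) \<in> \<Phi> \<and>
     (\<forall>s t s' t'. (s, t) \<in> \<Phi> \<longrightarrow> (s', t') \<in> \<Phi> \<longrightarrow> (s \<oplus>\<^bsub>G\<^esub> s', t \<oplus>\<^bsub>H\<^esub> t') \<in> \<Phi>) \<and>
     (\<forall>r s t. r \<in> carrier (Z_loc p) \<longrightarrow> (s, t) \<in> \<Phi> \<longrightarrow> (r \<odot>\<^bsub>G\<^esub> s, r \<odot>\<^bsub>H\<^esub> t) \<in> \<Phi>) \<and>
     (\<forall>s t. (s, t) \<in> \<Phi> \<longrightarrow> (s = \<zero>\<^bsub>G\<^esub> \<longleftrightarrow> t = \<zero>\<^bsub>H\<^esub>))"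

lemma height_iso_alg:
  fixes T :: "'k::wellorder itself"
  shows "height_iso p G H T \<Phi> \<longleftrightarrow> alg_iso p G H \<Phi> \<and> (\<forall>s t. (s, t) \<in> \<Phi> \<longrightarrow> (height p G s :: 'k height) = height p H t)"
  unfolding height_iso_def alg_iso_def by (simp only: conj_assoc)

lemma alg_isoD:
  assumes "alg_iso p G H \<Phi>"
  shows "\<Phi> \<subseteq> carrier G \<times> carrier H" and "(\<zero>\<^bsub>G\<^esub>, \<zero>\<^bsub>H\<^esub>) \<in> \<Phi>"
    and "\<forall>s t s' t'. (s, t) \<in> \<Phi> \<longrightarrow> (s', t') \<in> \<Phi> \<longrightarrow> (s \<oplus>\<^bsub>G\<^esub> s', t \<oplus>\<^bsub>H\<^esub> t') \<in> \<Phi>"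
    and "\<forall>r s t. r \<in> carrier (Z_loc p) \<longrightarrow> (s, t) \<in> \<Phi> \<longrightarrow> (r \<odot>\<^bsub>G\<^esub> s, r \<odot>\<^bsub>H\<^esub> t) \<in> \<Phi>"
    and "\<forall>s t. (s, t) \<in> \<Phi> \<longrightarrow> (s = \<zero>\<^bsub>G\<^esub> \<longleftrightarrow> t = \<zero>\<^bsub>H\<^esub>)"
proof -
  note D = assms[unfolded alg_iso_def]
  note D2 = D[THEN conjunct2]
  note D3 = D2[THEN conjunct2]
  note D4 = D3[THEN conjunct2]
  show "\<Phi> \<subseteq> carrier G \<times> carrier H" by (rule D[THEN conjunct1])
  show "(\<zero>\<^bsub>G\<^esub>, \<zero>\<^bsub>H\<^esub>) \<in> \<Phi>" by (rule D2[THEN conjunct1])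
  show "\<forall>s t s' t'. (s, t) \<in> \<Phi> \<longrightarrow> (s', t') \<in> \<Phi> \<longrightarrow> (s \<oplus>\<^bsub>G\<^esub> s', t \<oplus>\<^bsub>H\<^esub> t') \<in> \<Phi>" by (rule D3[THEN conjunct1])
  show "\<forall>r s t. r \<in> carrier (Z_loc p) \<longrightarrow> (s, t) \<in> \<Phi> \<longrightarrow> (r \<odot>\<^bsub>G\<^esub> s, r \<odot>\<^bsub>H\<^esub> t) \<in> \<Phi>" by (rule D4[THEN conjunct1])
  show "\<forall>s t. (s, t) \<in> \<Phi> \<longrightarrow> (s = \<zero>\<^bsub>G\<^esub> \<longleftrightarrow> t = \<zero>\<^bsub>H\<^esub>)" by (rule D4[THEN conjunct2])
qed

lemma alg_iso_converse:
  assumes "alg_iso p G H \<Phi>" shows "alg_iso p H G (\<Phi>\<inverse>)"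
  unfolding alg_iso_def converse_iff
proof (intro conjI allI impI)
  note D = alg_isoD[OF assms]
  show "\<Phi>\<inverse> \<subseteq> carrier H \<times> carrier G" using D(1) by auto
  show "(\<zero>\<^bsub>G\<^esub>, \<zero>\<^bsub>H\<^esub>) \<in> \<Phi>" by (rule D(2))
  fix s t assume st: "(t, s) \<in> \<Phi>"
  show "(t \<oplus>\<^bsub>G\<^esub> t', s \<oplus>\<^bsub>H\<^esub> s') \<in> \<Phi>" if "(t', s') \<in> \<Phi>" for s' t' using D(3) st that by simp
  show "(r \<odot>\<^bsub>G\<^esub> t, r \<odot>\<^bsub>H\<^esub> s) \<in> \<Phi>" if "r \<in> carrier (Z_loc p)" for r using D(4) st that by simp
  show "(s = \<zero>\<^bsub>H\<^esub>) = (t = \<zero>\<^bsub>G\<^esub>)" using D(5) st by simp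
qed

section \<open>Heights and finite tuples in back-and-forth systems\<close>

context zpair
begin

lemma submodule_iso_alg:
  assumes f: "submodule_iso p G H f"
  shows "alg_iso p G H (graph f)"
proof -
  have smd: "G.sm (dom f)" and smr: "H.sm (ran f)" and inj: "inj_on f (dom f)"
    and hom: "(\<lambda>x. the (f x)) \<in> LinearCombinations.module_hom (Z_loc p) (G\<lparr>carrier := dom f\<rparr>) (H\<lparr>carrier := ran f\<rparr>)"
    using f unfolding submodule_iso_def by blast+
  have add: "the (f (x \<oplus> y)) = the (f x) \<oplus>\<^bsub>H\<^esub> the (f y)" if "x \<in> dom f" "y \<in> dom f" for x y
    using LinearCombinations.module_hom_add[OF hom, of x y] that by simp
  have smult: "the (f (r \<odot> x)) = r \<odot>\<^bsub>H\<^esub> the (f x)" if "x \<in> dom f" "r \<in> Zp" for x r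
    using LinearCombinations.module_hom_smult[OF hom that(2), of x] that by simp
  have some: "f x = Some (the (f x))" if "x \<in> dom f" for x using that by auto
  have ranc: "t \<in> carrier H" if "f s = Some t" for s t
    using H.sm_carrier[OF smr ranI[of f s t]] that by blast
  have z: "\<zero> \<in> dom f" by (rule G.sm_zero[OF smd])
  have "the (f (0 \<odot> \<zero>)) = 0 \<odot>\<^bsub>H\<^esub> the (f \<zero>)" by (rule smult[OF z]) simp
  then have f0: "f \<zero> = Some \<zero>\<^bsub>H\<^esub>" using some[OF z] ranc[OF some[OF z]] by simp
  show ?thesis
    unfolding alg_iso_def graph_iff
  proof (intro conjI allI impI)
    show "graph f \<subseteq> carrier G \<times> carrier H"
      using G.sm_carrier[OF smd domI] ranc by (auto simp: graph_iff)
    show "f \<zero> = Some \<zero>\<^bsub>H\<^esub>" by (rule f0)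
    fix s t assume st: "f s = Some t"
    then have sd: "s \<in> dom f" by blast
    show "f (s \<oplus> s') = Some (t \<oplus>\<^bsub>H\<^esub> t')" if "f s' = Some t'" for s' t'
    proof -
      have sd': "s' \<in> dom f" using that by blast
      show ?thesis using add[OF sd sd'] some[OF G.sm_add[OF smd sd sd']] st that by simp
    qed
    show "f (r \<odot> s) = Some (r \<odot>\<^bsub>H\<^esub> t)" if "r \<in> Zp" for r
      using smult[OF sd that] some[OF G.sm_smult[OF smd that sd]] st by simp
    show "(s = \<zero>) = (t = \<zero>\<^bsub>H\<^esub>)"
    proof
      assume "s = \<zero>" then show "t = \<zero>\<^bsub>H\<^esub>" using f0 st by simp
    next
      assume "t = \<zero>\<^bsub>H\<^esub>"
      then have "f s = f \<zero>" using f0 st by simp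
      then show "s = \<zero>" by (rule inj_onD[OF inj _ sd z])
    qed
  qed
qed

lemma submodule_iso_iso:
  assumes \<Phi>: "iso (graph f)" shows "submodule_iso p G H f"
  unfolding submodule_iso_def
proof (intro conjI)
  show "G.sm (dom f)" using sm_Domain[OF \<Phi>] by (simp add: Domain_graph)
  show "H.sm (ran f)" using sm_Range[OF \<Phi>] by (simp add: Range_graph)
  have g: "(x, the (f x)) \<in> graph f" if "x \<in> dom f" for x using that by (auto simp: graph_iff)
  show "inj_on f (dom f)"
  proof (rule inj_onI)
    fix x y assume xy: "x \<in> dom f" "y \<in> dom f" "f x = f y"
    show "x = y" using iso_inj[OF \<Phi> g[OF xy(1)]] g[OF xy(2)] xy(3) by simp
  qed
  show "(\<lambda>x. the (f x)) \<in> LinearCombinations.module_hom (Z_loc p) (G\<lparr>carrier := dom f\<rparr>) (H\<lparr>carrier := ran f\<rparr>)"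
    unfolding LinearCombinations.module_hom_def
  proof (intro CollectI conjI allI impI)
    show "(\<lambda>x. the (f x)) \<in> carrier (G\<lparr>carrier := dom f\<rparr>) \<rightarrow> carrier (H\<lparr>carrier := ran f\<rparr>)"
      using ranI[of f] by force
    fix m1 m2 assume "m1 \<in> carrier (G\<lparr>carrier := dom f\<rparr>) \<and> m2 \<in> carrier (G\<lparr>carrier := dom f\<rparr>)"
    then have "(m1 \<oplus> m2, the (f m1) \<oplus>\<^bsub>H\<^esub> the (f m2)) \<in> graph f" by (intro iso_add[OF \<Phi>] g) auto
    then show "the (f (m1 \<oplus>\<^bsub>G\<lparr>carrier := dom f\<rparr>\<^esub> m2)) = the (f m1) \<oplus>\<^bsub>H\<lparr>carrier := ran f\<rparr>\<^esub> the (f m2)"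
      by (simp add: graph_iff)
  next
    fix r m assume "r \<in> Zp \<and> m \<in> carrier (G\<lparr>carrier := dom f\<rparr>)"
    then have "(r \<odot> m, r \<odot>\<^bsub>H\<^esub> the (f m)) \<in> graph f" by (intro iso_smult[OF \<Phi>] g) auto
    then show "the (f (r \<odot>\<^bsub>G\<lparr>carrier := dom f\<rparr>\<^esub> m)) = r \<odot>\<^bsub>H\<lparr>carrier := ran f\<rparr>\<^esub> the (f m)"
      by (simp add: graph_iff)
  qed
qed

lemma alg_iso_fun:
  assumes "alg_iso p G H \<Phi>" "(s, t) \<in> \<Phi>" "(s, t') \<in> \<Phi>" shows "t = t'"
proof -
  have A: "\<Phi> \<subseteq> carrier G \<times> carrier H"
    "\<And>s t s' t'. (s, t) \<in> \<Phi> \<Longrightarrow> (s', t') \<in> \<Phi> \<Longrightarrow> (s \<oplus> s', t \<oplus>\<^bsub>H\<^esub> t') \<in> \<Phi>"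
    "\<And>r s t. r \<in> Zp \<Longrightarrow> (s, t) \<in> \<Phi> \<Longrightarrow> (r \<odot> s, r \<odot>\<^bsub>H\<^esub> t) \<in> \<Phi>"
    "\<And>s t. (s, t) \<in> \<Phi> \<Longrightarrow> s = \<zero> \<longleftrightarrow> t = \<zero>\<^bsub>H\<^esub>"
    using alg_isoD[OF assms(1)] by simp_all
  have c: "s \<in> carrier G" "t \<in> carrier H" "t' \<in> carrier H" using A(1) assms(2,3) by auto
  have "(s \<oplus> (-1) \<odot> s, t \<oplus>\<^bsub>H\<^esub> (-1) \<odot>\<^bsub>H\<^esub> t') \<in> \<Phi>" by (intro A(2,3) assms(2,3)) simp
  moreover have "s \<oplus> (-1) \<odot> s = s \<ominus> s" "t \<oplus>\<^bsub>H\<^esub> (-1) \<odot>\<^bsub>H\<^esub> t' = t \<ominus>\<^bsub>H\<^esub> t'"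
    using c by (simp_all add: a_minus_def G.minus_smult[symmetric] H.minus_smult[symmetric])
  moreover have "s \<ominus> s = \<zero>" using c by (simp add: G.minus_eq_zero_iff)
  ultimately have "t \<ominus>\<^bsub>H\<^esub> t' = \<zero>\<^bsub>H\<^esub>" using A(4) by metis
  then show ?thesis using c H.minus_eq_zero_iff by simp
qed

text \<open>At a successor, s = p s' and the map extends to one defined at s'; single-valuedness
  makes t equal to p times the image of s'. Only the forth property is involved, so the other
  implication follows by exchanging G and H.\<close>

lemma forth_p_power:
  assumes J: "\<And>\<Phi>. \<Phi> \<in> J \<Longrightarrow> alg_iso p G H \<Phi>"
    and forth: "\<And>\<Phi> a. \<Phi> \<in> J \<Longrightarrow> a \<in> carrier G \<Longrightarrow> \<exists>\<Psi>\<in>J. \<Phi> \<subseteq> \<Psi> \<and> a \<in> Domain \<Psi>"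
  shows "\<Phi> \<in> J \<Longrightarrow> (s, t) \<in> \<Phi> \<Longrightarrow> s \<in> p_power p G (\<alpha> :: 'k) \<Longrightarrow> t \<in> p_power p H \<alpha>"
proof (induction \<alpha> arbitrary: \<Phi> s t rule: less_induct)
  case (less \<alpha>)
  have tc: "t \<in> carrier H" using alg_isoD(1)[OF J[OF less.prems(1)]] less.prems(2) by auto
  consider "\<And>\<gamma>. \<not> \<gamma> < \<alpha>" | \<gamma> where "is_pred \<gamma> \<alpha>" | \<gamma> where "\<gamma> < \<alpha>" "\<And>\<gamma>. \<not> is_pred \<gamma> \<alpha>"
    by blast
  then show ?case
  proof cases
    case 1
    then show ?thesis using tc by (simp add: p_power_zero)
  next
    case (2 \<gamma>)
    then have g: "\<gamma> < \<alpha>" by (simp add: is_pred_def)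
    obtain s' where s': "s' \<in> p_power p G \<gamma>" "s = pp \<odot> s'"
      using less.prems(3) unfolding p_power_Suc[OF 2] p_mult_def by blast
    have "s' \<in> carrier G" using G.sm_carrier[OF G.sm_p_power s'(1)] .
    then obtain \<Psi> t' where \<Psi>: "\<Psi> \<in> J" "\<Phi> \<subseteq> \<Psi>" "(s', t') \<in> \<Psi>" using forth[OF less.prems(1)] by blast
    have t': "t' \<in> p_power p H \<gamma>" by (rule less.IH[OF g \<Psi>(1,3) s'(1)])
    have "(pp \<odot> s', pp \<odot>\<^bsub>H\<^esub> t') \<in> \<Psi>" using alg_isoD(4)[OF J[OF \<Psi>(1)]] \<Psi>(3) by simp
    moreover have "(pp \<odot> s', t) \<in> \<Psi>" using less.prems(2) \<Psi>(2) s'(2) by auto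
    ultimately have "t = pp \<odot>\<^bsub>H\<^esub> t'" by (rule alg_iso_fun[OF J[OF \<Psi>(1)], symmetric])
    then show ?thesis using t' unfolding p_power_Suc[OF 2] p_mult_def by blast
  next
    case (3 \<gamma>)
    have "t \<in> p_power p H \<beta>" if "\<beta> < \<alpha>" for \<beta>
      using less.IH[OF that less.prems(1,2)] less.prems(3) that unfolding p_power_limit[OF 3] by simp
    then show ?thesis unfolding p_power_limit[OF 3] by simp
  qed
qed

definition bf :: "('a \<times> 'b) set set \<Rightarrow> bool" where
  "bf J \<longleftrightarrow> J \<noteq> {} \<and> (\<forall>\<Phi>\<in>J. iso \<Phi>) \<and> (\<forall>\<Phi>\<in>J. \<forall>a\<in>carrier G. \<exists>\<Psi>\<in>J. \<Phi> \<subseteq> \<Psi> \<and> a \<in> Domain \<Psi>) \<and>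
     (\<forall>\<Phi>\<in>J. \<forall>b\<in>carrier H. \<exists>\<Psi>\<in>J. \<Phi> \<subseteq> \<Psi> \<and> b \<in> Range \<Psi>)"

text \<open>By \<open>forth_p_power\<close> in both directions, partners lie in the same submodules
  of the descending chains, and these submodules determine heights.\<close>

lemma bfI_alg:
  assumes ne: "J \<noteq> {}" and J: "\<And>\<Phi>. \<Phi> \<in> J \<Longrightarrow> alg_iso p G H \<Phi>"
    and forth: "\<And>\<Phi> a. \<Phi> \<in> J \<Longrightarrow> a \<in> carrier G \<Longrightarrow> \<exists>\<Psi>\<in>J. \<Phi> \<subseteq> \<Psi> \<and> a \<in> Domain \<Psi>"
    and bwd: "\<And>\<Phi> b. \<Phi> \<in> J \<Longrightarrow> b \<in> carrier H \<Longrightarrow> \<exists>\<Psi>\<in>J. \<Phi> \<subseteq> \<Psi> \<and> b \<in> Range \<Psi>"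
  shows "bf J"
proof -
  interpret sw: zpair p H G T by (rule swap)
  have isoJ: "iso \<Phi>" if \<Phi>: "\<Phi> \<in> J" for \<Phi>
  proof -
    have h: "ht s = H.ht t" if st: "(s, t) \<in> \<Phi>" for s t
    proof -
      have c: "s \<in> carrier G" "t \<in> carrier H" using alg_isoD(1)[OF J[OF \<Phi>]] st by auto
      have "s \<in> p_power p G \<alpha> \<longleftrightarrow> t \<in> p_power p H \<alpha>" for \<alpha> :: 'k
      proof
        show "s \<in> p_power p G \<alpha> \<Longrightarrow> t \<in> p_power p H \<alpha>" by (rule forth_p_power[OF J forth \<Phi> st])
        show "t \<in> p_power p H \<alpha> \<Longrightarrow> s \<in> p_power p G \<alpha>"
        proof (rule sw.forth_p_power[of "converse ` J" "\<Phi>\<inverse>" t s \<alpha>])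
          show "alg_iso p H G \<Psi>" if m: "\<Psi> \<in> converse ` J" for \<Psi>
          proof -
            obtain \<Psi>0 where "\<Psi>0 \<in> J" "\<Psi> = \<Psi>0\<inverse>" using m by blast
            then show ?thesis using alg_iso_converse[OF J[of \<Psi>0]] by simp
          qed
          show "\<exists>\<Psi>'\<in>converse ` J. \<Psi> \<subseteq> \<Psi>' \<and> b \<in> Domain \<Psi>'" if \<Psi>: "\<Psi> \<in> converse ` J" and b: "b \<in> carrier H" for \<Psi> b
          proof -
            obtain \<Psi>0 where \<Psi>0: "\<Psi>0 \<in> J" "\<Psi> = \<Psi>0\<inverse>" using \<Psi> by blast
            obtain \<Psi>1 where "\<Psi>1 \<in> J" "\<Psi>0 \<subseteq> \<Psi>1" "b \<in> Range \<Psi>1" using bwd[OF \<Psi>0(1) b] by blast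
            then show ?thesis using \<Psi>0(2) by (intro bexI[of _ "\<Psi>1\<inverse>"]) auto
          qed
        qed (use \<Phi> st in auto)
      qed
      then have e: "s \<in> G.pw c \<longleftrightarrow> t \<in> H.pw c" for c
        by (cases c) (auto simp: G.pw_simps H.pw_simps p_power_inf_def)
      show ?thesis
      proof (rule antisym)
        show "ht s \<le> H.ht t"
          using e[of "ht s"] G.ht_ge_iff[OF c(1), of "ht s"] H.ht_ge_iff[OF c(2), of "ht s"] by simp
        show "H.ht t \<le> ht s"
          using e[of "H.ht t"] G.ht_ge_iff[OF c(1), of "H.ht t"] H.ht_ge_iff[OF c(2), of "H.ht t"] by simp
      qed
    qed
    then show ?thesis unfolding height_iso_alg using J[OF \<Phi>] by blast
  qed
  show ?thesis unfolding bf_def by (intro conjI ballI ne isoJ forth bwd)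
qed

lemma partial_isomorphism_bf:
  assumes I: "partial_isomorphism p G H I"
  shows "bf (graph ` I)"
proof (rule bfI_alg)
  note I' = I[unfolded partial_isomorphism_def]
  show "graph ` I \<noteq> {}" using I' by blast
  show "alg_iso p G H \<Phi>" if m: "\<Phi> \<in> graph ` I" for \<Phi>
  proof -
    obtain f where f: "f \<in> I" "\<Phi> = graph f" using m by blast
    have "submodule_iso p G H f" using I' f(1) by blast
    then show ?thesis unfolding f(2) by (rule submodule_iso_alg)
  qed
  fix \<Phi> assume "\<Phi> \<in> graph ` I"
  then obtain f where f: "f \<in> I" "\<Phi> = graph f" by blast
  show "\<exists>\<Psi>\<in>graph ` I. \<Phi> \<subseteq> \<Psi> \<and> a \<in> Domain \<Psi>" if a: "a \<in> carrier G" for a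
  proof -
    have "\<exists>g\<in>I. f \<subseteq>\<^sub>m g \<and> a \<in> dom g" using I' f(1) a by blast
    then show ?thesis unfolding f(2) by (auto simp: map_le_graph Domain_graph)
  qed
  show "\<exists>\<Psi>\<in>graph ` I. \<Phi> \<subseteq> \<Psi> \<and> b \<in> Range \<Psi>" if b: "b \<in> carrier H" for b
  proof -
    have "\<exists>g\<in>I. f \<subseteq>\<^sub>m g \<and> b \<in> ran g" using I' f(1) b by blast
    then show ?thesis unfolding f(2) by (auto simp: map_le_graph Range_graph)
  qed
qed

lemma bf_ne: "bf J \<Longrightarrow> J \<noteq> {}"
  and bf_iso: "bf J \<Longrightarrow> \<Phi> \<in> J \<Longrightarrow> iso \<Phi>"
  and bf_forth: "bf J \<Longrightarrow> \<Phi> \<in> J \<Longrightarrow> a \<in> carrier G \<Longrightarrow> \<exists>\<Psi>\<in>J. \<Phi> \<subseteq> \<Psi> \<and> a \<in> Domain \<Psi>"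
  and bf_back: "bf J \<Longrightarrow> \<Phi> \<in> J \<Longrightarrow> b \<in> carrier H \<Longrightarrow> \<exists>\<Psi>\<in>J. \<Phi> \<subseteq> \<Psi> \<and> b \<in> Range \<Psi>"
  by (simp_all add: bf_def)

lemma bf_converse:
  assumes "bf J" shows "zpair.bf p H G T (converse ` J)"
proof -
  interpret sw: zpair p H G T by (rule swap)
  note J = assms
  show ?thesis
    unfolding sw.bf_def
  proof (intro conjI ballI)
    show "converse ` J \<noteq> {}" using bf_ne[OF J] by simp
    fix \<Psi> assume "\<Psi> \<in> converse ` J"
    then obtain \<Phi> where \<Phi>: "\<Phi> \<in> J" "\<Psi> = \<Phi>\<inverse>" by blast
    show "sw.iso \<Psi>" unfolding \<Phi>(2) by (rule height_iso_converse[OF bf_iso[OF J \<Phi>(1)]])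
    show "\<exists>\<Psi>'\<in>converse ` J. \<Psi> \<subseteq> \<Psi>' \<and> a \<in> Domain \<Psi>'" if a: "a \<in> carrier H" for a
    proof -
      obtain \<Psi>1 where "\<Psi>1 \<in> J" "\<Phi> \<subseteq> \<Psi>1" "a \<in> Range \<Psi>1" using bf_back[OF J \<Phi>(1) a] by blast
      then show ?thesis using \<Phi>(2) by (intro bexI[of _ "\<Psi>1\<inverse>"]) auto
    qed
    show "\<exists>\<Psi>'\<in>converse ` J. \<Psi> \<subseteq> \<Psi>' \<and> b \<in> Range \<Psi>'" if b: "b \<in> carrier G" for b
    proof -
      obtain \<Psi>1 where "\<Psi>1 \<in> J" "\<Phi> \<subseteq> \<Psi>1" "b \<in> Domain \<Psi>1" using bf_forth[OF J \<Phi>(1) b] by blast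
      then show ?thesis using \<Phi>(2) by (intro bexI[of _ "\<Psi>1\<inverse>"]) auto
    qed
  qed
qed

lemma bf_finite_Domain:
  assumes J: "bf J" and A: "finite A" "A \<subseteq> carrier G" and \<Phi>: "\<Phi> \<in> J"
  shows "\<exists>\<Psi>\<in>J. \<Phi> \<subseteq> \<Psi> \<and> A \<subseteq> Domain \<Psi>"
  using A
proof (induction A)
  case empty then show ?case using \<Phi> by blast
next
  case (insert a A)
  then obtain \<Psi> where \<Psi>: "\<Psi> \<in> J" "\<Phi> \<subseteq> \<Psi>" "A \<subseteq> Domain \<Psi>" by auto
  have "\<exists>\<Psi>'\<in>J. \<Psi> \<subseteq> \<Psi>' \<and> a \<in> Domain \<Psi>'" using bf_forth[OF J \<Psi>(1)] insert.prems by simp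
  then obtain \<Psi>' where "\<Psi>' \<in> J" "\<Psi> \<subseteq> \<Psi>'" "a \<in> Domain \<Psi>'" by blast
  moreover have "Domain \<Psi> \<subseteq> Domain \<Psi>'" using \<open>\<Psi> \<subseteq> \<Psi>'\<close> by (rule Domain_mono)
  ultimately show ?case using \<Psi> by (intro bexI[of _ \<Psi>']) auto
qed

lemma bf_finite_Range:
  assumes J: "bf J" and B: "finite B" "B \<subseteq> carrier H" and \<Phi>: "\<Phi> \<in> J"
  shows "\<exists>\<Psi>\<in>J. \<Phi> \<subseteq> \<Psi> \<and> B \<subseteq> Range \<Psi>"
proof -
  interpret sw: zpair p H G T by (rule swap)
  have "\<Phi>\<inverse> \<in> converse ` J" using \<Phi> by (rule imageI)
  from sw.bf_finite_Domain[OF bf_converse[OF J] B this]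
  obtain \<Psi> where \<Psi>: "\<Psi> \<in> J" "\<Phi>\<inverse> \<subseteq> \<Psi>\<inverse>" "B \<subseteq> Domain (\<Psi>\<inverse>)" by blast
  then show ?thesis by (intro bexI[of _ \<Psi>]) auto
qed

text \<open>The elements of H with a partner in \<open>span A\<close> form a submodule, so partners
  of the generators suffice and no coefficients need to be transported.\<close>

lemma span_back:
  assumes \<Phi>: "iso \<Phi>" and A: "A \<subseteq> carrier G" and A': "\<And>a'. a' \<in> A' \<Longrightarrow> \<exists>a\<in>A. (a, a') \<in> \<Phi>" and s': "s' \<in> H.span A'"
  shows "\<exists>s\<in>G.span A. (s, s') \<in> \<Phi>"
proof -
  define N where "N = {t. \<exists>s\<in>G.span A. (s, t) \<in> \<Phi>}"
  note sA = G.sm_span[OF A]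
  have NI: "t \<in> N" if "s \<in> G.span A" "(s, t) \<in> \<Phi>" for s t using that unfolding N_def by blast
  have "H.sm N"
  proof (rule H.smI)
    show "N \<subseteq> carrier H" using iso_carrier[OF \<Phi>] by (auto simp: N_def)
    show "\<zero>\<^bsub>H\<^esub> \<in> N" by (rule NI[OF G.sm_zero[OF sA] iso_zero[OF \<Phi>]])
    fix x assume "x \<in> N"
    then obtain s where s: "s \<in> G.span A" "(s, x) \<in> \<Phi>" unfolding N_def by blast
    show "r \<odot>\<^bsub>H\<^esub> x \<in> N" if "r \<in> Zp" for r by (rule NI[OF G.sm_smult[OF sA that s(1)] iso_smult[OF \<Phi> that s(2)]])
    fix y assume "y \<in> N"
    then obtain t where t: "t \<in> G.span A" "(t, y) \<in> \<Phi>" unfolding N_def by blast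
    show "x \<oplus>\<^bsub>H\<^esub> y \<in> N" by (rule NI[OF G.sm_add[OF sA s(1) t(1)] iso_add[OF \<Phi> s(2) t(2)]])
  qed
  moreover have "A' \<subseteq> N"
  proof
    fix a' assume "a' \<in> A'"
    then obtain a where a: "a \<in> A" "(a, a') \<in> \<Phi>" using A' by blast
    show "a' \<in> N" by (rule NI[OF G.span_base[OF A a(1)] a(2)])
  qed
  ultimately have "H.span A' \<subseteq> N" by (rule H.span_least)
  then have "s' \<in> N" using s' by (rule subsetD)
  then show ?thesis by (simp add: N_def)
qed

lemma iso_choice:
  assumes "A \<subseteq> Domain \<Phi>" shows "\<exists>f. \<forall>a\<in>A. (a, f a) \<in> \<Phi>"
proof (rule bchoice, rule ballI)
  fix a assume "a \<in> A"
  then show "\<exists>b. (a, b) \<in> \<Phi>" using assms by blast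
qed

text \<open>Domination is read off heights of multiples and passes along one map. Negligibility
  quantifies over further elements, but an instance of it is witnessed by finitely many of them; one
  more extension puts these into the range and pulls the instance back to G.\<close>

lemma ulm_rank_transfer:
  assumes J: "bf J" and r: "G.ulm_rank n u" shows "H.ulm_rank n u"
proof -
  obtain Z where Z: "finite Z" "card Z = n" "Z \<subseteq> G.dominates u"
    and indep: "\<And>z s. z \<in> Z \<Longrightarrow> s \<in> G.span (Z - {z}) \<Longrightarrow> z \<oplus> s \<notin> G.neglig u"
    using r unfolding G.ulm_rank_def by blast
  have Zc: "Z \<subseteq> carrier G" using Z(3) by (auto simp: G.dominates_def)
  obtain \<Phi>0 where "\<Phi>0 \<in> J" using bf_ne[OF J] by blast
  from bf_finite_Domain[OF J Z(1) Zc this] obtain \<Phi> where \<Phi>: "\<Phi> \<in> J" "Z \<subseteq> Domain \<Phi>" by blast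
  note iso = bf_iso[OF J \<Phi>(1)]
  obtain f where f: "\<And>z. z \<in> Z \<Longrightarrow> (z, f z) \<in> \<Phi>" using iso_choice[OF \<Phi>(2)] by blast
  have fc: "f z \<in> carrier H" if "z \<in> Z" for z using iso_carrier[OF iso f[OF that]] by simp
  have inj: "inj_on f Z"
  proof (rule inj_onI)
    fix z z' assume z: "z \<in> Z" "z' \<in> Z" "f z = f z'"
    show "z = z'" using iso_inj[OF iso f[OF z(1)]] f[OF z(2)] z(3) by simp
  qed
  have "f ` Z \<subseteq> H.dominates u"
  proof
    fix y assume "y \<in> f ` Z"
    then obtain z where z: "z \<in> Z" "y = f z" by blast
    have "H.ht (pp ^ j \<odot>\<^bsub>H\<^esub> y) = ht (pp ^ j \<odot> z)" for j
      unfolding z(2) by (rule iso_height[OF iso iso_smult[OF iso _ f[OF z(1)]]]) simp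
    moreover obtain m where "\<forall>j\<ge>m. u j \<le> ht (pp ^ j \<odot> z)" using Z(3) z(1) by (auto simp: G.dominates_def)
    ultimately show "y \<in> H.dominates u" using fc[OF z(1)] z(2) unfolding H.dominates_def by auto
  qed
  moreover have "y \<oplus>\<^bsub>H\<^esub> s' \<notin> H.neglig u" if y: "y \<in> f ` Z" and s': "s' \<in> H.span (f ` Z - {y})" for y s'
  proof
    assume "y \<oplus>\<^bsub>H\<^esub> s' \<in> H.neglig u"
    then obtain m where m: "pp ^ m \<odot>\<^bsub>H\<^esub> (y \<oplus>\<^bsub>H\<^esub> s') \<in> H.span (H.exceeds u m)" by (auto simp: H.neglig_def)
    then obtain D' a where D': "finite D'" "D' \<subseteq> H.exceeds u m" "a \<in> D' \<rightarrow> Zp" "pp ^ m \<odot>\<^bsub>H\<^esub> (y \<oplus>\<^bsub>H\<^esub> s') = H.lincomb a D'"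
      unfolding H.span_def by auto
    have D'c: "D' \<subseteq> carrier H" using D'(2) H.exceeds_carrier by blast
    obtain z where z: "z \<in> Z" "y = f z" using y by blast
    have "\<exists>s\<in>G.span (Z - {z}). (s, s') \<in> \<Phi>"
    proof (rule span_back[OF iso _ _ s'])
      show "Z - {z} \<subseteq> carrier G" using Zc by auto
      show "\<exists>a\<in>Z - {z}. (a, a') \<in> \<Phi>" if "a' \<in> f ` Z - {y}" for a'
      proof -
        obtain a where "a \<in> Z" "a' = f a" "a \<noteq> z" using \<open>a' \<in> f ` Z - {y}\<close> z(2) by blast
        then show ?thesis using f[of a] by (intro bexI[of _ a]) auto
      qed
    qed
    then obtain s where s: "s \<in> G.span (Z - {z})" "(s, s') \<in> \<Phi>" by blast
    obtain \<Psi> where \<Psi>: "\<Psi> \<in> J" "\<Phi> \<subseteq> \<Psi>" "D' \<subseteq> Range \<Psi>" using bf_finite_Range[OF J D'(1) D'c \<Phi>(1)] by blast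
    note iso\<Psi> = bf_iso[OF J \<Psi>(1)]
    define D where "D = {d. \<exists>d'\<in>D'. (d, d') \<in> \<Psi>}"
    have D: "D \<subseteq> G.exceeds u m"
    proof
      fix d assume "d \<in> D"
      then obtain d' where d: "d' \<in> D'" "(d, d') \<in> \<Psi>" unfolding D_def by blast
      have "H.ht (pp ^ j \<odot>\<^bsub>H\<^esub> d') = ht (pp ^ j \<odot> d)" for j
        by (rule iso_height[OF iso\<Psi> iso_smult[OF iso\<Psi> _ d(2)]]) simp
      then show "d \<in> G.exceeds u m" using d(1) D'(2) iso_carrier[OF iso\<Psi> d(2)]
        unfolding H.exceeds_def G.exceeds_def by auto
    qed
    have Dc: "D \<subseteq> carrier G" using D G.exceeds_carrier by blast
    have "H.lincomb a D' \<in> H.span D'" by (rule H.lincomb_in_span[OF D'(1,3)])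
    then have "\<exists>t\<in>G.span D. (t, H.lincomb a D') \<in> \<Psi>"
    proof (rule span_back[OF iso\<Psi> Dc, rotated])
      fix d' assume d': "d' \<in> D'"
      then obtain d where "(d, d') \<in> \<Psi>" using \<Psi>(3) by blast
      then show "\<exists>a\<in>D. (a, d') \<in> \<Psi>" using d' by (intro bexI[of _ d]) (auto simp: D_def)
    qed
    then obtain t where t: "t \<in> G.span D" "(t, pp ^ m \<odot>\<^bsub>H\<^esub> (y \<oplus>\<^bsub>H\<^esub> s')) \<in> \<Psi>" using D'(4) by auto
    have "(z \<oplus> s, y \<oplus>\<^bsub>H\<^esub> s') \<in> \<Psi>" using iso_add[OF iso f[OF z(1)] s(2)] \<Psi>(2) z(2) by auto
    then have "(pp ^ m \<odot> (z \<oplus> s), pp ^ m \<odot>\<^bsub>H\<^esub> (y \<oplus>\<^bsub>H\<^esub> s')) \<in> \<Psi>" by (intro iso_smult[OF iso\<Psi>]) simp_all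
    then have "pp ^ m \<odot> (z \<oplus> s) = t" by (rule iso_inj[OF iso\<Psi> _ t(2)])
    moreover have "G.span D \<subseteq> G.span (G.exceeds u m)" by (rule G.span_is_monotone[OF D])
    ultimately have "pp ^ m \<odot> (z \<oplus> s) \<in> G.span (G.exceeds u m)" using t(1) by blast
    moreover have "z \<oplus> s \<in> carrier G" using iso_carrier(1)[OF iso f[OF z(1)]] iso_carrier(1)[OF iso s(2)] by simp
    ultimately have "z \<oplus> s \<in> G.neglig u" unfolding G.neglig_def by blast
    then show False using indep[OF z(1) s(1)] by simp
  qed
  ultimately show ?thesis
    unfolding H.ulm_rank_def using Z(1,2) card_image[OF inj] by (intro exI[of _ "f ` Z"]) auto
qed

text \<open>The elements are carried forward into P', while a congruence modulo Q' has to be carried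
  back; hence the opposite directions of the two hypotheses.\<close>

lemma incong_transfer:
  assumes J: "bf J" and P: "P \<subseteq> carrier G"
    and PQ: "\<And>\<Phi> s t. iso \<Phi> \<Longrightarrow> (s, t) \<in> \<Phi> \<Longrightarrow> s \<in> P \<Longrightarrow> t \<in> P'" "\<And>\<Phi> s t. iso \<Phi> \<Longrightarrow> (s, t) \<in> \<Phi> \<Longrightarrow> t \<in> Q' \<Longrightarrow> s \<in> Q"
    and i: "incong G P Q n"
  shows "incong H P' Q' n"
proof -
  obtain F where F: "F \<subseteq> P" "finite F" "card F = n" and inc: "\<And>a b. a \<in> F \<Longrightarrow> b \<in> F \<Longrightarrow> a \<noteq> b \<Longrightarrow> a \<ominus> b \<notin> Q"
    using i unfolding incong_def by blast
  obtain \<Phi>0 where "\<Phi>0 \<in> J" using bf_ne[OF J] by blast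
  moreover have Fc: "F \<subseteq> carrier G" using F(1) P by blast
  ultimately obtain \<Phi> where \<Phi>: "\<Phi> \<in> J" "F \<subseteq> Domain \<Phi>" using bf_finite_Domain[OF J F(2) Fc, of \<Phi>0] by blast
  note iso = bf_iso[OF J \<Phi>(1)]
  obtain f where f: "\<And>z. z \<in> F \<Longrightarrow> (z, f z) \<in> \<Phi>" using iso_choice[OF \<Phi>(2)] by blast
  have inj: "inj_on f F"
  proof (rule inj_onI)
    fix z z' assume z: "z \<in> F" "z' \<in> F" "f z = f z'"
    show "z = z'" using iso_inj[OF iso f[OF z(1)]] f[OF z(2)] z(3) by simp
  qed
  have "f ` F \<subseteq> P'" using f F(1) PQ(1)[OF iso] by blast
  moreover have "f a \<ominus>\<^bsub>H\<^esub> f b \<notin> Q'" if "a \<in> F" "b \<in> F" "f a \<noteq> f b" for a b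
    using PQ(2)[OF iso iso_diff[OF iso f[OF that(1)] f[OF that(2)]]] inc[OF that(1,2)] that(3) by blast
  ultimately show ?thesis
    unfolding incong_def using F(2,3) card_image[OF inj] by (intro exI[of _ "f ` F"]) auto
qed

lemma incong_torsion_transfer:
  assumes J: "bf J"
  shows "incong G (p_torsion p G (p_power p G (\<alpha> :: 'k))) (p_mult p G (p_power p G \<alpha>)) n \<Longrightarrow>
      incong H (p_torsion p H (p_power p H \<alpha>)) (p_mult p H (p_power p H \<alpha>)) n"
    "incong G (p_torsion p G (p_power_inf TYPE('k) p G)) {\<zero>} n \<Longrightarrow>
      incong H (p_torsion p H (p_power_inf TYPE('k) p H)) {\<zero>\<^bsub>H\<^esub>} n"
proof -
  have tor: "pp \<odot> s = \<zero> \<longleftrightarrow> pp \<odot>\<^bsub>H\<^esub> t = \<zero>\<^bsub>H\<^esub>" if "iso \<Phi>" "(s, t) \<in> \<Phi>" for \<Phi> s t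
    using iso_eq_zero[OF that(1) iso_smult[OF that(1) _ that(2)]] by simp
  show "incong G (p_torsion p G (p_power p G \<alpha>)) (p_mult p G (p_power p G \<alpha>)) n \<Longrightarrow>
      incong H (p_torsion p H (p_power p H \<alpha>)) (p_mult p H (p_power p H \<alpha>)) n"
    by (rule incong_transfer[OF J]) (use G.sm_carrier[OF G.sm_p_power] iso_pw tor in \<open>auto simp: p_torsion_def\<close>)
  have c: "p_power_inf TYPE('k) p G \<subseteq> carrier G"
    using G.sm_carrier[OF G.sm_pw[of Infty]] by (auto simp: G.pw_simps)
  show "incong G (p_torsion p G (p_power_inf TYPE('k) p G)) {\<zero>} n \<Longrightarrow>
      incong H (p_torsion p H (p_power_inf TYPE('k) p H)) {\<zero>\<^bsub>H\<^esub>} n"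
    by (rule incong_transfer[OF J]) (use c iso_pw(3) tor iso_eq_zero in \<open>auto simp: p_torsion_def\<close>)
qed

end


section \<open>Ulm invariants as counts of incongruent elements\<close>

text \<open>Coordinates with respect to a basis identify the space with the extensional functions
  from the basis to the field.\<close>

lemma vectorspace_card:
  assumes V: "vectorspace K V" and K: "finite (carrier K)"
  shows "vectorspace.fin_dim K V \<Longrightarrow> finite (carrier V) \<and> card (carrier V) = card (carrier K) ^ vectorspace.dim K V"
    and "finite (carrier V) \<Longrightarrow> vectorspace.fin_dim K V"
proof -
  interpret vectorspace K V by (rule V)
  show "fin_dim" if fin: "finite (carrier V)"
  proof -
    have "carrier V \<subseteq> span (carrier V)" by (rule in_own_span) simp
    moreover have "span (carrier V) \<subseteq> carrier V" by (rule span_is_subset2) simp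
    ultimately show ?thesis unfolding fin_dim_def using fin by (intro exI[of _ "carrier V"]) auto
  qed
  show "finite (carrier V) \<and> card (carrier V) = card (carrier K) ^ dim" if fd: "fin_dim"
  proof -
    obtain B where B: "finite B" "basis B" using finite_basis_exists[OF fd] by auto
    have Bc: "B \<subseteq> carrier V" using B(2) by (simp add: basis_def)
    have ex1: "\<exists>!a. a \<in> B \<rightarrow>\<^sub>E carrier K \<and> lincomb a B = v" if "v \<in> carrier V" for v
      using basis_criterion[OF B(1) Bc] B(2) that by simp
    have lc: "lincomb a B \<in> carrier V" if "a \<in> B \<rightarrow>\<^sub>E carrier K" for a
      using that Bc by (intro lincomb_closed) auto
    have "bij_betw (\<lambda>a. lincomb a B) (B \<rightarrow>\<^sub>E carrier K) (carrier V)"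
    proof (rule bij_betw_imageI)
      show "inj_on (\<lambda>a. lincomb a B) (B \<rightarrow>\<^sub>E carrier K)"
      proof (rule inj_onI)
        fix a b assume ab: "a \<in> B \<rightarrow>\<^sub>E carrier K" "b \<in> B \<rightarrow>\<^sub>E carrier K" "lincomb a B = lincomb b B"
        from ex1[OF lc[OF ab(2)]] show "a = b" using ab by (elim ex1E) metis
      qed
      show "(\<lambda>a. lincomb a B) ` (B \<rightarrow>\<^sub>E carrier K) = carrier V"
      proof
        show "(\<lambda>a. lincomb a B) ` (B \<rightarrow>\<^sub>E carrier K) \<subseteq> carrier V" using lc by (rule image_subsetI)
        show "carrier V \<subseteq> (\<lambda>a. lincomb a B) ` (B \<rightarrow>\<^sub>E carrier K)"
        proof
          fix v assume "v \<in> carrier V"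
          from ex1_implies_ex[OF ex1[OF this]] obtain a where "a \<in> B \<rightarrow>\<^sub>E carrier K" "lincomb a B = v" by blast
          then show "v \<in> (\<lambda>a. lincomb a B) ` (B \<rightarrow>\<^sub>E carrier K)" by (intro image_eqI[of _ _ a]) simp_all
        qed
      qed
    qed
    then have "card (B \<rightarrow>\<^sub>E carrier K) = card (carrier V)" and "finite (B \<rightarrow>\<^sub>E carrier K) = finite (carrier V)"
      by (rule bij_betw_same_card, rule bij_betw_finite)
    moreover have "finite (B \<rightarrow>\<^sub>E carrier K)" using B(1) K by (intro finite_PiE) auto
    moreover have "card (B \<rightarrow>\<^sub>E carrier K) = card (carrier K) ^ card B" using B(1) by (simp add: card_PiE)
    ultimately show ?thesis using dim_basis[OF B] by simp
  qed
qed

text \<open>\<open>card\<close> of an infinite set is 0, which is never a power of the size of the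
  field. This default lets one equation of cardinalities cover infinite dimension as well.\<close>

lemma trunc_dim_eq_iff:
  assumes V: "vectorspace K V" and W: "vectorspace K W" and K: "finite (carrier K)" "1 < card (carrier K)"
  shows "trunc_dim K V = trunc_dim K W \<longleftrightarrow> card (carrier V) = card (carrier W)"
proof -
  note cV = vectorspace_card[OF V K(1)] and cW = vectorspace_card[OF W K(1)]
  have pos: "0 < card (carrier K) ^ n" for n using K(2) by simp
  have inf: "card (carrier V) = 0" if "\<not> vectorspace.fin_dim K V" using cV(2) that by (metis card.infinite)
  have inf': "card (carrier W) = 0" if "\<not> vectorspace.fin_dim K W" using cW(2) that by (metis card.infinite)
  show ?thesis
  proof (cases "vectorspace.fin_dim K V"; cases "vectorspace.fin_dim K W")
    assume "vectorspace.fin_dim K V" "vectorspace.fin_dim K W"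
    then show ?thesis using cV(1) cW(1) K(2) by (simp add: trunc_dim_def)
  next
    assume *: "vectorspace.fin_dim K V" "\<not> vectorspace.fin_dim K W"
    have "card (carrier V) \<noteq> card (carrier W)" using cV(1)[OF *(1)] inf'[OF *(2)] pos[of "vectorspace.dim K V"] by simp
    then show ?thesis using * by (simp add: trunc_dim_def)
  next
    assume *: "\<not> vectorspace.fin_dim K V" "vectorspace.fin_dim K W"
    have "card (carrier V) \<noteq> card (carrier W)" using cW(1)[OF *(2)] inf[OF *(1)] pos[of "vectorspace.dim K W"] by simp
    then show ?thesis using * by (simp add: trunc_dim_def)
  next
    assume *: "\<not> vectorspace.fin_dim K V" "\<not> vectorspace.fin_dim K W"
    then show ?thesis using inf inf' by (simp add: trunc_dim_def)
  qed
qed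

text \<open>The disjunction expresses having at least n elements. Nonemptiness separates the empty
  set from the infinite ones, which share the value 0 of \<open>card\<close>.\<close>

lemma card_eq_iff_initial_segments:
  assumes "S \<noteq> {}" "S' \<noteq> {}"
  shows "card S = card S' \<longleftrightarrow> (\<forall>n. (infinite S \<or> n \<le> card S) \<longleftrightarrow> (infinite S' \<or> n \<le> card S'))"
proof
  assume e: "card S = card S'"
  have "finite S \<longleftrightarrow> finite S'" using e assms by (metis card_gt_0_iff)
  then show "\<forall>n. (infinite S \<or> n \<le> card S) \<longleftrightarrow> (infinite S' \<or> n \<le> card S')" using e by simp
next
  assume h: "\<forall>n. (infinite S \<or> n \<le> card S) \<longleftrightarrow> (infinite S' \<or> n \<le> card S')"
  show "card S = card S'"
  proof (cases "finite S")
    case True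
    then have "finite S'" using h[rule_format, of "Suc (card S)"] by auto
    then show ?thesis using True h[rule_format, of "card S"] h[rule_format, of "card S'"] by simp
  next
    case False
    then have "infinite S'" using h[rule_format, of "Suc (card S')"] by auto
    then show ?thesis using False by simp
  qed
qed

section \<open>Cosets and vector spaces over the residue field\<close>

context zmod
begin

definition cset :: "'a set \<Rightarrow> 'a \<Rightarrow> 'a set" where
  "cset B x = (\<lambda>b. b \<oplus> x) ` B"

lemma cset_eq_iff:
  assumes B: "sm B" and x: "x \<in> carrier G" and y: "y \<in> carrier G"
  shows "cset B x = cset B y \<longleftrightarrow> x \<ominus> y \<in> B"
proof
  assume e: "cset B x = cset B y"
  have "\<zero> \<oplus> x \<in> cset B x" unfolding cset_def using sm_zero[OF B] by (rule imageI)
  then have "x \<in> cset B y" using e x by simp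
  then obtain b where b: "b \<in> B" "x = b \<oplus> y" unfolding cset_def by blast
  have "x \<ominus> y = b" unfolding b(2) using sm_carrier[OF B b(1)] y by algebra
  then show "x \<ominus> y \<in> B" using b by simp
next
  have sub: "cset B x \<subseteq> cset B y" if x: "x \<in> carrier G" and y: "y \<in> carrier G" and d: "x \<ominus> y \<in> B" for x y
  proof
    fix z assume "z \<in> cset B x"
    then obtain b where b: "b \<in> B" "z = b \<oplus> x" unfolding cset_def by blast
    have "z = (b \<oplus> (x \<ominus> y)) \<oplus> y" unfolding b(2) using sm_carrier[OF B b(1)] x y by algebra
    then show "z \<in> cset B y" unfolding cset_def using sm_add[OF B b(1) d] by (rule image_eqI)
  qed
  assume d: "x \<ominus> y \<in> B"
  have "\<ominus> (x \<ominus> y) \<in> B" by (rule sm_uminus[OF B d])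
  also have "\<ominus> (x \<ominus> y) = y \<ominus> x" using x y by algebra
  finally show "cset B x = cset B y" using sub[OF x y d] sub[OF y x] by simp
qed

lemma incong_iff_card:
  assumes A: "A \<subseteq> carrier G" and B: "sm B"
  shows "incong G A B n \<longleftrightarrow> infinite (cset B ` A) \<or> n \<le> card (cset B ` A)"
proof
  assume "incong G A B n"
  then obtain F where F: "F \<subseteq> A" "finite F" "card F = n" and inc: "\<forall>a\<in>F. \<forall>b\<in>F. a \<noteq> b \<longrightarrow> a \<ominus> b \<notin> B"
    unfolding incong_def by blast
  have "inj_on (cset B) F"
  proof (rule inj_onI, rule ccontr)
    fix a b assume ab: "a \<in> F" "b \<in> F" "cset B a = cset B b" "a \<noteq> b"
    then have "a \<in> carrier G" "b \<in> carrier G" using F(1) A by auto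
    then show False using cset_eq_iff[OF B] ab inc by auto
  qed
  then have "card (cset B ` F) = n" using F(3) card_image by blast
  then show "infinite (cset B ` A) \<or> n \<le> card (cset B ` A)" using F(1) by (metis card_mono image_mono)
next
  assume "infinite (cset B ` A) \<or> n \<le> card (cset B ` A)"
  then obtain S where S: "S \<subseteq> cset B ` A" "finite S" "card S = n"
    using infinite_arbitrarily_large[of "cset B ` A" n] obtain_subset_with_card_n[of n "cset B ` A"]
    by (metis card.infinite)
  define g where "g = inv_into A (cset B)"
  have g: "g c \<in> A" "cset B (g c) = c" if "c \<in> S" for c
  proof -
    have c: "c \<in> cset B ` A" using S(1) that by (rule subsetD)
    show "g c \<in> A" "cset B (g c) = c" unfolding g_def by (rule inv_into_into[OF c], rule f_inv_into_f[OF c])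
  qed
  have inj: "inj_on g S" using g(2) by (rule inj_on_inverseI)
  have "a \<ominus> b \<notin> B" if "a \<in> g ` S" "b \<in> g ` S" "a \<noteq> b" for a b
  proof
    assume d: "a \<ominus> b \<in> B"
    obtain c c' where c: "c \<in> S" "c' \<in> S" "a = g c" "b = g c'" using \<open>a \<in> g ` S\<close> \<open>b \<in> g ` S\<close> by blast
    have "a \<in> carrier G" "b \<in> carrier G" using c g(1) A by auto
    then have "cset B a = cset B b" using cset_eq_iff[OF B] d by simp
    then show False using c g(2) \<open>a \<noteq> b\<close> by simp
  qed
  moreover have "g ` S \<subseteq> A" using g(1) by (rule image_subsetI)
  ultimately show "incong G A B n"
    unfolding incong_def using S(2,3) card_image[OF inj] by (intro exI[of _ "g ` S"]) simp
qed

text \<open>A difference of elements killed by p is killed by p. The invariants divide by the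
  torsion part of the next submodule, whereas Kaplansky's argument works modulo the whole of
  it.\<close>

lemma incong_torsion:
  assumes "sm P"
  shows "incong G (p_torsion p G P) Q n \<longleftrightarrow> incong G (p_torsion p G P) (p_torsion p G Q) n"
proof -
  have "a \<ominus> b \<in> Q \<longleftrightarrow> a \<ominus> b \<in> p_torsion p G Q" if "a \<in> p_torsion p G P" "b \<in> p_torsion p G P" for a b
  proof -
    have ab: "a \<in> carrier G" "b \<in> carrier G" "pp \<odot> a = \<zero>" "pp \<odot> b = \<zero>"
      using that sm_carrier[OF assms] by (auto simp: p_torsion_def)
    have "pp \<odot> (a \<ominus> b) = pp \<odot> a \<ominus> pp \<odot> b" using ab(1,2) by algebra
    also have "\<dots> = \<zero>" unfolding ab(3,4) by (simp add: minus_eq_zero_iff)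
    finally show ?thesis by (simp add: p_torsion_def)
  qed
  then have e: "(\<forall>a\<in>F. \<forall>b\<in>F. a \<noteq> b \<longrightarrow> a \<ominus> b \<notin> Q) \<longleftrightarrow> (\<forall>a\<in>F. \<forall>b\<in>F. a \<noteq> b \<longrightarrow> a \<ominus> b \<notin> p_torsion p G Q)"
    if "F \<subseteq> p_torsion p G P" for F using that by (meson subsetD)
  show ?thesis unfolding incong_def by (simp cong: conj_cong add: e)
qed

lemma sm_torsion: "sm P \<Longrightarrow> sm (p_torsion p G P)"
proof (rule smI)
  assume P: "sm P"
  note P' = sm_carrier[OF P] sm_zero[OF P] sm_add[OF P] sm_smult[OF P]
  show "p_torsion p G P \<subseteq> carrier G" using P' by (auto simp: p_torsion_def)
  show "\<zero> \<in> p_torsion p G P" using P' by (simp add: p_torsion_def)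
  show "x \<oplus> y \<in> p_torsion p G P" if "x \<in> p_torsion p G P" "y \<in> p_torsion p G P" for x y
    using that P' by (simp add: p_torsion_def smult_r_distr)
  show "a \<odot> x \<in> p_torsion p G P" if a: "a \<in> Zp" and x: "x \<in> p_torsion p G P" for a x
  proof -
    have x': "x \<in> P" "x \<in> carrier G" "pp \<odot> x = \<zero>" using x P' by (auto simp: p_torsion_def)
    have "pp \<odot> (a \<odot> x) = a \<odot> (pp \<odot> x)" using a x' by (intro smult_swap) auto
    then show ?thesis using a x' P'(4) unfolding p_torsion_def by simp
  qed
qed

lemma residue_field: "field (residue_ring (int p))" "finite (carrier (residue_ring (int p)))"
  "1 < card (carrier (residue_ring (int p)))"
proof -
  interpret residues_prime p "residue_ring (int p)" by unfold_locales (rule prime)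
  show "field (residue_ring (int p))" by (rule is_field)
  show "finite (carrier (residue_ring (int p)))" by (rule finite)
  show "1 < card (carrier (residue_ring (int p)))" using p_gt1 by (simp add: residue_ring_def)
qed

lemma residue_ring_simps:
  "carrier (residue_ring (int p)) = {0..int p - 1}" "zero (residue_ring (int p)) = 0" "one (residue_ring (int p)) = 1"
  "add (residue_ring (int p)) = (\<lambda>x y. (x + y) mod int p)" "monoid.mult (residue_ring (int p)) = (\<lambda>x y. (x * y) mod int p)"
  by (simp_all add: residue_ring_def)

lemma smult_mod:
  assumes x: "x \<in> carrier G" "pp \<odot> x = \<zero>"
  shows "of_int (k mod int p) \<odot> x = of_int k \<odot> x"
proof -
  have "k = k mod int p + k div int p * int p" by simp
  then have "(of_int k :: rat) = of_int (k mod int p) + of_int (k div int p) * pp"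
    by (metis of_int_add of_int_mult of_int_of_nat_eq)
  then have "of_int k \<odot> x = (of_int (k mod int p) + of_int (k div int p) * pp) \<odot> x"
    by (rule arg_cong[where f = "\<lambda>r. r \<odot> x"])
  also have "\<dots> = of_int (k mod int p) \<odot> x \<oplus> of_int (k div int p) \<odot> (pp \<odot> x)"
    using x(1) by (simp add: smult_add)
  also have "\<dots> = of_int (k mod int p) \<odot> x" unfolding x(2) using x(1) by simp
  finally show ?thesis by simp
qed

text \<open>
  Both the space \<^term>\<open>residue_space G A\<close> and its quotients are images of \<^term>\<open>A\<close> under a map
  compatible with the operations, so one verification of the axioms covers them.
\<close>

lemma residue_image_vectorspace:
  assumes A: "sm A" and pA: "\<And>x. x \<in> A \<Longrightarrow> pp \<odot> x = \<zero>"
    and carr: "carrier V = h ` A" and zero: "zero V = h \<zero>"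
    and add: "\<And>x y. x \<in> A \<Longrightarrow> y \<in> A \<Longrightarrow> add V (h x) (h y) = h (x \<oplus> y)"
    and smult: "\<And>k x. x \<in> A \<Longrightarrow> smult V k (h x) = h (of_int k \<odot> x)"
  shows "vectorspace (residue_ring (int p)) V"
proof (intro vectorspace.intro moduleI abelian_groupI)
  note A' = sm_carrier[OF A] sm_zero[OF A] sm_add[OF A]
  note As = sm_smult[OF A Zp_of_int]
  show "field (residue_ring (int p))" by (rule residue_field)
  then show "cring (residue_ring (int p))" by (simp add: field_def domain_def)
  show "zero V \<in> carrier V" unfolding carr zero using A'(2) by (rule imageI)
  fix u assume "u \<in> carrier V"
  then obtain x where x: "x \<in> A" "u = h x" unfolding carr by blast
  have xc: "x \<in> carrier G" "pp \<odot> x = \<zero>" using A'(1)[OF x(1)] pA[OF x(1)] by auto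
  show "add V (zero V) u = u" unfolding zero x(2) using add[OF A'(2) x(1)] xc by simp
  show "smult V a u \<in> carrier V" for a unfolding carr x(2) smult[OF x(1)] using As[OF x(1)] by (rule imageI)
  show "smult V (one (residue_ring (int p))) u = u"
    unfolding x(2) residue_ring_simps smult[OF x(1)] using xc by simp
  show "smult V (add (residue_ring (int p)) a b) u = add V (smult V a u) (smult V b u)" for a b
    unfolding x(2) residue_ring_simps smult[OF x(1)] add[OF As[OF x(1)] As[OF x(1)]] smult_mod[OF xc]
    using xc by (simp add: smult_add)
  show "smult V (monoid.mult (residue_ring (int p)) a b) u = smult V a (smult V b u)" for a b
    unfolding x(2) residue_ring_simps smult[OF x(1)] smult[OF As[OF x(1)]] smult_mod[OF xc]
    using xc by simp
  show "\<exists>y\<in>carrier V. add V y u = zero V"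
  proof (rule bexI[of _ "h (\<ominus> x)"])
    show "h (\<ominus> x) \<in> carrier V" unfolding carr using sm_uminus[OF A x(1)] by (rule imageI)
    show "add V (h (\<ominus> x)) u = zero V"
      unfolding x(2) zero add[OF sm_uminus[OF A x(1)] x(1)] using xc by (simp add: M.l_neg)
  qed
  fix v assume "v \<in> carrier V"
  then obtain y where y: "y \<in> A" "v = h y" unfolding carr by blast
  have yc: "y \<in> carrier G" using A'(1)[OF y(1)] .
  show "add V u v \<in> carrier V" unfolding carr x(2) y(2) add[OF x(1) y(1)] using A'(3)[OF x(1) y(1)] by (rule imageI)
  show "add V u v = add V v u"
    unfolding x(2) y(2) add[OF x(1) y(1)] add[OF y(1) x(1)] using xc yc by (simp add: M.a_comm)
  show "smult V a (add V u v) = add V (smult V a u) (smult V a v)" for a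
    unfolding x(2) y(2) add[OF x(1) y(1)] smult[OF A'(3)[OF x(1) y(1)]] smult[OF x(1)] smult[OF y(1)]
      add[OF As[OF x(1)] As[OF y(1)]] using xc yc by (simp add: smult_r_distr)
  fix w assume "w \<in> carrier V"
  then obtain z where z: "z \<in> A" "w = h z" unfolding carr by blast
  show "add V (add V u v) w = add V u (add V v w)"
    unfolding x(2) y(2) z(2) add[OF x(1) y(1)] add[OF A'(3)[OF x(1) y(1)] z(1)] add[OF y(1) z(1)]
      add[OF x(1) A'(3)[OF y(1) z(1)]] using xc yc A'(1)[OF z(1)] by (simp add: M.a_assoc)
qed

lemma residue_quotient:
  assumes A: "sm A" and pA: "\<And>x. x \<in> A \<Longrightarrow> pp \<odot> x = \<zero>" and B: "sm B" "B \<subseteq> A"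
  shows "carrier (quotient_module (residue_space G A) B) = cset B ` A"
    "vectorspace (residue_ring (int p)) (quotient_module (residue_space G A) B)"
proof -
  define M where "M = residue_space G A"
  define V where "V = quotient_module M B"
  have coset: "a_r_coset M B x = cset B x" for x
    unfolding a_r_coset_def r_coset_def cset_def M_def residue_space_def by auto
  have carrM: "carrier M = A" by (simp add: M_def residue_space_def)
  show carr: "carrier (quotient_module (residue_space G A) B) = cset B ` A"
    unfolding M_def[symmetric] quotient_module_def A_RCOSETS_def RCOSETS_def
    using coset carrM by (auto simp: a_r_coset_def)
  have A': "x \<in> carrier G" if "x \<in> A" for x using sm_carrier[OF A that] .
  have B': "b \<in> carrier G" if "b \<in> B" for b using sm_carrier[OF B(1) that] .
  have self: "x \<in> cset B x" if x: "x \<in> A" for x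
    unfolding cset_def using A'[OF x] sm_zero[OF B(1)] by (intro image_eqI[of _ _ \<zero>]) auto
  show "vectorspace (residue_ring (int p)) (quotient_module (residue_space G A) B)"
  proof (rule residue_image_vectorspace[OF A pA carr])
    show "zero (quotient_module (residue_space G A) B) = cset B \<zero>"
      unfolding quotient_module_def cset_def using B' by simp
    fix x assume x: "x \<in> A"
    show "add (quotient_module (residue_space G A) B) (cset B x) (cset B y) = cset B (x \<oplus> y)" if y: "y \<in> A" for y
    proof -
      have "add (quotient_module (residue_space G A) B) (cset B x) (cset B y) = {c \<oplus> d |c d. c \<in> cset B x \<and> d \<in> cset B y}"
        by (auto simp: quotient_module_def set_add_def set_mult_def residue_space_def)
      also have "\<dots> = cset B (x \<oplus> y)"
      proof
        show "{c \<oplus> d |c d. c \<in> cset B x \<and> d \<in> cset B y} \<subseteq> cset B (x \<oplus> y)"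
        proof
          fix z assume "z \<in> {c \<oplus> d |c d. c \<in> cset B x \<and> d \<in> cset B y}"
          then obtain b b' where b: "b \<in> B" "b' \<in> B" "z = (b \<oplus> x) \<oplus> (b' \<oplus> y)" unfolding cset_def by blast
          have "z = (b \<oplus> b') \<oplus> (x \<oplus> y)" unfolding b(3) using B'[OF b(1)] B'[OF b(2)] A'[OF x] A'[OF y] by algebra
          then show "z \<in> cset B (x \<oplus> y)" unfolding cset_def using sm_add[OF B(1) b(1,2)] by (rule image_eqI)
        qed
        show "cset B (x \<oplus> y) \<subseteq> {c \<oplus> d |c d. c \<in> cset B x \<and> d \<in> cset B y}"
        proof
          fix z assume "z \<in> cset B (x \<oplus> y)"
          then obtain b where b: "b \<in> B" "z = b \<oplus> (x \<oplus> y)" unfolding cset_def by blast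
          have "z = (b \<oplus> x) \<oplus> y" unfolding b(2) using B'[OF b(1)] A'[OF x] A'[OF y] by algebra
          moreover have "b \<oplus> x \<in> cset B x" unfolding cset_def using b(1) by (rule imageI)
          ultimately show "z \<in> {c \<oplus> d |c d. c \<in> cset B x \<and> d \<in> cset B y}"
            using self[OF y] by (intro CollectI exI[of _ "b \<oplus> x"] exI[of _ y]) simp
        qed
      qed
      finally show ?thesis .
    qed
    have ne: "cset B x \<noteq> {}" using self[OF x] by blast
    show "smult (quotient_module (residue_space G A) B) k (cset B x) = cset B (of_int k \<odot> x)" for k
    proof -
      have "smult (quotient_module (residue_space G A) B) k (cset B x) = (\<Union>y\<in>cset B x. cset B (of_int k \<odot> y))"
        unfolding quotient_module_def using coset unfolding M_def by (simp add: residue_space_def)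
      \<comment> \<open>The scalar action of the quotient is a union over all representatives; any
        two of them give the same coset, so the union collapses.\<close>
      also have "\<dots> = (\<Union>y\<in>cset B x. cset B (of_int k \<odot> x))"
      proof (rule SUP_cong[OF refl])
        fix y assume y: "y \<in> cset B x"
        obtain b where b: "b \<in> B" "y = b \<oplus> x" using y unfolding cset_def by blast
        have kZ: "(of_int k :: rat) \<in> Zp" by simp
        have "of_int k \<odot> y \<ominus> of_int k \<odot> x = of_int k \<odot> b" unfolding b(2) using B'[OF b(1)] A'[OF x] kZ by algebra
        then have "of_int k \<odot> y \<ominus> of_int k \<odot> x \<in> B" using sm_smult[OF B(1) kZ b(1)] by simp
        then show "cset B (of_int k \<odot> y) = cset B (of_int k \<odot> x)"
          using cset_eq_iff[OF B(1)] b A'[OF x] B'[OF b(1)] by simp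
      qed
      also have "\<dots> = cset B (of_int k \<odot> x)" using ne by simp
      finally show ?thesis .
    qed
  qed
qed

lemma residue_space_vectorspace:
  assumes A: "sm A" and pA: "\<And>x. x \<in> A \<Longrightarrow> pp \<odot> x = \<zero>"
  shows "vectorspace (residue_ring (int p)) (residue_space G A)"
  by (rule residue_image_vectorspace[OF A pA, where h = "\<lambda>x. x"]) (auto simp: residue_space_def)

end

section \<open>Equality of Ulm invariants as equality of counts\<close>

context zpair
begin

lemma u_hat_Ord_iff:
  "u_hat p G (Ord (\<alpha> :: 'k)) = u_hat p H (Ord \<alpha>) \<longleftrightarrow>
    (\<forall>n. incong G (p_torsion p G (p_power p G \<alpha>)) (p_mult p G (p_power p G \<alpha>)) n \<longleftrightarrow>
      incong H (p_torsion p H (p_power p H \<alpha>)) (p_mult p H (p_power p H \<alpha>)) n)"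
proof -
  define A where "A = p_torsion p G (p_power p G \<alpha>)"
  define B where "B = p_torsion p G (p_mult p G (p_power p G \<alpha>))"
  define A' where "A' = p_torsion p H (p_power p H \<alpha>)"
  define B' where "B' = p_torsion p H (p_mult p H (p_power p H \<alpha>))"
  have A: "G.sm A" "G.sm B" "B \<subseteq> A" "\<And>x. x \<in> A \<Longrightarrow> pp \<odot> x = \<zero>"
  proof -
    show "G.sm A" "G.sm B" unfolding A_def B_def by (intro G.sm_torsion G.sm_p_mult G.sm_p_power)+
    show "B \<subseteq> A" unfolding A_def B_def using G.decreasing(2)[of \<alpha>] by (auto simp: p_torsion_def)
  qed (simp add: A_def p_torsion_def)
  have A': "H.sm A'" "H.sm B'" "B' \<subseteq> A'" "\<And>x. x \<in> A' \<Longrightarrow> pp \<odot>\<^bsub>H\<^esub> x = \<zero>\<^bsub>H\<^esub>"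
  proof -
    show "H.sm A'" "H.sm B'" unfolding A'_def B'_def by (intro H.sm_torsion H.sm_p_mult H.sm_p_power)+
    show "B' \<subseteq> A'" unfolding A'_def B'_def using H.decreasing(2)[of \<alpha>] by (auto simp: p_torsion_def)
  qed (simp add: A'_def p_torsion_def)
  have Ac: "A \<subseteq> carrier G" "A' \<subseteq> carrier H" using G.sm_carrier[OF A(1)] H.sm_carrier[OF A'(1)] by auto
  have ne: "G.cset B ` A \<noteq> {}" "H.cset B' ` A' \<noteq> {}" using G.sm_zero[OF A(1)] H.sm_zero[OF A'(1)] by auto
  note q = G.residue_quotient[OF A(1,4,2,3)] and q' = H.residue_quotient[OF A'(1,4,2,3)]
  have "u_hat p G (Ord \<alpha>) = u_hat p H (Ord \<alpha>) \<longleftrightarrow> card (G.cset B ` A) = card (H.cset B' ` A')"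
    using trunc_dim_eq_iff[OF q(2) q'(2) G.residue_field(2,3)]
    by (simp add: A_def[symmetric] B_def[symmetric] A'_def[symmetric] B'_def[symmetric] q(1) q'(1))
  also have "\<dots> \<longleftrightarrow> (\<forall>n. incong G A B n \<longleftrightarrow> incong H A' B' n)"
    unfolding card_eq_iff_initial_segments[OF ne] G.incong_iff_card[OF Ac(1) A(2)] H.incong_iff_card[OF Ac(2) A'(2)] ..
  also have "\<dots> \<longleftrightarrow> (\<forall>n. incong G A (p_mult p G (p_power p G \<alpha>)) n \<longleftrightarrow> incong H A' (p_mult p H (p_power p H \<alpha>)) n)"
    unfolding A_def A'_def B_def B'_def
    using G.incong_torsion[OF G.sm_p_power] H.incong_torsion[OF H.sm_p_power] by simp
  finally show ?thesis unfolding A_def A'_def .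
qed

text \<open>Modulo the zero submodule cosets are singletons, which brings the value at infinity into
  the same counting form as the values at ordinals.\<close>

lemma u_hat_Infty_iff:
  "u_hat p G (Infty :: 'k height) = u_hat p H (Infty :: 'k height) \<longleftrightarrow>
    (\<forall>n. incong G (p_torsion p G (p_power_inf TYPE('k) p G)) {\<zero>} n \<longleftrightarrow>
      incong H (p_torsion p H (p_power_inf TYPE('k) p H)) {\<zero>\<^bsub>H\<^esub>} n)"
proof -
  define A where "A = p_torsion p G (p_power_inf TYPE('k) p G)"
  define A' where "A' = p_torsion p H (p_power_inf TYPE('k) p H)"
  have A: "G.sm A" "\<And>x. x \<in> A \<Longrightarrow> pp \<odot> x = \<zero>"
    unfolding A_def using G.sm_torsion[OF G.sm_pw[of Infty]] by (auto simp: G.pw_simps p_torsion_def)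
  have A': "H.sm A'" "\<And>x. x \<in> A' \<Longrightarrow> pp \<odot>\<^bsub>H\<^esub> x = \<zero>\<^bsub>H\<^esub>"
    unfolding A'_def using H.sm_torsion[OF H.sm_pw[of Infty]] by (auto simp: H.pw_simps p_torsion_def)
  have Ac: "A \<subseteq> carrier G" "A' \<subseteq> carrier H" using G.sm_carrier[OF A(1)] H.sm_carrier[OF A'(1)] by auto
  have ne: "G.cset {\<zero>} ` A \<noteq> {}" "H.cset {\<zero>\<^bsub>H\<^esub>} ` A' \<noteq> {}" using G.sm_zero[OF A(1)] H.sm_zero[OF A'(1)] by auto
  have inj: "inj_on (G.cset {\<zero>}) A" "inj_on (H.cset {\<zero>\<^bsub>H\<^esub>}) A'"
    using Ac by (auto simp: inj_on_def G.cset_def H.cset_def subset_iff)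
  note v = G.residue_space_vectorspace[OF A] and v' = H.residue_space_vectorspace[OF A']
  have c: "carrier (residue_space G A) = A" "carrier (residue_space H A') = A'" by (simp_all add: residue_space_def)
  have "u_hat p G (Infty :: 'k height) = u_hat p H (Infty :: 'k height) \<longleftrightarrow> card A = card A'"
    using trunc_dim_eq_iff[OF v v' G.residue_field(2,3)] by (simp add: A_def[symmetric] A'_def[symmetric] c)
  also have "\<dots> \<longleftrightarrow> card (G.cset {\<zero>} ` A) = card (H.cset {\<zero>\<^bsub>H\<^esub>} ` A')"
    using card_image[OF inj(1)] card_image[OF inj(2)] by simp
  also have "\<dots> \<longleftrightarrow> (\<forall>n. incong G A {\<zero>} n \<longleftrightarrow> incong H A' {\<zero>\<^bsub>H\<^esub>} n)"
    unfolding card_eq_iff_initial_segments[OF ne] G.incong_iff_card[OF Ac(1) G.sm_zero_set] H.incong_iff_card[OF Ac(2) H.sm_zero_set] ..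
  finally show ?thesis unfolding A_def A'_def .
qed

end


section \<open>Back-and-forth extension\<close>

context zmodk
begin

lemma closed_multiples_pp:
  assumes C: "closed_under_multiples G C" and X: "X \<in> C" "A \<subseteq> X" "A \<noteq> {}"
  shows "(\<lambda>x. pp ^ k x \<odot> x) ` A \<in> C"
proof -
  have "\<forall>x\<in>A. int p ^ k x \<noteq> 0" by simp
  with C[unfolded closed_under_multiples_def, rule_format, OF X, of "\<lambda>x. int p ^ k x"]
  have "(\<lambda>x. of_int (int p ^ k x) \<odot> x) ` A \<in> C" by blast
  then show ?thesis by simp
qed

lemma closed_subset:
  assumes C: "closed_under_multiples G C" and X: "X \<in> C" "A \<subseteq> X" "A \<noteq> {}" and Xc: "X \<subseteq> carrier G"
  shows "A \<in> C"
proof -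
  have "(\<lambda>x. pp ^ 0 \<odot> x) ` A = (\<lambda>x. x) ` A" using X Xc by (intro image_cong) auto
  then show ?thesis using closed_multiples_pp[OF C X, of "\<lambda>_. 0"] by simp
qed

lemma closed_insert_multiple:
  assumes C: "closed_under_multiples G C" and X: "insert x X \<in> C" and x: "x \<notin> X" and Xc: "X \<subseteq> carrier G"
  shows "insert (pp ^ k \<odot> x) X \<in> C"
proof -
  define f where "f z = (if z = x then k else 0)" for z
  have "(\<lambda>z. pp ^ f z \<odot> z) ` insert x X = insert (pp ^ k \<odot> x) ((\<lambda>z. pp ^ f z \<odot> z) ` X)"
    by (simp add: f_def)
  also have "(\<lambda>z. pp ^ f z \<odot> z) ` X = (\<lambda>z. z) ` X"
    using x Xc by (intro image_cong) (auto simp: f_def)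
  finally show ?thesis using closed_multiples_pp[OF C X order_refl, of f] by simp
qed

text \<open>Arbitrary bases are enlarged to ones closed under multiples for the converse direction.
  Because A may be empty, the closure contains the empty set, from which the back-and-forth system
  starts with the zero map.\<close>

definition multiples_closure :: "'a set set \<Rightarrow> 'a set set" where
  "multiples_closure C = {(\<lambda>x. k x \<odot> x) ` A |k A. \<exists>X\<in>C. A \<subseteq> X \<and> (\<forall>x\<in>A. k x \<in> Zp \<and> k x \<noteq> 0)}"

lemma multiples_closureI:
  "X \<in> C \<Longrightarrow> A \<subseteq> X \<Longrightarrow> (\<And>x. x \<in> A \<Longrightarrow> k x \<in> Zp \<and> k x \<noteq> 0) \<Longrightarrow> (\<lambda>x. k x \<odot> x) ` A \<in> multiples_closure C"
  unfolding multiples_closure_def by blast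

lemma multiples_closureE:
  assumes "Y \<in> multiples_closure C"
  obtains k A X where "Y = (\<lambda>x. k x \<odot> x) ` A" "X \<in> C" "A \<subseteq> X" "\<forall>x\<in>A. k x \<in> Zp \<and> k x \<noteq> 0"
  using assms unfolding multiples_closure_def by auto

lemma empty_multiples_closure: "C \<noteq> {} \<Longrightarrow> {} \<in> multiples_closure C"
  using multiples_closureI[of _ C "{}"] by fastforce

lemma closed_multiples_closure:
  assumes C: "\<And>X. X \<in> C \<Longrightarrow> X \<subseteq> carrier G"
  shows "closed_under_multiples G (multiples_closure C)"
  unfolding closed_under_multiples_def
proof (intro ballI allI impI)
  fix Y A a assume Y: "Y \<in> multiples_closure C" and A: "A \<subseteq> Y" "\<forall>x\<in>A. a x \<noteq> (0 :: int)"
  obtain k B X where B: "Y = (\<lambda>x. k x \<odot> x) ` B" "X \<in> C" "B \<subseteq> X" "\<forall>x\<in>B. k x \<in> Zp \<and> k x \<noteq> 0"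
    using multiples_closureE[OF Y] .
  define B' where "B' = {x \<in> B. k x \<odot> x \<in> A}"
  have "A = (\<lambda>x. k x \<odot> x) ` B'" using A(1) B(1) by (auto simp: B'_def)
  then have "(\<lambda>x. of_int (a x) \<odot> x) ` A = (\<lambda>x. of_int (a (k x \<odot> x)) \<odot> (k x \<odot> x)) ` B'"
    by (simp add: image_image)
  also have "\<dots> = (\<lambda>x. (of_int (a (k x \<odot> x)) * k x) \<odot> x) ` B'"
    using B C[OF B(2)] by (intro image_cong) (auto simp: B'_def subset_iff)
  also have "\<dots> \<in> multiples_closure C"
    by (rule multiples_closureI[OF B(2)]) (use B A(2) in \<open>auto simp: B'_def\<close>)
  finally show "(\<lambda>x. of_int (a x) \<odot> x) ` A \<in> multiples_closure C" .
qed

lemma pdb_multiples_closure: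
  assumes C: "pdb C" shows "pdb (multiples_closure C)"
  unfolding partial_decomposition_basis_def
proof (intro conjI ballI)
  have "C \<noteq> {}" using C unfolding partial_decomposition_basis_def by simp
  then show "multiples_closure C \<noteq> {}" using empty_multiples_closure by blast
  fix X' assume X': "X' \<in> multiples_closure C"
  obtain k A X where A: "X' = (\<lambda>x. k x \<odot> x) ` A" "X \<in> C" "A \<subseteq> X" "\<forall>x\<in>A. k x \<in> Zp \<and> k x \<noteq> 0"
    using multiples_closureE[OF X'] .
  have "dset X'" unfolding A(1) using dset_multiples(1)[OF pdb_dset[OF C A(2)] A(3), of k] A(4) by simp
  then show "finite X'" "decomposition_set T p G X'" by simp_all
  fix x assume x: "x \<in> carrier G"
  obtain Y where Y: "Y \<in> C" "X \<subseteq> Y" "{x} \<subseteq> hl (span Y)" using pdb_extend[OF C _ _ A(2), of "{x}"] x by auto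
  have Yc: "Y \<subseteq> carrier G" by (rule dset_carrier[OF pdb_dset[OF C Y(1)]])
  \<comment> \<open>The members added to X are multiplied by one, so the scaled set contains X', and
    scaling by nonzero factors leaves the rational hull large enough.\<close>
  define l where "l z = (if z \<in> A then k z else 1)" for z
  have l: "l z \<in> Zp \<and> l z \<noteq> 0" for z using A(4) by (simp add: l_def)
  define Y' where "Y' = (\<lambda>z. l z \<odot> z) ` Y"
  have Y'c: "Y' \<subseteq> carrier G" unfolding Y'_def using Yc l by auto
  have "Y' \<in> multiples_closure C" unfolding Y'_def by (rule multiples_closureI[OF Y(1) order_refl l])
  moreover have "X' \<subseteq> Y'"
  proof -
    have "X' = (\<lambda>z. l z \<odot> z) ` A" unfolding A(1) by (intro image_cong) (auto simp: l_def)
    then show ?thesis unfolding Y'_def using A(3) Y(2) by blast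
  qed
  moreover have "x \<in> hl (span Y')"
  proof -
    have "Y \<subseteq> hl (span Y')"
    proof
      fix y assume y: "y \<in> Y"
      have "l y \<odot> y \<in> span Y'" by (rule span_base[OF Y'c]) (use y in \<open>auto simp: Y'_def\<close>)
      then show "y \<in> hl (span Y')" unfolding rational_hull_def using y Yc l[of y] by blast
    qed
    then have "span Y \<subseteq> hl (span Y')" by (rule span_least[OF sm_hl[OF sm_span[OF Y'c]]])
    then have "hl (span Y) \<subseteq> hl (hl (span Y'))" by (rule hl_mono)
    then show ?thesis using Y(3) unfolding hl_hl[OF sm_span[OF Y'c]] by blast
  qed
  ultimately show "\<exists>Y\<in>multiples_closure C. X' \<subseteq> Y \<and> x \<in> hl (span Y)" by blast
qed

definition w_sizes :: "'a set set \<Rightarrow> (nat \<Rightarrow> 'k height) set \<Rightarrow> nat set" where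
  "w_sizes C e = {card A | A X. X \<in> C \<and> finite A \<and> A \<subseteq> X \<and> (\<forall>x\<in>A. ulm x \<in> e)}"

text \<open>The right-hand side does not mention C: this gives the independence of the Warfield
  invariant from the basis, and hence the legitimacy of the choice in \<open>w_hat\<close>.\<close>

lemma w_sizes_iff:
  assumes C: "pdb C" and e: "e \<in> UNIV // ulm_equiv"
  shows "n \<in> w_sizes C e \<longleftrightarrow> (\<exists>u\<in>e. ulm_rank n u)"
proof
  assume "n \<in> w_sizes C e"
  then obtain A X where A: "n = card A" "X \<in> C" "A \<subseteq> X" "\<forall>x\<in>A. ulm x \<in> e" unfolding w_sizes_def by blast
  show "\<exists>u\<in>e. ulm_rank n u" unfolding A(1) by (rule pdb_ulm_rank[OF C A(2,3) _ e]) (use A(4) in simp)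
next
  assume "\<exists>u\<in>e. ulm_rank n u"
  then obtain u where u: "u \<in> e" "ulm_rank n u" by blast
  have "C \<noteq> {}" using C unfolding partial_decomposition_basis_def by simp
  then obtain Y0 where "Y0 \<in> C" by blast
  from ulm_rank_pdb[OF C this u(2) e u(1)]
  obtain Y where Y: "Y \<in> C" "n \<le> card {x \<in> Y. ulm x \<in> e}" by blast
  obtain A where A: "A \<subseteq> {x \<in> Y. ulm x \<in> e}" "card A = n" "finite A"
    using obtain_subset_with_card_n[OF Y(2)] by blast
  have "X \<in> C \<Longrightarrow> finite A \<Longrightarrow> A \<subseteq> X \<Longrightarrow> \<forall>x\<in>A. ulm x \<in> e \<Longrightarrow> card A \<in> w_sizes C e" for X
    unfolding w_sizes_def by blast
  from this[OF Y(1) A(3)] show "n \<in> w_sizes C e" using A(1,2) by blast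
qed

lemma w_sizes_nonempty: "pdb C \<Longrightarrow> w_sizes C e \<noteq> {}"
proof -
  assume "pdb C"
  then obtain X where X: "X \<in> C" unfolding partial_decomposition_basis_def by blast
  have "card {} \<in> w_sizes C e" unfolding w_sizes_def using X by (intro CollectI exI[of _ "{}"] exI[of _ X]) simp
  then show ?thesis by blast
qed

lemma w_sizes_down:
  assumes "n \<in> w_sizes C e" "m \<le> n" shows "m \<in> w_sizes C e"
proof -
  obtain A X where A: "n = card A" "X \<in> C" "finite A" "A \<subseteq> X" "\<forall>x\<in>A. ulm x \<in> e"
    using assms(1) unfolding w_sizes_def by blast
  obtain B where B: "B \<subseteq> A" "card B = m" "finite B" using obtain_subset_with_card_n[of m A] assms(2) A(1) by auto
  have "m = card B \<and> X \<in> C \<and> finite B \<and> B \<subseteq> X \<and> (\<forall>x\<in>B. ulm x \<in> e)" using A B by auto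
  then show ?thesis unfolding w_sizes_def by blast
qed

end

text \<open>A nonempty downward closed set of natural numbers is either an initial segment,
  recovered from its maximum, or everything, which is the case of value \<infinity>.\<close>

lemma initial_segment_value_eq_iff:
  fixes N N' :: "nat set"
  assumes "N \<noteq> {}" "N' \<noteq> {}" and down: "\<And>m n. n \<in> N \<Longrightarrow> m \<le> n \<Longrightarrow> m \<in> N" "\<And>m n. n \<in> N' \<Longrightarrow> m \<le> n \<Longrightarrow> m \<in> N'"
  shows "(if \<exists>n\<in>N. \<forall>m\<in>N. m \<le> n then enat (Max N) else \<infinity>) = (if \<exists>n\<in>N'. \<forall>m\<in>N'. m \<le> n then enat (Max N') else \<infinity>)
    \<longleftrightarrow> N = N'"
proof
  have val: "(\<exists>n\<in>M. \<forall>m\<in>M. m \<le> n) \<Longrightarrow> M = {..Max M}" if "\<And>m n. n \<in> M \<Longrightarrow> m \<le> n \<Longrightarrow> m \<in> M" for M :: "nat set"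
  proof -
    assume "\<exists>n\<in>M. \<forall>m\<in>M. m \<le> n"
    then obtain n where n: "n \<in> M" "\<forall>m\<in>M. m \<le> n" by blast
    have fin: "finite M" using n(2) by (intro finite_subset[of M "{..n}"]) auto
    have "Max M = n" using n fin by (intro Max_eqI) auto
    moreover have "M = {..n}" using n that[OF n(1)] by auto
    ultimately show ?thesis by simp
  qed
  have unb: "M = UNIV" if d: "\<And>m n. n \<in> M \<Longrightarrow> m \<le> n \<Longrightarrow> m \<in> M" and ne: "M \<noteq> {}" and u: "\<not> (\<exists>n\<in>M. \<forall>m\<in>M. m \<le> n)" for M :: "nat set"
  proof -
    have "k \<in> M" for k
    proof (induction k)
      case 0
      obtain x where "x \<in> M" using ne by blast
      then show ?case by (rule d) simp
    next
      case (Suc k)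
      then obtain m where "m \<in> M" "\<not> m \<le> k" using u by blast
      then show ?case by (intro d[of m "Suc k"]) simp_all
    qed
    then show ?thesis by blast
  qed
  assume "(if \<exists>n\<in>N. \<forall>m\<in>N. m \<le> n then enat (Max N) else \<infinity>) = (if \<exists>n\<in>N'. \<forall>m\<in>N'. m \<le> n then enat (Max N') else \<infinity>)"
  then consider "\<exists>n\<in>N. \<forall>m\<in>N. m \<le> n" "\<exists>n\<in>N'. \<forall>m\<in>N'. m \<le> n" "Max N = Max N'"
    | "\<not> (\<exists>n\<in>N. \<forall>m\<in>N. m \<le> n)" "\<not> (\<exists>n\<in>N'. \<forall>m\<in>N'. m \<le> n)"
    by (auto split: if_split_asm)
  then show "N = N'"
  proof cases
    case 1
    have "N = {..Max N}" by (rule val[OF _ 1(1)]) (rule down(1))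
    moreover have "N' = {..Max N'}" by (rule val[OF _ 1(2)]) (rule down(2))
    ultimately show ?thesis using 1(3) by simp
  next
    case 2
    have "N = UNIV" by (rule unb[OF _ assms(1) 2(1)]) (rule down(1))
    moreover have "N' = UNIV" by (rule unb[OF _ assms(2) 2(2)]) (rule down(2))
    ultimately show ?thesis by simp
  qed
qed simp

section \<open>Comparing Warfield invariants and adjoining independent elements\<close>

context zpair
begin

lemma w_hat_wrt_eq_iff:
  assumes C: "G.pdb C" "H.pdb C'" and e: "e \<in> UNIV // ulm_equiv"
  shows "w_hat_wrt p G C e = w_hat_wrt p H C' e \<longleftrightarrow>
    (\<forall>n. (\<exists>u\<in>e. G.ulm_rank n u) \<longleftrightarrow> (\<exists>u\<in>e. H.ulm_rank n u))"
proof -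
  have "w_hat_wrt p G C e = w_hat_wrt p H C' e \<longleftrightarrow> G.w_sizes C e = H.w_sizes C' e"
    unfolding w_hat_wrt_def Let_def G.w_sizes_def[symmetric] H.w_sizes_def[symmetric]
    by (rule initial_segment_value_eq_iff[OF G.w_sizes_nonempty[OF C(1)] H.w_sizes_nonempty[OF C(2)]
      G.w_sizes_down H.w_sizes_down])
  also have "\<dots> \<longleftrightarrow> (\<forall>n. (\<exists>u\<in>e. G.ulm_rank n u) \<longleftrightarrow> (\<exists>u\<in>e. H.ulm_rank n u))"
    unfolding set_eq_iff G.w_sizes_iff[OF C(1) e] H.w_sizes_iff[OF C(2) e] ..
  finally show ?thesis .
qed

text \<open>Units do not affect heights, so the heights of the multiples by powers of p determine
  those of all multiples.\<close>

lemma ulm_eq_ht: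
  assumes x: "x \<in> carrier G" and y: "y \<in> carrier H" and u: "G.ulm x = H.ulm y" and r: "r \<in> Zp"
  shows "H.ht (r \<odot>\<^bsub>H\<^esub> y) = ht (r \<odot> x)"
proof (cases "r = 0")
  case True then show ?thesis using x y by simp
next
  case False
  obtain j v where j: "r = pp ^ j * v" "v \<in> Zp" "inverse v \<in> Zp" "v \<noteq> 0" using G.Zp_decompose[OF r False] .
  have "ht (r \<odot> x) = G.ulm x j" unfolding j(1) ulm_seq_def by (rule G.ht_mult_unit(1)[OF x j(2-4)]) simp
  moreover have "H.ht (r \<odot>\<^bsub>H\<^esub> y) = H.ulm y j" unfolding j(1) ulm_seq_def by (rule H.ht_mult_unit(1)[OF y j(2-4)]) simp
  ultimately show ?thesis using u by simp
qed

text \<open>Every multiple of x and of y is of maximal height in its coset, so heights in the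
  extension are minima of heights that already agree. Independence on both sides makes zero
  correspond to zero.\<close>

lemma ext_iso_free:
  assumes \<Phi>: "iso \<Phi>" and x: "x \<in> carrier G" and y: "y \<in> carrier H" and u: "G.ulm x = H.ulm y"
    and zx: "\<And>s r. s \<in> Domain \<Phi> \<Longrightarrow> r \<in> Zp \<Longrightarrow> s \<oplus> r \<odot> x = \<zero> \<Longrightarrow> r = 0"
    and zy: "\<And>t r. t \<in> Range \<Phi> \<Longrightarrow> r \<in> Zp \<Longrightarrow> t \<oplus>\<^bsub>H\<^esub> r \<odot>\<^bsub>H\<^esub> y = \<zero>\<^bsub>H\<^esub> \<Longrightarrow> r = 0"
    and hx: "\<And>s r. s \<in> Domain \<Phi> \<Longrightarrow> r \<in> Zp \<Longrightarrow> ht (s \<oplus> r \<odot> x) \<le> ht (r \<odot> x)"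
    and hy: "\<And>t r. t \<in> Range \<Phi> \<Longrightarrow> r \<in> Zp \<Longrightarrow> H.ht (t \<oplus>\<^bsub>H\<^esub> r \<odot>\<^bsub>H\<^esub> y) \<le> H.ht (r \<odot>\<^bsub>H\<^esub> y)"
  shows "iso (ext \<Phi> x y)"
proof (rule ext_iso[OF \<Phi> x y])
  fix s t r assume st: "(s, t) \<in> \<Phi>" and r: "r \<in> Zp"
  note c = iso_carrier[OF \<Phi> st]
  have sD: "s \<in> Domain \<Phi>" and tR: "t \<in> Range \<Phi>" using st by blast+
  show "s \<oplus> r \<odot> x = \<zero> \<longleftrightarrow> t \<oplus>\<^bsub>H\<^esub> r \<odot>\<^bsub>H\<^esub> y = \<zero>\<^bsub>H\<^esub>"
  proof
    assume 0: "s \<oplus> r \<odot> x = \<zero>"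
    have "r = 0" by (rule zx[OF sD r 0])
    then show "t \<oplus>\<^bsub>H\<^esub> r \<odot>\<^bsub>H\<^esub> y = \<zero>\<^bsub>H\<^esub>" using 0 c x y iso_eq_zero[OF \<Phi> st] by simp
  next
    assume 0: "t \<oplus>\<^bsub>H\<^esub> r \<odot>\<^bsub>H\<^esub> y = \<zero>\<^bsub>H\<^esub>"
    have "r = 0" by (rule zy[OF tR r 0])
    then show "s \<oplus> r \<odot> x = \<zero>" using 0 c x y iso_eq_zero[OF \<Phi> st] by simp
  qed
  have "H.ht (t \<oplus>\<^bsub>H\<^esub> r \<odot>\<^bsub>H\<^esub> y) = H.ht (r \<odot>\<^bsub>H\<^esub> y \<oplus>\<^bsub>H\<^esub> t)" using c y r by (simp add: H.M.a_comm)
  also have "\<dots> = min (H.ht (r \<odot>\<^bsub>H\<^esub> y)) (H.ht t)"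
    using hy[OF tR r] c y r by (intro H.ht_add_proper) (simp_all add: H.M.a_comm)
  also have "\<dots> = min (ht (r \<odot> x)) (ht s)" using ulm_eq_ht[OF x y u r] iso_height[OF \<Phi> st] by simp
  also have "\<dots> = ht (r \<odot> x \<oplus> s)"
    using hx[OF sD r] c x r by (intro G.ht_add_proper[symmetric]) (simp_all add: G.M.a_comm)
  also have "\<dots> = ht (s \<oplus> r \<odot> x)" using c x r by (simp add: G.M.a_comm)
  finally show "H.ht (t \<oplus>\<^bsub>H\<^esub> r \<odot>\<^bsub>H\<^esub> y) = ht (s \<oplus> r \<odot> x)" .
qed

text \<open>
  \<^term>\<open>adm X Y \<Phi>\<close> states the conditions (i)--(iv) on members of the extension system for the graph \<^term>\<open>\<Phi>\<close>.
\<close>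

definition adm :: "'a set \<Rightarrow> 'b set \<Rightarrow> ('a \<times> 'b) set \<Rightarrow> bool" where
  "adm X Y \<Phi> \<longleftrightarrow> iso \<Phi> \<and> (\<exists>A. finite A \<and> A \<subseteq> carrier G \<and> Domain \<Phi> = G.span A) \<and>
     (\<exists>B. finite B \<and> B \<subseteq> carrier H \<and> Range \<Phi> = H.span B) \<and>
     X \<subseteq> Domain \<Phi> \<and> Domain \<Phi> \<subseteq> G.hl (G.span X) \<and> Y \<subseteq> Range \<Phi> \<and> Range \<Phi> \<subseteq> H.hl (H.span Y) \<and>
     (\<forall>x\<in>X. \<exists>y\<in>Y. (x, y) \<in> \<Phi>) \<and> (\<forall>y\<in>Y. \<exists>x\<in>X. (x, y) \<in> \<Phi>)"

lemma admD:
  assumes "adm X Y \<Phi>"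
  shows "iso \<Phi>" and "\<exists>A. finite A \<and> A \<subseteq> carrier G \<and> Domain \<Phi> = G.span A"
    and "\<exists>B. finite B \<and> B \<subseteq> carrier H \<and> Range \<Phi> = H.span B"
    and "X \<subseteq> Domain \<Phi>" and "Domain \<Phi> \<subseteq> G.hl (G.span X)" and "Y \<subseteq> Range \<Phi>" and "Range \<Phi> \<subseteq> H.hl (H.span Y)"
    and "\<forall>x\<in>X. \<exists>y\<in>Y. (x, y) \<in> \<Phi>" and "\<forall>y\<in>Y. \<exists>x\<in>X. (x, y) \<in> \<Phi>"
  using assms unfolding adm_def by simp_all

lemma admI:
  assumes "iso \<Phi>" "finite A" "A \<subseteq> carrier G" "Domain \<Phi> = G.span A" "finite B" "B \<subseteq> carrier H" "Range \<Phi> = H.span B"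
    "X \<subseteq> Domain \<Phi>" "Domain \<Phi> \<subseteq> G.hl (G.span X)" "Y \<subseteq> Range \<Phi>" "Range \<Phi> \<subseteq> H.hl (H.span Y)"
    "\<forall>x\<in>X. \<exists>y\<in>Y. (x, y) \<in> \<Phi>" "\<forall>y\<in>Y. \<exists>x\<in>X. (x, y) \<in> \<Phi>"
  shows "adm X Y \<Phi>"
  unfolding adm_def by (intro conjI exI[of _ A] exI[of _ B] assms)

lemma adm_converse:
  assumes "adm X Y \<Phi>" shows "zpair.adm p H G T Y X (\<Phi>\<inverse>)"
proof -
  interpret sw: zpair p H G T by (rule swap)
  note D = admD[OF assms]
  show ?thesis
    unfolding sw.adm_def Domain_converse Range_converse converse_iff
    by (intro conjI D height_iso_converse)
qed

end

text \<open>The invariants appear as counts and ranks because these conditions have two sources: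
  equality of the invariants, and directly a given partial isomorphism when the bases are
  prescribed.\<close>

locale warfield_pair = zpair p G H T
  for p :: nat and G :: "(rat, 'a) module" (structure) and H :: "(rat, 'b) module"
    and T :: "'k::wellorder itself" +
  fixes C :: "'a set set" and C' :: "'b set set"
  assumes pdb: "G.pdb C" "H.pdb C'"
    and closed: "closed_under_multiples G C" "closed_under_multiples H C'"
    and countO: "\<And>\<alpha> n. incong G (p_torsion p G (p_power p G (\<alpha> :: 'k))) (p_mult p G (p_power p G \<alpha>)) n \<longleftrightarrow>
      incong H (p_torsion p H (p_power p H \<alpha>)) (p_mult p H (p_power p H \<alpha>)) n"
    and countI: "\<And>n. incong G (p_torsion p G (p_power_inf TYPE('k) p G)) {\<zero>} n \<longleftrightarrow>
      incong H (p_torsion p H (p_power_inf TYPE('k) p H)) {\<zero>\<^bsub>H\<^esub>} n"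
    and rank: "\<And>e n. e \<in> UNIV // ulm_equiv \<Longrightarrow> (\<exists>u\<in>e. G.ulm_rank n u) \<longleftrightarrow> (\<exists>u\<in>e. H.ulm_rank n u)"
begin

lemma swap_warfield: "warfield_pair p H G T C' C"
proof -
  interpret sw: zpair p H G T by (rule swap)
  show ?thesis
    by unfold_locales (rule pdb closed countO[symmetric] countI[symmetric] rank[symmetric], assumption?)+
qed

lemma step_torsion1:
  assumes a: "adm X Y \<Phi>" and X: "X \<in> C" "Y \<in> C'" and b: "b \<in> carrier G" "pp \<odot> b \<in> Domain \<Phi>"
  shows "\<exists>\<Psi>. adm X Y \<Psi> \<and> \<Phi> \<subseteq> \<Psi> \<and> b \<in> Domain \<Psi>"
proof (cases "b \<in> Domain \<Phi>")
  case True then show ?thesis using a by blast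
next
  case False
  note D = admD[OF a]
  obtain A where A: "finite A" "A \<subseteq> carrier G" "Domain \<Phi> = G.span A" using D(2) by blast
  obtain B where B: "finite B" "B \<subseteq> carrier H" "Range \<Phi> = H.span B" using D(3) by blast
  have dX: "G.dset X" "H.dset Y" using G.pdb_dset[OF pdb(1) X(1)] H.pdb_dset[OF pdb(2) X(2)] by auto
  note sX = G.sm_span[OF G.dset_carrier[OF dX(1)]] and sY = H.sm_span[OF H.dset_carrier[OF dX(2)]]
  show ?thesis
  proof (rule kaplansky_step[OF D(1) dX(1) A D(4,5) B _ _ b False])
    show "\<And>\<alpha> n. incong G (p_torsion p G (p_power p G (\<alpha> :: 'k))) (p_mult p G (p_power p G \<alpha>)) n \<Longrightarrow>
      incong H (p_torsion p H (p_power p H \<alpha>)) (p_mult p H (p_power p H \<alpha>)) n" using countO by blast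
    show "\<And>n. incong G (p_torsion p G (p_power_inf TYPE('k) p G)) {\<zero>} n \<Longrightarrow>
      incong H (p_torsion p H (p_power_inf TYPE('k) p H)) {\<zero>\<^bsub>H\<^esub>} n" using countI by blast
    fix x y assume xy: "x \<in> carrier G" "y \<in> carrier H" "iso (ext \<Phi> x y)" "b \<in> Domain (ext \<Phi> x y)"
      "pp \<odot> x \<in> Domain \<Phi>" "pp \<odot>\<^bsub>H\<^esub> y \<in> Range \<Phi>"
    note m = ext_mem[OF D(1) xy(1,2)]
    note dom = ext_Domain[OF D(1) A(2,3) xy(1,2)] and ran = ext_Range[OF D(1) B(2,3) xy(1,2)]
    have "pp ^ 1 \<odot> x \<in> G.hl (G.span X)" "pp ^ 1 \<odot>\<^bsub>H\<^esub> y \<in> H.hl (H.span Y)" using xy(5,6) D(5,7) by auto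
    then have "x \<in> G.hl (G.hl (G.span X))" "y \<in> H.hl (H.hl (H.span Y))"
      using xy(1,2) unfolding G.hl_iff[OF G.sm_hl[OF sX]] H.hl_iff[OF H.sm_hl[OF sY]] by blast+
    then have xh: "x \<in> G.hl (G.span X)" "y \<in> H.hl (H.span Y)" unfolding G.hl_hl[OF sX] H.hl_hl[OF sY] .
    have "adm X Y (ext \<Phi> x y)"
    proof (rule admI[OF xy(3) _ _ dom _ _ ran])
      show "Domain (ext \<Phi> x y) \<subseteq> G.hl (G.span X)" unfolding dom
        by (rule G.span_least[OF G.sm_hl[OF sX]]) (use xh(1) D(5) A G.span_base[OF A(2)] in auto)
      show "Range (ext \<Phi> x y) \<subseteq> H.hl (H.span Y)" unfolding ran
        by (rule H.span_least[OF H.sm_hl[OF sY]]) (use xh(2) D(7) B H.span_base[OF B(2)] in auto)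
      show "\<forall>x'\<in>X. \<exists>y'\<in>Y. (x', y') \<in> ext \<Phi> x y" "\<forall>y'\<in>Y. \<exists>x'\<in>X. (x', y') \<in> ext \<Phi> x y"
        using D(8,9) m(1) by blast+
      show "X \<subseteq> Domain (ext \<Phi> x y)" "Y \<subseteq> Range (ext \<Phi> x y)" using D(4,6) m(1) by blast+
    qed (use A B xy in auto)
    then show ?thesis using m(1) xy(4) by blast
  qed
qed

text \<open>The multiples of b by descending powers of p are adjoined one after another, b itself
  last. X and Y stay fixed throughout.\<close>

lemma step_torsion:
  assumes a: "adm X Y \<Phi>" and X: "X \<in> C" "Y \<in> C'" and b: "b \<in> carrier G" "pp ^ m \<odot> b \<in> Domain \<Phi>"
  shows "\<exists>\<Psi>. adm X Y \<Psi> \<and> \<Phi> \<subseteq> \<Psi> \<and> b \<in> Domain \<Psi>"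
  using a b
proof (induction m arbitrary: b \<Phi>)
  case 0
  then show ?case by auto
next
  case (Suc m)
  have pb: "pp \<odot> b \<in> carrier G" "pp ^ m \<odot> (pp \<odot> b) \<in> Domain \<Phi>" using Suc.prems by (simp_all add: mult.commute)
  from Suc.IH[OF Suc.prems(1) pb] obtain \<Psi> where \<Psi>: "adm X Y \<Psi>" "\<Phi> \<subseteq> \<Psi>" "pp \<odot> b \<in> Domain \<Psi>" by blast
  from step_torsion1[OF \<Psi>(1) X Suc.prems(2) \<Psi>(3)] obtain \<Psi>' where "adm X Y \<Psi>'" "\<Psi> \<subseteq> \<Psi>'" "b \<in> Domain \<Psi>'" by blast
  then show ?case using \<Psi>(2) by blast
qed

text \<open>The graph sends the members of Y in the class of x injectively to members of X in that
  class. As \<open>insert x X\<close> has one more, the rank forces an extension of Y with more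
  members of the class than Y itself; closure then allows all but one new element to be
  dropped.\<close>

lemma new_match:
  assumes a: "adm X Y \<Phi>" and X: "X \<in> C" "Y \<in> C'" and x: "x \<notin> X" "insert x X \<in> C"
  shows "\<exists>y. y \<notin> Y \<and> insert y Y \<in> C' \<and> (G.ulm x, H.ulm y) \<in> ulm_equiv"
proof -
  note D = admD[OF a]
  define e where "e = ulm_equiv `` {G.ulm x}"
  have e: "e \<in> UNIV // ulm_equiv" unfolding e_def by (intro quotientI) simp
  have xe: "G.ulm x \<in> e" unfolding e_def using equiv_ulm_equiv equiv_class_self by fastforce
  define EG where "EG = {z \<in> X. G.ulm z \<in> e}"
  define EH where "EH = {y \<in> Y. H.ulm y \<in> e}"
  have fin: "finite X" "finite Y" using G.pdb_dset[OF pdb(1) X(1)] H.pdb_dset[OF pdb(2) X(2)] by auto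
  then have fE: "finite EG" "finite EH" by (simp_all add: EG_def EH_def)
  have "card EH \<le> card EG"
  proof -
    have "\<forall>y\<in>EH. \<exists>z. z \<in> EG \<and> (z, y) \<in> \<Phi>"
    proof
      fix y assume y: "y \<in> EH"
      then obtain z where z: "z \<in> X" "(z, y) \<in> \<Phi>" using D(9) unfolding EH_def by blast
      have "H.ulm y = G.ulm z"
        unfolding ulm_seq_def using iso_height[OF D(1) iso_smult[OF D(1) _ z(2)]] by simp
      then show "\<exists>z. z \<in> EG \<and> (z, y) \<in> \<Phi>" using y z unfolding EG_def EH_def by auto
    qed
    then obtain g where g: "\<And>y. y \<in> EH \<Longrightarrow> g y \<in> EG \<and> (g y, y) \<in> \<Phi>" by metis
    have "inj_on g EH"
    proof (rule inj_onI)
      fix y y' assume "y \<in> EH" "y' \<in> EH" "g y = g y'"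
      then show "y = y'" using iso_fun[OF D(1), of "g y" y y'] g[of y] g[of y'] by simp
    qed
    then show ?thesis using g fE(1) by (intro card_inj_on_le) auto
  qed
  have "\<exists>u\<in>e. G.ulm_rank (card (insert x EG)) u"
    by (rule G.pdb_ulm_rank[OF pdb(1) x(2) _ _ e]) (use xe in \<open>auto simp: EG_def\<close>)
  then have "\<exists>u\<in>e. H.ulm_rank (card (insert x EG)) u" using rank[OF e] by simp
  then obtain u where u: "u \<in> e" "H.ulm_rank (card (insert x EG)) u" by blast
  obtain Y' where Y': "Y' \<in> C'" "Y \<subseteq> Y'" "card (insert x EG) \<le> card {y \<in> Y'. H.ulm y \<in> e}"
    using H.ulm_rank_pdb[OF pdb(2) X(2) u(2) e u(1)] by blast
  have "card (insert x EG) = Suc (card EG)" using fE(1) x(1) by (simp add: EG_def)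
  have "\<not> {y \<in> Y'. H.ulm y \<in> e} \<subseteq> EH"
  proof
    assume "{y \<in> Y'. H.ulm y \<in> e} \<subseteq> EH"
    then have "card {y \<in> Y'. H.ulm y \<in> e} \<le> card EH" by (rule card_mono[OF fE(2)])
    then show False using Y'(3) \<open>card EH \<le> card EG\<close> \<open>card (insert x EG) = Suc (card EG)\<close> by simp
  qed
  then obtain y where y: "y \<in> Y'" "H.ulm y \<in> e" "y \<notin> Y" unfolding EH_def by blast
  have "insert y Y \<in> C'"
    by (rule H.closed_subset[OF closed(2) Y'(1)])
      (use y Y'(2) H.dset_carrier[OF H.pdb_dset[OF pdb(2) Y'(1)]] in auto)
  moreover have "(G.ulm x, H.ulm y) \<in> ulm_equiv" using y(2) unfolding e_def by simp
  ultimately show ?thesis using y(3) by blast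
qed

text \<open>x and its partner y are only equivalent, and their multiples may be raised by elements
  of the domain or range. Both defects disappear after multiplication by suitable powers of
  p.\<close>

lemma step_new:
  assumes a: "adm X Y \<Phi>" and X: "X \<in> C" "Y \<in> C'" and x: "x \<notin> X" "insert x X \<in> C"
  shows "\<exists>k y \<Psi>. adm (insert (pp ^ k \<odot> x) X) (insert y Y) \<Psi> \<and> \<Phi> \<subseteq> \<Psi> \<and>
    insert (pp ^ k \<odot> x) X \<in> C \<and> insert y Y \<in> C'"
proof -
  note D = admD[OF a]
  obtain A where A: "finite A" "A \<subseteq> carrier G" "Domain \<Phi> = G.span A" using D(2) by blast
  obtain B where B: "finite B" "B \<subseteq> carrier H" "Range \<Phi> = H.span B" using D(3) by blast
  obtain y where y: "y \<notin> Y" "insert y Y \<in> C'" "(G.ulm x, H.ulm y) \<in> ulm_equiv" using new_match[OF assms] by blast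
  have dx: "G.dset (insert x X)" and dy: "H.dset (insert y Y)"
    using G.pdb_dset[OF pdb(1) x(2)] H.pdb_dset[OF pdb(2) y(2)] by auto
  have xc: "x \<in> carrier G" "X \<subseteq> carrier G" and yc: "y \<in> carrier H" "Y \<subseteq> carrier H"
    using G.dset_carrier[OF dx] H.dset_carrier[OF dy] by auto
  obtain m n where mn: "\<And>i. G.ulm x (i + n) = H.ulm y (i + m)" using y(3) unfolding ulm_equiv_def by blast
  have Ah: "A \<subseteq> G.hl (G.span X)" using D(5) A G.span_base[OF A(2)] by auto
  have Bh: "B \<subseteq> H.hl (H.span Y)" using D(7) B H.span_base[OF B(2)] by auto
  have XA: "X \<subseteq> G.span A" and YB: "Y \<subseteq> H.span B" using D(4,6) A(3) B(3) by auto
  obtain k1 where k1: "\<forall>s\<in>G.span A. \<forall>b\<in>Zp. ht (s \<oplus> (pp ^ k1 * b) \<odot> x) \<le> ht ((pp ^ k1 * b) \<odot> x)"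
    using G.dset_fg_split[OF dx x(1) A(1) Ah XA] by blast
  obtain k2 where k2: "\<forall>t\<in>H.span B. \<forall>b\<in>Zp. H.ht (t \<oplus>\<^bsub>H\<^esub> (pp ^ k2 * b) \<odot>\<^bsub>H\<^esub> y) \<le> H.ht ((pp ^ k2 * b) \<odot>\<^bsub>H\<^esub> y)"
    using H.dset_fg_split[OF dy y(1) B(1) Bh YB] by blast
  \<comment> \<open>n and m are the shifts at which the two Ulm sequences agree; k1 and k2 make the
    multiples of x and of y maximal modulo the domain and the range. Using k1 + k2 on both sides
    preserves the agreement.\<close>
  define x1 where "x1 = pp ^ (k1 + k2 + n) \<odot> x"
  define y1 where "y1 = pp ^ (k1 + k2 + m) \<odot>\<^bsub>H\<^esub> y"
  have x1: "x1 \<in> carrier G" and y1: "y1 \<in> carrier H" using xc yc by (simp_all add: x1_def y1_def)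
  have u: "G.ulm x1 = H.ulm y1"
  proof
    fix i show "G.ulm x1 i = H.ulm y1 i"
      using mn[of "i + (k1 + k2)"] xc yc unfolding x1_def y1_def by (simp add: G.ulm_pp H.ulm_pp add.assoc)
  qed
  have rx: "r \<odot> x1 = (pp ^ k1 * (pp ^ (k2 + n) * r)) \<odot> x" if "r \<in> Zp" for r
    using that xc(1) unfolding x1_def by (simp add: power_add ac_simps)
  have ry: "r \<odot>\<^bsub>H\<^esub> y1 = (pp ^ k2 * (pp ^ (k1 + m) * r)) \<odot>\<^bsub>H\<^esub> y" if "r \<in> Zp" for r
    using that yc(1) unfolding y1_def by (simp add: power_add ac_simps)
  have iso: "iso (ext \<Phi> x1 y1)"
  proof (rule ext_iso_free[OF D(1) x1 y1 u])
    fix s r assume s: "s \<in> Domain \<Phi>" and r: "r \<in> Zp"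
    show "ht (s \<oplus> r \<odot> x1) \<le> ht (r \<odot> x1)" unfolding rx[OF r] using k1 s A(3) r by simp
    assume 0: "s \<oplus> r \<odot> x1 = \<zero>"
    have sh: "s \<in> G.hl (G.span X)" using s D(5) by blast
    obtain l where l: "s \<in> carrier G" "pp ^ l \<odot> s \<in> G.span X" using sh G.hl_iff[OF G.sm_span[OF xc(2)]] by blast
    \<comment> \<open>The element s lies only in the hull of \<open>span X\<close>. Multiplying the
      relation by \<open>pp ^ l\<close> clears its denominator, and c is the resulting coefficient
      of x.\<close>
    define c where "c = pp ^ l * (r * pp ^ (k1 + k2 + n))"
    have "c \<odot> x \<oplus> pp ^ l \<odot> s = pp ^ l \<odot> (s \<oplus> r \<odot> x1)"
      unfolding c_def x1_def using xc(1) l(1) r by (simp add: G.smult_r_distr G.M.a_comm mult.assoc)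
    also have "\<dots> = \<zero>" unfolding 0 by simp
    finally have "c = 0"
      by (rule G.dset_split(3)[OF dx subset_insertI insertI1 x(1) l(2), rotated]) (use r in \<open>simp add: c_def\<close>)
    then show "r = 0" by (simp add: c_def)
  next
    fix t r assume t: "t \<in> Range \<Phi>" and r: "r \<in> Zp"
    show "H.ht (t \<oplus>\<^bsub>H\<^esub> r \<odot>\<^bsub>H\<^esub> y1) \<le> H.ht (r \<odot>\<^bsub>H\<^esub> y1)" unfolding ry[OF r] using k2 t B(3) r by simp
    assume 0: "t \<oplus>\<^bsub>H\<^esub> r \<odot>\<^bsub>H\<^esub> y1 = \<zero>\<^bsub>H\<^esub>"
    have th: "t \<in> H.hl (H.span Y)" using t D(7) by blast
    obtain l where l: "t \<in> carrier H" "pp ^ l \<odot>\<^bsub>H\<^esub> t \<in> H.span Y" using th H.hl_iff[OF H.sm_span[OF yc(2)]] by blast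
    define c where "c = pp ^ l * (r * pp ^ (k1 + k2 + m))"
    have "c \<odot>\<^bsub>H\<^esub> y \<oplus>\<^bsub>H\<^esub> pp ^ l \<odot>\<^bsub>H\<^esub> t = pp ^ l \<odot>\<^bsub>H\<^esub> (t \<oplus>\<^bsub>H\<^esub> r \<odot>\<^bsub>H\<^esub> y1)"
      unfolding c_def y1_def using yc(1) l(1) r by (simp add: H.smult_r_distr H.M.a_comm mult.assoc)
    also have "\<dots> = \<zero>\<^bsub>H\<^esub>" unfolding 0 by simp
    finally have "c = 0"
      by (rule H.dset_split(3)[OF dy subset_insertI insertI1 y(1) l(2), rotated]) (use r in \<open>simp add: c_def\<close>)
    then show "r = 0" by (simp add: c_def)
  qed
  note mem = ext_mem[OF D(1) x1 y1]
  note dom = ext_Domain[OF D(1) A(2,3) x1 y1] and ran = ext_Range[OF D(1) B(2,3) x1 y1]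
  have iX: "insert x1 X \<subseteq> carrier G" and iY: "insert y1 Y \<subseteq> carrier H" using x1 y1 xc yc by auto
  have "adm (insert x1 X) (insert y1 Y) (ext \<Phi> x1 y1)"
  proof (rule admI[OF iso _ _ dom _ _ ran])
    show "Domain (ext \<Phi> x1 y1) \<subseteq> G.hl (G.span (insert x1 X))" unfolding dom
    proof (rule G.span_least[OF G.sm_hl[OF G.sm_span[OF iX]]])
      have "x1 \<in> G.hl (G.span (insert x1 X))"
        using G.hl_base[OF G.sm_span[OF iX]] G.span_base[OF iX] by blast
      moreover have "G.hl (G.span X) \<subseteq> G.hl (G.span (insert x1 X))" by (intro G.hl_mono G.span_is_monotone) auto
      ultimately show "insert x1 A \<subseteq> G.hl (G.span (insert x1 X))" using Ah by auto
    qed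
    show "Range (ext \<Phi> x1 y1) \<subseteq> H.hl (H.span (insert y1 Y))" unfolding ran
    proof (rule H.span_least[OF H.sm_hl[OF H.sm_span[OF iY]]])
      have "y1 \<in> H.hl (H.span (insert y1 Y))"
        using H.hl_base[OF H.sm_span[OF iY]] H.span_base[OF iY] by blast
      moreover have "H.hl (H.span Y) \<subseteq> H.hl (H.span (insert y1 Y))" by (intro H.hl_mono H.span_is_monotone) auto
      ultimately show "insert y1 B \<subseteq> H.hl (H.span (insert y1 Y))" using Bh by auto
    qed
    show "insert x1 X \<subseteq> Domain (ext \<Phi> x1 y1)" "insert y1 Y \<subseteq> Range (ext \<Phi> x1 y1)" using D(4,6) mem by blast+
    show "\<forall>x'\<in>insert x1 X. \<exists>y'\<in>insert y1 Y. (x', y') \<in> ext \<Phi> x1 y1"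
      "\<forall>y'\<in>insert y1 Y. \<exists>x'\<in>insert x1 X. (x', y') \<in> ext \<Phi> x1 y1" using D(8,9) mem by blast+
  qed (use A B x1 y1 in auto)
  moreover have "insert x1 X \<in> C" unfolding x1_def by (rule G.closed_insert_multiple[OF closed(1) x(2,1) xc(2)])
  moreover have "insert y1 Y \<in> C'" unfolding y1_def by (rule H.closed_insert_multiple[OF closed(2) y(2,1) yc(2)])
  ultimately show ?thesis using mem(1) unfolding x1_def by blast
qed

text \<open>In general only multiples of the members of R enter X1, so the conclusion speaks of
  rational hulls, which do not notice nonzero factors.\<close>

lemma add_many:
  assumes "finite R" "adm X Y \<Phi>" "X \<in> C" "Y \<in> C'" "X \<inter> R = {}" "X \<union> R \<in> C"
  shows "\<exists>X1 Y1 \<Psi>. X1 \<in> C \<and> Y1 \<in> C' \<and> adm X1 Y1 \<Psi> \<and> \<Phi> \<subseteq> \<Psi> \<and> X \<subseteq> X1 \<and> Y \<subseteq> Y1 \<and>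
    G.hl (G.span (X \<union> R)) \<subseteq> G.hl (G.span X1)"
  using assms
proof (induction R arbitrary: X Y \<Phi>)
  case empty
  then show ?case by (intro exI[of _ X] exI[of _ Y] exI[of _ \<Phi>]) simp
next
  case (insert x R)
  have dU: "G.dset (X \<union> insert x R)" by (rule G.pdb_dset[OF pdb(1) insert.prems(5)])
  have Uc: "X \<union> insert x R \<subseteq> carrier G" by (rule G.dset_carrier[OF dU])
  have xX: "x \<notin> X" "x \<notin> X \<union> R" using insert.prems(4) insert.hyps(2) by auto
  have "insert x X \<in> C" by (rule G.closed_subset[OF closed(1) insert.prems(5)]) (use Uc in auto)
  from step_new[OF insert.prems(1-3) xX(1) this]
  obtain k y \<Psi> where s: "adm (insert (pp ^ k \<odot> x) X) (insert y Y) \<Psi>" "\<Phi> \<subseteq> \<Psi>"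
    "insert (pp ^ k \<odot> x) X \<in> C" "insert y Y \<in> C'" by blast
  define x1 where "x1 = pp ^ k \<odot> x"
  \<comment> \<open>Scaling x alone is injective on the decomposition set, so the multiple of x
    cannot coincide with a member still waiting in R.\<close>
  have x1R: "x1 \<notin> R"
  proof
    assume R: "x1 \<in> R"
    define f where "f z = (if z = x then pp ^ k else 1)" for z
    have inj: "inj_on (\<lambda>z. f z \<odot> z) (X \<union> insert x R)"
      by (rule G.dset_multiples(2)[OF dU order_refl]) (simp add: f_def)
    have ne: "x1 \<noteq> x" using R insert.hyps(2) by blast
    have "f x \<odot> x = f x1 \<odot> x1" using ne R Uc by (auto simp: f_def x1_def[symmetric])
    then have "x = x1" using inj_onD[OF inj, of x x1] R by simp
    then show False using ne by simp
  qed
  have U: "X \<union> insert x R = insert x (X \<union> R)" by auto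
  have "insert x1 (X \<union> R) \<in> C" unfolding x1_def
    by (rule G.closed_insert_multiple[OF closed(1) _ xX(2)]) (use insert.prems(5) Uc U in auto)
  then have "insert x1 X \<union> R \<in> C" by simp
  moreover have "insert x1 X \<inter> R = {}" using x1R insert.prems(4) by auto
  ultimately obtain X1 Y1 \<Psi>' where r: "X1 \<in> C" "Y1 \<in> C'" "adm X1 Y1 \<Psi>'" "\<Psi> \<subseteq> \<Psi>'" "insert x1 X \<subseteq> X1" "insert y Y \<subseteq> Y1"
    "G.hl (G.span (insert x1 X \<union> R)) \<subseteq> G.hl (G.span X1)"
    using insert.IH[OF s(1)[folded x1_def] s(3)[folded x1_def] s(4)] by blast
  have Vc: "insert x1 X \<union> R \<subseteq> carrier G" using Uc by (auto simp: x1_def)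
  note sV = G.sm_span[OF Vc]
  have "X \<union> insert x R \<subseteq> G.hl (G.span (insert x1 X \<union> R))"
  proof
    fix z assume z: "z \<in> X \<union> insert x R"
    show "z \<in> G.hl (G.span (insert x1 X \<union> R))"
    proof (cases "z = x")
      case True
      have "pp ^ k \<odot> z \<in> G.span (insert x1 X \<union> R)" unfolding True x1_def[symmetric]
        by (rule G.span_base[OF Vc]) simp
      moreover have "z \<in> carrier G" using z Uc by blast
      ultimately show ?thesis using G.hl_iff[OF sV] by blast
    next
      case False
      then have "z \<in> G.span (insert x1 X \<union> R)" by (intro G.span_base[OF Vc]) (use z in auto)
      then show ?thesis using G.hl_base[OF sV] by blast
    qed
  qed
  then have "G.span (X \<union> insert x R) \<subseteq> G.hl (G.span (insert x1 X \<union> R))" by (rule G.span_least[OF G.sm_hl[OF sV]])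
  then have "G.hl (G.span (X \<union> insert x R)) \<subseteq> G.hl (G.hl (G.span (insert x1 X \<union> R)))" by (rule G.hl_mono)
  then have "G.hl (G.span (X \<union> insert x R)) \<subseteq> G.hl (G.span X1)" unfolding G.hl_hl[OF sV] using r(7) by (rule order_trans)
  moreover have "\<Phi> \<subseteq> \<Psi>'" using s(2) r(4) by (rule order_trans)
  moreover have "X \<subseteq> X1" "Y \<subseteq> Y1" using r(5,6) by auto
  ultimately show ?case using r(1-3) by (intro exI[of _ X1] exI[of _ Y1] exI[of _ \<Psi>']) simp
qed

text \<open>Once the missing basis elements are adjoined, b is in the hull of the enlarged X1, so a
  multiple of b by a power of p is in the domain and only torsion steps remain.\<close>

lemma adm_forth:
  assumes a: "adm X Y \<Phi>" and X: "X \<in> C" "Y \<in> C'" and b: "b \<in> carrier G"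
  shows "\<exists>X1 Y1 \<Psi>. X1 \<in> C \<and> Y1 \<in> C' \<and> adm X1 Y1 \<Psi> \<and> \<Phi> \<subseteq> \<Psi> \<and> X \<subseteq> X1 \<and> Y \<subseteq> Y1 \<and> b \<in> Domain \<Psi>"
proof -
  obtain X' where X': "X' \<in> C" "X \<subseteq> X'" "{b} \<subseteq> G.hl (G.span X')" using G.pdb_extend[OF pdb(1) _ _ X(1), of "{b}"] b by auto
  have fin: "finite (X' - X)" using G.pdb_dset[OF pdb(1) X'(1)] by simp
  have U: "X \<union> (X' - X) = X'" using X'(2) by auto
  have "X \<inter> (X' - X) = {}" by auto
  from add_many[OF fin a X this] obtain X1 Y1 \<Psi> where r: "X1 \<in> C" "Y1 \<in> C'" "adm X1 Y1 \<Psi>" "\<Phi> \<subseteq> \<Psi>" "X \<subseteq> X1" "Y \<subseteq> Y1"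
    "G.hl (G.span X') \<subseteq> G.hl (G.span X1)" unfolding U using X'(1) by blast
  note D = admD[OF r(3)]
  have X1c: "X1 \<subseteq> carrier G" by (rule G.dset_carrier[OF G.pdb_dset[OF pdb(1) r(1)]])
  have "b \<in> G.hl (G.span X1)" using X'(3) r(7) by auto
  then obtain m where "pp ^ m \<odot> b \<in> G.span X1" using G.hl_iff[OF G.sm_span[OF X1c]] by blast
  moreover have "G.span X1 \<subseteq> Domain \<Psi>" by (rule G.span_least[OF sm_Domain[OF D(1)] D(4)])
  ultimately have "pp ^ m \<odot> b \<in> Domain \<Psi>" by blast
  from step_torsion[OF r(3,1,2) b this] obtain \<Psi>' where "adm X1 Y1 \<Psi>'" "\<Psi> \<subseteq> \<Psi>'" "b \<in> Domain \<Psi>'" by blast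
  moreover from this have "\<Phi> \<subseteq> \<Psi>'" using r(4) by blast
  ultimately show ?thesis using r(1,2,5,6) by (intro exI[of _ X1] exI[of _ Y1] exI[of _ \<Psi>']) simp
qed

lemma adm_back:
  assumes a: "adm X Y \<Phi>" and X: "X \<in> C" "Y \<in> C'" and b: "b \<in> carrier H"
  shows "\<exists>X1 Y1 \<Psi>. X1 \<in> C \<and> Y1 \<in> C' \<and> adm X1 Y1 \<Psi> \<and> \<Phi> \<subseteq> \<Psi> \<and> X \<subseteq> X1 \<and> Y \<subseteq> Y1 \<and> b \<in> Range \<Psi>"
proof -
  interpret sw: warfield_pair p H G T C' C by (rule swap_warfield)
  from sw.adm_forth[OF adm_converse[OF a] X(2,1) b]
  obtain Y1 X1 \<Psi> where r: "Y1 \<in> C'" "X1 \<in> C" "sw.adm Y1 X1 \<Psi>" "\<Phi>\<inverse> \<subseteq> \<Psi>" "Y \<subseteq> Y1" "X \<subseteq> X1" "b \<in> Domain \<Psi>" by blast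
  have "adm X1 Y1 (\<Psi>\<inverse>)" by (rule sw.adm_converse[OF r(3)])
  moreover have "\<Phi> \<subseteq> \<Psi>\<inverse>" "b \<in> Range (\<Psi>\<inverse>)" using r(4,7) by auto
  ultimately show ?thesis using r by (intro exI[of _ X1] exI[of _ Y1] exI[of _ "\<Psi>\<inverse>"]) simp
qed

text \<open>Members of a decomposition set are already of maximal height modulo the span of the
  others, so here the elements are matched one by one without rescaling. For empty X the result is
  the zero map.\<close>

lemma adm_initial:
  assumes X: "X \<in> C" "Y \<in> C'" and f: "bij_betw f X Y" and u: "\<And>x. x \<in> X \<Longrightarrow> G.ulm x = H.ulm (f x)"
  shows "\<exists>\<Phi>. adm X Y \<Phi> \<and> (\<forall>x\<in>X. (x, f x) \<in> \<Phi>)"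
proof -
  have dX: "G.dset X" and dY: "H.dset Y" using G.pdb_dset[OF pdb(1) X(1)] H.pdb_dset[OF pdb(2) X(2)] by auto
  have Xc: "X \<subseteq> carrier G" "finite X" and Yc: "Y \<subseteq> carrier H" "finite Y"
    using G.dset_carrier[OF dX] H.dset_carrier[OF dY] dX dY by auto
  have "\<exists>\<Phi>. iso \<Phi> \<and> Domain \<Phi> = G.span A \<and> Range \<Phi> = H.span (f ` A) \<and> (\<forall>x\<in>A. (x, f x) \<in> \<Phi>)" if "A \<subseteq> X" for A
    using finite_subset[OF that Xc(2)] that
  proof (induction A)
    case empty
    have "iso {(\<zero>, \<zero>\<^bsub>H\<^esub>)}" unfolding height_iso_def by auto
    moreover have "G.span {} = {\<zero>}" "H.span {} = {\<zero>\<^bsub>H\<^esub>}"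
      by (auto simp: G.span_def H.span_def G.lincomb_def H.lincomb_def)
    ultimately show ?case by (intro exI[of _ "{(\<zero>, \<zero>\<^bsub>H\<^esub>)}"]) auto
  next
    case (insert x A)
    then obtain \<Phi> where \<Phi>: "iso \<Phi>" "Domain \<Phi> = G.span A" "Range \<Phi> = H.span (f ` A)" "\<forall>x\<in>A. (x, f x) \<in> \<Phi>" by auto
    have x: "x \<in> X" "x \<in> carrier G" and A: "A \<subseteq> X" "A \<subseteq> carrier G" using insert.prems Xc by auto
    have fA: "f ` A \<subseteq> Y" "f x \<in> Y" using f x A by (auto simp: bij_betw_def)
    have fAc: "f ` A \<subseteq> carrier H" "f x \<in> carrier H" using fA Yc by auto
    have fn: "f x \<notin> f ` A" using f x A insert.hyps(2) by (auto simp: bij_betw_def inj_on_def)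
    have "iso (ext \<Phi> x (f x))"
    proof (rule ext_iso_free[OF \<Phi>(1) x(2) fAc(2) u[OF x(1)]])
      fix s r assume s: "s \<in> Domain \<Phi>" and r: "r \<in> Zp"
      have s': "s \<in> G.span A" using s \<Phi>(2) by simp
      have c: "s \<oplus> r \<odot> x = r \<odot> x \<oplus> s" using G.sm_carrier[OF G.sm_span[OF A(2)] s'] x r by (simp add: G.M.a_comm)
      show "ht (s \<oplus> r \<odot> x) \<le> ht (r \<odot> x)" unfolding c by (rule G.dset_split(1)[OF dX A(1) x(1) insert.hyps(2) s' r])
      show "r = 0" if "s \<oplus> r \<odot> x = \<zero>" by (rule G.dset_split(3)[OF dX A(1) x(1) insert.hyps(2) s' r]) (use that c in simp)
    next
      fix t r assume t: "t \<in> Range \<Phi>" and r: "r \<in> Zp"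
      have t': "t \<in> H.span (f ` A)" using t \<Phi>(3) by simp
      have c: "t \<oplus>\<^bsub>H\<^esub> r \<odot>\<^bsub>H\<^esub> f x = r \<odot>\<^bsub>H\<^esub> f x \<oplus>\<^bsub>H\<^esub> t" using H.sm_carrier[OF H.sm_span[OF fAc(1)] t'] fAc r by (simp add: H.M.a_comm)
      show "H.ht (t \<oplus>\<^bsub>H\<^esub> r \<odot>\<^bsub>H\<^esub> f x) \<le> H.ht (r \<odot>\<^bsub>H\<^esub> f x)" unfolding c by (rule H.dset_split(1)[OF dY fA(1,2) fn t' r])
      show "r = 0" if "t \<oplus>\<^bsub>H\<^esub> r \<odot>\<^bsub>H\<^esub> f x = \<zero>\<^bsub>H\<^esub>" by (rule H.dset_split(3)[OF dY fA(1,2) fn t' r]) (use that c in simp)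
    qed
    moreover have "Domain (ext \<Phi> x (f x)) = G.span (insert x A)" by (rule ext_Domain[OF \<Phi>(1) A(2) \<Phi>(2) x(2) fAc(2)])
    moreover have "Range (ext \<Phi> x (f x)) = H.span (f ` insert x A)"
      using ext_Range[OF \<Phi>(1) fAc(1) \<Phi>(3) x(2) fAc(2)] by simp
    moreover have "\<forall>z\<in>insert x A. (z, f z) \<in> ext \<Phi> x (f x)"
      using ext_mem[OF \<Phi>(1) x(2) fAc(2)] \<Phi>(4) by auto
    ultimately show ?case by (intro exI[of _ "ext \<Phi> x (f x)"]) simp
  qed
  from this[OF order_refl] obtain \<Phi> where \<Phi>: "iso \<Phi>" "Domain \<Phi> = G.span X" "Range \<Phi> = H.span (f ` X)" "\<forall>x\<in>X. (x, f x) \<in> \<Phi>"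
    by blast
  have fX: "f ` X = Y" using f by (simp add: bij_betw_def)
  have "adm X Y \<Phi>"
  proof (rule admI[OF \<Phi>(1) Xc(2,1) \<Phi>(2) Yc(2,1)])
    show "Range \<Phi> = H.span Y" using \<Phi>(3) fX by simp
    show "X \<subseteq> Domain \<Phi>" "Y \<subseteq> Range \<Phi>" using \<Phi>(4) fX by auto
    show "Domain \<Phi> \<subseteq> G.hl (G.span X)" unfolding \<Phi>(2) by (rule G.hl_base[OF G.sm_span[OF Xc(1)]])
    show "Range \<Phi> \<subseteq> H.hl (H.span Y)" unfolding \<Phi>(3) fX by (rule H.hl_base[OF H.sm_span[OF Yc(1)]])
    show "\<forall>x\<in>X. \<exists>y\<in>Y. (x, y) \<in> \<Phi>" using \<Phi>(4) fX by auto
    show "\<forall>y\<in>Y. \<exists>x\<in>X. (x, y) \<in> \<Phi>" using \<Phi>(4) fX by auto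
  qed
  then show ?thesis using \<Phi>(4) by blast
qed

lemma extension_system_iff:
  "f \<in> extension_system T p G H C C' X0 f0 \<longleftrightarrow>
    (\<exists>X\<in>C. \<exists>Y\<in>C'. adm X Y (graph f) \<and> X0 \<subseteq> X \<and> (\<forall>x\<in>X0. (x, f0 x) \<in> graph f))"
proof -
  have iso_iff: "iso (graph f) \<longleftrightarrow> submodule_iso p G H f \<and> height_preserving T p G H f"
  proof
    assume h: "submodule_iso p G H f \<and> height_preserving T p G H f"
    have "ht s = H.ht t" if "f s = Some t" for s t
    proof -
      have "s \<in> dom f" using that by blast
      then have "H.ht (the (f s)) = ht s" using h by (simp add: height_preserving_def)
      then show ?thesis using that by simp
    qed
    then show "iso (graph f)" unfolding height_iso_alg graph_iff using submodule_iso_alg h by blast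
  next
    assume h: "iso (graph f)"
    have "H.ht (the (f x)) = ht x" if "x \<in> dom f" for x
      by (rule iso_height[OF h]) (use that in \<open>auto simp: graph_iff\<close>)
    then show "submodule_iso p G H f \<and> height_preserving T p G H f"
      using submodule_iso_iso[OF h] by (simp add: height_preserving_def)
  qed
  have fg: "(iso (graph f) \<and> fin_gen_submodule p G (dom f) \<and> fin_gen_submodule p H (ran f)) \<longleftrightarrow>
      (iso (graph f) \<and> (\<exists>A. finite A \<and> A \<subseteq> carrier G \<and> Domain (graph f) = G.span A) \<and>
       (\<exists>B. finite B \<and> B \<subseteq> carrier H \<and> Range (graph f) = H.span B))"
    unfolding fin_gen_submodule_def Domain_graph[symmetric] Range_graph[symmetric]
    using sm_Domain[of "graph f"] sm_Range[of "graph f"] by blast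
  \<comment> \<open>Outside the domain of f the value \<open>the (f x)\<close> is unspecified, so
    the image condition can be read in the graph only for X inside the domain.\<close>
  have img: "(\<lambda>x. the (f x)) ` X = Y \<longleftrightarrow> (\<forall>x\<in>X. \<exists>y\<in>Y. (x, y) \<in> graph f) \<and> (\<forall>y\<in>Y. \<exists>x\<in>X. (x, y) \<in> graph f)"
    if X: "X \<subseteq> dom f" for X Y
  proof -
    have fs: "f x = Some (the (f x))" if "x \<in> X" for x using X that by auto
    show ?thesis
    proof
      assume e: "(\<lambda>x. the (f x)) ` X = Y"
      show "(\<forall>x\<in>X. \<exists>y\<in>Y. (x, y) \<in> graph f) \<and> (\<forall>y\<in>Y. \<exists>x\<in>X. (x, y) \<in> graph f)"
        unfolding e[symmetric] graph_iff using fs by auto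
    next
      assume h: "(\<forall>x\<in>X. \<exists>y\<in>Y. (x, y) \<in> graph f) \<and> (\<forall>y\<in>Y. \<exists>x\<in>X. (x, y) \<in> graph f)"
      show "(\<lambda>x. the (f x)) ` X = Y"
      proof
        show "(\<lambda>x. the (f x)) ` X \<subseteq> Y"
        proof (rule image_subsetI)
          fix x assume "x \<in> X"
          then obtain y where "y \<in> Y" "f x = Some y" using h unfolding graph_iff by blast
          then show "the (f x) \<in> Y" by simp
        qed
        show "Y \<subseteq> (\<lambda>x. the (f x)) ` X"
        proof
          fix y assume "y \<in> Y"
          then obtain x where "x \<in> X" "f x = Some y" using h unfolding graph_iff by blast
          then show "y \<in> (\<lambda>x. the (f x)) ` X" by (intro image_eqI[of _ _ x]) simp_all
        qed
      qed
    qed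
  qed
  have key: "(fin_gen_submodule p G (dom f) \<and> fin_gen_submodule p H (ran f) \<and>
        submodule_iso p G H f \<and> height_preserving T p G H f \<and>
        X \<subseteq> dom f \<and> dom f \<subseteq> G.hl (G.span X) \<and> Y \<subseteq> ran f \<and> ran f \<subseteq> H.hl (H.span Y) \<and>
        (\<lambda>x. the (f x)) ` X = Y \<and> X0 \<subseteq> X \<and> (\<forall>x\<in>X0. f x = Some (f0 x))) \<longleftrightarrow>
      (adm X Y (graph f) \<and> X0 \<subseteq> X \<and> (\<forall>x\<in>X0. (x, f0 x) \<in> graph f))" for X Y
  proof (cases "X \<subseteq> dom f")
    case True
    show ?thesis
      unfolding adm_def img[OF True] using iso_iff fg unfolding graph_iff Domain_graph Range_graph by argo
  next
    case False
    then show ?thesis unfolding adm_def Domain_graph by simp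
  qed
  show ?thesis unfolding extension_system_def mem_Collect_eq key ..
qed

lemma partial_isomorphism_extension_system:
  assumes X: "X0 \<in> C" "Y0 \<in> C'" and f: "bij_betw f0 X0 Y0" and u: "\<And>x. x \<in> X0 \<Longrightarrow> G.ulm x = H.ulm (f0 x)"
  shows "partial_isomorphism p G H (extension_system T p G H C C' X0 f0)"
proof -
  let ?I = "extension_system T p G H C C' X0 f0"
  have gm: "graph (map_of_graph \<Phi>) = \<Phi>" if "iso \<Phi>" for \<Phi> by (rule graph_map_of_graph) (rule iso_fun[OF that])
  have memI: "map_of_graph \<Phi> \<in> ?I" if "X \<in> C" "Y \<in> C'" "adm X Y \<Phi>" "X0 \<subseteq> X" "\<forall>x\<in>X0. (x, f0 x) \<in> \<Phi>" for X Y \<Phi>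
    unfolding extension_system_iff gm[OF admD(1)[OF that(3)]] using that by blast
  show ?thesis
    unfolding partial_isomorphism_def
  proof (intro conjI ballI)
    obtain \<Phi> where \<Phi>: "adm X0 Y0 \<Phi>" "\<forall>x\<in>X0. (x, f0 x) \<in> \<Phi>" using adm_initial[OF X f u] by blast
    show "?I \<noteq> {}" using memI[OF X \<Phi>(1) order_refl \<Phi>(2)] by blast
    fix f assume "f \<in> ?I"
    then obtain X Y where f: "X \<in> C" "Y \<in> C'" "adm X Y (graph f)" "X0 \<subseteq> X" "\<forall>x\<in>X0. (x, f0 x) \<in> graph f"
      unfolding extension_system_iff by blast
    show "submodule_iso p G H f" by (rule submodule_iso_iso[OF admD(1)[OF f(3)]])
    show "\<exists>g\<in>?I. f \<subseteq>\<^sub>m g \<and> a \<in> dom g" if a: "a \<in> carrier G" for a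
    proof -
      from adm_forth[OF f(3,1,2) a] obtain X1 Y1 \<Psi> where r: "X1 \<in> C" "Y1 \<in> C'" "adm X1 Y1 \<Psi>" "graph f \<subseteq> \<Psi>" "X \<subseteq> X1" "a \<in> Domain \<Psi>"
        by blast
      note g = gm[OF admD(1)[OF r(3)]]
      have "map_of_graph \<Psi> \<in> ?I" by (rule memI[OF r(1-3)]) (use f(4,5) r(4,5) in auto)
      then show ?thesis
        by (rule bexI[rotated]) (use r(4,6) in \<open>simp add: map_le_graph Domain_graph[symmetric] g\<close>)
    qed
    show "\<exists>g\<in>?I. f \<subseteq>\<^sub>m g \<and> b \<in> ran g" if b: "b \<in> carrier H" for b
    proof -
      from adm_back[OF f(3,1,2) b] obtain X1 Y1 \<Psi> where r: "X1 \<in> C" "Y1 \<in> C'" "adm X1 Y1 \<Psi>" "graph f \<subseteq> \<Psi>" "X \<subseteq> X1" "b \<in> Range \<Psi>"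
        by blast
      note g = gm[OF admD(1)[OF r(3)]]
      have "map_of_graph \<Psi> \<in> ?I" by (rule memI[OF r(1-3)]) (use f(4,5) r(4,5) in auto)
      then show ?thesis
        by (rule bexI[rotated]) (use r(4,6) in \<open>simp add: map_le_graph Range_graph[symmetric] g\<close>)
    qed
  qed
qed

end

section \<open>The equivalence and the prescribed extension system\<close>

context zmodk
begin

text \<open>\<open>w_hat\<close> makes its choice at \<open>TYPE('k)\<close>, while the locale
  carries the variable T; the definitions do not inspect this argument, so both predicates
  coincide.\<close>

lemma pdb_SOME:
  assumes "pdb C" shows "pdb (SOME C. partial_decomposition_basis TYPE('k) p G C)"
proof -
  have T: "partial_decomposition_basis TYPE('k) p G = (partial_decomposition_basis T p G :: 'a set set \<Rightarrow> bool)"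
    by (intro ext) (simp only: partial_decomposition_basis_def decomposition_set_def)
  show ?thesis unfolding T by (rule someI[of "partial_decomposition_basis T p G", OF assms])
qed

end

context zpair
begin

lemma partial_isomorphism_incong:
  assumes I: "partial_isomorphism p G H I"
  shows "incong G (p_torsion p G (p_power p G (\<alpha> :: 'k))) (p_mult p G (p_power p G \<alpha>)) n \<longleftrightarrow>
      incong H (p_torsion p H (p_power p H \<alpha>)) (p_mult p H (p_power p H \<alpha>)) n" (is ?t1)
    and "incong G (p_torsion p G (p_power_inf TYPE('k) p G)) {\<zero>} n \<longleftrightarrow>
      incong H (p_torsion p H (p_power_inf TYPE('k) p H)) {\<zero>\<^bsub>H\<^esub>} n" (is ?t2)
    and "G.ulm_rank n u \<longleftrightarrow> H.ulm_rank n u" (is ?t3)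
proof -
  interpret sw: zpair p H G T by (rule swap)
  note J = partial_isomorphism_bf[OF I]
  note J' = bf_converse[OF J]
  show ?t1 by (rule iffI[OF incong_torsion_transfer(1)[OF J] sw.incong_torsion_transfer(1)[OF J']])
  show ?t2 by (rule iffI[OF incong_torsion_transfer(2)[OF J] sw.incong_torsion_transfer(2)[OF J']])
  show ?t3 by (rule iffI[OF ulm_rank_transfer[OF J] sw.ulm_rank_transfer[OF J']])
qed

text \<open>For prescribed bases the counts and ranks are transported along the given partial
  isomorphism, without a detour through the numerical invariants.\<close>

lemma warfield_pair_partial_isomorphism:
  assumes I: "partial_isomorphism p G H I" and C: "G.pdb C" "H.pdb C'"
    and closed: "closed_under_multiples G C" "closed_under_multiples H C'"
  shows "warfield_pair p G H T C C'"
  by unfold_locales (simp_all only: C closed partial_isomorphism_incong[OF I])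

lemma partially_isomorphic_iff:
  assumes C: "G.pdb C" "H.pdb C'"
  shows "partially_isomorphic p G H \<longleftrightarrow>
    (\<forall>\<alpha> :: 'k height. u_hat p G \<alpha> = u_hat p H \<alpha>) \<and>
    (\<forall>e \<in> (UNIV :: (nat \<Rightarrow> 'k height) set) // ulm_equiv. w_hat p G e = w_hat p H e)"
proof
  assume "partially_isomorphic p G H"
  then obtain I where I: "partial_isomorphism p G H I" unfolding partially_isomorphic_def by blast
  note inv = partial_isomorphism_incong[OF I]
  show "(\<forall>\<alpha> :: 'k height. u_hat p G \<alpha> = u_hat p H \<alpha>) \<and>
    (\<forall>e \<in> (UNIV :: (nat \<Rightarrow> 'k height) set) // ulm_equiv. w_hat p G e = w_hat p H e)"
  proof (intro conjI allI ballI)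
    fix \<alpha> :: "'k height"
    show "u_hat p G \<alpha> = u_hat p H \<alpha>"
    proof (cases \<alpha>)
      case (Ord \<beta>) then show ?thesis using u_hat_Ord_iff[of \<beta>] inv(1)[of \<beta>] by simp
    next
      case Infty then show ?thesis using u_hat_Infty_iff inv(2) by simp
    qed
  next
    fix e :: "(nat \<Rightarrow> 'k height) set" assume e: "e \<in> UNIV // ulm_equiv"
    show "w_hat p G e = w_hat p H e" unfolding w_hat_def
      by (subst w_hat_wrt_eq_iff[OF G.pdb_SOME[OF C(1)] H.pdb_SOME[OF C(2)] e])
        (intro allI bex_cong[OF refl] inv(3))
  qed
next
  assume *: "(\<forall>\<alpha> :: 'k height. u_hat p G \<alpha> = u_hat p H \<alpha>) \<and>
    (\<forall>e \<in> (UNIV :: (nat \<Rightarrow> 'k height) set) // ulm_equiv. w_hat p G e = w_hat p H e)"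
  have uO: "u_hat p G (Ord (\<alpha> :: 'k)) = u_hat p H (Ord \<alpha>)" for \<alpha> using * by blast
  have uI: "u_hat p G (Infty :: 'k height) = u_hat p H (Infty :: 'k height)" using * by blast
  have w: "w_hat p G e = w_hat p H e" if "e \<in> (UNIV :: (nat \<Rightarrow> 'k height) set) // ulm_equiv" for e using * that by blast
  have rank: "(\<exists>u\<in>e. G.ulm_rank n u) \<longleftrightarrow> (\<exists>u\<in>e. H.ulm_rank n u)" if e: "e \<in> UNIV // ulm_equiv" for e n
    using w[OF e] unfolding w_hat_def w_hat_wrt_eq_iff[OF G.pdb_SOME[OF C(1)] H.pdb_SOME[OF C(2)] e] by simp
  have Cc: "X \<subseteq> carrier G" if "X \<in> C" for X by (rule G.dset_carrier[OF G.pdb_dset[OF C(1) that]])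
  have C'c: "X \<subseteq> carrier H" if "X \<in> C'" for X by (rule H.dset_carrier[OF H.pdb_dset[OF C(2) that]])
  \<comment> \<open>The given bases need not be closed under multiples, which the extension steps
    demand; hence the passage to the closures.\<close>
  interpret W: warfield_pair p G H T "G.multiples_closure C" "H.multiples_closure C'"
  proof unfold_locales
    show "G.pdb (G.multiples_closure C)" by (rule G.pdb_multiples_closure[OF C(1)])
    show "H.pdb (H.multiples_closure C')" by (rule H.pdb_multiples_closure[OF C(2)])
    show "closed_under_multiples G (G.multiples_closure C)" by (rule G.closed_multiples_closure[OF Cc])
    show "closed_under_multiples H (H.multiples_closure C')" by (rule H.closed_multiples_closure[OF C'c])
    show "incong G (p_torsion p G (p_power p G \<alpha>)) (p_mult p G (p_power p G \<alpha>)) n \<longleftrightarrow>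
      incong H (p_torsion p H (p_power p H \<alpha>)) (p_mult p H (p_power p H \<alpha>)) n" for \<alpha> :: 'k and n
      using uO[of \<alpha>] unfolding u_hat_Ord_iff by blast
    show "incong G (p_torsion p G (p_power_inf TYPE('k) p G)) {\<zero>} n \<longleftrightarrow>
      incong H (p_torsion p H (p_power_inf TYPE('k) p H)) {\<zero>\<^bsub>H\<^esub>} n" for n
      using uI unfolding u_hat_Infty_iff by blast
  qed (rule rank)
  have "C \<noteq> {}" "C' \<noteq> {}" using C unfolding partial_decomposition_basis_def by simp_all
  note empty = G.empty_multiples_closure[OF this(1)] H.empty_multiples_closure[OF this(2)]
  \<comment> \<open>No initial bijection is prescribed, so the system starts from the empty sets,
    which belong to both closures.\<close>
  have "partial_isomorphism p G H
    (extension_system T p G H (G.multiples_closure C) (H.multiples_closure C') {} (\<lambda>_. undefined))"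
    by (rule W.partial_isomorphism_extension_system[OF empty]) (simp_all add: bij_betw_def)
  then show "partially_isomorphic p G H" unfolding partially_isomorphic_def by blast
qed

end

lemma p_power_inf_divisible:
  fixes G :: "(rat, 'a) module" and e :: "'a \<Rightarrow> 'c"
  assumes "prime p" "Module.module (Z_loc p) G" "inj e"
  shows "p_mult p G (p_power_inf TYPE('c ordinal) p G) = p_power_inf TYPE('c ordinal) p G"
  using p_power_stable[OF assms] by metis

theorem theorem11:
  fixes p :: nat
    and G :: "(rat, 'a) module"
    and H :: "(rat, 'b) module"
    and T :: "('a, 'b, 'o) ordinals itself"
  assumes "prime p"
    and "Module.module (Z_loc p) G"
    and "Module.module (Z_loc p) H"
    and "\<exists>C. partial_decomposition_basis T p G C"
    and "\<exists>C. partial_decomposition_basis T p H C"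
  shows "(partially_isomorphic p G H \<longleftrightarrow>
            (\<forall>\<alpha> :: ('a, 'b, 'o) ordinals height. u_hat p G \<alpha> = u_hat p H \<alpha>) \<and>
            (\<forall>e \<in> (UNIV :: (nat \<Rightarrow> ('a, 'b, 'o) ordinals height) set) // ulm_equiv.
               w_hat p G e = w_hat p H e)) \<and>
         (partially_isomorphic p G H \<longrightarrow>
            (\<forall>C C' X\<^sub>0 Y\<^sub>0 f\<^sub>0.
               partial_decomposition_basis T p G C \<longrightarrow>
               partial_decomposition_basis T p H C' \<longrightarrow>
               closed_under_multiples G C \<longrightarrow>
               closed_under_multiples H C' \<longrightarrow>
               X\<^sub>0 \<in> C \<longrightarrow> Y\<^sub>0 \<in> C' \<longrightarrow> bij_betw f\<^sub>0 X\<^sub>0 Y\<^sub>0 \<longrightarrow>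
               (\<forall>x\<in>X\<^sub>0. (ulm_seq p G x :: nat \<Rightarrow> ('a, 'b, 'o) ordinals height) =
                  ulm_seq p H (f\<^sub>0 x)) \<longrightarrow>
               partial_isomorphism p G H (extension_system T p G H C C' X\<^sub>0 f\<^sub>0)))"
proof -
  \<comment> \<open>The type of ordinals is built over a sum containing both element types. These
    injections make both descending chains stationary within it, as the locale requires.\<close>
  have "inj (Inl :: 'a \<Rightarrow> 'a + 'b + nat + 'o)" "inj (Inr \<circ> Inl :: 'b \<Rightarrow> 'a + 'b + nat + 'o)"
    by (simp_all add: inj_def)
  note stable = p_power_inf_divisible[OF assms(1,2) this(1)] p_power_inf_divisible[OF assms(1,3) this(2)]
  interpret zpair p G H T
    by (intro zpair.intro zmodk.intro zmod.intro zmod_axioms.intro zmodk_axioms.intro assms stable)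
  obtain C\<^sub>1 C\<^sub>2 where "partial_decomposition_basis T p G C\<^sub>1" "partial_decomposition_basis T p H C\<^sub>2"
    using assms(4,5) by blast
  from partially_isomorphic_iff[OF this] show ?thesis
  proof (rule conjI, intro impI allI)
    fix C C' X\<^sub>0 Y\<^sub>0 f\<^sub>0
    assume "partially_isomorphic p G H"
      and C: "partial_decomposition_basis T p G C" "partial_decomposition_basis T p H C'"
        "closed_under_multiples G C" "closed_under_multiples H C'"
      and X: "X\<^sub>0 \<in> C" "Y\<^sub>0 \<in> C'" "bij_betw f\<^sub>0 X\<^sub>0 Y\<^sub>0"
      and u: "\<forall>x\<in>X\<^sub>0. (ulm_seq p G x :: nat \<Rightarrow> ('a, 'b, 'o) ordinals height) = ulm_seq p H (f\<^sub>0 x)"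
    then obtain I where "partial_isomorphism p G H I" unfolding partially_isomorphic_def by blast
    from warfield_pair_partial_isomorphism[OF this C]
    interpret warfield_pair p G H T C C' .
    show "partial_isomorphism p G H (extension_system T p G H C C' X\<^sub>0 f\<^sub>0)"
      by (rule partial_isomorphism_extension_system[OF X u[rule_format]])
  qed
qed

end
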